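(* Let $R$ be a commutative ring with unit, let $\delta\in R$, and let $n$ be any positive integer. Let $\mathrm{Br}_n(\delta)$ be the Brauer algebra over $R$, and let $I_0\le \mathrm{Br}_n(\delta)$ be the two-sided ideal that is free as an $R$-module on the Brauer $n$-diagrams with no left-to-right connections. Then $$\mathrm{Tor}^{\mathrm{Br}_n(\delta)/I_0}_*(\mathbf{1},\mathbf{1})\cong \mathrm{Tor}^{R\Sigma_n}_*(\mathbf{1},\mathbf{1})=: H_*(\Sigma_n;R),$$ where $\Sigma_n$ is the symmetric group on $n$ letters and $R\Sigma_n$ is its group algebra.
   Context: A Brauer $n$-diagram is a graph on two columns (left and right) of $n$ nodes each, in which each node is connected to exactly one other node by an edge. A left-to-right connection is an edge joining a left node to a right node. The Brauer algebra $\mathrm{Br}_n(\delta)$ is the free $R$-module on the Brauer $n$-diagrams, with the bilinear multiplication given on diagrams $x,y$ as follows: identify the right nodes of $x$ with the left nodes of $y$; the product $xy$ is $\delta^a$ times the diagram in which two outer nodes are joined exactly when they are connected by a path in the concatenated graph, where $a$ is the number of closed loops (consisting entirely of middle nodes) in the concatenated graph. The trivial module $\mathbf{1}$ for $\mathrm{Br}_n(\delta)$ (both as a left and as a right module) is a single copy of $R$, on which diagrams with no left-to-left or right-to-right edges act as multiplication by $1$ and all other diagrams act as multiplication by $0$. The ideal $I_0$ acts as zero on $\mathbf{1}$, so $\mathbf{1}$ is also a left and right module over $\mathrm{Br}_n(\delta)/I_0$. The trivial module $\mathbf{1}$ for $R\Sigma_n$ is $R$ with every element of $\Sigma_n$ acting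 as the identity. *)

theory Defs
  imports "HOL-Algebra.Module" "HOL-Algebra.QuotRing" "HOL-Algebra.Sym_Groups"
begin

section \<open>Modules over possibly non-commutative rings\<close>

text \<open>
  Modules and algebras are records of type \<^typ>\<open>('a, 'b) module\<close>. An \<open>R\<close>-algebra is such a record
  over \<open>R\<close> whose ring fields carry the (possibly non-commutative) ring structure. In a module that
  is not an algebra the fields \<open>mult\<close> and \<open>one\<close> have no meaning. A right module \<open>M\<close> over \<open>A\<close> is
  recorded with \<open>a \<odot>\<^bsub>M\<^esub> m\<close> standing for the right action \<open>m \<cdot> a\<close>.
\<close>

locale left_module = A?: ring A + N?: abelian_group N
  for A :: "('a, 's) ring_scheme" (structure) and N :: "('a, 'n, 't) module_scheme" (structure) +
  assumes smult_closed [simp, intro]: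
      "\<lbrakk>a \<in> carrier A; x \<in> carrier N\<rbrakk> \<Longrightarrow> a \<odot>\<^bsub>N\<^esub> x \<in> carrier N"
    and smult_l_distr:
      "\<lbrakk>a \<in> carrier A; b \<in> carrier A; x \<in> carrier N\<rbrakk> \<Longrightarrow>
        (a \<oplus>\<^bsub>A\<^esub> b) \<odot>\<^bsub>N\<^esub> x = a \<odot>\<^bsub>N\<^esub> x \<oplus>\<^bsub>N\<^esub> b \<odot>\<^bsub>N\<^esub> x"
    and smult_r_distr:
      "\<lbrakk>a \<in> carrier A; x \<in> carrier N; y \<in> carrier N\<rbrakk> \<Longrightarrow>
        a \<odot>\<^bsub>N\<^esub> (x \<oplus>\<^bsub>N\<^esub> y) = a \<odot>\<^bsub>N\<^esub> x \<oplus>\<^bsub>N\<^esub> a \<odot>\<^bsub>N\<^esub> y"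
    and smult_assoc:
      "\<lbrakk>a \<in> carrier A; b \<in> carrier A; x \<in> carrier N\<rbrakk> \<Longrightarrow>
        (a \<otimes>\<^bsub>A\<^esub> b) \<odot>\<^bsub>N\<^esub> x = a \<odot>\<^bsub>N\<^esub> (b \<odot>\<^bsub>N\<^esub> x)"
    and smult_one [simp]: "x \<in> carrier N \<Longrightarrow> \<one>\<^bsub>A\<^esub> \<odot>\<^bsub>N\<^esub> x = x"

definition module_iso ::
  "('r, 's) ring_scheme \<Rightarrow> ('r, 'a, 'b) module_scheme \<Rightarrow> ('r, 'c, 'd) module_scheme \<Rightarrow> bool" where
  "module_iso R M N \<longleftrightarrow> (\<exists>f. bij_betw f (carrier M) (carrier N) \<and>
     (\<forall>x\<in>carrier M. \<forall>y\<in>carrier M. f (x \<oplus>\<^bsub>M\<^esub> y) = f x \<oplus>\<^bsub>N\<^esub> f y) \<and>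
     (\<forall>r\<in>carrier R. \<forall>x\<in>carrier M. f (r \<odot>\<^bsub>M\<^esub> x) = r \<odot>\<^bsub>N\<^esub> f x))"

text \<open>The free (left) module on a set \<open>S\<close>: finitely supported functions.\<close>

definition free_module :: "('a, 's) ring_scheme \<Rightarrow> 'x set \<Rightarrow> ('a, 'x \<Rightarrow> 'a) module" where
  "free_module A S =
    \<lparr>carrier = {f. finite {x. f x \<noteq> \<zero>\<^bsub>A\<^esub>} \<and> (\<forall>x\<in>S. f x \<in> carrier A) \<and> (\<forall>x. x \<notin> S \<longrightarrow> f x = \<zero>\<^bsub>A\<^esub>)},
     monoid.mult = undefined, one = undefined,
     zero = (\<lambda>x. \<zero>\<^bsub>A\<^esub>), add = (\<lambda>f g x. f x \<oplus>\<^bsub>A\<^esub> g x), smult = (\<lambda>a f x. a \<otimes>\<^bsub>A\<^esub> f x)\<rparr>"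

definition single :: "('a, 's) ring_scheme \<Rightarrow> 'x \<Rightarrow> 'a \<Rightarrow> 'x \<Rightarrow> 'a" where
  "single A x a = (\<lambda>y. if y = x then a else \<zero>\<^bsub>A\<^esub>)"

definition submodule_generated ::
  "('a, 's) ring_scheme \<Rightarrow> ('a, 'x, 't) module_scheme \<Rightarrow> 'x set \<Rightarrow> 'x set" where
  "submodule_generated R M X = \<Inter>{S. submodule S R M \<and> X \<subseteq> S}"

text \<open>
  The quotient by a submodule, or of an algebra by a two-sided ideal: the library's quotient
  ring with the induced scalar multiplication added.
\<close>

definition quotient_module :: "('r, 'x, 't) module_scheme \<Rightarrow> 'x set \<Rightarrow> ('r, 'x set) module" where
  "quotient_module M S =
    ring.extend (M Quot S) (module.fields (\<lambda>r X. \<Union>x\<in>X. S +>\<^bsub>M\<^esub> (r \<odot>\<^bsub>M\<^esub> x)))"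

text \<open>
  A module over \<open>A\<close> on which the ideal acts as zero, regarded as a module over the quotient
  of \<open>A\<close>: a coset acts as any of its elements, so the image below is a singleton.
\<close>

definition over_quotient :: "('a, 'x, 't) module_scheme \<Rightarrow> ('a set, 'x) module" where
  "over_quotient N =
    \<lparr>carrier = carrier N, monoid.mult = monoid.mult N, one = one N, zero = zero N, add = add N,
     smult = (\<lambda>X v. the_elem ((\<lambda>a. a \<odot>\<^bsub>N\<^esub> v) ` X))\<rparr>"


section \<open>The tensor product\<close>

text \<open>
  For an algebra \<open>A\<close> over a commutative ring \<open>R\<close>, a right \<open>A\<close>-module \<open>M\<close> and a left \<open>A\<close>-module \<open>N\<close>,
  the tensor product over \<open>A\<close> as an \<open>R\<close>-module. By the last family of relations \<open>r\<close> acts as the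
  element \<open>r 1\<close> of \<open>A\<close>, so the underlying abelian group is the usual tensor product over \<open>A\<close>.
\<close>

definition tensor_rel ::
  "('r, 's) ring_scheme \<Rightarrow> ('r, 'a, 't) module_scheme \<Rightarrow> ('a, 'x, 'u) module_scheme \<Rightarrow>
   ('a, 'y, 'v) module_scheme \<Rightarrow> ('x \<times> 'y \<Rightarrow> 'r) set" where
  "tensor_rel R A M N =
    (let F = free_module R (carrier M \<times> carrier N); e = (\<lambda>m n. single R (m, n) \<one>\<^bsub>R\<^esub>) in
     submodule_generated R F
      ({e (m \<oplus>\<^bsub>M\<^esub> m') n \<ominus>\<^bsub>F\<^esub> (e m n \<oplus>\<^bsub>F\<^esub> e m' n) | m m' n.
          m \<in> carrier M \<and> m' \<in> carrier M \<and> n \<in> carrier N} \<union>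
       {e m (n \<oplus>\<^bsub>N\<^esub> n') \<ominus>\<^bsub>F\<^esub> (e m n \<oplus>\<^bsub>F\<^esub> e m n') | m n n'.
          m \<in> carrier M \<and> n \<in> carrier N \<and> n' \<in> carrier N} \<union>
       {e (a \<odot>\<^bsub>M\<^esub> m) n \<ominus>\<^bsub>F\<^esub> e m (a \<odot>\<^bsub>N\<^esub> n) | a m n.
          a \<in> carrier A \<and> m \<in> carrier M \<and> n \<in> carrier N} \<union>
       {e ((r \<odot>\<^bsub>A\<^esub> \<one>\<^bsub>A\<^esub>) \<odot>\<^bsub>M\<^esub> m) n \<ominus>\<^bsub>F\<^esub> r \<odot>\<^bsub>F\<^esub> e m n | r m n.
          r \<in> carrier R \<and> m \<in> carrier M \<and> n \<in> carrier N}))"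

definition tensor ::
  "('r, 's) ring_scheme \<Rightarrow> ('r, 'a, 't) module_scheme \<Rightarrow> ('a, 'x, 'u) module_scheme \<Rightarrow>
   ('a, 'y, 'v) module_scheme \<Rightarrow> ('r, ('x \<times> 'y \<Rightarrow> 'r) set) module" where
  "tensor R A M N = quotient_module (free_module R (carrier M \<times> carrier N)) (tensor_rel R A M N)"

text \<open>
  The map \<open>id \<otimes> \<phi>\<close> into the tensor product of \<open>M\<close> with \<open>N'\<close>, for \<open>\<phi>\<close> a module map into \<open>N'\<close>:
  on representatives, the linear extension of \<open>(m, p) \<mapsto> (m, \<phi> p)\<close>.
\<close>

definition tensor_map ::
  "('r, 's) ring_scheme \<Rightarrow> ('r, 'a, 't) module_scheme \<Rightarrow> ('a, 'x, 'u) module_scheme \<Rightarrow>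
   ('a, 'z, 'v) module_scheme \<Rightarrow> ('y \<Rightarrow> 'z) \<Rightarrow> ('x \<times> 'y \<Rightarrow> 'r) set \<Rightarrow> ('x \<times> 'z \<Rightarrow> 'r) set" where
  "tensor_map R A M N' \<phi> X =
    (\<Union>f\<in>X. tensor_rel R A M N' +>\<^bsub>free_module R (carrier M \<times> carrier N')\<^esub>
       (\<lambda>(m, q). \<Oplus>\<^bsub>R\<^esub>p\<in>{p. f (m, p) \<noteq> \<zero>\<^bsub>R\<^esub> \<and> \<phi> p = q}. f (m, p)))"


section \<open>The standard free resolution\<close>

text \<open>
  Every left \<open>A\<close>-module \<open>N\<close> has the functorial free resolution in which \<open>P\<^sub>0\<close> is free on the elements
  of \<open>N\<close> and \<open>P\<^sub>k\<^sub>+\<^sub>1\<close> is free on the set of all formal linear combinations (lists of coefficients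
  and basis elements of \<open>P\<^sub>k\<close>) that represent an element of the kernel of the preceding map;
  this map is the augmentation \<open>P\<^sub>0 \<rightarrow> N\<close> for \<open>k = 0\<close> and the differential of \<open>P\<^sub>k\<close> for \<open>k > 0\<close>.
  Using formal combinations keeps the bases of all the \<open>P\<^sub>k\<close> in a single type.
\<close>

datatype ('a, 'n) gen = Gen 'n | Syz "('a \<times> ('a, 'n) gen) list"

primrec comb :: "('a, 's) ring_scheme \<Rightarrow> ('a \<times> 'x) list \<Rightarrow> 'x \<Rightarrow> 'a" where
  "comb A [] = (\<lambda>y. \<zero>\<^bsub>A\<^esub>)"
| "comb A (p # ps) = (\<lambda>y. single A (snd p) (fst p) y \<oplus>\<^bsub>A\<^esub> comb A ps y)"

primrec gen_elem :: "('a, 'n) gen \<Rightarrow> 'n" where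
  "gen_elem (Gen m) = m"
| "gen_elem (Syz xs) = undefined"

definition augmentation ::
  "('a, 's) ring_scheme \<Rightarrow> ('a, 'n, 't) module_scheme \<Rightarrow> (('a, 'n) gen \<Rightarrow> 'a) \<Rightarrow> 'n" where
  "augmentation A N f = (\<Oplus>\<^bsub>N\<^esub>g\<in>{g. f g \<noteq> \<zero>\<^bsub>A\<^esub>}. f g \<odot>\<^bsub>N\<^esub> gen_elem g)"

primrec gen_boundary :: "('a, 's) ring_scheme \<Rightarrow> ('a, 'n) gen \<Rightarrow> ('a, 'n) gen \<Rightarrow> 'a" where
  "gen_boundary A (Gen m) = (\<lambda>h. \<zero>\<^bsub>A\<^esub>)"
| "gen_boundary A (Syz xs) = comb A xs"

definition boundary :: "('a, 's) ring_scheme \<Rightarrow> (('a, 'n) gen \<Rightarrow> 'a) \<Rightarrow> ('a, 'n) gen \<Rightarrow> 'a" where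
  "boundary A f = (\<lambda>h. \<Oplus>\<^bsub>A\<^esub>g\<in>{g. f g \<noteq> \<zero>\<^bsub>A\<^esub>}. f g \<otimes>\<^bsub>A\<^esub> gen_boundary A g h)"

primrec gens :: "('a, 's) ring_scheme \<Rightarrow> ('a, 'n, 't) module_scheme \<Rightarrow> nat \<Rightarrow> ('a, 'n) gen set" where
  "gens A N 0 = Gen ` carrier N"
| "gens A N (Suc k) = {Syz xs | xs. set xs \<subseteq> carrier A \<times> gens A N k \<and>
     (if k = 0 then augmentation A N (comb A xs) = \<zero>\<^bsub>N\<^esub> else boundary A (comb A xs) = (\<lambda>h. \<zero>\<^bsub>A\<^esub>))}"

definition std_res ::
  "('a, 's) ring_scheme \<Rightarrow> ('a, 'n, 't) module_scheme \<Rightarrow> nat \<Rightarrow> ('a, ('a, 'n) gen \<Rightarrow> 'a) module" where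
  "std_res A N k = free_module A (gens A N k)"

text \<open>
  The standard resolution consists of free modules and linear maps, is exact and ends
  in a surjection onto \<open>N\<close>.
\<close>

context left_module
begin

lemma smult_zero_left [simp]: "x \<in> carrier N \<Longrightarrow> \<zero>\<^bsub>A\<^esub> \<odot>\<^bsub>N\<^esub> x = \<zero>\<^bsub>N\<^esub>"
  by (metis A.l_zero A.zero_closed N.add.l_cancel_one' smult_closed smult_l_distr)

lemma smult_zero_right [simp]: "a \<in> carrier A \<Longrightarrow> a \<odot>\<^bsub>N\<^esub> \<zero>\<^bsub>N\<^esub> = \<zero>\<^bsub>N\<^esub>"
  by (metis N.l_zero N.zero_closed N.add.l_cancel_one' smult_closed smult_r_distr)

lemma single_in_free:
  assumes "g \<in> S" "a \<in> carrier A"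
  shows "single A g a \<in> carrier (free_module A S)"
proof -
  have "finite {x. single A g a x \<noteq> \<zero>\<^bsub>A\<^esub>}"
    by (rule finite_subset[of _ "{g}"]) (auto simp: single_def)
  then show ?thesis
    using assms by (auto simp: free_module_def single_def)
qed

lemma zero_in_free: "(\<lambda>x. \<zero>\<^bsub>A\<^esub>) \<in> carrier (free_module A S)"
  by (auto simp: free_module_def)

lemma add_in_free:
  assumes "f \<in> carrier (free_module A S)" "g \<in> carrier (free_module A S)"
  shows "(\<lambda>x. f x \<oplus>\<^bsub>A\<^esub> g x) \<in> carrier (free_module A S)"
proof -
  have "finite {x. f x \<oplus>\<^bsub>A\<^esub> g x \<noteq> \<zero>\<^bsub>A\<^esub>}"
    by (rule finite_subset[of _ "{x. f x \<noteq> \<zero>\<^bsub>A\<^esub>} \<union> {x. g x \<noteq> \<zero>\<^bsub>A\<^esub>}"])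
      (use assms in \<open>auto simp: free_module_def\<close>)
  then show ?thesis
    using assms by (auto simp: free_module_def)
qed

lemma smult_in_free:
  assumes "f \<in> carrier (free_module A S)" "a \<in> carrier A"
  shows "(\<lambda>x. a \<otimes>\<^bsub>A\<^esub> f x) \<in> carrier (free_module A S)"
proof -
  have "finite {x. a \<otimes>\<^bsub>A\<^esub> f x \<noteq> \<zero>\<^bsub>A\<^esub>}"
    by (rule finite_subset[of _ "{x. f x \<noteq> \<zero>\<^bsub>A\<^esub>}"]) (use assms in \<open>auto simp: free_module_def\<close>)
  then show ?thesis
    using assms by (auto simp: free_module_def)
qed

lemma free_val: "f \<in> carrier (free_module A S) \<Longrightarrow> f x \<in> carrier A"
  by (cases "x \<in> S") (auto simp: free_module_def)

lemma comb_in_free: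
  "set xs \<subseteq> carrier A \<times> S \<Longrightarrow> comb A xs \<in> carrier (free_module A S)"
  by (induction xs) (auto intro!: zero_in_free add_in_free single_in_free)

lemma free_eq_comb:
  assumes "f \<in> carrier (free_module A S)"
  obtains xs where "set xs \<subseteq> carrier A \<times> S" "f = comb A xs"
proof -
  have "\<exists>xs. set xs \<subseteq> carrier A \<times> S \<and> f = comb A xs"
    if "finite T" "f \<in> carrier (free_module A S)" "{x. f x \<noteq> \<zero>\<^bsub>A\<^esub>} \<subseteq> T" for T f
    using that
  proof (induction T arbitrary: f)
    case empty
    then show ?case by (intro exI[of _ "[]"]) auto
  next
    case (insert t T)
    define f' where "f' = (\<lambda>x. if x = t then \<zero>\<^bsub>A\<^esub> else f x)"
    have "finite {x. f' x \<noteq> \<zero>\<^bsub>A\<^esub>}"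
      by (rule finite_subset[of _ "{x. f x \<noteq> \<zero>\<^bsub>A\<^esub>}"])
        (use insert.prems in \<open>auto simp: f'_def free_module_def\<close>)
    then have "f' \<in> carrier (free_module A S)"
      using insert.prems by (auto simp: f'_def free_module_def)
    moreover have "{x. f' x \<noteq> \<zero>\<^bsub>A\<^esub>} \<subseteq> T"
      using insert.prems by (auto simp: f'_def)
    ultimately obtain xs where xs: "set xs \<subseteq> carrier A \<times> S" "f' = comb A xs"
      using insert.IH by blast
    show ?case
    proof (cases "t \<in> S")
      case True
      have "f = comb A ((f t, t) # xs)"
        using free_val[OF insert.prems(1)] by (auto simp: xs(2)[symmetric] single_def f'_def)
      then show ?thesis
        using xs True free_val[OF insert.prems(1)] by (intro exI[of _ "(f t, t) # xs"]) auto
    next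
      case False
      then have "f = f'"
        using insert.prems by (auto simp: f'_def free_module_def)
      then show ?thesis
        using xs by blast
    qed
  qed
  from this[of "{x. f x \<noteq> \<zero>\<^bsub>A\<^esub>}" f] show ?thesis
    using assms that by (auto simp: free_module_def)
qed

lemma gen_boundary_in_free:
  "g \<in> gens A N (Suc k) \<Longrightarrow> gen_boundary A g \<in> carrier (free_module A (gens A N k))"
  by (auto intro: comb_in_free)

lemma gen_boundary_val: "g \<in> gens A N k \<Longrightarrow> gen_boundary A g h \<in> carrier A"
proof (cases k)
  case 0
  then show "g \<in> gens A N k \<Longrightarrow> ?thesis" by auto
next
  case (Suc j)
  then show "g \<in> gens A N k \<Longrightarrow> ?thesis" using free_val[OF gen_boundary_in_free] by blast
qed

lemma boundary_superset:
  assumes "f \<in> carrier (free_module A (gens A N k))" "finite T"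
    "{g. f g \<noteq> \<zero>\<^bsub>A\<^esub>} \<subseteq> T" "T \<subseteq> gens A N k"
  shows "boundary A f h = (\<Oplus>\<^bsub>A\<^esub>g\<in>T. f g \<otimes>\<^bsub>A\<^esub> gen_boundary A g h)"
  unfolding boundary_def
  by (rule A.add.finprod_mono_neutral_cong_left)
    (use assms gen_boundary_val[of _ k] free_val[OF assms(1)] in auto)

lemma augmentation_superset:
  assumes "f \<in> carrier (free_module A (gens A N 0))" "finite T"
    "{g. f g \<noteq> \<zero>\<^bsub>A\<^esub>} \<subseteq> T" "T \<subseteq> gens A N 0"
  shows "augmentation A N f = (\<Oplus>\<^bsub>N\<^esub>g\<in>T. f g \<odot>\<^bsub>N\<^esub> gen_elem g)"
  unfolding augmentation_def
  by (rule N.add.finprod_mono_neutral_cong_left)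
    (use assms free_val[OF assms(1)] in auto)

lemma supp_free:
  "f \<in> carrier (free_module A S) \<Longrightarrow> finite {g. f g \<noteq> \<zero>\<^bsub>A\<^esub>} \<and> {g. f g \<noteq> \<zero>\<^bsub>A\<^esub>} \<subseteq> S"
  by (auto simp: free_module_def)

lemma boundary_add:
  assumes f: "f \<in> carrier (free_module A (gens A N k))"
    and g: "g \<in> carrier (free_module A (gens A N k))"
  shows "boundary A (\<lambda>x. f x \<oplus>\<^bsub>A\<^esub> g x) = (\<lambda>h. boundary A f h \<oplus>\<^bsub>A\<^esub> boundary A g h)"
proof
  fix h
  let ?T = "{x. f x \<noteq> \<zero>\<^bsub>A\<^esub>} \<union> {x. g x \<noteq> \<zero>\<^bsub>A\<^esub>}"
  have T: "finite ?T" "?T \<subseteq> gens A N k"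
    using supp_free[OF f] supp_free[OF g] by auto
  have bv: "gen_boundary A x h \<in> carrier A" if "x \<in> ?T" for x
    using T that gen_boundary_val by blast
  have "boundary A (\<lambda>x. f x \<oplus>\<^bsub>A\<^esub> g x) h
      = (\<Oplus>\<^bsub>A\<^esub>x\<in>?T. (f x \<oplus>\<^bsub>A\<^esub> g x) \<otimes>\<^bsub>A\<^esub> gen_boundary A x h)"
    by (rule boundary_superset[OF add_in_free[OF f g] T(1) _ T(2)]) auto
  also have "\<dots> = (\<Oplus>\<^bsub>A\<^esub>x\<in>?T. f x \<otimes>\<^bsub>A\<^esub> gen_boundary A x h \<oplus>\<^bsub>A\<^esub> g x \<otimes>\<^bsub>A\<^esub> gen_boundary A x h)"
    using bv free_val[OF f] free_val[OF g]
    by (intro A.add.finprod_cong') (auto simp: A.l_distr)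
  also have "\<dots> = (\<Oplus>\<^bsub>A\<^esub>x\<in>?T. f x \<otimes>\<^bsub>A\<^esub> gen_boundary A x h)
      \<oplus>\<^bsub>A\<^esub> (\<Oplus>\<^bsub>A\<^esub>x\<in>?T. g x \<otimes>\<^bsub>A\<^esub> gen_boundary A x h)"
    using bv free_val[OF f] free_val[OF g] by (intro A.finsum_addf) auto
  also have "\<dots> = boundary A f h \<oplus>\<^bsub>A\<^esub> boundary A g h"
    using boundary_superset[OF f T(1) _ T(2)] boundary_superset[OF g T(1) _ T(2)] by simp
  finally show "boundary A (\<lambda>x. f x \<oplus>\<^bsub>A\<^esub> g x) h = boundary A f h \<oplus>\<^bsub>A\<^esub> boundary A g h" .
qed

lemma boundary_smult:
  assumes f: "f \<in> carrier (free_module A (gens A N k))" and a: "a \<in> carrier A"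
  shows "boundary A (\<lambda>x. a \<otimes>\<^bsub>A\<^esub> f x) = (\<lambda>h. a \<otimes>\<^bsub>A\<^esub> boundary A f h)"
proof
  fix h
  let ?T = "{x. f x \<noteq> \<zero>\<^bsub>A\<^esub>}"
  have T: "finite ?T" "?T \<subseteq> gens A N k"
    using supp_free[OF f] by auto
  have bv: "gen_boundary A x h \<in> carrier A" if "x \<in> ?T" for x
    using T that gen_boundary_val by blast
  have "boundary A (\<lambda>x. a \<otimes>\<^bsub>A\<^esub> f x) h
      = (\<Oplus>\<^bsub>A\<^esub>x\<in>?T. (a \<otimes>\<^bsub>A\<^esub> f x) \<otimes>\<^bsub>A\<^esub> gen_boundary A x h)"
    by (rule boundary_superset[OF smult_in_free[OF f a] T(1) _ T(2)]) (use a in auto)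
  also have "\<dots> = (\<Oplus>\<^bsub>A\<^esub>x\<in>?T. a \<otimes>\<^bsub>A\<^esub> (f x \<otimes>\<^bsub>A\<^esub> gen_boundary A x h))"
    using bv free_val[OF f] a by (intro A.add.finprod_cong') (auto simp: A.m_assoc)
  also have "\<dots> = a \<otimes>\<^bsub>A\<^esub> (\<Oplus>\<^bsub>A\<^esub>x\<in>?T. f x \<otimes>\<^bsub>A\<^esub> gen_boundary A x h)"
    using bv free_val[OF f] a T(1) by (intro A.finsum_rdistr[symmetric]) auto
  finally show "boundary A (\<lambda>x. a \<otimes>\<^bsub>A\<^esub> f x) h = a \<otimes>\<^bsub>A\<^esub> boundary A f h"
    by (simp add: boundary_def)
qed

lemma boundary_single:
  assumes "g \<in> gens A N k" "a \<in> carrier A"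
  shows "boundary A (single A g a) = (\<lambda>h. a \<otimes>\<^bsub>A\<^esub> gen_boundary A g h)"
proof
  fix h
  have "boundary A (single A g a) h = (\<Oplus>\<^bsub>A\<^esub>x\<in>{g}. single A g a x \<otimes>\<^bsub>A\<^esub> gen_boundary A x h)"
    by (rule boundary_superset[OF single_in_free[OF assms]]) (use assms in \<open>auto simp: single_def\<close>)
  then show "boundary A (single A g a) h = a \<otimes>\<^bsub>A\<^esub> gen_boundary A g h"
    using assms gen_boundary_val[OF assms(1), of h] by (simp add: single_def)
qed

lemma boundary_zero: "boundary A (\<lambda>x. \<zero>\<^bsub>A\<^esub>) = (\<lambda>h. \<zero>\<^bsub>A\<^esub>)"
  by (simp add: boundary_def)

lemma augmentation_zero: "augmentation A N (\<lambda>x. \<zero>\<^bsub>A\<^esub>) = \<zero>\<^bsub>N\<^esub>"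
  by (simp add: augmentation_def)

lemma augmentation_closed:
  assumes f: "f \<in> carrier (free_module A (gens A N 0))"
  shows "augmentation A N f \<in> carrier N"
  unfolding augmentation_def
  by (rule N.finsum_closed) (use supp_free[OF f] free_val[OF f] in auto)

lemma augmentation_add:
  assumes f: "f \<in> carrier (free_module A (gens A N 0))"
    and g: "g \<in> carrier (free_module A (gens A N 0))"
  shows "augmentation A N (\<lambda>x. f x \<oplus>\<^bsub>A\<^esub> g x) = augmentation A N f \<oplus>\<^bsub>N\<^esub> augmentation A N g"
proof -
  let ?T = "{x. f x \<noteq> \<zero>\<^bsub>A\<^esub>} \<union> {x. g x \<noteq> \<zero>\<^bsub>A\<^esub>}"
  have T: "finite ?T" "?T \<subseteq> gens A N 0"
    using supp_free[OF f] supp_free[OF g] by auto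
  have bv: "gen_elem x \<in> carrier N" if "x \<in> ?T" for x
    using T that by auto
  have "augmentation A N (\<lambda>x. f x \<oplus>\<^bsub>A\<^esub> g x) = (\<Oplus>\<^bsub>N\<^esub>x\<in>?T. (f x \<oplus>\<^bsub>A\<^esub> g x) \<odot>\<^bsub>N\<^esub> gen_elem x)"
    by (rule augmentation_superset[OF add_in_free[OF f g] T(1) _ T(2)]) auto
  also have "\<dots> = (\<Oplus>\<^bsub>N\<^esub>x\<in>?T. f x \<odot>\<^bsub>N\<^esub> gen_elem x \<oplus>\<^bsub>N\<^esub> g x \<odot>\<^bsub>N\<^esub> gen_elem x)"
    using bv free_val[OF f] free_val[OF g]
    by (intro N.add.finprod_cong') (auto simp: smult_l_distr)
  also have "\<dots> = (\<Oplus>\<^bsub>N\<^esub>x\<in>?T. f x \<odot>\<^bsub>N\<^esub> gen_elem x) \<oplus>\<^bsub>N\<^esub> (\<Oplus>\<^bsub>N\<^esub>x\<in>?T. g x \<odot>\<^bsub>N\<^esub> gen_elem x)"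
    using bv free_val[OF f] free_val[OF g] by (intro N.finsum_addf) auto
  also have "\<dots> = augmentation A N f \<oplus>\<^bsub>N\<^esub> augmentation A N g"
    using augmentation_superset[OF f T(1) _ T(2)] augmentation_superset[OF g T(1) _ T(2)] by simp
  finally show ?thesis .
qed

lemma smult_finsum:
  assumes "finite T" "a \<in> carrier A" "F \<in> T \<rightarrow> carrier N"
  shows "(\<Oplus>\<^bsub>N\<^esub>x\<in>T. a \<odot>\<^bsub>N\<^esub> F x) = a \<odot>\<^bsub>N\<^esub> (\<Oplus>\<^bsub>N\<^esub>x\<in>T. F x)"
  using assms by (induction T) (auto simp: smult_r_distr Pi_def)

lemma augmentation_smult:
  assumes f: "f \<in> carrier (free_module A (gens A N 0))" and a: "a \<in> carrier A"
  shows "augmentation A N (\<lambda>x. a \<otimes>\<^bsub>A\<^esub> f x) = a \<odot>\<^bsub>N\<^esub> augmentation A N f"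
proof -
  let ?T = "{x. f x \<noteq> \<zero>\<^bsub>A\<^esub>}"
  have T: "finite ?T" "?T \<subseteq> gens A N 0"
    using supp_free[OF f] by auto
  have bv: "gen_elem x \<in> carrier N" if "x \<in> ?T" for x
    using T that by auto
  have "augmentation A N (\<lambda>x. a \<otimes>\<^bsub>A\<^esub> f x) = (\<Oplus>\<^bsub>N\<^esub>x\<in>?T. (a \<otimes>\<^bsub>A\<^esub> f x) \<odot>\<^bsub>N\<^esub> gen_elem x)"
    by (rule augmentation_superset[OF smult_in_free[OF f a] T(1) _ T(2)]) (use a in auto)
  also have "\<dots> = (\<Oplus>\<^bsub>N\<^esub>x\<in>?T. a \<odot>\<^bsub>N\<^esub> (f x \<odot>\<^bsub>N\<^esub> gen_elem x))"
    using bv free_val[OF f] a by (intro N.add.finprod_cong') (auto simp: smult_assoc)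
  also have "\<dots> = a \<odot>\<^bsub>N\<^esub> augmentation A N f"
    unfolding augmentation_def using bv free_val[OF f] a T(1) by (intro smult_finsum) auto
  finally show ?thesis .
qed

lemma augmentation_single:
  assumes "x \<in> carrier N" "a \<in> carrier A"
  shows "augmentation A N (single A (Gen x) a) = a \<odot>\<^bsub>N\<^esub> x"
proof -
  have g: "Gen x \<in> gens A N 0"
    using assms by auto
  have "{y. single A (Gen x) a y \<noteq> \<zero>\<^bsub>A\<^esub>} \<subseteq> {Gen x}"
    by (auto simp: single_def)
  then show ?thesis
    using augmentation_superset[where T = "{Gen x}", OF single_in_free[OF g assms(2)]] assms
    by (simp add: single_def)
qed

lemma boundary_comb_in_free:
  assumes "set xs \<subseteq> carrier A \<times> gens A N (Suc k)"
  shows "boundary A (comb A xs) \<in> carrier (free_module A (gens A N k))"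
  using assms
proof (induction xs)
  case Nil
  then show ?case by (simp add: boundary_zero zero_in_free)
next
  case (Cons p xs)
  obtain a g where p: "p = (a, g)" "a \<in> carrier A" "g \<in> gens A N (Suc k)"
    using Cons.prems by (cases p) auto
  have "boundary A (comb A (p # xs))
      = (\<lambda>h. boundary A (single A g a) h \<oplus>\<^bsub>A\<^esub> boundary A (comb A xs) h)"
    using boundary_add[OF single_in_free[OF p(3,2)] comb_in_free[of xs]] Cons.prems p by simp
  then show ?case
    using Cons p gen_boundary_in_free[OF p(3)]
    by (simp add: boundary_single[OF p(3,2)] add_in_free smult_in_free del: gens.simps)
qed

lemma boundary_closed:
  "f \<in> carrier (free_module A (gens A N (Suc k))) \<Longrightarrow>
    boundary A f \<in> carrier (free_module A (gens A N k))"
  by (metis free_eq_comb boundary_comb_in_free)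

lemma boundary_boundary:
  assumes "f \<in> carrier (free_module A (gens A N (Suc (Suc k))))"
  shows "boundary A (boundary A f) = (\<lambda>h. \<zero>\<^bsub>A\<^esub>)"
proof -
  have "boundary A (boundary A (comb A xs)) = (\<lambda>h. \<zero>\<^bsub>A\<^esub>)"
    if "set xs \<subseteq> carrier A \<times> gens A N (Suc (Suc k))" for xs
    using that
  proof (induction xs)
    case Nil
    then show ?case by (simp add: boundary_zero)
  next
    case (Cons p xs)
    obtain a g where p: "p = (a, g)" "a \<in> carrier A" "g \<in> gens A N (Suc (Suc k))"
      using Cons.prems by (cases p) auto
    have xs: "set xs \<subseteq> carrier A \<times> gens A N (Suc (Suc k))"
      using Cons.prems by simp
    have g: "boundary A (gen_boundary A g) = (\<lambda>h. \<zero>\<^bsub>A\<^esub>)"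
      using p(3) by auto
    have bg: "gen_boundary A g \<in> carrier (free_module A (gens A N (Suc k)))"
      by (rule gen_boundary_in_free[OF p(3)])
    have "boundary A (comb A (p # xs))
        = (\<lambda>h. a \<otimes>\<^bsub>A\<^esub> gen_boundary A g h \<oplus>\<^bsub>A\<^esub> boundary A (comb A xs) h)"
      using boundary_add[OF single_in_free[OF p(3,2)] comb_in_free[OF xs]] p
      by (simp add: boundary_single[OF p(3,2)])
    then show ?case
      using boundary_add[OF smult_in_free[OF bg p(2)] boundary_comb_in_free[OF xs]]
        boundary_smult[OF bg p(2)] Cons.IH[OF xs] g p(2)
      by simp
  qed
  then show ?thesis
    using free_eq_comb[OF assms] by metis
qed

lemma augmentation_boundary:
  assumes "f \<in> carrier (free_module A (gens A N (Suc 0)))"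
  shows "augmentation A N (boundary A f) = \<zero>\<^bsub>N\<^esub>"
proof -
  have "augmentation A N (boundary A (comb A xs)) = \<zero>\<^bsub>N\<^esub>"
    if "set xs \<subseteq> carrier A \<times> gens A N (Suc 0)" for xs
    using that
  proof (induction xs)
    case Nil
    then show ?case by (simp add: boundary_zero augmentation_zero)
  next
    case (Cons p xs)
    obtain a g where p: "p = (a, g)" "a \<in> carrier A" "g \<in> gens A N (Suc 0)"
      using Cons.prems by (cases p) auto
    have xs: "set xs \<subseteq> carrier A \<times> gens A N (Suc 0)"
      using Cons.prems by simp
    have g: "augmentation A N (gen_boundary A g) = \<zero>\<^bsub>N\<^esub>"
      using p(3) by auto
    have bg: "gen_boundary A g \<in> carrier (free_module A (gens A N 0))"
      by (rule gen_boundary_in_free[OF p(3)])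
    have "boundary A (comb A (p # xs))
        = (\<lambda>h. a \<otimes>\<^bsub>A\<^esub> gen_boundary A g h \<oplus>\<^bsub>A\<^esub> boundary A (comb A xs) h)"
      using boundary_add[OF single_in_free[OF p(3,2)] comb_in_free[OF xs]] p
      by (simp add: boundary_single[OF p(3,2)])
    then show ?case
      using augmentation_add[OF smult_in_free[OF bg p(2)] boundary_comb_in_free[OF xs]]
        augmentation_smult[OF bg p(2)] Cons.IH[OF xs] g p(2)
      by simp
  qed
  then show ?thesis
    using free_eq_comb[OF assms] by metis
qed

lemma boundary_hits:
  assumes "set xs \<subseteq> carrier A \<times> gens A N k" "Syz xs \<in> gens A N (Suc k)"
  shows "comb A xs \<in> boundary A ` carrier (free_module A (gens A N (Suc k)))"
proof
  show "comb A xs = boundary A (single A (Syz xs) \<one>\<^bsub>A\<^esub>)"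
    using boundary_single[OF assms(2) A.one_closed] free_val[OF comb_in_free[OF assms(1)]] by simp
  show "single A (Syz xs) \<one>\<^bsub>A\<^esub> \<in> carrier (free_module A (gens A N (Suc k)))"
    by (rule single_in_free[OF assms(2) A.one_closed])
qed

theorem std_res_resolution:
  shows "\<And>f. f \<in> carrier (std_res A N 0) \<Longrightarrow> augmentation A N f \<in> carrier N"
    and "\<And>f g. \<lbrakk>f \<in> carrier (std_res A N 0); g \<in> carrier (std_res A N 0)\<rbrakk> \<Longrightarrow>
      augmentation A N (f \<oplus>\<^bsub>std_res A N 0\<^esub> g) = augmentation A N f \<oplus>\<^bsub>N\<^esub> augmentation A N g"
    and "\<And>a f. \<lbrakk>a \<in> carrier A; f \<in> carrier (std_res A N 0)\<rbrakk> \<Longrightarrow>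
      augmentation A N (a \<odot>\<^bsub>std_res A N 0\<^esub> f) = a \<odot>\<^bsub>N\<^esub> augmentation A N f"
    and "\<And>k f. f \<in> carrier (std_res A N (Suc k)) \<Longrightarrow> boundary A f \<in> carrier (std_res A N k)"
    and "\<And>k f g. \<lbrakk>f \<in> carrier (std_res A N (Suc k)); g \<in> carrier (std_res A N (Suc k))\<rbrakk> \<Longrightarrow>
      boundary A (f \<oplus>\<^bsub>std_res A N (Suc k)\<^esub> g) = boundary A f \<oplus>\<^bsub>std_res A N k\<^esub> boundary A g"
    and "\<And>k a f. \<lbrakk>a \<in> carrier A; f \<in> carrier (std_res A N (Suc k))\<rbrakk> \<Longrightarrow>
      boundary A (a \<odot>\<^bsub>std_res A N (Suc k)\<^esub> f) = a \<odot>\<^bsub>std_res A N k\<^esub> boundary A f"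
    and "augmentation A N ` carrier (std_res A N 0) = carrier N"
    and "{f \<in> carrier (std_res A N 0). augmentation A N f = \<zero>\<^bsub>N\<^esub>}
      = boundary A ` carrier (std_res A N (Suc 0))"
    and "\<And>k. {f \<in> carrier (std_res A N (Suc k)). boundary A f = \<zero>\<^bsub>std_res A N k\<^esub>}
      = boundary A ` carrier (std_res A N (Suc (Suc k)))"
proof -
  have add: "f \<oplus>\<^bsub>std_res A N k\<^esub> g = (\<lambda>x. f x \<oplus>\<^bsub>A\<^esub> g x)"
    and smult: "a \<odot>\<^bsub>std_res A N k\<^esub> f = (\<lambda>x. a \<otimes>\<^bsub>A\<^esub> f x)"
    and zero: "\<zero>\<^bsub>std_res A N k\<^esub> = (\<lambda>x. \<zero>\<^bsub>A\<^esub>)" for k a f g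
    by (auto simp: std_res_def free_module_def)
  show "\<And>f. f \<in> carrier (std_res A N 0) \<Longrightarrow> augmentation A N f \<in> carrier N"
    unfolding std_res_def by (rule augmentation_closed)
  show "\<And>f g. \<lbrakk>f \<in> carrier (std_res A N 0); g \<in> carrier (std_res A N 0)\<rbrakk> \<Longrightarrow>
      augmentation A N (f \<oplus>\<^bsub>std_res A N 0\<^esub> g) = augmentation A N f \<oplus>\<^bsub>N\<^esub> augmentation A N g"
    unfolding add unfolding std_res_def by (rule augmentation_add)
  show "\<And>a f. \<lbrakk>a \<in> carrier A; f \<in> carrier (std_res A N 0)\<rbrakk> \<Longrightarrow>
      augmentation A N (a \<odot>\<^bsub>std_res A N 0\<^esub> f) = a \<odot>\<^bsub>N\<^esub> augmentation A N f"
    unfolding smult unfolding std_res_def by (rule augmentation_smult)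
  show "\<And>k f. f \<in> carrier (std_res A N (Suc k)) \<Longrightarrow> boundary A f \<in> carrier (std_res A N k)"
    unfolding std_res_def by (rule boundary_closed)
  show "\<And>k f g. \<lbrakk>f \<in> carrier (std_res A N (Suc k)); g \<in> carrier (std_res A N (Suc k))\<rbrakk> \<Longrightarrow>
      boundary A (f \<oplus>\<^bsub>std_res A N (Suc k)\<^esub> g) = boundary A f \<oplus>\<^bsub>std_res A N k\<^esub> boundary A g"
    unfolding add unfolding std_res_def by (rule boundary_add)
  show "\<And>k a f. \<lbrakk>a \<in> carrier A; f \<in> carrier (std_res A N (Suc k))\<rbrakk> \<Longrightarrow>
      boundary A (a \<odot>\<^bsub>std_res A N (Suc k)\<^esub> f) = a \<odot>\<^bsub>std_res A N k\<^esub> boundary A f"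
    unfolding smult unfolding std_res_def by (rule boundary_smult)
  show "augmentation A N ` carrier (std_res A N 0) = carrier N"
  proof
    show "augmentation A N ` carrier (std_res A N 0) \<subseteq> carrier N"
      unfolding std_res_def using augmentation_closed by blast
    show "carrier N \<subseteq> augmentation A N ` carrier (std_res A N 0)"
    proof
      fix x assume x: "x \<in> carrier N"
      then have "x = augmentation A N (single A (Gen x) \<one>\<^bsub>A\<^esub>)"
        using augmentation_single[OF x A.one_closed] by simp
      moreover have "single A (Gen x) \<one>\<^bsub>A\<^esub> \<in> carrier (std_res A N 0)"
        unfolding std_res_def by (rule single_in_free) (use x in auto)
      ultimately show "x \<in> augmentation A N ` carrier (std_res A N 0)"
        by blast
    qed
  qed
  show "{f \<in> carrier (std_res A N 0). augmentation A N f = \<zero>\<^bsub>N\<^esub>}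
      = boundary A ` carrier (std_res A N (Suc 0))"
  proof
    show "boundary A ` carrier (std_res A N (Suc 0))
        \<subseteq> {f \<in> carrier (std_res A N 0). augmentation A N f = \<zero>\<^bsub>N\<^esub>}"
      unfolding std_res_def using augmentation_boundary boundary_closed by blast
    show "{f \<in> carrier (std_res A N 0). augmentation A N f = \<zero>\<^bsub>N\<^esub>}
        \<subseteq> boundary A ` carrier (std_res A N (Suc 0))"
    proof
      fix f assume f: "f \<in> {f \<in> carrier (std_res A N 0). augmentation A N f = \<zero>\<^bsub>N\<^esub>}"
      then obtain xs where xs: "set xs \<subseteq> carrier A \<times> gens A N 0" "f = comb A xs"
        unfolding std_res_def by (blast elim: free_eq_comb)
      moreover from this have "Syz xs \<in> gens A N (Suc 0)"
        using f by simp
      ultimately show "f \<in> boundary A ` carrier (std_res A N (Suc 0))"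
        unfolding std_res_def using boundary_hits by blast
    qed
  qed
  show "{f \<in> carrier (std_res A N (Suc k)). boundary A f = \<zero>\<^bsub>std_res A N k\<^esub>}
      = boundary A ` carrier (std_res A N (Suc (Suc k)))" for k
  proof
    show "boundary A ` carrier (std_res A N (Suc (Suc k)))
        \<subseteq> {f \<in> carrier (std_res A N (Suc k)). boundary A f = \<zero>\<^bsub>std_res A N k\<^esub>}"
      unfolding zero unfolding std_res_def using boundary_boundary boundary_closed by blast
    show "{f \<in> carrier (std_res A N (Suc k)). boundary A f = \<zero>\<^bsub>std_res A N k\<^esub>}
        \<subseteq> boundary A ` carrier (std_res A N (Suc (Suc k)))"
    proof
      fix f assume f: "f \<in> {f \<in> carrier (std_res A N (Suc k)). boundary A f = \<zero>\<^bsub>std_res A N k\<^esub>}"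
      then obtain xs where xs: "set xs \<subseteq> carrier A \<times> gens A N (Suc k)" "f = comb A xs"
        unfolding std_res_def by (blast elim: free_eq_comb)
      moreover from this have "Syz xs \<in> gens A N (Suc (Suc k))"
        using f unfolding zero by simp
      ultimately show "f \<in> boundary A ` carrier (std_res A N (Suc (Suc k)))"
        unfolding std_res_def using boundary_hits by blast
    qed
  qed
qed

end


section \<open>Tor\<close>

text \<open>
  The homology in degree \<open>k\<close> of \<open>M \<otimes> P\<close> where \<open>P\<close> is the standard free resolution of \<open>N\<close>;
  by theorem \<open>std_res_resolution\<close> this is a free resolution.
\<close>

definition Tor_chain ::
  "('r, 's) ring_scheme \<Rightarrow> ('r, 'a, 't) module_scheme \<Rightarrow> ('a, 'm, 'u) module_scheme \<Rightarrow>
   ('a, 'n, 'v) module_scheme \<Rightarrow> nat \<Rightarrow> ('r, ('m \<times> (('a, 'n) gen \<Rightarrow> 'a) \<Rightarrow> 'r) set) module" where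
  "Tor_chain R A M N k = tensor R A M (std_res A N k)"

text \<open>\<open>Tor_diff R A M N k\<close> is the differential from degree \<open>k + 1\<close> to degree \<open>k\<close>.\<close>

definition Tor_diff ::
  "('r, 's) ring_scheme \<Rightarrow> ('r, 'a, 't) module_scheme \<Rightarrow> ('a, 'm, 'u) module_scheme \<Rightarrow>
   ('a, 'n, 'v) module_scheme \<Rightarrow> nat \<Rightarrow> ('m \<times> (('a, 'n) gen \<Rightarrow> 'a) \<Rightarrow> 'r) set \<Rightarrow>
   ('m \<times> (('a, 'n) gen \<Rightarrow> 'a) \<Rightarrow> 'r) set" where
  "Tor_diff R A M N k = tensor_map R A M (std_res A N k) (boundary A)"

definition Tor_cycles ::
  "('r, 's) ring_scheme \<Rightarrow> ('r, 'a, 't) module_scheme \<Rightarrow> ('a, 'm, 'u) module_scheme \<Rightarrow>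
   ('a, 'n, 'v) module_scheme \<Rightarrow> nat \<Rightarrow> ('m \<times> (('a, 'n) gen \<Rightarrow> 'a) \<Rightarrow> 'r) set set" where
  "Tor_cycles R A M N k =
    (case k of 0 \<Rightarrow> carrier (Tor_chain R A M N 0)
     | Suc j \<Rightarrow> {x \<in> carrier (Tor_chain R A M N (Suc j)).
                  Tor_diff R A M N j x = \<zero>\<^bsub>Tor_chain R A M N j\<^esub>})"

definition Tor ::
  "('r, 's) ring_scheme \<Rightarrow> ('r, 'a, 't) module_scheme \<Rightarrow> nat \<Rightarrow> ('a, 'm, 'u) module_scheme \<Rightarrow>
   ('a, 'n, 'v) module_scheme \<Rightarrow> ('r, ('m \<times> (('a, 'n) gen \<Rightarrow> 'a) \<Rightarrow> 'r) set set) module" where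
  "Tor R A k M N =
    quotient_module ((Tor_chain R A M N k)\<lparr>carrier := Tor_cycles R A M N k\<rparr>)
      (Tor_diff R A M N k ` carrier (Tor_chain R A M N (Suc k)))"


section \<open>Algebras given by a basis\<close>

text \<open>
  The free module on \<open>S\<close> with the bilinear multiplication in which the product of the basis
  elements \<open>x\<close> and \<open>y\<close> is \<open>c x y\<close> times the basis element \<open>\<mu> x y\<close>, with unit the basis
  element \<open>e\<close>.
\<close>

definition basis_algebra ::
  "('r, 's) ring_scheme \<Rightarrow> 'x set \<Rightarrow> ('x \<Rightarrow> 'x \<Rightarrow> 'r) \<Rightarrow> ('x \<Rightarrow> 'x \<Rightarrow> 'x) \<Rightarrow> 'x \<Rightarrow> ('r, 'x \<Rightarrow> 'r) module" where
  "basis_algebra R S c \<mu> e = (free_module R S)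
    \<lparr>monoid.mult := (\<lambda>f g z.
       \<Oplus>\<^bsub>R\<^esub>p\<in>{(x, y). x \<in> S \<and> y \<in> S \<and> f x \<noteq> \<zero>\<^bsub>R\<^esub> \<and> g y \<noteq> \<zero>\<^bsub>R\<^esub> \<and> \<mu> x y = z}.
         c (fst p) (snd p) \<otimes>\<^bsub>R\<^esub> (f (fst p) \<otimes>\<^bsub>R\<^esub> g (snd p))),
     one := single R e \<one>\<^bsub>R\<^esub>\<rparr>"

text \<open>
  A single copy of \<open>R\<close> on which the basis elements in the finite set \<open>U\<close> act as \<open>1\<close> and the other
  basis elements act as \<open>0\<close>. As \<open>R\<close> is commutative, the same record serves as a left and as a
  right module.
\<close>

definition rank_one_module :: "('r, 's) ring_scheme \<Rightarrow> 'x set \<Rightarrow> ('x \<Rightarrow> 'r, 'r) module" where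
  "rank_one_module R U =
    \<lparr>carrier = carrier R, monoid.mult = monoid.mult R, one = one R, zero = zero R, add = add R,
     smult = (\<lambda>a v. (\<Oplus>\<^bsub>R\<^esub>x\<in>U. a x) \<otimes>\<^bsub>R\<^esub> v)\<rparr>"

definition group_algebra ::
  "('r, 's) ring_scheme \<Rightarrow> ('g, 't) monoid_scheme \<Rightarrow> ('r, 'g \<Rightarrow> 'r) module" where
  "group_algebra R G = basis_algebra R (carrier G) (\<lambda>x y. \<one>\<^bsub>R\<^esub>) (\<otimes>\<^bsub>G\<^esub>) \<one>\<^bsub>G\<^esub>"

definition group_trivial_module ::
  "('r, 's) ring_scheme \<Rightarrow> ('g, 't) monoid_scheme \<Rightarrow> ('g \<Rightarrow> 'r, 'r) module" where
  "group_trivial_module R G = rank_one_module R (carrier G)"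


section \<open>Brauer algebras\<close>

datatype node = Lft nat | Rgt nat

type_synonym diagram = "node set set"

definition nodes :: "nat \<Rightarrow> node set" where
  "nodes n = Lft ` {1..n} \<union> Rgt ` {1..n}"

definition brauer_diagrams :: "nat \<Rightarrow> diagram set" where
  "brauer_diagrams n = {d.
     (\<forall>e\<in>d. \<exists>u\<in>nodes n. \<exists>v\<in>nodes n. u \<noteq> v \<and> e = {u, v}) \<and>
     (\<forall>u\<in>nodes n. \<exists>!v. {u, v} \<in> d)}"

definition identity_diagram :: "nat \<Rightarrow> diagram" where
  "identity_diagram n = {{Lft i, Rgt i} | i. i \<in> {1..n}}"

definition has_left_right :: "diagram \<Rightarrow> bool" where
  "has_left_right d \<longleftrightarrow> (\<exists>i j. {Lft i, Rgt j} \<in> d)"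

definition has_left_left :: "diagram \<Rightarrow> bool" where
  "has_left_left d \<longleftrightarrow> (\<exists>i j. {Lft i, Lft j} \<in> d)"

definition has_right_right :: "diagram \<Rightarrow> bool" where
  "has_right_right d \<longleftrightarrow> (\<exists>i j. {Rgt i, Rgt j} \<in> d)"

text \<open>
  The concatenated graph of \<open>x\<close> and \<open>y\<close> has outer nodes (the left nodes of \<open>x\<close> and the right nodes
  of \<open>y\<close>) and middle nodes (the right nodes of \<open>x\<close> identified with the left nodes of \<open>y\<close>).
\<close>

datatype cnode = Outer node | Mid nat

primrec to_left :: "node \<Rightarrow> cnode" where
  "to_left (Lft i) = Outer (Lft i)"
| "to_left (Rgt i) = Mid i"

primrec to_right :: "node \<Rightarrow> cnode" where
  "to_right (Lft i) = Mid i"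
| "to_right (Rgt i) = Outer (Rgt i)"

definition concat_graph :: "diagram \<Rightarrow> diagram \<Rightarrow> cnode set set" where
  "concat_graph x y = (`) to_left ` x \<union> (`) to_right ` y"

definition linked :: "cnode set set \<Rightarrow> (cnode \<times> cnode) set" where
  "linked E = {(u, v). {u, v} \<in> E}\<^sup>*"

definition diagram_comp :: "diagram \<Rightarrow> diagram \<Rightarrow> diagram" where
  "diagram_comp x y =
    {{u, v} | u v. u \<noteq> v \<and> (Outer u, Outer v) \<in> linked (concat_graph x y)}"

text \<open>
  The closed loops are the connected components consisting of middle nodes. Counting components
  rather than cycles of the set of edges takes care of the loop formed by two parallel edges, one
  from \<open>x\<close> and one from \<open>y\<close>, which become the same set of two middle nodes.
\<close>

definition loops :: "diagram \<Rightarrow> diagram \<Rightarrow> cnode set set" where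
  "loops x y =
    {C. (\<exists>v\<in>\<Union>(concat_graph x y). C = linked (concat_graph x y) `` {v}) \<and> C \<subseteq> range Mid}"

definition brauer_algebra :: "('r, 's) ring_scheme \<Rightarrow> 'r \<Rightarrow> nat \<Rightarrow> ('r, diagram \<Rightarrow> 'r) module" where
  "brauer_algebra R \<delta> n =
    basis_algebra R (brauer_diagrams n) (\<lambda>x y. \<delta> [^]\<^bsub>R\<^esub> card (loops x y)) diagram_comp
      (identity_diagram n)"

definition brauer_I0 :: "('r, 's) ring_scheme \<Rightarrow> 'r \<Rightarrow> nat \<Rightarrow> (diagram \<Rightarrow> 'r) set" where
  "brauer_I0 R \<delta> n =
    {f \<in> carrier (brauer_algebra R \<delta> n). \<forall>d. has_left_right d \<longrightarrow> f d = \<zero>\<^bsub>R\<^esub>}"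

definition brauer_trivial_module :: "('r, 's) ring_scheme \<Rightarrow> nat \<Rightarrow> (diagram \<Rightarrow> 'r, 'r) module" where
  "brauer_trivial_module R n =
    rank_one_module R {d \<in> brauer_diagrams n. \<not> has_left_left d \<and> \<not> has_right_right d}"

end

theory Submission
  imports Defs
begin

text \<open>
  Write \<open>A\<close> for the Brauer algebra modulo \<open>I\<^sub>0\<close> and \<open>J\<close> for the ideal of \<open>A\<close> spanned by the diagrams that are not
  permutations, so that \<open>A / J\<close> is the group algebra. Let \<open>P\<close> be a free resolution of the trivial module over \<open>A\<close>. If
  \<open>J P\<close> is exact, then \<open>P / J P\<close> is a free resolution of the trivial module over the group algebra, and both Tor groups
  are the homology of \<open>P\<close> tensored with the trivial module.

  To see that \<open>J P\<close> is exact, sort the diagrams by their sets of left-to-left edges. For every such set \<open>S\<close> that leaves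
  a node \<open>k\<close> free (and the other sets do not occur in \<open>A\<close>), the right ideal spanned by the diagrams whose left-to-left
  edges include \<open>S\<close> is \<open>e A\<close> for an idempotent \<open>e\<close>, even if \<open>\<delta>\<close> is not invertible. Hence \<open>e P\<close> is a direct summand of
  \<open>P\<close>, up to the augmentation, and exact. Right ideals spanned by the diagrams with left-to-left edges in an upward
  closed family of sets are then treated by a Mayer-Vietoris argument, adding one minimal set at a time.
\<close>


section \<open>Linear extension\<close>

text \<open>The obvious candidate for \<open>e\<close>, the diagram with the edges \<open>S\<close>
  on the left and their mirror images on the right, squares to a power of \<open>\<delta>\<close>
  times itself. Instead a strand starting at the free node \<open>k\<close> is led through all edges
  of \<open>S\<close>, so that no loop closes when \<open>e\<close> meets a diagram containing
  \<open>S\<close>. The diagrams that leave no such node are exactly those spanning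
  \<open>I\<^sub>0\<close>, which is why it has to be divided out. Right ideals enter because chains
  carry their coefficients on the left and the differential multiplies these on the right: chains
  with values in a right ideal form a subcomplex. As \<open>S\<close> is nonempty, \<open>e\<close>
  lies in \<open>J\<close> and annihilates the trivial module, so the augmentation vanishes on
  \<open>e P\<close>. For a minimal \<open>S\<close> in a family, \<open>e A\<close> meets the ideal
  of the other sets in the ideal of the sets strictly containing \<open>S\<close>; this is of the
  same kind, so the argument can recur. \<open>P / J P\<close> differs from the standard resolution
  over the group algebra, by which Tor is defined; hence the comparison of resolutions.\<close>

abbreviation Free :: "('a, 's) ring_scheme \<Rightarrow> 'x set \<Rightarrow> ('x \<Rightarrow> 'a) set" where
  "Free A S \<equiv> carrier (free_module A S)"

lemma abelian_group_cong:
  assumes "abelian_group M" "carrier N = carrier M" "add N = add M" "zero N = zero M"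
  shows "abelian_group N"
proof -
  interpret abelian_group M by fact
  show ?thesis
    by (rule abelian_groupI) (use assms(2-) l_neg in \<open>auto simp: a_ac intro!: bexI\<close>)
qed

text \<open>The left-linear map of free modules with matrix \<open>\<kappa>\<close>: a chain is a
  row vector of coefficients that the matrix multiplies on the right.\<close>

definition lin :: "('a, 's) ring_scheme \<Rightarrow> ('x \<Rightarrow> 'y \<Rightarrow> 'a) \<Rightarrow> ('x \<Rightarrow> 'a) \<Rightarrow> 'y \<Rightarrow> 'a" where
  "lin A \<kappa> f = (\<lambda>h. \<Oplus>\<^bsub>A\<^esub>g\<in>{g. f g \<noteq> \<zero>\<^bsub>A\<^esub>}. f g \<otimes>\<^bsub>A\<^esub> \<kappa> g h)"

lemma boundary_eq_lin: "boundary A = lin A (gen_boundary A)"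
  by (simp add: boundary_def lin_def fun_eq_iff)

context ring
begin

text \<open>Instantiating \<open>left_module\<close> with the ring acting on itself makes the facts
  on free modules proved in that locale available in every ring.\<close>

lemma left_module_regular:
  "left_module R \<lparr>carrier = carrier R, monoid.mult = (\<otimes>), one = \<one>, zero = \<zero>, add = (\<oplus>), smult = (\<otimes>)\<rparr>"
proof (intro left_module.intro left_module_axioms.intro)
  show "abelian_group \<lparr>carrier = carrier R, monoid.mult = (\<otimes>), one = \<one>, zero = \<zero>, add = (\<oplus>), smult = (\<otimes>)\<rparr>"
    by (rule abelian_group_cong[OF is_abelian_group]) simp_all
qed (auto simp: l_distr r_distr m_assoc ring_axioms)

interpretation reg: left_module R
  "\<lparr>carrier = carrier R, monoid.mult = (\<otimes>), one = \<one>, zero = \<zero>, add = (\<oplus>), smult = (\<otimes>)\<rparr>"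
  by (rule left_module_regular)

lemmas free_single = reg.single_in_free
lemmas free_zero [simp] = reg.zero_in_free
lemmas free_add = reg.add_in_free
lemmas free_smult = reg.smult_in_free
lemmas free_value = reg.free_val
lemmas free_supp = reg.supp_free

lemma free_minus:
  assumes "f \<in> Free R S" "g \<in> Free R S"
  shows "(\<lambda>x. f x \<ominus> g x) \<in> Free R S"
proof -
  have "finite {x. f x \<ominus> g x \<noteq> \<zero>}"
    by (rule finite_subset[of _ "{x. f x \<noteq> \<zero>} \<union> {x. g x \<noteq> \<zero>}"])
      (use assms in \<open>auto simp: free_module_def minus_eq\<close>)
  then show ?thesis
    using assms by (auto simp: free_module_def minus_eq)
qed

lemma free_induct [consumes 1, case_names zero add]:
  assumes "f \<in> Free R S" "P (\<lambda>x. \<zero>)"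
    and "\<And>g a u. \<lbrakk>g \<in> S; a \<in> carrier R; u \<in> Free R S; P u\<rbrakk> \<Longrightarrow>
      P (\<lambda>x. single R g a x \<oplus> u x)"
  shows "P f"
proof -
  have "P (comb R xs)" if "set xs \<subseteq> carrier R \<times> S" for xs
    using that by (induction xs) (auto intro!: assms reg.comb_in_free)
  then show ?thesis
    using reg.free_eq_comb[OF assms(1)] by metis
qed

lemma lin_superset:
  assumes "f \<in> Free R S" "finite T" "{g. f g \<noteq> \<zero>} \<subseteq> T"
    "\<And>g h. g \<in> T \<Longrightarrow> \<kappa> g h \<in> carrier R"
  shows "lin R \<kappa> f h = (\<Oplus>g\<in>T. f g \<otimes> \<kappa> g h)"
  unfolding lin_def
  by (rule add.finprod_mono_neutral_cong_left) (use assms free_value[OF assms(1)] in auto)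

lemma lin_zero [simp]: "lin R \<kappa> (\<lambda>x. \<zero>) = (\<lambda>h. \<zero>)"
  by (simp add: lin_def)

lemma lin_single:
  assumes "g \<in> S" "a \<in> carrier R" "\<And>h. \<kappa> g h \<in> carrier R"
  shows "lin R \<kappa> (single R g a) = (\<lambda>h. a \<otimes> \<kappa> g h)"
proof
  fix h
  have "lin R \<kappa> (single R g a) h = (\<Oplus>x\<in>{g}. single R g a x \<otimes> \<kappa> x h)"
    by (rule lin_superset[OF free_single[OF assms(1,2)]]) (use assms in \<open>auto simp: single_def\<close>)
  then show "lin R \<kappa> (single R g a) h = a \<otimes> \<kappa> g h"
    using assms by (simp add: single_def)
qed

lemma lin_add:
  assumes f: "f \<in> Free R S" and g: "g \<in> Free R S"
    and \<kappa>: "\<And>s h. s \<in> S \<Longrightarrow> \<kappa> s h \<in> carrier R"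
  shows "lin R \<kappa> (\<lambda>x. f x \<oplus> g x) = (\<lambda>h. lin R \<kappa> f h \<oplus> lin R \<kappa> g h)"
proof
  fix h
  let ?T = "{x. f x \<noteq> \<zero>} \<union> {x. g x \<noteq> \<zero>}"
  have T: "finite ?T" "?T \<subseteq> S"
    using free_supp[OF f] free_supp[OF g] by auto
  then have \<kappa>T: "\<kappa> x h \<in> carrier R" if "x \<in> ?T" for x h
    using that \<kappa> by blast
  have "lin R \<kappa> (\<lambda>x. f x \<oplus> g x) h = (\<Oplus>x\<in>?T. (f x \<oplus> g x) \<otimes> \<kappa> x h)"
    by (rule lin_superset[OF free_add[OF f g] T(1)]) (use \<kappa>T in auto)
  also have "\<dots> = (\<Oplus>x\<in>?T. f x \<otimes> \<kappa> x h \<oplus> g x \<otimes> \<kappa> x h)"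
    using \<kappa>T free_value[OF f] free_value[OF g] by (intro add.finprod_cong') (auto simp: l_distr)
  also have "\<dots> = (\<Oplus>x\<in>?T. f x \<otimes> \<kappa> x h) \<oplus> (\<Oplus>x\<in>?T. g x \<otimes> \<kappa> x h)"
    using \<kappa>T free_value[OF f] free_value[OF g] by (intro finsum_addf) auto
  also have "(\<Oplus>x\<in>?T. f x \<otimes> \<kappa> x h) = lin R \<kappa> f h"
    by (rule lin_superset[OF f T(1), symmetric]) (use \<kappa>T in auto)
  also have "(\<Oplus>x\<in>?T. g x \<otimes> \<kappa> x h) = lin R \<kappa> g h"
    by (rule lin_superset[OF g T(1), symmetric]) (use \<kappa>T in auto)
  finally show "lin R \<kappa> (\<lambda>x. f x \<oplus> g x) h = lin R \<kappa> f h \<oplus> lin R \<kappa> g h" .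
qed

lemma lin_smult:
  assumes f: "f \<in> Free R S" and a: "a \<in> carrier R"
    and \<kappa>: "\<And>s h. s \<in> S \<Longrightarrow> \<kappa> s h \<in> carrier R"
  shows "lin R \<kappa> (\<lambda>x. a \<otimes> f x) = (\<lambda>h. a \<otimes> lin R \<kappa> f h)"
proof
  fix h
  let ?T = "{x. f x \<noteq> \<zero>}"
  have T: "finite ?T" "?T \<subseteq> S"
    using free_supp[OF f] by auto
  then have \<kappa>T: "\<kappa> x h \<in> carrier R" if "x \<in> ?T" for x h
    using that \<kappa> by blast
  have "lin R \<kappa> (\<lambda>x. a \<otimes> f x) h = (\<Oplus>x\<in>?T. (a \<otimes> f x) \<otimes> \<kappa> x h)"
    by (rule lin_superset[OF free_smult[OF f a] T(1)]) (use \<kappa>T a in auto)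
  also have "\<dots> = (\<Oplus>x\<in>?T. a \<otimes> (f x \<otimes> \<kappa> x h))"
    using \<kappa>T free_value[OF f] a by (intro add.finprod_cong') (auto simp: m_assoc)
  also have "\<dots> = a \<otimes> lin R \<kappa> f h"
    unfolding lin_def using \<kappa>T free_value[OF f] a T(1) by (intro finsum_rdistr[symmetric]) auto
  finally show "lin R \<kappa> (\<lambda>x. a \<otimes> f x) h = a \<otimes> lin R \<kappa> f h" .
qed

lemma lin_value:
  assumes "f \<in> Free R S" "\<And>s h. s \<in> S \<Longrightarrow> \<kappa> s h \<in> carrier R"
  shows "lin R \<kappa> f h \<in> carrier R"
  unfolding lin_def
  by (rule finsum_closed) (use assms free_supp[OF assms(1)] free_value[OF assms(1)] in auto)

lemma lin_step:
  assumes "g \<in> S" "a \<in> carrier R" "u \<in> Free R S"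
    and "\<And>s h. s \<in> S \<Longrightarrow> \<kappa> s h \<in> carrier R"
  shows "lin R \<kappa> (\<lambda>x. single R g a x \<oplus> u x) = (\<lambda>h. a \<otimes> \<kappa> g h \<oplus> lin R \<kappa> u h)"
  by (subst lin_add[OF free_single[OF assms(1,2)] assms(3,4)])
    (use lin_single[where \<kappa> = \<kappa>, OF assms(1,2)] assms in auto)

lemma lin_closed:
  assumes "f \<in> Free R S" "\<And>s. s \<in> S \<Longrightarrow> \<kappa> s \<in> Free R T"
  shows "lin R \<kappa> f \<in> Free R T"
  using assms(1)
proof (induction rule: free_induct)
  case zero
  then show ?case by simp
next
  case (add g a u)
  show ?case
    by (subst lin_step[OF add(1-3)])
      (use free_value[OF assms(2)] add in \<open>auto intro!: free_add free_smult assms(2)\<close>)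
qed

lemma lin_lin:
  assumes "f \<in> Free R S" "\<And>s. s \<in> S \<Longrightarrow> \<kappa> s \<in> Free R T"
    and "\<And>t h. t \<in> T \<Longrightarrow> \<kappa>' t h \<in> carrier R"
  shows "lin R \<kappa>' (lin R \<kappa> f) = lin R (\<lambda>s. lin R \<kappa>' (\<kappa> s)) f"
  using assms(1)
proof (induction rule: free_induct)
  case zero
  then show ?case by simp
next
  case (add g a u)
  note v = free_value[OF assms(2)] lin_value[OF assms(2,3)]
  have "lin R \<kappa>' (lin R \<kappa> (\<lambda>x. single R g a x \<oplus> u x))
      = lin R \<kappa>' (\<lambda>h. a \<otimes> \<kappa> g h \<oplus> lin R \<kappa> u h)"
    by (subst lin_step[OF add(1-3)]) (use v in auto)
  also have "\<dots> = (\<lambda>h. lin R \<kappa>' (\<lambda>h. a \<otimes> \<kappa> g h) h \<oplus> lin R \<kappa>' (lin R \<kappa> u) h)"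
    by (rule lin_add[where S = T]) (use add assms in \<open>auto intro!: free_smult lin_closed\<close>)
  also have "lin R \<kappa>' (\<lambda>h. a \<otimes> \<kappa> g h) = (\<lambda>h. a \<otimes> lin R \<kappa>' (\<kappa> g) h)"
    by (rule lin_smult[where S = T]) (use add assms in auto)
  also have "(\<lambda>h. a \<otimes> lin R \<kappa>' (\<kappa> g) h \<oplus> lin R \<kappa>' (lin R \<kappa> u) h)
      = lin R (\<lambda>s. lin R \<kappa>' (\<kappa> s)) (\<lambda>x. single R g a x \<oplus> u x)"
    by (subst lin_step[OF add(1-3)]) (use v add in auto)
  finally show ?case .
qed

lemma lin_cong:
  assumes "f \<in> Free R S" "\<And>s. s \<in> S \<Longrightarrow> \<kappa> s = \<kappa>' s"
    "\<And>s h. s \<in> S \<Longrightarrow> \<kappa>' s h \<in> carrier R"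
  shows "lin R \<kappa> f = lin R \<kappa>' f"
  unfolding lin_def using assms free_supp[OF assms(1)] free_value[OF assms(1)]
  by (intro ext add.finprod_cong') auto

lemma lin_id:
  assumes "f \<in> Free R S"
  shows "lin R (\<lambda>s. single R s \<one>) f = f"
  using assms
proof (induction rule: free_induct)
  case (add g a u)
  show ?case
    by (subst lin_step[OF add(1-3)]) (use add in \<open>auto simp: single_def\<close>)
qed simp

lemma lin_add_fun:
  assumes "f \<in> Free R S"
    "\<And>s h. s \<in> S \<Longrightarrow> \<kappa> s h \<in> carrier R" "\<And>s h. s \<in> S \<Longrightarrow> \<kappa>' s h \<in> carrier R"
  shows "lin R (\<lambda>s h. \<kappa> s h \<oplus> \<kappa>' s h) f = (\<lambda>h. lin R \<kappa> f h \<oplus> lin R \<kappa>' f h)"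
proof
  fix h
  have "lin R (\<lambda>s h. \<kappa> s h \<oplus> \<kappa>' s h) f h
      = (\<Oplus>g\<in>{g. f g \<noteq> \<zero>}. f g \<otimes> \<kappa> g h \<oplus> f g \<otimes> \<kappa>' g h)"
    unfolding lin_def using assms free_supp[OF assms(1)] free_value[OF assms(1)]
    by (intro add.finprod_cong') (auto simp: r_distr subset_iff)
  also have "\<dots> = lin R \<kappa> f h \<oplus> lin R \<kappa>' f h"
    unfolding lin_def using assms free_supp[OF assms(1)] free_value[OF assms(1)]
    by (intro finsum_addf) auto
  finally show "lin R (\<lambda>s h. \<kappa> s h \<oplus> \<kappa>' s h) f h = lin R \<kappa> f h \<oplus> lin R \<kappa>' f h" .
qed

lemma add_eq_imp_minus: "\<lbrakk>x \<in> carrier R; y \<in> carrier R; x \<oplus> y = z\<rbrakk> \<Longrightarrow> x = z \<ominus> y"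
  by (auto simp: minus_eq a_assoc r_neg)

lemma minus_add_cancel: "\<lbrakk>x \<in> carrier R; y \<in> carrier R\<rbrakk> \<Longrightarrow> x \<ominus> y \<oplus> y = x"
  by (auto simp: minus_eq a_assoc l_neg)

lemma lin_minus:
  assumes f: "f \<in> Free R S" and g: "g \<in> Free R S"
    and \<kappa>: "\<And>s h. s \<in> S \<Longrightarrow> \<kappa> s h \<in> carrier R"
  shows "lin R \<kappa> (\<lambda>x. f x \<ominus> g x) = (\<lambda>h. lin R \<kappa> f h \<ominus> lin R \<kappa> g h)"
proof
  fix h
  have "lin R \<kappa> (\<lambda>x. f x \<ominus> g x) h \<oplus> lin R \<kappa> g h = lin R \<kappa> (\<lambda>x. f x \<ominus> g x \<oplus> g x) h"
    by (subst lin_add[OF free_minus[OF f g] g]) (use \<kappa> in auto)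
  also have "\<dots> = lin R \<kappa> f h"
    using free_value[OF f] free_value[OF g] by (simp add: minus_add_cancel)
  finally show "lin R \<kappa> (\<lambda>x. f x \<ominus> g x) h = lin R \<kappa> f h \<ominus> lin R \<kappa> g h"
    using lin_value[where S = S and \<kappa> = \<kappa>] f g \<kappa> free_minus[OF f g] by (intro add_eq_imp_minus) auto
qed

lemma lin_minus_fun:
  assumes "f \<in> Free R S"
    "\<And>s h. s \<in> S \<Longrightarrow> \<kappa> s h \<in> carrier R" "\<And>s h. s \<in> S \<Longrightarrow> \<kappa>' s h \<in> carrier R"
  shows "lin R (\<lambda>s h. \<kappa> s h \<ominus> \<kappa>' s h) f = (\<lambda>h. lin R \<kappa> f h \<ominus> lin R \<kappa>' f h)"
proof
  fix h
  have "lin R (\<lambda>s h. \<kappa> s h \<ominus> \<kappa>' s h) f h \<oplus> lin R \<kappa>' f h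
      = lin R (\<lambda>s h. \<kappa> s h \<ominus> \<kappa>' s h \<oplus> \<kappa>' s h) f h"
    by (subst lin_add_fun[OF assms(1)]) (use assms in auto)
  also have "lin R (\<lambda>s h. \<kappa> s h \<ominus> \<kappa>' s h \<oplus> \<kappa>' s h) f = lin R \<kappa> f"
    by (rule lin_cong[OF assms(1)]) (use assms in \<open>auto simp: minus_add_cancel\<close>)
  finally show "lin R (\<lambda>s h. \<kappa> s h \<ominus> \<kappa>' s h) f h = lin R \<kappa> f h \<ominus> lin R \<kappa>' f h"
    using assms by (intro add_eq_imp_minus lin_value[where S = S]) auto
qed

end

lemma free_map_hom:
  assumes "ring A" "ring B" "\<phi> \<in> ring_hom A B" "f \<in> Free A S"
  shows "(\<lambda>x. \<phi> (f x)) \<in> Free B S"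
proof -
  interpret h: ring_hom_ring A B \<phi>
    using assms by (intro ring_hom_ringI2) auto
  have "finite {x. \<phi> (f x) \<noteq> \<zero>\<^bsub>B\<^esub>}"
    by (rule finite_subset[of _ "{x. f x \<noteq> \<zero>\<^bsub>A\<^esub>}"]) (use assms in \<open>auto simp: free_module_def\<close>)
  then show ?thesis
    using assms by (auto simp: free_module_def)
qed

lemma lin_map_hom:
  assumes "ring A" "ring B" "\<phi> \<in> ring_hom A B" "f \<in> Free A S"
    and \<kappa>: "\<And>s h. s \<in> S \<Longrightarrow> \<kappa> s h \<in> carrier A"
  shows "(\<lambda>h. \<phi> (lin A \<kappa> f h)) = lin B (\<lambda>s h. \<phi> (\<kappa> s h)) (\<lambda>x. \<phi> (f x))"
proof -
  interpret h: ring_hom_ring A B \<phi>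
    using assms by (intro ring_hom_ringI2) auto
  show ?thesis
    using assms(4)
  proof (induction rule: h.R.free_induct)
    case zero
    then show ?case by simp
  next
    case (add g a u)
    have *: "(\<lambda>x. \<phi> (single A g a x \<oplus>\<^bsub>A\<^esub> u x)) = (\<lambda>x. single B g (\<phi> a) x \<oplus>\<^bsub>B\<^esub> \<phi> (u x))"
      using add h.R.free_value[OF add(3)] by (auto simp: single_def)
    have "(\<lambda>h. \<phi> (lin A \<kappa> (\<lambda>x. single A g a x \<oplus>\<^bsub>A\<^esub> u x) h))
        = (\<lambda>h. \<phi> a \<otimes>\<^bsub>B\<^esub> \<phi> (\<kappa> g h) \<oplus>\<^bsub>B\<^esub> \<phi> (lin A \<kappa> u h))"
      by (subst h.R.lin_step[OF add(1-3)]) (use \<kappa> add h.R.lin_value[where \<kappa> = \<kappa>, OF add(3)] in \<open>auto simp: fun_eq_iff\<close>)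
    also have "\<dots> = lin B (\<lambda>s h. \<phi> (\<kappa> s h)) (\<lambda>x. \<phi> (single A g a x \<oplus>\<^bsub>A\<^esub> u x))"
      unfolding *
      by (subst h.S.lin_step[where S = S])
        (use \<kappa> add free_map_hom[OF assms(1-3)] in \<open>auto simp: fun_eq_iff\<close>)
    finally show ?case .
  qed
qed


section \<open>Quotient modules\<close>

lemma quotient_module_simps [simp]:
  "carrier (quotient_module M S) = a_rcosets\<^bsub>M\<^esub> S"
  "add (quotient_module M S) = set_add M"
  "zero (quotient_module M S) = S"
  "monoid.mult (quotient_module M S) = rcoset_mult M S"
  "one (quotient_module M S) = S +>\<^bsub>M\<^esub> \<one>\<^bsub>M\<^esub>"
  "smult (quotient_module M S) = (\<lambda>r X. \<Union>x\<in>X. S +>\<^bsub>M\<^esub> (r \<odot>\<^bsub>M\<^esub> x))"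
  by (simp_all add: quotient_module_def ring.extend_def module.fields_def FactRing_def)

lemma a_rcosets_image: "a_rcosets\<^bsub>M\<^esub> S = (\<lambda>x. S +>\<^bsub>M\<^esub> x) ` carrier M"
  by (auto simp: A_RCOSETS_def')

locale module_with_submodule = module + fixes S assumes submodule: "submodule S R M"
begin

lemma S_subset: "S \<subseteq> carrier M"
  using submoduleE[OF submodule] by blast

lemma abelian_subgroup: "abelian_subgroup S M"
  by (rule abelian_subgroupI3)
    (auto intro!: additive_subgroup.intro submodule.axioms(1)[OF submodule] M.abelian_group_axioms)

lemma coset_eq_iff:
  assumes "x \<in> carrier M" "y \<in> carrier M"
  shows "S +>\<^bsub>M\<^esub> x = S +>\<^bsub>M\<^esub> y \<longleftrightarrow> x \<ominus>\<^bsub>M\<^esub> y \<in> S"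
proof -
  interpret S: abelian_subgroup S M
    by (rule abelian_subgroup)
  show ?thesis
    using S.a_rcos_module[OF assms(2,1)] a_repr_independence[OF _ assms(2)] S.a_rcos_self[OF assms(1)]
      S.a_subgroup assms by (auto simp: minus_eq)
qed

lemma coset_add:
  "\<lbrakk>x \<in> carrier M; y \<in> carrier M\<rbrakk> \<Longrightarrow> S +>\<^bsub>M\<^esub> x <+>\<^bsub>M\<^esub> (S +>\<^bsub>M\<^esub> y) = S +>\<^bsub>M\<^esub> (x \<oplus>\<^bsub>M\<^esub> y)"
  by (rule abelian_subgroup.a_rcos_sum[OF abelian_subgroup])

lemma coset_memD:
  assumes "x \<in> carrier M" "y \<in> S +>\<^bsub>M\<^esub> x"
  shows "y \<in> carrier M" "S +>\<^bsub>M\<^esub> y = S +>\<^bsub>M\<^esub> x" "y \<ominus>\<^bsub>M\<^esub> x \<in> S"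
proof -
  show y: "y \<in> carrier M"
    using assms a_r_coset_subset_G[OF S_subset] by blast
  show "S +>\<^bsub>M\<^esub> y = S +>\<^bsub>M\<^esub> x"
    using a_repr_independence[OF assms(2,1)] submodule by (simp add: submodule_def)
  then show "y \<ominus>\<^bsub>M\<^esub> x \<in> S"
    using coset_eq_iff y assms(1) by blast
qed

lemma coset_self: "x \<in> carrier M \<Longrightarrow> x \<in> S +>\<^bsub>M\<^esub> x"
  by (rule abelian_subgroup.a_rcos_self[OF abelian_subgroup])

lemma smult_diff:
  assumes "r \<in> carrier R" "x \<in> carrier M" "y \<in> carrier M"
  shows "r \<odot>\<^bsub>M\<^esub> (x \<ominus>\<^bsub>M\<^esub> y) = r \<odot>\<^bsub>M\<^esub> x \<ominus>\<^bsub>M\<^esub> r \<odot>\<^bsub>M\<^esub> y"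
  using assms by (simp add: minus_eq smult_r_distr smult_r_minus)

text \<open>The union in the definition of \<open>quotient_module\<close> ranges over copies of one
  and the same coset, since \<open>S\<close> absorbs scalars.\<close>

lemma coset_smult:
  assumes "r \<in> carrier R" "x \<in> carrier M"
  shows "(\<Union>y\<in>S +>\<^bsub>M\<^esub> x. S +>\<^bsub>M\<^esub> (r \<odot>\<^bsub>M\<^esub> y)) = S +>\<^bsub>M\<^esub> (r \<odot>\<^bsub>M\<^esub> x)"
proof -
  have "S +>\<^bsub>M\<^esub> (r \<odot>\<^bsub>M\<^esub> y) = S +>\<^bsub>M\<^esub> (r \<odot>\<^bsub>M\<^esub> x)" if "y \<in> S +>\<^bsub>M\<^esub> x" for y
    using coset_memD[OF assms(2) that] assms
    by (simp add: coset_eq_iff smult_diff[symmetric] submoduleE(4)[OF submodule])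
  then have "(\<Union>y\<in>S +>\<^bsub>M\<^esub> x. S +>\<^bsub>M\<^esub> (r \<odot>\<^bsub>M\<^esub> y)) = (\<Union>y\<in>S +>\<^bsub>M\<^esub> x. S +>\<^bsub>M\<^esub> (r \<odot>\<^bsub>M\<^esub> x))"
    by (rule SUP_cong[OF refl])
  then show ?thesis
    using coset_self[OF assms(2)] by (simp only: UN_constant) auto
qed

abbreviation Q where "Q \<equiv> quotient_module M S"

lemma quotient_add:
  "\<lbrakk>x \<in> carrier M; y \<in> carrier M\<rbrakk> \<Longrightarrow> (S +>\<^bsub>M\<^esub> x) \<oplus>\<^bsub>Q\<^esub> (S +>\<^bsub>M\<^esub> y) = S +>\<^bsub>M\<^esub> (x \<oplus>\<^bsub>M\<^esub> y)"
  by (simp add: coset_add)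

lemma quotient_smult:
  "\<lbrakk>r \<in> carrier R; x \<in> carrier M\<rbrakk> \<Longrightarrow> r \<odot>\<^bsub>Q\<^esub> (S +>\<^bsub>M\<^esub> x) = S +>\<^bsub>M\<^esub> (r \<odot>\<^bsub>M\<^esub> x)"
  by (simp add: coset_smult)

lemma quotient_carrier: "carrier Q = (\<lambda>x. S +>\<^bsub>M\<^esub> x) ` carrier M"
  by (simp add: a_rcosets_image)

lemma quotient_zero: "\<zero>\<^bsub>Q\<^esub> = S +>\<^bsub>M\<^esub> \<zero>\<^bsub>M\<^esub>"
  using S_subset by simp

lemma module_quotient: "module R Q"
proof (rule moduleI)
  show "cring R" ..
  show "abelian_group Q"
  proof (rule abelian_groupI)
    fix X assume "X \<in> carrier Q"
    then obtain x where x: "x \<in> carrier M" "X = S +>\<^bsub>M\<^esub> x"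
      unfolding quotient_carrier by blast
    then have "(S +>\<^bsub>M\<^esub> (\<ominus>\<^bsub>M\<^esub> x)) \<oplus>\<^bsub>Q\<^esub> X = \<zero>\<^bsub>Q\<^esub>"
      by (simp only: quotient_add quotient_zero M.a_inv_closed M.l_neg)
    then show "\<exists>Y\<in>carrier Q. Y \<oplus>\<^bsub>Q\<^esub> X = \<zero>\<^bsub>Q\<^esub>"
      using x(1) unfolding quotient_carrier by blast
  qed (auto simp: quotient_carrier quotient_add quotient_zero M.a_ac simp del: quotient_module_simps)
qed (auto simp: quotient_carrier quotient_add quotient_smult smult_l_distr smult_r_distr smult_assoc1
    simp del: quotient_module_simps)

end

text \<open>Kernel and surjectivity are required only modulo the submodules, so \<open>f\<close>
  itself may fail to be injective or onto. This is the form in which a homotopy equivalence provides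
  them.\<close>

lemma quotient_iso:
  assumes "module_with_submodule R M S" "module_with_submodule R M' S'"
    and closed: "\<And>x. x \<in> carrier M \<Longrightarrow> f x \<in> carrier M'"
    and add: "\<And>x y. \<lbrakk>x \<in> carrier M; y \<in> carrier M\<rbrakk> \<Longrightarrow> f (x \<oplus>\<^bsub>M\<^esub> y) = f x \<oplus>\<^bsub>M'\<^esub> f y"
    and smult: "\<And>r x. \<lbrakk>r \<in> carrier R; x \<in> carrier M\<rbrakk> \<Longrightarrow> f (r \<odot>\<^bsub>M\<^esub> x) = r \<odot>\<^bsub>M'\<^esub> f x"
    and ker: "\<And>x. x \<in> carrier M \<Longrightarrow> f x \<in> S' \<longleftrightarrow> x \<in> S"
    and surj: "\<And>y. y \<in> carrier M' \<Longrightarrow> \<exists>x\<in>carrier M. y \<ominus>\<^bsub>M'\<^esub> f x \<in> S'"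
  shows "module_iso R (quotient_module M S) (quotient_module M' S')"
proof -
  interpret M: module_with_submodule R M S by fact
  interpret N: module_with_submodule R M' S' by fact
  have minus: "f x \<ominus>\<^bsub>M'\<^esub> f y = f (x \<ominus>\<^bsub>M\<^esub> y)" if "x \<in> carrier M" "y \<in> carrier M" for x y
  proof -
    have "f x = f (x \<ominus>\<^bsub>M\<^esub> y) \<oplus>\<^bsub>M'\<^esub> f y"
      using that by (simp add: add[symmetric] M.minus_eq M.a_assoc M.l_neg)
    then show ?thesis
      using that closed by (simp add: N.minus_eq N.a_assoc N.r_neg)
  qed
  \<comment> \<open>A coset is sent on by way of a chosen representative; \<open>ker\<close> makes
    the result independent of the choice.\<close>
  define F where "F X = S' +>\<^bsub>M'\<^esub> f (SOME x. x \<in> X)" for X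
  have F: "F (S +>\<^bsub>M\<^esub> x) = S' +>\<^bsub>M'\<^esub> f x" if "x \<in> carrier M" for x
  proof -
    define y where "y = (SOME y. y \<in> S +>\<^bsub>M\<^esub> x)"
    have y: "y \<in> S +>\<^bsub>M\<^esub> x"
      unfolding y_def by (rule someI, rule M.coset_self[OF that])
    show ?thesis
      unfolding F_def y_def[symmetric] using M.coset_memD[OF that y] that closed
      by (simp add: N.coset_eq_iff minus ker)
  qed
  have inj: "X = Y" if XY: "X \<in> carrier M.Q" "Y \<in> carrier M.Q" "F X = F Y" for X Y
  proof -
    obtain x y where xy: "x \<in> carrier M" "X = S +>\<^bsub>M\<^esub> x" "y \<in> carrier M" "Y = S +>\<^bsub>M\<^esub> y"
      using XY(1,2) unfolding M.quotient_carrier by blast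
    then show ?thesis
      using XY(3) by (simp add: F N.coset_eq_iff closed minus ker M.coset_eq_iff)
  qed
  have "F ` carrier M.Q = carrier N.Q"
  proof
    show "F ` carrier M.Q \<subseteq> carrier N.Q"
      unfolding M.quotient_carrier N.quotient_carrier by (auto simp: F closed)
    show "carrier N.Q \<subseteq> F ` carrier M.Q"
    proof
      fix Y assume "Y \<in> carrier N.Q"
      then obtain y where y: "y \<in> carrier M'" "Y = S' +>\<^bsub>M'\<^esub> y"
        unfolding N.quotient_carrier by auto
      then obtain x where x: "x \<in> carrier M" "y \<ominus>\<^bsub>M'\<^esub> f x \<in> S'"
        using surj by blast
      have "Y = F (S +>\<^bsub>M\<^esub> x)"
        using x y closed by (simp add: F N.coset_eq_iff)
      then show "Y \<in> F ` carrier M.Q"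
        unfolding M.quotient_carrier using x by blast
    qed
  qed
  then have "bij_betw F (carrier M.Q) (carrier N.Q)"
    using inj by (auto simp: bij_betw_def inj_on_def)
  moreover have "F (X \<oplus>\<^bsub>M.Q\<^esub> Y) = F X \<oplus>\<^bsub>N.Q\<^esub> F Y" if "X \<in> carrier M.Q" "Y \<in> carrier M.Q" for X Y
    using that unfolding M.quotient_carrier
    by (auto simp: M.quotient_add N.quotient_add F add closed simp del: quotient_module_simps)
  moreover have "F (r \<odot>\<^bsub>M.Q\<^esub> X) = r \<odot>\<^bsub>N.Q\<^esub> F X" if "r \<in> carrier R" "X \<in> carrier M.Q" for r X
    using that unfolding M.quotient_carrier
    by (auto simp: M.quotient_smult N.quotient_smult F smult closed simp del: quotient_module_simps)
  ultimately show ?thesis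
    unfolding module_iso_def by blast
qed

lemma module_iso_sym:
  assumes "module R M" "module_iso R M N"
  shows "module_iso R N M"
proof -
  interpret module R M by fact
  obtain f where f: "bij_betw f (carrier M) (carrier N)"
    "\<And>x y. \<lbrakk>x \<in> carrier M; y \<in> carrier M\<rbrakk> \<Longrightarrow> f (x \<oplus>\<^bsub>M\<^esub> y) = f x \<oplus>\<^bsub>N\<^esub> f y"
    "\<And>r x. \<lbrakk>r \<in> carrier R; x \<in> carrier M\<rbrakk> \<Longrightarrow> f (r \<odot>\<^bsub>M\<^esub> x) = r \<odot>\<^bsub>N\<^esub> f x"
    using assms(2) unfolding module_iso_def by blast
  let ?g = "inv_into (carrier M) f"
  have g: "?g x \<in> carrier M" "f (?g x) = x" if "x \<in> carrier N" for x
    using f(1) that by (auto simp: bij_betw_def inv_into_into f_inv_into_f)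
  have gf: "?g (f x) = x" if "x \<in> carrier M" for x
    using f(1) that by (simp add: bij_betw_def)
  have "?g (x \<oplus>\<^bsub>N\<^esub> y) = ?g x \<oplus>\<^bsub>M\<^esub> ?g y" if "x \<in> carrier N" "y \<in> carrier N" for x y
    using gf[of "?g x \<oplus>\<^bsub>M\<^esub> ?g y"] that by (simp add: f(2) g)
  moreover have "?g (r \<odot>\<^bsub>N\<^esub> x) = r \<odot>\<^bsub>M\<^esub> ?g x" if "r \<in> carrier R" "x \<in> carrier N" for r x
    using gf[of "r \<odot>\<^bsub>M\<^esub> ?g x"] that by (simp add: f(3) g)
  ultimately show ?thesis
    unfolding module_iso_def using bij_betw_inv_into[OF f(1)] by blast
qed

lemma module_iso_trans:
  assumes "module_iso R M N" "module_iso R N P"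
  shows "module_iso R M P"
proof -
  obtain f where f: "bij_betw f (carrier M) (carrier N)"
    "\<And>x y. \<lbrakk>x \<in> carrier M; y \<in> carrier M\<rbrakk> \<Longrightarrow> f (x \<oplus>\<^bsub>M\<^esub> y) = f x \<oplus>\<^bsub>N\<^esub> f y"
    "\<And>r x. \<lbrakk>r \<in> carrier R; x \<in> carrier M\<rbrakk> \<Longrightarrow> f (r \<odot>\<^bsub>M\<^esub> x) = r \<odot>\<^bsub>N\<^esub> f x"
    using assms(1) unfolding module_iso_def by blast
  obtain g where g: "bij_betw g (carrier N) (carrier P)"
    "\<And>x y. \<lbrakk>x \<in> carrier N; y \<in> carrier N\<rbrakk> \<Longrightarrow> g (x \<oplus>\<^bsub>N\<^esub> y) = g x \<oplus>\<^bsub>P\<^esub> g y"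
    "\<And>r x. \<lbrakk>r \<in> carrier R; x \<in> carrier N\<rbrakk> \<Longrightarrow> g (r \<odot>\<^bsub>N\<^esub> x) = r \<odot>\<^bsub>P\<^esub> g x"
    using assms(2) unfolding module_iso_def by blast
  have "f x \<in> carrier N" if "x \<in> carrier M" for x
    using f(1) that by (auto simp: bij_betw_def)
  then show ?thesis
    unfolding module_iso_def
    by (intro exI[of _ "g \<circ> f"]) (auto simp: f g bij_betw_trans[OF f(1) g(1)])
qed


section \<open>Homology of complexes of free modules\<close>

lemma free_module_simps:
  "zero (free_module A S) = (\<lambda>x. \<zero>\<^bsub>A\<^esub>)"
  "f \<oplus>\<^bsub>free_module A S\<^esub> g = (\<lambda>x. f x \<oplus>\<^bsub>A\<^esub> g x)"
  "a \<odot>\<^bsub>free_module A S\<^esub> f = (\<lambda>x. a \<otimes>\<^bsub>A\<^esub> f x)"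
  by (simp_all add: free_module_def)

lemma (in ring) abelian_group_free: "abelian_group (free_module R S)"
proof (rule abelian_groupI)
  fix x assume x: "x \<in> Free R S"
  show "\<exists>y\<in>Free R S. y \<oplus>\<^bsub>free_module R S\<^esub> x = \<zero>\<^bsub>free_module R S\<^esub>"
    using free_minus[OF free_zero x] free_value[OF x]
    by (intro bexI[of _ "\<lambda>h. \<zero> \<ominus> x h"]) (auto simp: free_module_simps minus_eq l_neg)
qed (auto simp: free_module_simps free_add free_value a_ac fun_eq_iff)

lemma (in ring) free_minus_eq:
  assumes "f \<in> Free R S" "g \<in> Free R S"
  shows "f \<ominus>\<^bsub>free_module R S\<^esub> g = (\<lambda>x. f x \<ominus> g x)"
proof -
  interpret F: abelian_group "free_module R S"
    by (rule abelian_group_free)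
  have "(\<lambda>x. f x \<ominus> g x) \<oplus>\<^bsub>free_module R S\<^esub> g = f"
    using free_value[OF assms(1)] free_value[OF assms(2)] by (auto simp: free_module_simps minus_add_cancel fun_eq_iff)
  then show ?thesis
    using F.add.inv_solve_right[of "\<lambda>x. f x \<ominus> g x" f g] free_minus[OF assms] assms
    by (simp add: F.minus_eq)
qed

lemma (in cring) module_free: "module R (free_module R S)"
  by (intro moduleI is_cring abelian_group_free)
    (auto simp: free_module_simps free_smult free_value l_distr r_distr m_assoc fun_eq_iff)

text \<open>The disjunct \<open>k = 0\<close> makes every chain of degree 0 a cycle, whatever
  \<open>d\<close> is on \<open>S 0\<close>.\<close>

definition cycles :: "('a, 's) ring_scheme \<Rightarrow> (nat \<Rightarrow> 'x set) \<Rightarrow> ('x \<Rightarrow> 'x \<Rightarrow> 'a) \<Rightarrow> nat \<Rightarrow> ('x \<Rightarrow> 'a) set" where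
  "cycles A S d k = {u \<in> Free A (S k). k = 0 \<or> lin A d u = (\<lambda>h. \<zero>\<^bsub>A\<^esub>)}"

abbreviation cycle_module ::
  "('a, 's) ring_scheme \<Rightarrow> (nat \<Rightarrow> 'x set) \<Rightarrow> ('x \<Rightarrow> 'x \<Rightarrow> 'a) \<Rightarrow> nat \<Rightarrow> ('a, 'x \<Rightarrow> 'a) module" where
  "cycle_module A S d k \<equiv> (free_module A (S k))\<lparr>carrier := cycles A S d k\<rparr>"

definition homology :: "('a, 's) ring_scheme \<Rightarrow> (nat \<Rightarrow> 'x set) \<Rightarrow> ('x \<Rightarrow> 'x \<Rightarrow> 'a) \<Rightarrow> nat \<Rightarrow> ('a, ('x \<Rightarrow> 'a) set) module" where
  "homology A S d k =
    quotient_module (cycle_module A S d k)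
      (lin A d ` Free A (S (Suc k)))"

locale free_complex = ring R for R (structure) +
  fixes S :: "nat \<Rightarrow> 'x set" and d :: "'x \<Rightarrow> 'x \<Rightarrow> 'a"
  assumes d_closed: "s \<in> S (Suc k) \<Longrightarrow> d s \<in> Free R (S k)"
    and d_d: "s \<in> S (Suc (Suc k)) \<Longrightarrow> lin R d (d s) = (\<lambda>h. \<zero>)"
begin

lemma d_value: "s \<in> S (Suc k) \<Longrightarrow> d s h \<in> carrier R"
  using free_value[OF d_closed] .

lemma lin_d_closed:
  "u \<in> Free R (S (Suc k)) \<Longrightarrow> lin R d u \<in> Free R (S k)"
  by (rule lin_closed[OF _ d_closed])

lemma lin_d_d:
  assumes "u \<in> Free R (S (Suc (Suc k)))"
  shows "lin R d (lin R d u) = (\<lambda>h. \<zero>)"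
proof -
  have "lin R d (lin R d u) = lin R (\<lambda>s. lin R d (d s)) u"
    by (rule lin_lin[OF assms d_closed d_value])
  also have "\<dots> = lin R (\<lambda>s h. \<zero>) u"
    by (rule lin_cong[OF assms]) (auto simp: d_d)
  finally show ?thesis
    using free_value[OF assms] by (simp add: lin_def)
qed

lemma boundary_in_cycles:
  assumes "u \<in> Free R (S (Suc k))"
  shows "lin R d u \<in> cycles R S d k"
  using assms lin_d_closed lin_d_d by (cases k) (auto simp: cycles_def)

lemma cycles_add:
  assumes "f \<in> cycles R S d k" "g \<in> cycles R S d k"
  shows "(\<lambda>x. f x \<oplus> g x) \<in> cycles R S d k"
  using assms d_value by (cases k) (auto simp: cycles_def free_add lin_add)

lemma cycles_minus:
  assumes "f \<in> cycles R S d k" "g \<in> cycles R S d k"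
  shows "(\<lambda>x. f x \<ominus> g x) \<in> cycles R S d k"
proof -
  have "\<zero> \<ominus> \<zero> = \<zero>"
    by (simp add: minus_eq)
  then show ?thesis
    using assms d_value by (cases k) (auto simp: cycles_def free_minus lin_minus)
qed

end

locale free_complex_comm = cring R + free_complex R S d for R (structure) and S d
begin

lemma submodule_cycles: "submodule (cycles R S d k) R (free_module R (S k))"
proof -
  interpret F: module R "free_module R (S k)" by (rule module_free)
  have z: "(\<lambda>x. \<zero>) \<in> cycles R S d k"
    by (simp add: cycles_def)
  show ?thesis
  proof (rule F.submoduleI)
    show "\<ominus>\<^bsub>free_module R (S k)\<^esub> f \<in> cycles R S d k" if f: "f \<in> cycles R S d k" for f
    proof -
      have "\<ominus>\<^bsub>free_module R (S k)\<^esub> f = \<zero>\<^bsub>free_module R (S k)\<^esub> \<ominus>\<^bsub>free_module R (S k)\<^esub> f"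
        using f by (auto simp: cycles_def F.minus_eq)
      also have "\<dots> = (\<lambda>x. \<zero> \<ominus> f x)"
        using f by (auto simp: free_minus_eq free_module_simps cycles_def)
      finally show ?thesis
        using cycles_minus[OF z f] by simp
    qed
    show "a \<odot>\<^bsub>free_module R (S k)\<^esub> f \<in> cycles R S d k" if "a \<in> carrier R" "f \<in> cycles R S d k" for a f
      using that d_value by (cases k) (auto simp: cycles_def free_module_simps free_smult lin_smult)
  qed (use cycles_add z in \<open>auto simp: cycles_def free_module_simps\<close>)
qed

lemma homology_submodule:
  "module_with_submodule R (cycle_module R S d k)
    (lin R d ` Free R (S (Suc k)))"
proof -
  interpret F: module R "free_module R (S k)" by (rule module_free)
  interpret Z: module R "cycle_module R S d k"
    by (rule submodule.submodule_is_module[OF submodule_cycles module_free])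
  let ?F = "free_module R (S (Suc k))"
  interpret F': module R ?F by (rule module_free)
  let ?Z = "cycle_module R S d k"
  let ?B = "lin R d ` carrier ?F"
  have sub: "?B \<subseteq> carrier ?Z"
    using boundary_in_cycles by auto
  have minus: "(\<lambda>x. f x \<ominus> g x) \<in> ?B" if "f \<in> ?B" "g \<in> ?B" for f g
    using that by (auto simp: lin_minus[OF _ _ d_value, symmetric] intro!: imageI free_minus)
  have z: "(\<lambda>x. \<zero>) \<in> ?B"
    by (rule image_eqI[of _ _ "\<lambda>x. \<zero>"]) auto
  have inv: "\<ominus>\<^bsub>?Z\<^esub> f = (\<lambda>x. \<zero> \<ominus> f x)" if "f \<in> ?B" for f
  proof -
    have f: "f \<in> carrier ?Z" using that sub by blast
    have "(\<lambda>x. \<zero> \<ominus> f x) \<oplus>\<^bsub>?Z\<^esub> f = \<zero>\<^bsub>?Z\<^esub>"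
      using f by (auto simp: free_module_simps cycles_def fun_eq_iff minus_add_cancel free_value)
    moreover have "(\<lambda>x. \<zero> \<ominus> f x) \<in> carrier ?Z"
      using minus[OF z that] sub by blast
    ultimately show ?thesis
      using Z.minus_equality f by blast
  qed
  show ?thesis
  proof (intro module_with_submodule.intro module_with_submodule_axioms.intro Z.submoduleI)
    show "module R ?Z" ..
    show "f \<oplus>\<^bsub>?Z\<^esub> g \<in> ?B" if "f \<in> ?B" "g \<in> ?B" for f g
      using that by (auto simp: free_module_simps lin_add[OF _ _ d_value, symmetric] intro!: imageI free_add)
    show "a \<odot>\<^bsub>?Z\<^esub> f \<in> ?B" if "a \<in> carrier R" "f \<in> ?B" for a f
      using that by (auto simp: free_module_simps lin_smult[OF _ _ d_value, symmetric] intro!: imageI free_smult)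
  qed (use sub z inv minus in \<open>auto simp: free_module_simps\<close>)
qed

text \<open>Inverses in a record are defined relative to its carrier, so the subtraction of
  \<open>cycle_module\<close> has to be identified with the pointwise one.\<close>

lemma homology_minus:
  assumes "f \<in> cycles R S d k" "g \<in> cycles R S d k"
  shows "f \<ominus>\<^bsub>cycle_module R S d k\<^esub> g = (\<lambda>x. f x \<ominus> g x)"
proof -
  let ?Z = "cycle_module R S d k"
  interpret Z: module_with_submodule R ?Z "lin R d ` Free R (S (Suc k))"
    by (rule homology_submodule)
  interpret F: module R "free_module R (S k)" by (rule module_free)
  have "(\<lambda>x. f x \<ominus> g x) \<in> carrier ?Z"
    using cycles_minus[OF assms] by simp
  moreover have "f x \<in> carrier R" "g x \<in> carrier R" for x
    using assms free_value[where S = "S k"] by (auto simp: cycles_def)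
  then have "(\<lambda>x. f x \<ominus> g x) \<oplus>\<^bsub>?Z\<^esub> g = f"
    by (auto simp: free_module_simps minus_add_cancel fun_eq_iff)
  ultimately show ?thesis
    using Z.add.inv_solve_right[of "\<lambda>x. f x \<ominus> g x" f g] assms by (simp add: Z.minus_eq)
qed

end


section \<open>Chain maps and homotopies\<close>

definition chain_map ::
  "('a, 's) ring_scheme \<Rightarrow> (nat \<Rightarrow> 'x set) \<Rightarrow> ('x \<Rightarrow> 'x \<Rightarrow> 'a) \<Rightarrow> (nat \<Rightarrow> 'y set) \<Rightarrow> ('y \<Rightarrow> 'y \<Rightarrow> 'a) \<Rightarrow>
   (nat \<Rightarrow> 'x \<Rightarrow> 'y \<Rightarrow> 'a) \<Rightarrow> bool" where
  "chain_map A S d T e f \<longleftrightarrow>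
    (\<forall>k. \<forall>s\<in>S k. f k s \<in> Free A (T k)) \<and>
    (\<forall>k. \<forall>s\<in>S (Suc k). lin A e (f (Suc k) s) = lin A (f k) (d s))"

text \<open>The usual equation \<open>e h + h d = f - g\<close>, solved for \<open>e h\<close>: in
  this form exactness of the target yields \<open>h\<close> degree by degree. In degree 0 the term
  \<open>h d\<close> is absent.\<close>

definition homotopy ::
  "('a, 's) ring_scheme \<Rightarrow> (nat \<Rightarrow> 'x set) \<Rightarrow> ('x \<Rightarrow> 'x \<Rightarrow> 'a) \<Rightarrow> (nat \<Rightarrow> 'y set) \<Rightarrow> ('y \<Rightarrow> 'y \<Rightarrow> 'a) \<Rightarrow>
   (nat \<Rightarrow> 'x \<Rightarrow> 'y \<Rightarrow> 'a) \<Rightarrow> (nat \<Rightarrow> 'x \<Rightarrow> 'y \<Rightarrow> 'a) \<Rightarrow> (nat \<Rightarrow> 'x \<Rightarrow> 'y \<Rightarrow> 'a) \<Rightarrow> bool" where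
  "homotopy A S d T e f g h \<longleftrightarrow>
    (\<forall>k. \<forall>s\<in>S k. h k s \<in> Free A (T (Suc k))) \<and>
    (\<forall>s\<in>S 0. lin A e (h 0 s) = (\<lambda>x. f 0 s x \<ominus>\<^bsub>A\<^esub> g 0 s x)) \<and>
    (\<forall>k. \<forall>s\<in>S (Suc k). lin A e (h (Suc k) s) =
      (\<lambda>x. f (Suc k) s x \<ominus>\<^bsub>A\<^esub> g (Suc k) s x \<ominus>\<^bsub>A\<^esub> lin A (h k) (d s) x))"

definition comp_map :: "('a, 's) ring_scheme \<Rightarrow> (nat \<Rightarrow> 'y \<Rightarrow> 'z \<Rightarrow> 'a) \<Rightarrow> (nat \<Rightarrow> 'x \<Rightarrow> 'y \<Rightarrow> 'a) \<Rightarrow>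
    nat \<Rightarrow> 'x \<Rightarrow> 'z \<Rightarrow> 'a" where
  "comp_map A g f = (\<lambda>k s. lin A (g k) (f k s))"

definition id_map :: "('a, 's) ring_scheme \<Rightarrow> nat \<Rightarrow> 'x \<Rightarrow> 'x \<Rightarrow> 'a" where
  "id_map A = (\<lambda>k s. single A s \<one>\<^bsub>A\<^esub>)"

locale two_complexes = S: free_complex R S d + T: free_complex R T e
  for R (structure) and S :: "nat \<Rightarrow> 'x set" and d and T :: "nat \<Rightarrow> 'y set" and e
begin

lemma chain_map_lin:
  assumes "chain_map R S d T e f" "u \<in> Free R (S (Suc k))"
  shows "lin R e (lin R (f (Suc k)) u) = lin R (f k) (lin R d u)"
proof -
  have f: "f k s \<in> Free R (T k)" if "s \<in> S k" for k s
    using assms(1) that by (auto simp: chain_map_def)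
  have "lin R e (lin R (f (Suc k)) u) = lin R (\<lambda>s. lin R e (f (Suc k) s)) u"
    by (rule S.lin_lin[OF assms(2) f T.d_value])
  also have "\<dots> = lin R (\<lambda>s. lin R (f k) (d s)) u"
    by (rule S.lin_cong[OF assms(2)])
      (use assms(1) S.lin_value[OF S.d_closed S.free_value[OF f]] in \<open>auto simp: chain_map_def\<close>)
  also have "\<dots> = lin R (f k) (lin R d u)"
    by (rule S.lin_lin[OF assms(2) S.d_closed S.free_value[OF f], symmetric])
  finally show ?thesis .
qed

lemma chain_map_closed:
  assumes "chain_map R S d T e f" "u \<in> Free R (S k)"
  shows "lin R (f k) u \<in> Free R (T k)"
  using assms by (intro S.lin_closed) (auto simp: chain_map_def)

lemma chain_map_value:
  assumes "chain_map R S d T e f" "s \<in> S k"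
  shows "f k s x \<in> carrier R"
  using assms S.free_value by (fastforce simp: chain_map_def)

lemma chain_map_cycles:
  assumes "chain_map R S d T e f" "u \<in> cycles R S d k"
  shows "lin R (f k) u \<in> cycles R T e k"
proof (cases k)
  case 0
  then show ?thesis
    using assms chain_map_closed[OF assms(1)] by (auto simp: cycles_def)
next
  case (Suc j)
  then show ?thesis
    using assms chain_map_closed[OF assms(1)] chain_map_lin[OF assms(1)] by (auto simp: cycles_def)
qed

text \<open>On a cycle the term \<open>h d\<close> vanishes, so the difference of the two chain maps
  is a boundary.\<close>

lemma homotopy_lin:
  assumes "chain_map R S d T e f" "chain_map R S d T e g" "homotopy R S d T e f g h"
    and u: "u \<in> cycles R S d k"
  shows "lin R e (lin R (h k) u) = (\<lambda>x. lin R (f k) u x \<ominus> lin R (g k) u x)"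
proof -
  have h: "h k s \<in> Free R (T (Suc k))" if "s \<in> S k" for k s
    using assms(3) that by (auto simp: homotopy_def)
  have uF: "u \<in> Free R (S k)"
    using u by (simp add: cycles_def)
  note fv = chain_map_value[OF assms(1)] and gv = chain_map_value[OF assms(2)]
  have "lin R e (lin R (h k) u) = lin R (\<lambda>s. lin R e (h k s)) u"
    by (rule S.lin_lin[OF uF h T.d_value])
  also have "\<dots> = (\<lambda>x. lin R (f k) u x \<ominus> lin R (g k) u x)"
  proof (cases k)
    case 0
    have "lin R (\<lambda>s. lin R e (h k s)) u = lin R (\<lambda>s x. f k s x \<ominus> g k s x) u"
      by (rule S.lin_cong[OF uF]) (use assms(3) 0 fv gv in \<open>auto simp: homotopy_def\<close>)
    then show ?thesis
      using S.lin_minus_fun[OF uF fv gv] by simp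
  next
    case (Suc j)
    have hd: "lin R (h j) (d s) x \<in> carrier R" if "s \<in> S k" for s x
      by (rule S.lin_value[OF S.d_closed S.free_value[OF h]]) (use that Suc in auto)
    have "lin R (\<lambda>s. lin R e (h k s)) u
        = lin R (\<lambda>s x. f k s x \<ominus> g k s x \<ominus> lin R (h j) (d s) x) u"
      by (rule S.lin_cong[OF uF]) (use assms(3) Suc fv gv hd in \<open>auto simp: homotopy_def\<close>)
    also have "\<dots> = (\<lambda>x. lin R (\<lambda>s x. f k s x \<ominus> g k s x) u x \<ominus> lin R (\<lambda>s. lin R (h j) (d s)) u x)"
      by (rule S.lin_minus_fun[OF uF]) (use fv gv hd in auto)
    also have "lin R (\<lambda>s x. f k s x \<ominus> g k s x) u = (\<lambda>x. lin R (f k) u x \<ominus> lin R (g k) u x)"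
      by (rule S.lin_minus_fun[OF uF fv gv])
    also have "lin R (\<lambda>s. lin R (h j) (d s)) u = lin R (h j) (lin R d u)"
      using uF unfolding Suc by (rule S.lin_lin[OF _ S.d_closed S.free_value[OF h], symmetric])
    also have "lin R d u = (\<lambda>x. \<zero>)"
      using u Suc by (simp add: cycles_def)
    finally show ?thesis
      using S.lin_value[where \<kappa> = "f k", OF uF fv] S.lin_value[where \<kappa> = "g k", OF uF gv]
      by (simp add: S.minus_eq)
  qed
  finally show ?thesis .
qed

end

lemma id_map_lin:
  assumes "free_complex R S d" "u \<in> Free R (S k)"
  shows "lin R (id_map R k) u = u"
proof -
  interpret free_complex R S d by fact
  show ?thesis
    using lin_id[OF assms(2)] by (simp add: id_map_def)
qed

lemma comp_map_lin:
  assumes "free_complex R S d" "free_complex R T e" "free_complex R U c"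
    "chain_map R S d T e f" "chain_map R T e U c g" "u \<in> Free R (S k)"
  shows "lin R (comp_map R g f k) u = lin R (g k) (lin R (f k) u)"
proof -
  interpret ST: two_complexes R S d T e using assms by (intro two_complexes.intro)
  interpret TU: two_complexes R T e U c using assms by (intro two_complexes.intro)
  show ?thesis
    unfolding comp_map_def
    by (rule ST.S.lin_lin[OF assms(6) _ TU.chain_map_value[OF assms(5)], symmetric])
      (use assms(4) in \<open>auto simp: chain_map_def\<close>)
qed

lemma chain_map_id:
  assumes "free_complex R S d"
  shows "chain_map R S d S d (id_map R)"
proof -
  interpret free_complex R S d by fact
  show ?thesis
    unfolding chain_map_def
  proof (intro conjI allI ballI)
    fix k s assume s: "s \<in> S (Suc k)"
    have "lin R d (id_map R (Suc k) s) = d s"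
      unfolding id_map_def by (subst lin_single[OF s]) (use d_value[OF s] in auto)
    then show "lin R d (id_map R (Suc k) s) = lin R (id_map R k) (d s)"
      using id_map_lin[OF assms d_closed[OF s]] by simp
  qed (auto simp: id_map_def free_single)
qed

lemma chain_map_comp:
  assumes "free_complex R S d" "free_complex R T e" "free_complex R U c"
    "chain_map R S d T e f" "chain_map R T e U c g"
  shows "chain_map R S d U c (comp_map R g f)"
proof -
  interpret ST: two_complexes R S d T e using assms by (intro two_complexes.intro)
  interpret TU: two_complexes R T e U c using assms by (intro two_complexes.intro)
  show ?thesis
    unfolding chain_map_def
  proof (intro conjI allI ballI)
    show "comp_map R g f k s \<in> Free R (U k)" if "s \<in> S k" for k s
      unfolding comp_map_def
      by (rule TU.chain_map_closed[OF assms(5)]) (use assms(4) that in \<open>auto simp: chain_map_def\<close>)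
    fix k s assume s: "s \<in> S (Suc k)"
    have f: "f (Suc k) s \<in> Free R (T (Suc k))"
      using assms(4) s by (auto simp: chain_map_def)
    have "lin R c (comp_map R g f (Suc k) s) = lin R (g k) (lin R e (f (Suc k) s))"
      unfolding comp_map_def by (rule TU.chain_map_lin[OF assms(5) f])
    also have "lin R e (f (Suc k) s) = lin R (f k) (d s)"
      using assms(4) s by (auto simp: chain_map_def)
    also have "lin R (g k) \<dots> = lin R (comp_map R g f k) (d s)"
      by (rule comp_map_lin[OF assms ST.S.d_closed[OF s], symmetric])
    finally show "lin R c (comp_map R g f (Suc k) s) = lin R (comp_map R g f k) (d s)" .
  qed
qed

text \<open>\<open>quotient_iso\<close> is applied to \<open>f\<close>. The homotopy on
  \<open>S\<close> shows that a cycle sent to a boundary is a boundary, the homotopy on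
  \<open>T\<close> that every cycle of \<open>T\<close> is homologous to the image of a
  cycle.\<close>

lemma homology_iso:
  fixes R (structure)
  assumes "cring R" "free_complex R S d" "free_complex R T e"
    and f: "chain_map R S d T e f" and g: "chain_map R T e S d g"
    and h: "homotopy R S d S d (comp_map R g f) (id_map R) h"
    and h': "homotopy R T e T e (comp_map R f g) (id_map R) h'"
  shows "module_iso R (homology R S d k) (homology R T e k)"
proof -
  interpret cring R by fact
  interpret S: free_complex_comm R S d
    using assms by (intro free_complex_comm.intro)
  interpret T: free_complex_comm R T e
    using assms by (intro free_complex_comm.intro)
  interpret ST: two_complexes R S d T e using assms by (intro two_complexes.intro)
  interpret TS: two_complexes R T e S d using assms by (intro two_complexes.intro)
  interpret SS: two_complexes R S d S d using assms by (intro two_complexes.intro)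
  interpret TT: two_complexes R T e T e using assms by (intro two_complexes.intro)
  have gf: "lin R d (lin R (h k) u) = (\<lambda>x. lin R (g k) (lin R (f k) u) x \<ominus> u x)"
    if "u \<in> cycles R S d k" for u
    using SS.homotopy_lin[OF chain_map_comp[OF assms(2,3,2) f g] chain_map_id[OF assms(2)] h that]
      that comp_map_lin[OF assms(2,3,2) f g] id_map_lin[OF assms(2)] by (simp add: cycles_def)
  have fg: "lin R e (lin R (h' k) u) = (\<lambda>x. lin R (f k) (lin R (g k) u) x \<ominus> u x)"
    if "u \<in> cycles R T e k" for u
    using TT.homotopy_lin[OF chain_map_comp[OF assms(3,2,3) g f] chain_map_id[OF assms(3)] h' that]
      that comp_map_lin[OF assms(3,2,3) g f] id_map_lin[OF assms(3)] by (simp add: cycles_def)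
  have hcl: "lin R (h k) u \<in> Free R (S (Suc k))" if "u \<in> cycles R S d k" for u
    using h that by (intro lin_closed[where S = "S k"]) (auto simp: cycles_def homotopy_def)
  have h'cl: "lin R (h' k) u \<in> Free R (T (Suc k))" if "u \<in> cycles R T e k" for u
    using h' that by (intro lin_closed[where S = "T k"]) (auto simp: cycles_def homotopy_def)
  have cS: "u \<in> Free R (S k)" if "u \<in> cycles R S d k" for u
    using that by (simp add: cycles_def)
  show ?thesis
    unfolding homology_def
  proof (rule quotient_iso[OF S.homology_submodule T.homology_submodule, where f = "lin R (f k)"])
    show "lin R (f k) u \<in> carrier (cycle_module R T e k)"
      if "u \<in> carrier (cycle_module R S d k)" for u
      using ST.chain_map_cycles[OF f] that by simp
    show "lin R (f k) (u \<oplus>\<^bsub>cycle_module R S d k\<^esub> v) =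
        lin R (f k) u \<oplus>\<^bsub>cycle_module R T e k\<^esub> lin R (f k) v"
      if "u \<in> carrier (cycle_module R S d k)"
        "v \<in> carrier (cycle_module R S d k)" for u v
      using that lin_add[OF cS cS ST.chain_map_value[OF f]] by (simp add: free_module_simps)
    show "lin R (f k) (r \<odot>\<^bsub>cycle_module R S d k\<^esub> u) =
        r \<odot>\<^bsub>cycle_module R T e k\<^esub> lin R (f k) u"
      if "r \<in> carrier R" "u \<in> carrier (cycle_module R S d k)" for r u
      using that lin_smult[OF cS _ ST.chain_map_value[OF f]] by (simp add: free_module_simps)
    show "lin R (f k) u \<in> lin R e ` Free R (T (Suc k)) \<longleftrightarrow>
        u \<in> lin R d ` Free R (S (Suc k))"
      if "u \<in> carrier (cycle_module R S d k)" for u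
    proof
      assume "u \<in> lin R d ` Free R (S (Suc k))"
      then obtain w where w: "w \<in> Free R (S (Suc k))" "u = lin R d w"
        by blast
      then have "lin R (f k) u = lin R e (lin R (f (Suc k)) w)"
        using ST.chain_map_lin[OF f] by simp
      then show "lin R (f k) u \<in> lin R e ` Free R (T (Suc k))"
        using ST.chain_map_closed[OF f w(1)] by blast
    next
      have u: "u \<in> cycles R S d k" using that by simp
      assume "lin R (f k) u \<in> lin R e ` Free R (T (Suc k))"
      then obtain w where w: "w \<in> Free R (T (Suc k))" "lin R (f k) u = lin R e w"
        by blast
      \<comment> \<open>From \<open>f u = e w\<close> and \<open>d (h u) = g (f u) - u\<close>
        follows \<open>u = d (g w - h u)\<close>.\<close>
      let ?w = "\<lambda>x. lin R (g (Suc k)) w x \<ominus> lin R (h k) u x"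
      have gw: "lin R (g (Suc k)) w \<in> Free R (S (Suc k))"
        by (rule TS.chain_map_closed[OF g w(1)])
      have gv: "lin R (g k) (lin R (f k) u) x \<in> carrier R" for x
        using free_value[OF S.lin_d_closed[OF gw]] TS.chain_map_lin[OF g w(1)] w(2) by metis
      have uv: "u x \<in> carrier R" for x
        using free_value[OF cS[OF u]] .
      have "lin R d ?w = (\<lambda>x. lin R d (lin R (g (Suc k)) w) x \<ominus> lin R d (lin R (h k) u) x)"
        by (rule lin_minus[OF gw hcl[OF u] S.d_value])
      also have "\<dots> = (\<lambda>x. lin R (g k) (lin R (f k) u) x \<ominus> (lin R (g k) (lin R (f k) u) x \<ominus> u x))"
        using gf[OF u] TS.chain_map_lin[OF g w(1)] w(2) by simp
      also have "\<dots> = u"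
      proof
        fix x
        show "lin R (g k) (lin R (f k) u) x \<ominus> (lin R (g k) (lin R (f k) u) x \<ominus> u x) = u x"
          using gv[of x] uv[of x] by algebra
      qed
      finally have "u = lin R d ?w" by simp
      then show "u \<in> lin R d ` Free R (S (Suc k))"
        using free_minus[OF gw hcl[OF u]] by blast
    qed
    show "\<exists>u\<in>carrier (cycle_module R S d k).
        v \<ominus>\<^bsub>cycle_module R T e k\<^esub> lin R (f k) u
          \<in> lin R e ` Free R (T (Suc k))"
      if "v \<in> carrier (cycle_module R T e k)" for v
    proof -
      have v: "v \<in> cycles R T e k" using that by simp
      \<comment> \<open>The cycle \<open>g v\<close> is mapped to \<open>f (g v)\<close>, which is
        \<open>v\<close> up to the boundary of \<open>h' v\<close>; the sign is needed because the
        homotopy yields \<open>f (g v) - v\<close>.\<close>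
      let ?w = "\<lambda>x. \<zero> \<ominus> lin R (h' k) v x"
      have gv: "lin R (g k) v \<in> cycles R S d k"
        by (rule TS.chain_map_cycles[OF g v])
      have fgv: "lin R (f k) (lin R (g k) v) \<in> cycles R T e k"
        by (rule ST.chain_map_cycles[OF f gv])
      have "lin R e ?w = (\<lambda>x. lin R e (\<lambda>x. \<zero>) x \<ominus> lin R e (lin R (h' k) v) x)"
        by (rule lin_minus[OF free_zero h'cl[OF v] T.d_value])
      also have "\<dots> = (\<lambda>x. \<zero> \<ominus> (lin R (f k) (lin R (g k) v) x \<ominus> v x))"
        by (simp add: fg[OF v])
      also have "\<dots> = (\<lambda>x. v x \<ominus> lin R (f k) (lin R (g k) v) x)"
      proof
        fix x
        have "v x \<in> carrier R" "lin R (f k) (lin R (g k) v) x \<in> carrier R"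
          using v fgv free_value[where S = "T k"] by (auto simp: cycles_def)
        then show "\<zero> \<ominus> (lin R (f k) (lin R (g k) v) x \<ominus> v x) = v x \<ominus> lin R (f k) (lin R (g k) v) x"
          by algebra
      qed
      finally have "(\<lambda>x. v x \<ominus> lin R (f k) (lin R (g k) v) x) \<in> lin R e ` Free R (T (Suc k))"
        using free_minus[OF free_zero h'cl[OF v]] by (metis image_eqI)
      then show ?thesis
        using T.homology_minus[OF v fgv] gv by (intro bexI[of _ "lin R (g k) v"]) simp_all
    qed
  qed
qed


section \<open>Comparison of free resolutions\<close>

text \<open>\<open>\<epsilon>\<close> is a function on 0-chains and not a matrix, because
  \<open>N\<close> is an arbitrary module; the other arrows are the linear extensions of
  \<open>d\<close>.\<close>

locale free_resolution = left_module A N + free_complex A S d for A N S d +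
  fixes \<epsilon> :: "('c \<Rightarrow> 'a) \<Rightarrow> 'b"
  assumes \<epsilon>_closed: "u \<in> Free A (S 0) \<Longrightarrow> \<epsilon> u \<in> carrier N"
    and \<epsilon>_add: "\<lbrakk>u \<in> Free A (S 0); v \<in> Free A (S 0)\<rbrakk> \<Longrightarrow>
      \<epsilon> (\<lambda>x. u x \<oplus>\<^bsub>A\<^esub> v x) = \<epsilon> u \<oplus>\<^bsub>N\<^esub> \<epsilon> v"
    and \<epsilon>_smult: "\<lbrakk>a \<in> carrier A; u \<in> Free A (S 0)\<rbrakk> \<Longrightarrow>
      \<epsilon> (\<lambda>x. a \<otimes>\<^bsub>A\<^esub> u x) = a \<odot>\<^bsub>N\<^esub> \<epsilon> u"
    and \<epsilon>_d: "u \<in> Free A (S (Suc 0)) \<Longrightarrow> \<epsilon> (lin A d u) = \<zero>\<^bsub>N\<^esub>"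
    and \<epsilon>_surj: "x \<in> carrier N \<Longrightarrow> \<exists>u\<in>Free A (S 0). \<epsilon> u = x"
    and exact_0: "\<lbrakk>u \<in> Free A (S 0); \<epsilon> u = \<zero>\<^bsub>N\<^esub>\<rbrakk> \<Longrightarrow>
      \<exists>w\<in>Free A (S (Suc 0)). lin A d w = u"
    and exact_Suc: "\<lbrakk>u \<in> Free A (S (Suc k)); lin A d u = (\<lambda>h. \<zero>\<^bsub>A\<^esub>)\<rbrakk> \<Longrightarrow>
      \<exists>w\<in>Free A (S (Suc (Suc k))). lin A d w = u"
begin

lemma \<epsilon>_zero: "\<epsilon> (\<lambda>x. \<zero>\<^bsub>A\<^esub>) = \<zero>\<^bsub>N\<^esub>"
  using \<epsilon>_smult[OF A.zero_closed free_zero] \<epsilon>_closed[OF free_zero] by simp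

lemma \<epsilon>_minus:
  assumes "u \<in> Free A (S 0)" "v \<in> Free A (S 0)"
    and "\<epsilon> u = \<epsilon> v"
  shows "\<epsilon> (\<lambda>x. u x \<ominus>\<^bsub>A\<^esub> v x) = \<zero>\<^bsub>N\<^esub>"
proof -
  have "\<epsilon> (\<lambda>x. u x \<ominus>\<^bsub>A\<^esub> v x) \<oplus>\<^bsub>N\<^esub> \<epsilon> v = \<epsilon> (\<lambda>x. (u x \<ominus>\<^bsub>A\<^esub> v x) \<oplus>\<^bsub>A\<^esub> v x)"
    by (rule \<epsilon>_add[OF free_minus[OF assms(1,2)] assms(2), symmetric])
  also have "\<dots> = \<epsilon> v"
    using free_value[OF assms(1)] free_value[OF assms(2)] assms(3) by (simp add: minus_add_cancel)
  finally show ?thesis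
    using \<epsilon>_closed[OF free_minus[OF assms(1,2)]] \<epsilon>_closed[OF assms(2)]
    by (simp add: N.add.r_cancel_one)
qed

lemma exact_cycle:
  assumes "u \<in> cycles A S d k" "k = 0 \<Longrightarrow> \<epsilon> u = \<zero>\<^bsub>N\<^esub>"
  shows "\<exists>w\<in>Free A (S (Suc k)). lin A d w = u"
  using assms exact_0 exact_Suc by (cases k) (auto simp: cycles_def)

end

context left_module
begin

lemma std_free_resolution:
  "free_resolution A N (gens A N) (gen_boundary A) (augmentation A N)"
proof (intro free_resolution.intro free_resolution_axioms.intro free_complex.intro free_complex_axioms.intro)
  show "left_module A N" by (rule left_module_axioms)
  show "ring A" by (rule A.ring_axioms)
  show d: "gen_boundary A s \<in> Free A (gens A N k)" if "s \<in> gens A N (Suc k)" for s k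
    using that by (rule gen_boundary_in_free)
  fix s k assume s: "s \<in> gens A N (Suc (Suc k))"
  have "boundary A (boundary A (single A s \<one>\<^bsub>A\<^esub>)) = (\<lambda>h. \<zero>\<^bsub>A\<^esub>)"
    by (rule boundary_boundary[OF single_in_free[OF s A.one_closed]])
  moreover have "boundary A (single A s \<one>\<^bsub>A\<^esub>) = gen_boundary A s"
    using boundary_single[OF s A.one_closed] free_val[OF d[OF s]] by simp
  ultimately show "lin A (gen_boundary A) (gen_boundary A s) = (\<lambda>h. \<zero>\<^bsub>A\<^esub>)"
    by (simp add: boundary_eq_lin)
next
  note res = std_res_resolution[unfolded std_res_def]
  show "augmentation A N u \<in> carrier N" if "u \<in> Free A (gens A N 0)" for u
    by (rule augmentation_closed[OF that])
  show "augmentation A N (\<lambda>x. u x \<oplus>\<^bsub>A\<^esub> v x) = augmentation A N u \<oplus>\<^bsub>N\<^esub> augmentation A N v"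
    if "u \<in> Free A (gens A N 0)" "v \<in> Free A (gens A N 0)" for u v
    by (rule augmentation_add[OF that])
  show "augmentation A N (\<lambda>x. a \<otimes>\<^bsub>A\<^esub> u x) = a \<odot>\<^bsub>N\<^esub> augmentation A N u"
    if "a \<in> carrier A" "u \<in> Free A (gens A N 0)" for a u
    by (rule augmentation_smult[OF that(2,1)])
  show "augmentation A N (lin A (gen_boundary A) u) = \<zero>\<^bsub>N\<^esub>"
    if "u \<in> Free A (gens A N (Suc 0))" for u
    using augmentation_boundary[OF that] by (simp add: boundary_eq_lin)
  show "\<exists>u\<in>Free A (gens A N 0). augmentation A N u = x" if "x \<in> carrier N" for x
    using that res(7) by (metis imageE)
  show "\<exists>w\<in>Free A (gens A N (Suc 0)). lin A (gen_boundary A) w = u"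
    if "u \<in> Free A (gens A N 0)" "augmentation A N u = \<zero>\<^bsub>N\<^esub>" for u
  proof -
    have "u \<in> boundary A ` Free A (gens A N (Suc 0))"
      unfolding res(8)[symmetric] using that by blast
    then show ?thesis unfolding boundary_eq_lin by blast
  qed
  show "\<exists>w\<in>Free A (gens A N (Suc (Suc k))). lin A (gen_boundary A) w = u"
    if "u \<in> Free A (gens A N (Suc k))" "lin A (gen_boundary A) u = (\<lambda>h. \<zero>\<^bsub>A\<^esub>)" for u k
  proof -
    have "u \<in> boundary A ` Free A (gens A N (Suc (Suc k)))"
      unfolding res(9)[symmetric] using that by (simp add: free_module_simps boundary_eq_lin)
    then show ?thesis unfolding boundary_eq_lin by blast
  qed
qed

end

locale two_resolutions =
  S: free_resolution A N S d \<epsilon> + T: free_resolution A N T e \<epsilon>' for A N S d \<epsilon> T e \<epsilon>'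
begin

sublocale two_complexes A S d T e ..

text \<open>Such an \<open>f\<close> lifts the identity of \<open>N\<close>.\<close>

definition augmented where
  "augmented f \<longleftrightarrow> (\<forall>s\<in>S 0. \<epsilon>' (f (0 :: nat) s) = \<epsilon> (single A s \<one>\<^bsub>A\<^esub>))"

lemma \<epsilon>_lin:
  assumes "\<And>s. s \<in> S 0 \<Longrightarrow> f s \<in> Free A (T 0)"
    and "\<And>s. s \<in> S 0 \<Longrightarrow> \<epsilon>' (f s) = \<epsilon> (single A s \<one>\<^bsub>A\<^esub>)"
    and "u \<in> Free A (S 0)"
  shows "\<epsilon>' (lin A f u) = \<epsilon> u"
  using assms(3)
proof (induction rule: S.free_induct)
  case zero
  then show ?case by (simp add: S.\<epsilon>_zero T.\<epsilon>_zero)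
next
  case (add s a u)
  have "lin A f (\<lambda>x. single A s a x \<oplus>\<^bsub>A\<^esub> u x) = (\<lambda>h. a \<otimes>\<^bsub>A\<^esub> f s h \<oplus>\<^bsub>A\<^esub> lin A f u h)"
    by (rule S.lin_step[OF add(1-3) S.free_value[OF assms(1)]])
  then have "\<epsilon>' (lin A f (\<lambda>x. single A s a x \<oplus>\<^bsub>A\<^esub> u x)) = a \<odot>\<^bsub>N\<^esub> \<epsilon>' (f s) \<oplus>\<^bsub>N\<^esub> \<epsilon>' (lin A f u)"
    using add assms(1) S.lin_closed[OF add(3) assms(1)]
    by (simp add: T.\<epsilon>_add T.\<epsilon>_smult S.free_smult)
  also have "\<dots> = \<epsilon> (\<lambda>x. a \<otimes>\<^bsub>A\<^esub> single A s \<one>\<^bsub>A\<^esub> x) \<oplus>\<^bsub>N\<^esub> \<epsilon> u"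
    using add assms(2) by (simp add: S.\<epsilon>_smult S.free_single)
  also have "(\<lambda>x. a \<otimes>\<^bsub>A\<^esub> single A s \<one>\<^bsub>A\<^esub> x) = single A s a"
    using add by (auto simp: single_def)
  also have "\<epsilon> (single A s a) \<oplus>\<^bsub>N\<^esub> \<epsilon> u = \<epsilon> (\<lambda>x. single A s a x \<oplus>\<^bsub>A\<^esub> u x)"
    using add by (simp add: S.\<epsilon>_add S.free_single)
  finally show ?case .
qed

lemma chain_map_exists: "\<exists>f. chain_map A S d T e f \<and> augmented f"
proof -
  \<comment> \<open>Besides the values of \<open>f\<close> in degree \<open>n\<close>, the predicate
    records that \<open>f\<close> sends the boundaries of the next generators to cycles. Exactness
    of the target then permits the choice of the following stage.\<close>
  define P where "P n f \<longleftrightarrow> (\<forall>s\<in>S n. f s \<in> Free A (T n)) \<and>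
      (n = 0 \<longrightarrow> (\<forall>s\<in>S 0. \<epsilon>' (f s) = \<epsilon> (single A s \<one>\<^bsub>A\<^esub>))) \<and>
      (\<forall>s\<in>S (Suc n). lin A f (d s) \<in> cycles A T e n \<and> (n = 0 \<longrightarrow> \<epsilon>' (lin A f (d s)) = \<zero>\<^bsub>N\<^esub>))"
    for n f
  have single: "single A s \<one>\<^bsub>A\<^esub> \<in> Free A (S k)" if "s \<in> S k" for s k
    using that by (simp add: S.free_single)
  have single_d: "lin A d (single A s \<one>\<^bsub>A\<^esub>) = d s" if "s \<in> S (Suc k)" for s k
    by (subst S.lin_single[OF that]) (use S.d_value[OF that] in auto)
  have 0: "\<exists>f. P 0 f"
  proof -
    have "\<forall>s\<in>S 0. \<exists>w. w \<in> Free A (T 0) \<and> \<epsilon>' w = \<epsilon> (single A s \<one>\<^bsub>A\<^esub>)"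
      using T.\<epsilon>_surj S.\<epsilon>_closed single by blast
    then obtain f where f: "\<And>s. s \<in> S 0 \<Longrightarrow> f s \<in> Free A (T 0)"
      "\<And>s. s \<in> S 0 \<Longrightarrow> \<epsilon>' (f s) = \<epsilon> (single A s \<one>\<^bsub>A\<^esub>)"
      by metis
    have "lin A f (d s) \<in> cycles A T e 0 \<and> \<epsilon>' (lin A f (d s)) = \<zero>\<^bsub>N\<^esub>" if s: "s \<in> S (Suc 0)" for s
      using \<epsilon>_lin[OF f S.d_closed[OF s]] S.\<epsilon>_d[OF single[OF s]] single_d[OF s]
        S.lin_closed[OF S.d_closed[OF s] f(1)] by (simp add: cycles_def)
    then show ?thesis
      using f unfolding P_def by (intro exI[of _ f]) auto
  qed
  have Suc: "\<exists>f'. P (Suc n) f' \<and> (\<forall>s\<in>S (Suc n). lin A e (f' s) = lin A f (d s))" if f: "P n f" for n f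
  proof -
    have "\<forall>s\<in>S (Suc n). \<exists>w. w \<in> Free A (T (Suc n)) \<and> lin A e w = lin A f (d s)"
      using f T.exact_cycle unfolding P_def by blast
    then obtain f' where f': "\<And>s. s \<in> S (Suc n) \<Longrightarrow> f' s \<in> Free A (T (Suc n))"
      "\<And>s. s \<in> S (Suc n) \<Longrightarrow> lin A e (f' s) = lin A f (d s)"
      by metis
    have fT: "f s \<in> Free A (T n)" if "s \<in> S n" for s
      using f that unfolding P_def by blast
    have "lin A f' (d s) \<in> cycles A T e (Suc n)" if s: "s \<in> S (Suc (Suc n))" for s
    proof -
      have "lin A e (lin A f' (d s)) = lin A (\<lambda>s. lin A e (f' s)) (d s)"
        by (rule S.lin_lin[OF S.d_closed[OF s] f'(1) T.d_value])
      also have "\<dots> = lin A (\<lambda>s. lin A f (d s)) (d s)"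
        by (rule S.lin_cong[OF S.d_closed[OF s]])
          (use f'(2) S.lin_value[OF S.d_closed S.free_value[OF fT]] in auto)
      also have "\<dots> = lin A f (lin A d (d s))"
        by (rule S.lin_lin[OF S.d_closed[OF s] S.d_closed S.free_value[OF fT], symmetric])
      finally show ?thesis
        using S.d_d[OF s] S.lin_closed[OF S.d_closed[OF s] f'(1)] by (simp add: cycles_def)
    qed
    then show ?thesis
      using f' unfolding P_def by (intro exI[of _ f']) auto
  qed
  obtain f where "\<forall>n. P n (f n) \<and> (\<forall>s\<in>S (Suc n). lin A e (f (Suc n) s) = lin A (f n) (d s))"
    using dependent_nat_choice[of P "\<lambda>n f f'. \<forall>s\<in>S (Suc n). lin A e (f' s) = lin A f (d s)", OF 0 Suc]
    by blast
  then show ?thesis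
    unfolding P_def chain_map_def augmented_def by (intro exI[of _ f]) auto
qed

lemma homotopy_exists:
  assumes f: "chain_map A S d T e f" and g: "chain_map A S d T e g"
    and aug: "augmented f" "augmented g"
  shows "\<exists>h. homotopy A S d T e f g h"
proof -
  define \<phi> where "\<phi> n s = (\<lambda>x. f n s x \<ominus>\<^bsub>A\<^esub> g n s x)" for n s
  have fT: "f n s \<in> Free A (T n)" if "s \<in> S n" for n s
    using f that unfolding chain_map_def by blast
  have gT: "g n s \<in> Free A (T n)" if "s \<in> S n" for n s
    using g that unfolding chain_map_def by blast
  have \<phi>T: "\<phi> n s \<in> Free A (T n)" if "s \<in> S n" for n s
    unfolding \<phi>_def by (rule S.free_minus[OF fT gT]) (use that in auto)
  have \<phi>_lin: "lin A (\<phi> n) u = (\<lambda>x. lin A (f n) u x \<ominus>\<^bsub>A\<^esub> lin A (g n) u x)"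
    if "u \<in> Free A (S n)" for n u
    unfolding \<phi>_def by (rule S.lin_minus_fun[OF that S.free_value[OF fT] S.free_value[OF gT]])
  have \<phi>_d: "lin A e (\<phi> (Suc n) s) = lin A (\<phi> n) (d s)" if "s \<in> S (Suc n)" for n s
  proof -
    have "lin A e (\<phi> (Suc n) s) = (\<lambda>x. lin A e (f (Suc n) s) x \<ominus>\<^bsub>A\<^esub> lin A e (g (Suc n) s) x)"
      unfolding \<phi>_def by (rule S.lin_minus[OF fT[OF that] gT[OF that] T.d_value])
    then show ?thesis
      unfolding \<phi>_lin[OF S.d_closed[OF that]] using f g that by (simp add: chain_map_def)
  qed
  define P where "P n h \<longleftrightarrow> (\<forall>s\<in>S n. h s \<in> Free A (T (Suc n))) \<and>
      (n = 0 \<longrightarrow> (\<forall>s\<in>S 0. lin A e (h s) = \<phi> 0 s)) \<and>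
      (\<forall>s\<in>S (Suc n). (\<lambda>x. \<phi> (Suc n) s x \<ominus>\<^bsub>A\<^esub> lin A h (d s) x) \<in> cycles A T e (Suc n))"
    for n h
  \<comment> \<open>If \<open>h\<close> is a homotopy in degree \<open>n\<close>, the right-hand side of the equation in degree \<open>n + 1\<close> is a cycle.\<close>
  have cyc: "(\<lambda>x. \<phi> (Suc n) s x \<ominus>\<^bsub>A\<^esub> lin A h (d s) x) \<in> cycles A T e (Suc n)"
    if h: "\<And>s. s \<in> S n \<Longrightarrow> h s \<in> Free A (T (Suc n))"
      and s: "s \<in> S (Suc n)" and eq: "lin A (\<lambda>s. lin A e (h s)) (d s) = lin A (\<phi> n) (d s)" for n h s
  proof -
    have hd: "lin A h (d s) \<in> Free A (T (Suc n))"
      by (rule S.lin_closed[OF S.d_closed[OF s] h])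
    have "lin A e (\<lambda>x. \<phi> (Suc n) s x \<ominus>\<^bsub>A\<^esub> lin A h (d s) x)
        = (\<lambda>x. lin A e (\<phi> (Suc n) s) x \<ominus>\<^bsub>A\<^esub> lin A e (lin A h (d s)) x)"
      by (rule S.lin_minus[OF \<phi>T[OF s] hd T.d_value])
    also have "lin A e (lin A h (d s)) = lin A (\<lambda>s. lin A e (h s)) (d s)"
      by (rule S.lin_lin[OF S.d_closed[OF s] h T.d_value])
    also have "\<dots> = lin A e (\<phi> (Suc n) s)"
      using eq \<phi>_d[OF s] by simp
    also have "(\<lambda>x. lin A e (\<phi> (Suc n) s) x \<ominus>\<^bsub>A\<^esub> lin A e (\<phi> (Suc n) s) x) = (\<lambda>x. \<zero>\<^bsub>A\<^esub>)"
      using S.free_value[OF T.lin_d_closed[OF \<phi>T[OF s]]] by (simp add: S.A.r_neg S.A.minus_eq)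
    finally show ?thesis
      using S.free_minus[OF \<phi>T[OF s] hd] by (simp add: cycles_def)
  qed
  have 0: "\<exists>h. P 0 h"
  proof -
    have "\<phi> 0 s \<in> cycles A T e 0 \<and> \<epsilon>' (\<phi> 0 s) = \<zero>\<^bsub>N\<^esub>" if "s \<in> S 0" for s
      using that aug \<phi>T[OF that] T.\<epsilon>_minus[OF fT[OF that] gT[OF that]]
      by (simp add: cycles_def augmented_def \<phi>_def)
    then have "\<forall>s\<in>S 0. \<exists>w. w \<in> Free A (T (Suc 0)) \<and> lin A e w = \<phi> 0 s"
      using T.exact_cycle by blast
    then obtain h where h: "\<And>s. s \<in> S 0 \<Longrightarrow> h s \<in> Free A (T (Suc 0))"
      "\<And>s. s \<in> S 0 \<Longrightarrow> lin A e (h s) = \<phi> 0 s"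
      by metis
    have "lin A (\<lambda>s. lin A e (h s)) (d s) = lin A (\<phi> 0) (d s)" if s: "s \<in> S (Suc 0)" for s
      by (rule S.lin_cong[OF S.d_closed[OF s]]) (use h(2) S.free_value[OF \<phi>T] in auto)
    then show ?thesis
      using h cyc[of 0 h] unfolding P_def by (intro exI[of _ h]) auto
  qed
  have Suc: "\<exists>h'. P (Suc n) h' \<and>
      (\<forall>s\<in>S (Suc n). lin A e (h' s) = (\<lambda>x. \<phi> (Suc n) s x \<ominus>\<^bsub>A\<^esub> lin A h (d s) x))" if h: "P n h" for n h
  proof -
    have hT: "h s \<in> Free A (T (Suc n))" if "s \<in> S n" for s
      using h that unfolding P_def by blast
    have "\<forall>s\<in>S (Suc n). \<exists>w. w \<in> Free A (T (Suc (Suc n))) \<and>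
        lin A e w = (\<lambda>x. \<phi> (Suc n) s x \<ominus>\<^bsub>A\<^esub> lin A h (d s) x)"
      using h T.exact_cycle[of _ "Suc n"] unfolding P_def by blast
    then obtain h' where h': "\<And>s. s \<in> S (Suc n) \<Longrightarrow> h' s \<in> Free A (T (Suc (Suc n)))"
      "\<And>s. s \<in> S (Suc n) \<Longrightarrow> lin A e (h' s) = (\<lambda>x. \<phi> (Suc n) s x \<ominus>\<^bsub>A\<^esub> lin A h (d s) x)"
      by metis
    have "lin A (\<lambda>s. lin A e (h' s)) (d s) = lin A (\<phi> (Suc n)) (d s)" if s: "s \<in> S (Suc (Suc n))" for s
    proof -
      note ds = S.d_closed[OF s]
      have hd: "lin A h (d s) x \<in> carrier A" if "s \<in> S (Suc n)" for s x
        by (rule S.lin_value[OF S.d_closed[OF that] S.free_value[OF hT]])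
      have "lin A (\<lambda>s. lin A e (h' s)) (d s) = lin A (\<lambda>s x. \<phi> (Suc n) s x \<ominus>\<^bsub>A\<^esub> lin A h (d s) x) (d s)"
        by (rule S.lin_cong[OF ds]) (use h'(2) S.free_value[OF \<phi>T] hd in auto)
      also have "\<dots> = (\<lambda>x. lin A (\<phi> (Suc n)) (d s) x \<ominus>\<^bsub>A\<^esub> lin A (\<lambda>s. lin A h (d s)) (d s) x)"
        by (rule S.lin_minus_fun[OF ds S.free_value[OF \<phi>T] hd])
      also have "lin A (\<lambda>s. lin A h (d s)) (d s) = lin A h (lin A d (d s))"
        by (rule S.lin_lin[OF ds S.d_closed S.free_value[OF hT], symmetric])
      also have "\<dots> = (\<lambda>x. \<zero>\<^bsub>A\<^esub>)"
        using S.d_d[OF s] by simp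
      finally show ?thesis
        using S.lin_value[where \<kappa> = "\<phi> (Suc n)", OF ds S.free_value[OF \<phi>T]]
        by (simp add: S.A.minus_eq)
    qed
    then show ?thesis
      using h' cyc[of "Suc n" h'] unfolding P_def by (intro exI[of _ h']) auto
  qed
  obtain h where "\<forall>n. P n (h n) \<and>
      (\<forall>s\<in>S (Suc n). lin A e (h (Suc n) s) = (\<lambda>x. \<phi> (Suc n) s x \<ominus>\<^bsub>A\<^esub> lin A (h n) (d s) x))"
    using dependent_nat_choice[of P
        "\<lambda>n h h'. \<forall>s\<in>S (Suc n). lin A e (h' s) = (\<lambda>x. \<phi> (Suc n) s x \<ominus>\<^bsub>A\<^esub> lin A h (d s) x)", OF 0 Suc]
    by blast
  then show ?thesis
    unfolding P_def homotopy_def \<phi>_def by (intro exI[of _ h]) auto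
qed

end


section \<open>Base change of complexes along a ring homomorphism\<close>

definition base_change :: "('a \<Rightarrow> 'b) \<Rightarrow> ('x \<Rightarrow> 'y \<Rightarrow> 'a) \<Rightarrow> 'x \<Rightarrow> 'y \<Rightarrow> 'b" where
  "base_change \<beta> \<kappa> = (\<lambda>s t. \<beta> (\<kappa> s t))"

locale change_of_rings = A: ring A + R: ring R for A and R (structure) and \<beta> +
  assumes hom: "\<beta> \<in> ring_hom A R"
begin

sublocale h: ring_hom_ring A R \<beta>
  by (rule ring_hom_ringI2[OF A.ring_axioms R.ring_axioms hom])

lemma map_free: "u \<in> Free A S \<Longrightarrow> (\<lambda>x. \<beta> (u x)) \<in> Free R S"
  by (rule free_map_hom[OF A.ring_axioms R.ring_axioms hom])

lemma lin_map:
  assumes "u \<in> Free A S" "\<And>s h. s \<in> S \<Longrightarrow> \<kappa> s h \<in> carrier A"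
  shows "lin R (base_change \<beta> \<kappa>) (\<lambda>x. \<beta> (u x)) = (\<lambda>h. \<beta> (lin A \<kappa> u h))"
  using lin_map_hom[where \<kappa> = \<kappa>, OF A.ring_axioms R.ring_axioms hom assms] by (simp add: base_change_def)

lemma \<beta>_minus: "\<lbrakk>x \<in> carrier A; y \<in> carrier A\<rbrakk> \<Longrightarrow> \<beta> (x \<ominus>\<^bsub>A\<^esub> y) = \<beta> x \<ominus> \<beta> y"
  by (simp add: A.minus_eq R.minus_eq)

lemma free_complex_base_change:
  assumes "free_complex A S d"
  shows "free_complex R S (base_change \<beta> d)"
proof -
  interpret free_complex A S d by fact
  show ?thesis
  proof (intro free_complex.intro free_complex_axioms.intro R.ring_axioms)
    show "base_change \<beta> d s \<in> Free R (S k)" if "s \<in> S (Suc k)" for s k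
      unfolding base_change_def by (rule map_free[OF d_closed[OF that]])
    show "lin R (base_change \<beta> d) (base_change \<beta> d s) = (\<lambda>h. \<zero>)" if "s \<in> S (Suc (Suc k))" for s k
      using lin_map[where \<kappa> = d, OF d_closed[OF that] d_value] d_d[OF that] by (simp add: base_change_def)
  qed
qed

lemma chain_map_base_change:
  assumes "free_complex A S d" "free_complex A T e" "chain_map A S d T e f"
  shows "chain_map R S (base_change \<beta> d) T (base_change \<beta> e) (\<lambda>k. base_change \<beta> (f k))"
proof -
  interpret two_complexes A S d T e using assms by (intro two_complexes.intro)
  have f: "f k s \<in> Free A (T k)" if "s \<in> S k" for k s
    using assms(3) that by (auto simp: chain_map_def)
  show ?thesis
    unfolding chain_map_def
  proof (intro conjI allI ballI)
    show "base_change \<beta> (f k) s \<in> Free R (T k)" if "s \<in> S k" for k s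
      unfolding base_change_def by (rule map_free[OF f[OF that]])
    show "lin R (base_change \<beta> e) (base_change \<beta> (f (Suc k)) s) = lin R (base_change \<beta> (f k)) (base_change \<beta> d s)"
      if "s \<in> S (Suc k)" for k s
      using lin_map[where \<kappa> = e, OF f[OF that] T.d_value] lin_map[where \<kappa> = "f k", OF S.d_closed[OF that] A.free_value[OF f]] assms(3) that
      by (simp add: base_change_def[of \<beta> "f (Suc k)"] base_change_def[of \<beta> d] chain_map_def)
  qed
qed

lemma comp_map_base_change:
  assumes "free_complex A S d" "free_complex A T e" "chain_map A S d T e f" "chain_map A T e S d g"
    "s \<in> S k"
  shows "comp_map R (\<lambda>k. base_change \<beta> (g k)) (\<lambda>k. base_change \<beta> (f k)) k s
    = (\<lambda>x. \<beta> (comp_map A g f k s x))"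
proof -
  interpret TS: two_complexes A T e S d using assms by (intro two_complexes.intro)
  have f: "f k s \<in> Free A (T k)"
    using assms by (auto simp: chain_map_def)
  show ?thesis
    using lin_map[where \<kappa> = "g k", OF f TS.chain_map_value[OF assms(4)]] by (simp add: comp_map_def base_change_def[of \<beta> "f k"])
qed

lemma homotopy_base_change:
  assumes "free_complex A S d" "free_complex A T e" "chain_map A S d T e f" "chain_map A T e S d g"
    and "homotopy A S d S d (comp_map A g f) (id_map A) h"
  shows "homotopy R S (base_change \<beta> d) S (base_change \<beta> d)
    (comp_map R (\<lambda>k. base_change \<beta> (g k)) (\<lambda>k. base_change \<beta> (f k))) (id_map R) (\<lambda>k. base_change \<beta> (h k))"
proof -
  interpret S: free_complex A S d by fact
  interpret SS: two_complexes A S d S d using assms by (intro two_complexes.intro)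
  note comp = chain_map_comp[OF assms(1,2,1,3,4)]
  note gf = SS.chain_map_value[OF comp]
  have id_value: "id_map A k s x \<in> carrier A" if "s \<in> S k" for k s x
    by (simp add: id_map_def single_def)
  have id: "id_map R k s = (\<lambda>x. \<beta> (id_map A k s x))" if "s \<in> S k" for k s
    by (auto simp: id_map_def single_def)
  have h: "h k s \<in> Free A (S (Suc k))" if "s \<in> S k" for k s
    using assms(5) that by (auto simp: homotopy_def)
  have hd: "lin A (h k) (d s) x \<in> carrier A" if "s \<in> S (Suc k)" for k s x
    by (rule A.lin_value[OF S.d_closed[OF that] A.free_value[OF h]])
  show ?thesis
    unfolding homotopy_def
  proof (intro conjI allI ballI)
    show "base_change \<beta> (h k) s \<in> Free R (S (Suc k))" if "s \<in> S k" for k s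
      unfolding base_change_def by (rule map_free[OF h[OF that]])
    show "lin R (base_change \<beta> d) (base_change \<beta> (h 0) s) =
        (\<lambda>x. comp_map R (\<lambda>k. base_change \<beta> (g k)) (\<lambda>k. base_change \<beta> (f k)) 0 s x \<ominus> id_map R 0 s x)"
      if "s \<in> S 0" for s
      using lin_map[where \<kappa> = d, OF h[OF that] S.d_value] assms(5) that gf
      by (simp add: base_change_def[of \<beta> "h 0"] comp_map_base_change[OF assms(1-4)] id homotopy_def
          \<beta>_minus id_value)
    show "lin R (base_change \<beta> d) (base_change \<beta> (h (Suc k)) s) =
        (\<lambda>x. comp_map R (\<lambda>k. base_change \<beta> (g k)) (\<lambda>k. base_change \<beta> (f k)) (Suc k) s x
          \<ominus> id_map R (Suc k) s x \<ominus> lin R (base_change \<beta> (h k)) (base_change \<beta> d s) x)"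
      if "s \<in> S (Suc k)" for k s
      using lin_map[where \<kappa> = d, OF h[OF that] S.d_value] lin_map[where \<kappa> = "h k", OF S.d_closed[OF that] A.free_value[OF h]]
        assms(5) that gf hd
      by (simp add: base_change_def[of \<beta> "h (Suc k)"] base_change_def[of \<beta> d]
          comp_map_base_change[OF assms(1-4)] id homotopy_def \<beta>_minus id_value)
  qed
qed

end

text \<open>The comparison maps and homotopies constructed over \<open>A\<close> survive base change
  along \<open>\<beta>\<close>, although the complexes obtained over \<open>R\<close> need not be
  exact. Hence their homology does not depend on the resolution.\<close>

theorem free_resolution_homology_iso:
  assumes "cring R" "\<beta> \<in> ring_hom A R" "free_resolution A N S d \<epsilon>" "free_resolution A N T e \<epsilon>'"
  shows "module_iso R (homology R S (base_change \<beta> d) k) (homology R T (base_change \<beta> e) k)"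
proof -
  interpret R: cring R by fact
  interpret ST: two_resolutions A N S d \<epsilon> T e \<epsilon>'
    using assms by (intro two_resolutions.intro)
  interpret TS: two_resolutions A N T e \<epsilon>' S d \<epsilon>
    using assms by (intro two_resolutions.intro)
  interpret SS: two_resolutions A N S d \<epsilon> S d \<epsilon>
    using assms by (intro two_resolutions.intro)
  interpret TT: two_resolutions A N T e \<epsilon>' T e \<epsilon>'
    using assms by (intro two_resolutions.intro)
  interpret change_of_rings A R \<beta>
    by unfold_locales (rule assms)
  note S = ST.S.free_complex_axioms and T = ST.T.free_complex_axioms
  obtain f where f: "chain_map A S d T e f" "ST.augmented f"
    using ST.chain_map_exists by blast
  obtain g where g: "chain_map A T e S d g" "TS.augmented g"
    using TS.chain_map_exists by blast
  have "SS.augmented (comp_map A g f)"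
    unfolding SS.augmented_def
  proof
    fix s assume s: "s \<in> S 0"
    have "\<epsilon> (comp_map A g f 0 s) = \<epsilon>' (f 0 s)"
      unfolding comp_map_def
      by (rule TS.\<epsilon>_lin) (use f g s in \<open>auto simp: chain_map_def TS.augmented_def\<close>)
    then show "\<epsilon> (comp_map A g f 0 s) = \<epsilon> (single A s \<one>\<^bsub>A\<^esub>)"
      using f(2) s by (simp add: ST.augmented_def)
  qed
  moreover have "TT.augmented (comp_map A f g)"
    unfolding TT.augmented_def
  proof
    fix s assume s: "s \<in> T 0"
    have "\<epsilon>' (comp_map A f g 0 s) = \<epsilon> (g 0 s)"
      unfolding comp_map_def
      by (rule ST.\<epsilon>_lin) (use f g s in \<open>auto simp: chain_map_def ST.augmented_def\<close>)
    then show "\<epsilon>' (comp_map A f g 0 s) = \<epsilon>' (single A s \<one>\<^bsub>A\<^esub>)"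
      using g(2) s by (simp add: TS.augmented_def)
  qed
  moreover have "SS.augmented (id_map A)" "TT.augmented (id_map A)"
    by (simp_all add: SS.augmented_def TT.augmented_def id_map_def)
  ultimately obtain h h' where
    "homotopy A S d S d (comp_map A g f) (id_map A) h" "homotopy A T e T e (comp_map A f g) (id_map A) h'"
    using SS.homotopy_exists[OF chain_map_comp[OF S T S f(1) g(1)] chain_map_id[OF S]]
      TT.homotopy_exists[OF chain_map_comp[OF T S T g(1) f(1)] chain_map_id[OF T]] by blast
  then show ?thesis
    by (intro homology_iso[OF assms(1) free_complex_base_change[OF S] free_complex_base_change[OF T]
          chain_map_base_change[OF S T f(1)] chain_map_base_change[OF T S g(1)]
          homotopy_base_change[OF S T f(1) g(1)] homotopy_base_change[OF T S g(1) f(1)]])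
qed


section \<open>Tor with coefficients in a rank one module\<close>

lemma (in module) submodule_generated:
  assumes "X \<subseteq> carrier M"
  shows "submodule (submodule_generated R M X) R M"
    and "X \<subseteq> submodule_generated R M X"
    and "\<And>K. \<lbrakk>submodule K R M; X \<subseteq> K\<rbrakk> \<Longrightarrow> submodule_generated R M X \<subseteq> K"
proof -
  have "submodule_generated R M X \<subseteq> carrier M"
    using carrier_is_submodule assms by (auto simp: submodule_generated_def)
  moreover have "\<zero>\<^bsub>M\<^esub> \<in> K" if "submodule K R M" for K
    using that submoduleE[OF that] by (metis all_not_in_conv smult_l_null R.zero_closed subsetD)
  ultimately show "submodule (submodule_generated R M X) R M"
    by (intro submoduleI) (auto simp: submodule_generated_def submoduleE)
qed (auto simp: submodule_generated_def)

text \<open>The module axioms are identities, apart from the existence of inverses, and so pass to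
  the image of a map that respects the operations. This will spare computations inside the quotients
  that define Tor.\<close>

lemma module_with_submodule_image:
  assumes "module_with_submodule R M S" "f ` carrier M = carrier M'" "f \<zero>\<^bsub>M\<^esub> = \<zero>\<^bsub>M'\<^esub>" "f ` S = S'"
    and add: "\<And>x y. \<lbrakk>x \<in> carrier M; y \<in> carrier M\<rbrakk> \<Longrightarrow> f (x \<oplus>\<^bsub>M\<^esub> y) = f x \<oplus>\<^bsub>M'\<^esub> f y"
    and smult: "\<And>r x. \<lbrakk>r \<in> carrier R; x \<in> carrier M\<rbrakk> \<Longrightarrow> f (r \<odot>\<^bsub>M\<^esub> x) = r \<odot>\<^bsub>M'\<^esub> f x"
  shows "module_with_submodule R M' S'"
proof -
  interpret M: module_with_submodule R M S by fact
  note zero = assms(3)[symmetric]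
  have M': "module R M'"
  proof (rule moduleI)
    show "cring R" ..
    show "abelian_group M'"
    proof (rule abelian_groupI)
      fix x' assume "x' \<in> carrier M'"
      then obtain x where x: "x \<in> carrier M" "x' = f x"
        using assms(2) by blast
      then have "f (\<ominus>\<^bsub>M\<^esub> x) \<oplus>\<^bsub>M'\<^esub> x' = \<zero>\<^bsub>M'\<^esub>"
        by (simp add: add[symmetric] M.l_neg zero)
      then show "\<exists>y\<in>carrier M'. y \<oplus>\<^bsub>M'\<^esub> x' = \<zero>\<^bsub>M'\<^esub>"
        using x(1) unfolding assms(2)[symmetric] by blast
    qed (auto simp: assms(2)[symmetric] zero add[symmetric] M.M.a_ac)
  qed (auto simp: assms(2)[symmetric] add[symmetric] smult[symmetric] M.smult_l_distr M.smult_r_distr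
      M.smult_assoc1)
  then interpret M': module R M' .
  note sub = M.submoduleE[OF M.submodule]
  have inv: "\<ominus>\<^bsub>M'\<^esub> f x = f (\<ominus>\<^bsub>M\<^esub> x)" if "x \<in> carrier M" for x
    by (rule M'.minus_equality) (use that assms(2) in \<open>auto simp: add[symmetric] M.l_neg zero\<close>)
  have "\<zero>\<^bsub>M\<^esub> \<in> S"
    using sub M.smult_l_null by (metis M.R.zero_closed all_not_in_conv subsetD)
  then have "submodule S' R M'"
    using sub(1) by (intro M'.submoduleI)
      (auto simp: assms(2,4)[symmetric] zero subset_iff inv add[symmetric] smult[symmetric] intro!: sub imageI)
  then show ?thesis
    using M' by (simp add: module_with_submodule_def module_with_submodule_axioms_def)
qed

text \<open>\<open>M\<close> is a copy of \<open>R\<close> on which \<open>A\<close> acts through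
  the ring homomorphism \<open>\<alpha>\<close>. Tensoring a free \<open>A\<close>-module with it
  amounts to applying \<open>\<alpha>\<close> to all coefficients.\<close>

locale augmented_algebra = R: cring R + change_of_rings A R \<alpha>
  for R :: "('r, 's) ring_scheme" (structure) and A :: "('r, 'a, 't) module_scheme" and \<alpha> +
  fixes M :: "('a, 'r, 'u) module_scheme"
  assumes scalar_closed: "r \<in> carrier R \<Longrightarrow> r \<odot>\<^bsub>A\<^esub> \<one>\<^bsub>A\<^esub> \<in> carrier A"
    and \<alpha>_scalar: "r \<in> carrier R \<Longrightarrow> \<alpha> (r \<odot>\<^bsub>A\<^esub> \<one>\<^bsub>A\<^esub>) = r"
    and M_carrier: "carrier M = carrier R"
    and M_add: "add M = add R"
    and M_smult: "\<lbrakk>a \<in> carrier A; v \<in> carrier R\<rbrakk> \<Longrightarrow> a \<odot>\<^bsub>M\<^esub> v = \<alpha> a \<otimes> v"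
begin

abbreviation basis :: "'c set \<Rightarrow> ('r \<times> ('c \<Rightarrow> 'a)) set" where
  "basis S \<equiv> carrier M \<times> Free A S"

abbreviation tensors :: "'c set \<Rightarrow> ('r, 'r \<times> ('c \<Rightarrow> 'a) \<Rightarrow> 'r) module" where
  "tensors S \<equiv> free_module R (basis S)"

abbreviation rel :: "'c set \<Rightarrow> ('r \<times> ('c \<Rightarrow> 'a) \<Rightarrow> 'r) set" where
  "rel S \<equiv> tensor_rel R A M (free_module A S)"

text \<open>
  These two maps induce inverse isomorphisms between the tensor product of \<open>M\<close> with the free \<open>A\<close>-module on \<open>S\<close> and the
  free \<open>R\<close>-module on \<open>S\<close>.
\<close>

definition contract :: "'r \<times> ('c \<Rightarrow> 'a) \<Rightarrow> 'c \<Rightarrow> 'r" where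
  "contract = (\<lambda>(m, p) s. m \<otimes> \<alpha> (p s))"

lemma contract_apply: "contract (m, p) = (\<lambda>s. m \<otimes> \<alpha> (p s))"
  by (simp add: contract_def)

definition expand :: "('c \<Rightarrow> 'r) \<Rightarrow> 'r \<times> ('c \<Rightarrow> 'a) \<Rightarrow> 'r" where
  "expand = lin R (\<lambda>s. single R (\<one>, single A s \<one>\<^bsub>A\<^esub>) \<one>)"

lemma contract_closed: "x \<in> basis S \<Longrightarrow> contract x \<in> Free R S"
  by (auto simp: contract_def M_carrier intro!: R.free_smult map_free)

lemma contract_value: "x \<in> basis S \<Longrightarrow> contract x s \<in> carrier R"
  using R.free_value[OF contract_closed] .

lemma expand_gen: "s \<in> S \<Longrightarrow> single R (\<one>, single A s \<one>\<^bsub>A\<^esub>) \<one> \<in> carrier (tensors S)"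
  by (auto simp: M_carrier intro!: R.free_single A.free_single)

lemma expand_closed: "u \<in> Free R S \<Longrightarrow> expand u \<in> carrier (tensors S)"
  unfolding expand_def by (rule R.lin_closed[OF _ expand_gen])

definition gen_tensor :: "'r \<Rightarrow> ('c \<Rightarrow> 'a) \<Rightarrow> 'r \<times> ('c \<Rightarrow> 'a) \<Rightarrow> 'r" where
  "gen_tensor m p = single R (m, p) \<one>"

text \<open>The relators of \<open>tensor_rel\<close>, restated with the opaque constant
  \<open>gen_tensor\<close> so that simplification does not take them apart.\<close>

definition relations :: "'c set \<Rightarrow> ('r \<times> ('c \<Rightarrow> 'a) \<Rightarrow> 'r) set" where
  "relations S =
    {gen_tensor (m \<oplus>\<^bsub>M\<^esub> m') n \<ominus>\<^bsub>tensors S\<^esub> (gen_tensor m n \<oplus>\<^bsub>tensors S\<^esub> gen_tensor m' n) | m m' n.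
       m \<in> carrier M \<and> m' \<in> carrier M \<and> n \<in> Free A S} \<union>
    {gen_tensor m (n \<oplus>\<^bsub>free_module A S\<^esub> n') \<ominus>\<^bsub>tensors S\<^esub> (gen_tensor m n \<oplus>\<^bsub>tensors S\<^esub> gen_tensor m n') | m n n'.
       m \<in> carrier M \<and> n \<in> Free A S \<and> n' \<in> Free A S} \<union>
    {gen_tensor (a \<odot>\<^bsub>M\<^esub> m) n \<ominus>\<^bsub>tensors S\<^esub> gen_tensor m (a \<odot>\<^bsub>free_module A S\<^esub> n) | a m n.
       a \<in> carrier A \<and> m \<in> carrier M \<and> n \<in> Free A S} \<union>
    {gen_tensor ((r \<odot>\<^bsub>A\<^esub> \<one>\<^bsub>A\<^esub>) \<odot>\<^bsub>M\<^esub> m) n \<ominus>\<^bsub>tensors S\<^esub> r \<odot>\<^bsub>tensors S\<^esub> gen_tensor m n | r m n.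
       r \<in> carrier R \<and> m \<in> carrier M \<and> n \<in> Free A S}"

lemma rel_eq: "rel S = submodule_generated R (tensors S) (relations S)"
  unfolding tensor_rel_def Let_def relations_def gen_tensor_def ..

lemma relationsI:
  assumes "m \<in> carrier M" "m' \<in> carrier M" "p \<in> Free A S" "p' \<in> Free A S"
      "a \<in> carrier A" "r \<in> carrier R"
  shows "gen_tensor (m \<oplus>\<^bsub>M\<^esub> m') p \<ominus>\<^bsub>tensors S\<^esub> (gen_tensor m p \<oplus>\<^bsub>tensors S\<^esub> gen_tensor m' p) \<in> relations S"
    and "gen_tensor m (p \<oplus>\<^bsub>free_module A S\<^esub> p') \<ominus>\<^bsub>tensors S\<^esub> (gen_tensor m p \<oplus>\<^bsub>tensors S\<^esub> gen_tensor m p') \<in> relations S"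
    and "gen_tensor (a \<odot>\<^bsub>M\<^esub> m) p \<ominus>\<^bsub>tensors S\<^esub> gen_tensor m (a \<odot>\<^bsub>free_module A S\<^esub> p) \<in> relations S"
    and "gen_tensor ((r \<odot>\<^bsub>A\<^esub> \<one>\<^bsub>A\<^esub>) \<odot>\<^bsub>M\<^esub> m) p \<ominus>\<^bsub>tensors S\<^esub> r \<odot>\<^bsub>tensors S\<^esub> gen_tensor m p \<in> relations S"
  unfolding relations_def
     apply (rule UnI1, rule UnI1, rule UnI1, rule CollectI, intro exI conjI, rule refl; rule assms)
    apply (rule UnI1, rule UnI1, rule UnI2, rule CollectI, intro exI conjI, rule refl; rule assms)
   apply (rule UnI1, rule UnI2, rule CollectI, intro exI conjI, rule refl; rule assms)
  apply (rule UnI2, rule CollectI, intro exI conjI, rule refl; rule assms)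
  done

lemma gen_tensor_closed:
  assumes "m \<in> carrier R" "p \<in> Free A S"
  shows "gen_tensor m p \<in> carrier (tensors S)"
  unfolding gen_tensor_def using assms by (intro R.free_single) (auto simp: M_carrier)

lemma contract_gen_tensor:
  assumes "m \<in> carrier R" "p \<in> Free A S"
  shows "lin R contract (gen_tensor m p) = contract (m, p)"
proof -
  have x: "(m, p) \<in> basis S" using assms by (simp add: M_carrier)
  have "lin R contract (single R (m, p) \<one>) = (\<lambda>h. \<one> \<otimes> contract (m, p) h)"
    by (rule R.lin_single[where \<kappa> = contract, OF x R.one_closed contract_value[OF x]])
  then show ?thesis
    using contract_value[OF x] by (simp add: gen_tensor_def)
qed

lemma contract_expand:
  assumes "u \<in> Free R S"
  shows "lin R contract (expand u) = u"
proof -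
  have "lin R contract (expand u) = lin R (\<lambda>s. lin R contract (single R (\<one>, single A s \<one>\<^bsub>A\<^esub>) \<one>)) u"
    unfolding expand_def by (rule R.lin_lin[OF assms expand_gen contract_value])
  also have "\<dots> = lin R (\<lambda>s. single R s \<one>) u"
  proof (rule R.lin_cong[OF assms])
    fix s assume s: "s \<in> S"
    then show "lin R contract (single R (\<one>, single A s \<one>\<^bsub>A\<^esub>) \<one>) = single R s \<one>"
      using contract_gen_tensor[OF R.one_closed A.free_single[OF s A.one_closed]]
      by (auto simp: gen_tensor_def contract_def single_def fun_eq_iff)
  qed (auto simp: single_def)
  also have "\<dots> = u"
    by (rule R.lin_id[OF assms])
  finally show ?thesis .
qed

lemma M_smult_closed: "\<lbrakk>a \<in> carrier A; v \<in> carrier R\<rbrakk> \<Longrightarrow> a \<odot>\<^bsub>M\<^esub> v \<in> carrier R"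
  by (simp add: M_smult)

text \<open>The kernel of \<open>contract\<close> is a submodule that contains the relators, hence
  all that they generate. The same inclusion shows that the relators lie in
  \<open>tensors S\<close>, so both claims are proved together.\<close>

lemma rel_submodule: "module_with_submodule R (tensors S) (rel S)"
  and rel_subset_kernel: "f \<in> rel S \<Longrightarrow> lin R contract f = (\<lambda>s. \<zero>)"
proof -
  interpret F: module R "tensors S" by (rule R.module_free)
  let ?K = "{f \<in> carrier (tensors S). lin R contract f = (\<lambda>s. \<zero>)}"
  have l0: "\<zero> \<ominus> \<zero> = \<zero>" by (simp add: R.minus_eq)
  have K: "submodule ?K R (tensors S)"
  proof (rule F.submoduleI)
    show "\<ominus>\<^bsub>tensors S\<^esub> f \<in> ?K" if f: "f \<in> ?K" for f
    proof -
      have lin: "lin R contract (\<lambda>x. \<zero> \<ominus> f x) = (\<lambda>s. lin R contract (\<lambda>x. \<zero>) s \<ominus> lin R contract f s)"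
        by (rule R.lin_minus[OF R.free_zero _ contract_value]) (use f in auto)
      have "\<ominus>\<^bsub>tensors S\<^esub> f = \<zero>\<^bsub>tensors S\<^esub> \<ominus>\<^bsub>tensors S\<^esub> f"
        using f by (auto simp: F.minus_eq)
      also have "\<dots> = (\<lambda>x. \<zero> \<ominus> f x)"
        using f by (subst R.free_minus_eq) (auto simp: free_module_simps)
      finally show ?thesis
        using f l0 lin R.free_minus[OF R.free_zero, where g = f and S = "basis S"] by simp
    qed
  qed (auto simp: free_module_simps R.lin_add[OF _ _ contract_value] R.lin_smult[OF _ _ contract_value]
        R.free_add R.free_smult)
  have diff: "f \<ominus>\<^bsub>tensors S\<^esub> g \<in> ?K"
    if "f \<in> carrier (tensors S)" "g \<in> carrier (tensors S)" "lin R contract f = lin R contract g" for f g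
  proof -
    have "lin R contract (f \<ominus>\<^bsub>tensors S\<^esub> g) = (\<lambda>s. lin R contract g s \<ominus> lin R contract g s)"
      unfolding R.free_minus_eq[OF that(1,2)] using R.lin_minus[where \<kappa> = contract, OF that(1,2) contract_value] that(3) by simp
    then show ?thesis
      using that R.lin_value[where \<kappa> = contract, OF that(2) contract_value] by (simp add: R.minus_eq R.r_neg)
  qed
  have add: "lin R contract (f \<oplus>\<^bsub>tensors S\<^esub> g) = (\<lambda>s. lin R contract f s \<oplus> lin R contract g s)"
    if "f \<in> carrier (tensors S)" "g \<in> carrier (tensors S)" for f g
    unfolding free_module_simps by (rule R.lin_add[OF that contract_value])
  have smult: "lin R contract (r \<odot>\<^bsub>tensors S\<^esub> f) = (\<lambda>s. r \<otimes> lin R contract f s)"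
    if "f \<in> carrier (tensors S)" "r \<in> carrier R" for f r
    unfolding free_module_simps by (rule R.lin_smult[OF that contract_value])
  note A_value = h.hom_closed A.free_value[where S = S]
  have X: "relations S \<subseteq> ?K"
    unfolding relations_def
  proof (intro Un_least subsetI; elim CollectE exE conjE; simp only:)
    note [simp] = gen_tensor_closed contract_gen_tensor add smult contract_apply A_value
    fix m m' n n' a r
    assume "m \<in> carrier M"
    then have m: "m \<in> carrier R" by (simp add: M_carrier)
    assume n: "n \<in> Free A S"
    {
      assume "m' \<in> carrier M"
      then have m': "m' \<in> carrier R" by (simp add: M_carrier)
      show "gen_tensor (m \<oplus>\<^bsub>M\<^esub> m') n \<ominus>\<^bsub>tensors S\<^esub> (gen_tensor m n \<oplus>\<^bsub>tensors S\<^esub> gen_tensor m' n) \<in> ?K"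
        by (rule diff) (use m m' n in \<open>auto simp: M_add R.l_distr intro!: F.a_closed\<close>)
    }
    {
      assume n': "n' \<in> Free A S"
      show "gen_tensor m (n \<oplus>\<^bsub>free_module A S\<^esub> n') \<ominus>\<^bsub>tensors S\<^esub> (gen_tensor m n \<oplus>\<^bsub>tensors S\<^esub> gen_tensor m n') \<in> ?K"
        by (rule diff)
          (use m n n' A.free_add[OF n n'] in \<open>auto simp: free_module_simps(2)[of A] R.r_distr intro!: F.a_closed\<close>)
    }
    {
      assume a: "a \<in> carrier A"
      show "gen_tensor (a \<odot>\<^bsub>M\<^esub> m) n \<ominus>\<^bsub>tensors S\<^esub> gen_tensor m (a \<odot>\<^bsub>free_module A S\<^esub> n) \<in> ?K"
        by (rule diff)
          (use m n a A.free_smult[OF n a] in \<open>auto simp: free_module_simps(3)[of A] M_smult R.m_ac\<close>)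
    }
    {
      assume r: "r \<in> carrier R"
      show "gen_tensor ((r \<odot>\<^bsub>A\<^esub> \<one>\<^bsub>A\<^esub>) \<odot>\<^bsub>M\<^esub> m) n \<ominus>\<^bsub>tensors S\<^esub> r \<odot>\<^bsub>tensors S\<^esub> gen_tensor m n \<in> ?K"
        by (rule diff) (use m n r in \<open>auto simp: M_smult scalar_closed \<alpha>_scalar R.m_assoc\<close>)
    }
  qed
  then have X': "relations S \<subseteq> carrier (tensors S)" by blast
  show "module_with_submodule R (tensors S) (rel S)"
    unfolding rel_eq by (intro module_with_submodule.intro module_with_submodule_axioms.intro
        F.submodule_generated(1)[OF X'] R.module_free)
  show "f \<in> rel S \<Longrightarrow> lin R contract f = (\<lambda>s. \<zero>)"
    unfolding rel_eq using F.submodule_generated(3)[OF X' K X] by blast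
qed

abbreviation coset :: "'c set \<Rightarrow> ('r \<times> ('c \<Rightarrow> 'a) \<Rightarrow> 'r) \<Rightarrow> ('r \<times> ('c \<Rightarrow> 'a) \<Rightarrow> 'r) set" where
  "coset S f \<equiv> rel S +>\<^bsub>tensors S\<^esub> f"

abbreviation tensor_product :: "'c set \<Rightarrow> ('r, ('r \<times> ('c \<Rightarrow> 'a) \<Rightarrow> 'r) set) module" where
  "tensor_product S \<equiv> tensor R A M (free_module A S)"

lemma coset_ops:
  assumes "f \<in> carrier (tensors S)"
  shows "g \<in> carrier (tensors S) \<Longrightarrow> coset S (\<lambda>x. f x \<oplus> g x) = coset S f \<oplus>\<^bsub>tensor_product S\<^esub> coset S g"
    and "r \<in> carrier R \<Longrightarrow> coset S (\<lambda>x. r \<otimes> f x) = r \<odot>\<^bsub>tensor_product S\<^esub> coset S f"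
    and "coset S f \<in> carrier (tensor_product S)"
proof -
  interpret T: module_with_submodule R "tensors S" "rel S"
    by (rule rel_submodule)
  show "g \<in> carrier (tensors S) \<Longrightarrow> coset S (\<lambda>x. f x \<oplus> g x) = coset S f \<oplus>\<^bsub>tensor_product S\<^esub> coset S g"
    "r \<in> carrier R \<Longrightarrow> coset S (\<lambda>x. r \<otimes> f x) = r \<odot>\<^bsub>tensor_product S\<^esub> coset S f"
    "coset S f \<in> carrier (tensor_product S)"
    using assms T.quotient_add[of f g] T.quotient_smult[of r f] T.quotient_carrier
    by (auto simp: free_module_simps tensor_def simp del: quotient_module_simps)
qed

lemma coset_zero: "\<zero>\<^bsub>tensor_product S\<^esub> = coset S (\<lambda>x. \<zero>)"
proof -
  interpret T: module_with_submodule R "tensors S" "rel S"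
    by (rule rel_submodule)
  show ?thesis
    using T.quotient_zero by (simp add: tensor_def free_module_simps del: quotient_module_simps)
qed

lemma module_tensor: "module R (tensor_product S)"
proof -
  interpret T: module_with_submodule R "tensors S" "rel S"
    by (rule rel_submodule)
  show ?thesis
    using T.module_quotient by (simp add: tensor_def)
qed

lemma coset_gen_tensor:
  assumes m: "m \<in> carrier R" "m' \<in> carrier R"
    and p: "p \<in> Free A S" "p' \<in> Free A S"
    and a: "a \<in> carrier A" and r: "r \<in> carrier R"
  shows "coset S (gen_tensor m (\<lambda>x. p x \<oplus>\<^bsub>A\<^esub> p' x))
      = coset S (gen_tensor m p) \<oplus>\<^bsub>tensor_product S\<^esub> coset S (gen_tensor m p')"
    and "coset S (gen_tensor m (\<lambda>x. a \<otimes>\<^bsub>A\<^esub> p x)) = coset S (gen_tensor (\<alpha> a \<otimes> m) p)"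
    and "coset S (gen_tensor (r \<otimes> m) p) = r \<odot>\<^bsub>tensor_product S\<^esub> coset S (gen_tensor m p)"
proof -
  interpret T: module_with_submodule R "tensors S" "rel S"
    by (rule rel_submodule)
  have relI: "coset S f = coset S g"
    if "f \<in> carrier (tensors S)" "g \<in> carrier (tensors S)" "f \<ominus>\<^bsub>tensors S\<^esub> g \<in> relations S" for f g
  proof -
    have "relations S \<subseteq> rel S"
      unfolding rel_eq submodule_generated_def by blast
    then show ?thesis
      using T.coset_eq_iff[OF that(1,2)] that(3) by blast
  qed
  have mM: "m \<in> carrier M" "m' \<in> carrier M"
    using m by (simp_all add: M_carrier)
  note I = relationsI[OF mM p a r]
  note cl = gen_tensor_closed
  show "coset S (gen_tensor m (\<lambda>x. p x \<oplus>\<^bsub>A\<^esub> p' x))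
      = coset S (gen_tensor m p) \<oplus>\<^bsub>tensor_product S\<^esub> coset S (gen_tensor m p')"
    using relI[OF _ _ I(2)] cl[OF m(1) A.free_add[OF p]] R.free_add[OF cl[OF m(1) p(1)] cl[OF m(1) p(2)]]
      coset_ops(1)[OF cl[OF m(1) p(1)] cl[OF m(1) p(2)]]
    by (simp add: free_module_simps)
  show "coset S (gen_tensor m (\<lambda>x. a \<otimes>\<^bsub>A\<^esub> p x)) = coset S (gen_tensor (\<alpha> a \<otimes> m) p)"
    using relI[OF _ _ I(3)] cl[OF m(1) A.free_smult[OF p(1) a]] cl[OF M_smult_closed[OF a m(1)] p(1)] a m
    by (simp add: free_module_simps M_smult)
  show "coset S (gen_tensor (r \<otimes> m) p) = r \<odot>\<^bsub>tensor_product S\<^esub> coset S (gen_tensor m p)"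
    using relI[OF _ _ I(4)] cl[OF M_smult_closed[OF scalar_closed[OF r] m(1)] p(1)]
      R.free_smult[OF cl[OF m(1) p(1)] r] coset_ops(2)[OF cl[OF m(1) p(1)] r] scalar_closed[OF r] r m
    by (simp add: free_module_simps M_smult \<alpha>_scalar)
qed

lemma expand_step:
  assumes "s \<in> S" "r \<in> carrier R" "u \<in> Free R S"
  shows "expand (\<lambda>x. single R s r x \<oplus> u x)
    = (\<lambda>x. r \<otimes> gen_tensor \<one> (single A s \<one>\<^bsub>A\<^esub>) x \<oplus> expand u x)"
  unfolding expand_def gen_tensor_def
  by (rule R.lin_step[OF assms R.free_value[OF expand_gen]])

text \<open>Modulo the relations, the tensor of \<open>m\<close> with \<open>a s + u\<close> is
  \<open>\<alpha> a m\<close> times the tensor of 1 with \<open>s\<close>, plus the tensor of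
  \<open>m\<close> with \<open>u\<close>. Peeling off basis elements in this way leaves a
  combination of the tensors of 1 with basis elements, which is what \<open>expand\<close>
  produces.\<close>

lemma coset_expand_contract_gen:
  fixes S :: "'c set"
  assumes m: "m \<in> carrier R" and p: "p \<in> Free A S"
  shows "coset S (gen_tensor m p) = coset S (expand (contract (m, p)))"
  using p
proof (induction rule: A.free_induct)
  case zero
  interpret T: module R "tensor_product S" by (rule module_tensor)
  let ?E = "coset S (gen_tensor m (\<lambda>x. \<zero>\<^bsub>A\<^esub>))"
  have E: "?E \<in> carrier (tensor_product S)"
    by (rule coset_ops(3)[OF gen_tensor_closed[OF m A.free_zero]])
  have "?E = ?E \<oplus>\<^bsub>tensor_product S\<^esub> ?E"
    using coset_gen_tensor(1)[OF m m A.free_zero A.free_zero A.zero_closed m] by simp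
  then have "?E = \<zero>\<^bsub>tensor_product S\<^esub>"
    using E by (metis T.M.add.l_cancel_one')
  moreover have "contract (m, \<lambda>x :: 'c. \<zero>\<^bsub>A\<^esub>) = (\<lambda>s. \<zero>)"
    using m by (simp add: contract_def)
  ultimately show ?case
    by (simp add: expand_def coset_zero)
next
  case (add s a u)
  have sA: "single A s \<one>\<^bsub>A\<^esub> \<in> Free A S" and saA: "single A s a \<in> Free A S"
    using add by (auto intro!: A.free_single)
  have sa: "single A s a = (\<lambda>x. a \<otimes>\<^bsub>A\<^esub> single A s \<one>\<^bsub>A\<^esub> x)"
    using add(2) by (auto simp: single_def)
  have \<alpha>a: "\<alpha> a \<in> carrier R" "\<alpha> a \<otimes> m \<in> carrier R"
    using add(2) m by auto
  have cu: "contract (m, u) \<in> Free R S"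
    using m add(3) by (intro contract_closed) (simp add: M_carrier)
  have c: "contract (m, \<lambda>x. single A s a x \<oplus>\<^bsub>A\<^esub> u x)
      = (\<lambda>x. single R s (\<alpha> a \<otimes> m) x \<oplus> contract (m, u) x)"
    using m add A.free_value[OF add(3)] by (auto simp: contract_def single_def R.r_distr R.m_comm fun_eq_iff)
  have "coset S (gen_tensor m (\<lambda>x. single A s a x \<oplus>\<^bsub>A\<^esub> u x))
      = coset S (gen_tensor m (single A s a)) \<oplus>\<^bsub>tensor_product S\<^esub> coset S (gen_tensor m u)"
    by (rule coset_gen_tensor(1)[OF m m saA add(3) add(2) m])
  also have "coset S (gen_tensor m (single A s a))
      = coset S (gen_tensor (\<alpha> a \<otimes> m \<otimes> \<one>) (single A s \<one>\<^bsub>A\<^esub>))"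
    using coset_gen_tensor(2)[OF m m sA sA add(2) m] \<alpha>a unfolding sa by simp
  also have "\<dots> = (\<alpha> a \<otimes> m) \<odot>\<^bsub>tensor_product S\<^esub> coset S (gen_tensor \<one> (single A s \<one>\<^bsub>A\<^esub>))"
    by (rule coset_gen_tensor(3)[OF R.one_closed m sA sA add(2) \<alpha>a(2)])
  also have "\<dots> = coset S (\<lambda>x. \<alpha> a \<otimes> m \<otimes> gen_tensor \<one> (single A s \<one>\<^bsub>A\<^esub>) x)"
    by (rule coset_ops(2)[OF gen_tensor_closed[OF R.one_closed sA] \<alpha>a(2), symmetric])
  also have "\<dots> \<oplus>\<^bsub>tensor_product S\<^esub> coset S (gen_tensor m u)
      = coset S (expand (contract (m, \<lambda>x. single A s a x \<oplus>\<^bsub>A\<^esub> u x)))"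
    unfolding c expand_step[OF add(1) \<alpha>a(2) cu] add(4)
    by (rule coset_ops(1)[symmetric, OF R.free_smult[OF gen_tensor_closed[OF R.one_closed sA] \<alpha>a(2)]
          expand_closed[OF cu]])
  finally show ?case .
qed

lemma coset_expand_contract:
  assumes "f \<in> carrier (tensors S)"
  shows "coset S f = coset S (expand (lin R contract f))"
  using assms
proof (induction rule: R.free_induct)
  case zero
  then show ?case by (simp add: expand_def)
next
  case (add x r u)
  obtain m p where x: "x = (m, p)" "m \<in> carrier R" "p \<in> Free A S"
    using add(1) by (auto simp: M_carrier)
  have e: "single R x r = (\<lambda>y. r \<otimes> gen_tensor m p y)"
    using add(2) x(1) by (auto simp: single_def gen_tensor_def)
  have g: "gen_tensor m p \<in> carrier (tensors S)" and c: "contract (m, p) \<in> Free R S"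
    using x gen_tensor_closed[OF x(2,3)] contract_closed[of "(m, p)" S] by (auto simp: M_carrier)
  note lc = R.lin_closed[OF add(3) contract_closed]
  have E: "expand (lin R contract (\<lambda>y. single R x r y \<oplus> u y))
      = (\<lambda>y. r \<otimes> expand (contract (m, p)) y \<oplus> expand (lin R contract u) y)"
  proof -
    have "lin R contract (\<lambda>y. single R x r y \<oplus> u y) = (\<lambda>s. r \<otimes> contract x s \<oplus> lin R contract u s)"
      by (rule R.lin_step[OF add(1-3) contract_value])
    moreover have "expand (\<lambda>s. r \<otimes> contract x s \<oplus> lin R contract u s)
        = (\<lambda>y. expand (\<lambda>s. r \<otimes> contract x s) y \<oplus> expand (lin R contract u) y)"
      unfolding expand_def using c x
      by (intro R.lin_add[OF R.free_smult[OF _ add(2)] lc R.free_value[OF expand_gen]]) auto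
    moreover have "expand (\<lambda>s. r \<otimes> contract x s) = (\<lambda>y. r \<otimes> expand (contract x) y)"
      unfolding expand_def using c x by (intro R.lin_smult[OF _ add(2) R.free_value[OF expand_gen]]) auto
    ultimately show ?thesis using x by simp
  qed
  have "coset S (\<lambda>y. single R x r y \<oplus> u y)
      = r \<odot>\<^bsub>tensor_product S\<^esub> coset S (gen_tensor m p) \<oplus>\<^bsub>tensor_product S\<^esub> coset S u"
    unfolding e using coset_ops(1)[OF R.free_smult[OF g add(2)] add(3)] coset_ops(2)[OF g add(2)] by simp
  also have "\<dots> = r \<odot>\<^bsub>tensor_product S\<^esub> coset S (expand (contract (m, p)))
      \<oplus>\<^bsub>tensor_product S\<^esub> coset S (expand (lin R contract u))"
    using add(4) coset_expand_contract_gen[OF x(2,3)] by simp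
  also have "\<dots> = coset S (expand (lin R contract (\<lambda>y. single R x r y \<oplus> u y)))"
    unfolding E using coset_ops(1)[OF R.free_smult[OF expand_closed[OF c] add(2)] expand_closed[OF lc]]
      coset_ops(2)[OF expand_closed[OF c] add(2)] by simp
  finally show ?case .
qed

definition to_tensor :: "'c set \<Rightarrow> ('c \<Rightarrow> 'r) \<Rightarrow> ('r \<times> ('c \<Rightarrow> 'a) \<Rightarrow> 'r) set" where
  "to_tensor S u = coset S (expand u)"

lemma to_tensor_add:
  assumes "u \<in> Free R S" "v \<in> Free R S"
  shows "to_tensor S (\<lambda>x. u x \<oplus> v x) = to_tensor S u \<oplus>\<^bsub>tensor_product S\<^esub> to_tensor S v"
proof -
  have "expand (\<lambda>x. u x \<oplus> v x) = (\<lambda>x. expand u x \<oplus> expand v x)"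
    unfolding expand_def by (rule R.lin_add[OF assms R.free_value[OF expand_gen]])
  then show ?thesis
    using coset_ops(1)[OF expand_closed[OF assms(1)] expand_closed[OF assms(2)]] by (simp add: to_tensor_def)
qed

lemma to_tensor_smult:
  assumes "u \<in> Free R S" "r \<in> carrier R"
  shows "to_tensor S (\<lambda>x. r \<otimes> u x) = r \<odot>\<^bsub>tensor_product S\<^esub> to_tensor S u"
proof -
  have "expand (\<lambda>x. r \<otimes> u x) = (\<lambda>x. r \<otimes> expand u x)"
    unfolding expand_def by (rule R.lin_smult[OF assms R.free_value[OF expand_gen]])
  then show ?thesis
    using coset_ops(2)[OF expand_closed[OF assms(1)] assms(2)] by (simp add: to_tensor_def)
qed

lemma to_tensor_zero: "to_tensor S (\<lambda>x. \<zero>) = \<zero>\<^bsub>tensor_product S\<^esub>"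
  by (simp add: to_tensor_def expand_def coset_zero)

lemma to_tensor_inj:
  assumes "u \<in> Free R S" "v \<in> Free R S" "to_tensor S u = to_tensor S v"
  shows "u = v"
proof -
  interpret T: module_with_submodule R "tensors S" "rel S"
    by (rule rel_submodule)
  note e = expand_closed[OF assms(1)] expand_closed[OF assms(2)]
  have "expand u \<ominus>\<^bsub>tensors S\<^esub> expand v \<in> rel S"
    using assms(3) T.coset_eq_iff[OF e] by (simp add: to_tensor_def)
  then have "lin R contract (\<lambda>x. expand u x \<ominus> expand v x) = (\<lambda>s. \<zero>)"
    using rel_subset_kernel R.free_minus_eq[OF e] by simp
  moreover have "lin R contract (\<lambda>x. expand u x \<ominus> expand v x) = (\<lambda>s. u s \<ominus> v s)"
    using R.lin_minus[where \<kappa> = contract, OF e contract_value] contract_expand[OF assms(1)]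
      contract_expand[OF assms(2)] by simp
  ultimately have "u s \<ominus> v s = \<zero>" for s
    using fun_cong[of "\<lambda>s. u s \<ominus> v s" "\<lambda>s. \<zero>" s] by simp
  then show ?thesis
    using R.minus_add_cancel[OF R.free_value[OF assms(1)] R.free_value[OF assms(2)]]
      R.free_value[OF assms(2)] by (intro ext) (metis R.l_zero)
qed

lemma to_tensor_image: "to_tensor S ` Free R S = carrier (tensor_product S)"
proof -
  interpret T: module_with_submodule R "tensors S" "rel S"
    by (rule rel_submodule)
  have c: "carrier (tensor_product S) = coset S ` carrier (tensors S)"
    using T.quotient_carrier by (simp add: tensor_def del: quotient_module_simps)
  show ?thesis
  proof
    show "to_tensor S ` Free R S \<subseteq> carrier (tensor_product S)"
      unfolding to_tensor_def c by (intro image_subsetI imageI expand_closed)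
    show "carrier (tensor_product S) \<subseteq> to_tensor S ` Free R S"
    proof
      fix X assume "X \<in> carrier (tensor_product S)"
      then obtain f where f: "f \<in> carrier (tensors S)" "X = coset S f"
        unfolding c by (rule imageE)
      have "lin R contract f \<in> Free R S"
        by (rule R.lin_closed[OF f(1) contract_closed])
      moreover have "X = to_tensor S (lin R contract f)"
        unfolding to_tensor_def f(2) by (rule coset_expand_contract[OF f(1)])
      ultimately show "X \<in> to_tensor S ` Free R S"
        by simp
    qed
  qed
qed

text \<open>The map on representatives that occurs inside \<open>tensor_map\<close>.\<close>

definition push :: "(('c \<Rightarrow> 'a) \<Rightarrow> 'd \<Rightarrow> 'a) \<Rightarrow> ('r \<times> ('c \<Rightarrow> 'a) \<Rightarrow> 'r) \<Rightarrow> 'r \<times> ('d \<Rightarrow> 'a) \<Rightarrow> 'r" where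
  "push \<phi> f = (\<lambda>(m, q). \<Oplus>p\<in>{p. f (m, p) \<noteq> \<zero> \<and> \<phi> p = q}. f (m, p))"

lemma push_eq_lin:
  fixes \<phi> :: "('c \<Rightarrow> 'a) \<Rightarrow> 'd \<Rightarrow> 'a"
  assumes f: "f \<in> carrier (tensors S)"
  shows "push \<phi> f = lin R (\<lambda>x. single R (fst x, \<phi> (snd x)) \<one>) f"
proof
  fix y :: "'r \<times> ('d \<Rightarrow> 'a)"
  obtain m q where y: "y = (m, q)" by (cases y)
  let ?T = "{x. f x \<noteq> \<zero>}" and ?P = "{p. f (m, p) \<noteq> \<zero> \<and> \<phi> p = q}"
  have fin: "finite ?T"
    using R.free_supp[OF f] by blast
  have v: "f x \<in> carrier R" for x
    using R.free_value[OF f] .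
  have "lin R (\<lambda>x. single R (fst x, \<phi> (snd x)) \<one>) f y
      = (\<Oplus>x\<in>?T. f x \<otimes> single R (fst x, \<phi> (snd x)) \<one> y)"
    by (simp add: lin_def)
  also have "\<dots> = (\<Oplus>x\<in>Pair m ` ?P. f x)"
    using v fin by (intro R.add.finprod_mono_neutral_cong_right) (auto simp: single_def y)
  also have "\<dots> = (\<Oplus>p\<in>?P. f (m, p))"
    by (rule R.add.finprod_reindex) (auto intro: inj_onI v)
  finally show "push \<phi> f y = lin R (\<lambda>x. single R (fst x, \<phi> (snd x)) \<one>) f y"
    by (simp add: push_def y)
qed

lemma contract_push:
  assumes d: "\<And>s. s \<in> S \<Longrightarrow> d s \<in> Free A S'"
    and f: "f \<in> carrier (tensors S)"
  shows "push (lin A d) f \<in> carrier (tensors S')"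
    and "lin R contract (push (lin A d) f) = lin R (base_change \<alpha> d) (lin R contract f)"
proof -
  let ?\<sigma> = "\<lambda>x. single R (fst x, lin A d (snd x)) \<one>"
  have mem: "(fst x, lin A d (snd x)) \<in> basis S'" if "x \<in> basis S" for x
    using that A.lin_closed[OF _ d] by auto
  then have \<sigma>: "?\<sigma> x \<in> carrier (tensors S')" if "x \<in> basis S" for x
    using that by (intro R.free_single) auto
  show "push (lin A d) f \<in> carrier (tensors S')"
    unfolding push_eq_lin[OF f] by (rule R.lin_closed[OF f \<sigma>])
  have bd: "base_change \<alpha> d s \<in> Free R S'" if "s \<in> S" for s
    unfolding base_change_def by (rule map_free[OF d[OF that]])
  note dv = A.free_value[OF d]
  have "lin R contract (push (lin A d) f) = lin R (\<lambda>x. lin R contract (?\<sigma> x)) f"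
    unfolding push_eq_lin[OF f] by (rule R.lin_lin[OF f \<sigma> contract_value])
  also have "\<dots> = lin R (\<lambda>x. lin R (base_change \<alpha> d) (contract x)) f"
  proof (rule R.lin_cong[OF f])
    fix x assume x: "x \<in> basis S"
    then obtain m p where mp: "x = (m, p)" "m \<in> carrier R" "p \<in> Free A S"
      by (auto simp: M_carrier)
    have "lin R contract (?\<sigma> x) = contract (m, lin A d p)"
      using contract_gen_tensor[OF mp(2) A.lin_closed[OF mp(3) d]] by (simp add: gen_tensor_def mp(1))
    also have "\<dots> = (\<lambda>s. m \<otimes> lin R (base_change \<alpha> d) (\<lambda>x. \<alpha> (p x)) s)"
      using lin_map[where \<kappa> = d, OF mp(3) dv] by (simp add: contract_def)
    also have "\<dots> = lin R (base_change \<alpha> d) (contract x)"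
      unfolding contract_def mp(1) prod.case
      by (rule R.lin_smult[OF map_free[OF mp(3)] mp(2) R.free_value[OF bd], symmetric])
    finally show "lin R contract (?\<sigma> x) = lin R (base_change \<alpha> d) (contract x)" .
    fix h show "lin R (base_change \<alpha> d) (contract x) h \<in> carrier R"
      by (rule R.lin_value[OF contract_closed[OF x] R.free_value[OF bd]])
  qed
  also have "\<dots> = lin R (base_change \<alpha> d) (lin R contract f)"
    by (rule R.lin_lin[OF f contract_closed R.free_value[OF bd], symmetric])
  finally show "lin R contract (push (lin A d) f) = lin R (base_change \<alpha> d) (lin R contract f)" .
qed

text \<open>\<open>tensor_map\<close> is a union over all representatives of a coset. These agree
  under \<open>contract\<close>, which determines cosets, so the union collapses to one
  coset.\<close>

lemma tensor_map_to_tensor: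
  assumes d: "\<And>s. s \<in> S \<Longrightarrow> d s \<in> Free A S'"
    and u: "u \<in> Free R S"
  shows "tensor_map R A M (free_module A S') (lin A d) (to_tensor S u)
    = to_tensor S' (lin R (base_change \<alpha> d) u)"
proof -
  interpret T: module_with_submodule R "tensors S" "rel S"
    by (rule rel_submodule)
  note e = expand_closed[OF u]
  have "coset S' (push (lin A d) g) = to_tensor S' (lin R (base_change \<alpha> d) u)" if "g \<in> to_tensor S u" for g
  proof -
    have g: "g \<in> carrier (tensors S)" and "g \<ominus>\<^bsub>tensors S\<^esub> expand u \<in> rel S"
      using T.coset_memD[OF e] that by (auto simp: to_tensor_def)
    then have "lin R contract (\<lambda>x. g x \<ominus> expand u x) = (\<lambda>s. \<zero>)"
      using rel_subset_kernel R.free_minus_eq[OF g e] by simp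
    moreover have "lin R contract (\<lambda>x. g x \<ominus> expand u x) = (\<lambda>s. lin R contract g s \<ominus> u s)"
      using R.lin_minus[where \<kappa> = contract, OF g e contract_value] contract_expand[OF u] by simp
    ultimately have "lin R contract g s \<ominus> u s = \<zero>" for s
      using fun_cong[of "\<lambda>s. lin R contract g s \<ominus> u s" "\<lambda>s. \<zero>" s] by simp
    then have "lin R contract g = u"
      using R.minus_add_cancel[OF R.lin_value[where \<kappa> = contract, OF g contract_value] R.free_value[OF u]]
        R.free_value[OF u] by (intro ext) (metis R.l_zero)
    then show ?thesis
      using coset_expand_contract[OF contract_push(1)[OF d g]] contract_push(2)[OF d g]
      by (simp add: to_tensor_def)
  qed
  moreover have "tensor_map R A M (free_module A S') (lin A d) (to_tensor S u)
      = (\<Union>g\<in>to_tensor S u. coset S' (push (lin A d) g))"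
    by (simp add: tensor_map_def push_def)
  moreover have "to_tensor S u \<noteq> {}"
    using T.coset_self[OF e] by (auto simp: to_tensor_def)
  ultimately show ?thesis
    by simp
qed

text \<open>The maps \<open>to_tensor\<close> form an isomorphism from the base change of the
  standard resolution along \<open>\<alpha>\<close> onto the complex that defines Tor; cycles and
  boundaries correspond.\<close>

lemma Tor_iso_homology:
  assumes "left_module A N"
  shows "module_iso R (homology R (gens A N) (base_change \<alpha> (gen_boundary A)) k) (Tor R A k M N)"
proof -
  interpret N: left_module A N by fact
  define S where "S = gens A N"
  let ?D = "base_change \<alpha> (gen_boundary A)"
  let ?t = "\<lambda>k. to_tensor (S k)"
  have d: "s \<in> S (Suc k) \<Longrightarrow> gen_boundary A s \<in> Free A (S k)" for s k
    unfolding S_def by (rule N.gen_boundary_in_free)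
  have cx: "free_complex A S (gen_boundary A)"
    unfolding S_def by (rule free_resolution.axioms(2)[OF N.std_free_resolution])
  interpret C: free_complex_comm R S ?D
    by (intro free_complex_comm.intro R.cring_axioms free_complex_base_change[OF cx])
  have diff: "Tor_diff R A M N k (?t (Suc k) u) = ?t k (lin R ?D u)"
    if "u \<in> Free R (S (Suc k))" for k u
    unfolding Tor_diff_def std_res_def boundary_eq_lin S_def[symmetric] by (rule tensor_map_to_tensor[OF d that])
  have chain: "Tor_chain R A M N k = tensor_product (S k)" for k
    by (simp add: Tor_chain_def std_res_def S_def)
  have cyc: "?t k ` cycles R S ?D k = Tor_cycles R A M N k"
  proof (cases k)
    case 0
    then show ?thesis
      by (simp add: cycles_def Tor_cycles_def chain to_tensor_image)
  next
    case (Suc j)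
    have "Tor_diff R A M N j (?t (Suc j) u) = \<zero>\<^bsub>Tor_chain R A M N j\<^esub> \<longleftrightarrow> lin R ?D u = (\<lambda>h. \<zero>)"
      if "u \<in> Free R (S (Suc j))" for u
      unfolding diff[OF that] chain to_tensor_zero[symmetric]
      by (auto dest: to_tensor_inj[OF C.lin_d_closed[OF that] R.free_zero])
    then show ?thesis
      unfolding Suc Tor_cycles_def nat.case cycles_def chain[of "Suc j"] to_tensor_image[symmetric]
      by auto
  qed
  have im: "?t k ` lin R ?D ` Free R (S (Suc k))
      = Tor_diff R A M N k ` carrier (Tor_chain R A M N (Suc k))"
    unfolding chain to_tensor_image[symmetric] image_image
    by (rule image_cong[OF refl], rule diff[symmetric])
  let ?Z = "cycle_module R S ?D k"
  let ?Z' = "(Tor_chain R A M N k)\<lparr>carrier := Tor_cycles R A M N k\<rparr>"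
  have Zc: "u \<in> Free R (S k)" if "u \<in> carrier ?Z" for u
    using that by (simp add: cycles_def)
  have add: "?t k (u \<oplus>\<^bsub>?Z\<^esub> v) = ?t k u \<oplus>\<^bsub>?Z'\<^esub> ?t k v" if "u \<in> carrier ?Z" "v \<in> carrier ?Z" for u v
    using to_tensor_add[OF Zc[OF that(1)] Zc[OF that(2)]] by (simp add: free_module_simps chain)
  have smult: "?t k (r \<odot>\<^bsub>?Z\<^esub> u) = r \<odot>\<^bsub>?Z'\<^esub> ?t k u" if "r \<in> carrier R" "u \<in> carrier ?Z" for r u
    using to_tensor_smult[OF Zc[OF that(2)] that(1)] by (simp add: free_module_simps chain)
  have Z': "module_with_submodule R ?Z' (Tor_diff R A M N k ` carrier (Tor_chain R A M N (Suc k)))"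
    by (rule module_with_submodule_image[where f = "?t k", OF C.homology_submodule _ _ im])
      (use add smult in \<open>auto simp: cyc free_module_simps chain to_tensor_zero\<close>)
  interpret Z': module_with_submodule R ?Z' "Tor_diff R A M N k ` carrier (Tor_chain R A M N (Suc k))"
    by (rule Z')
  show ?thesis
    unfolding homology_def Tor_def S_def[symmetric]
  proof (rule quotient_iso[where f = "?t k", OF C.homology_submodule Z' _ add smult])
    show "?t k u \<in> carrier ?Z'" if "u \<in> carrier ?Z" for u
      using that cyc by auto
    show "?t k u \<in> Tor_diff R A M N k ` carrier (Tor_chain R A M N (Suc k)) \<longleftrightarrow>
        u \<in> lin R ?D ` Free R (S (Suc k))" if "u \<in> carrier ?Z" for u
      unfolding im[symmetric] using to_tensor_inj[OF Zc[OF that] C.lin_d_closed] by blast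
    show "\<exists>u\<in>carrier ?Z. v \<ominus>\<^bsub>?Z'\<^esub> ?t k u \<in> Tor_diff R A M N k ` carrier (Tor_chain R A M N (Suc k))"
      if v: "v \<in> carrier ?Z'" for v
    proof -
      obtain u where u: "u \<in> carrier ?Z" "v = ?t k u"
        using v cyc by auto
      have "v \<ominus>\<^bsub>?Z'\<^esub> ?t k u = \<zero>\<^bsub>?Z'\<^esub>"
        unfolding u(2)[symmetric] Z'.M.minus_eq by (rule Z'.M.r_neg[OF v])
      moreover have "\<zero>\<^bsub>?Z'\<^esub> \<in> Tor_diff R A M N k ` carrier (Tor_chain R A M N (Suc k))"
        using subgroup.one_closed[OF submodule.axioms(1)[OF Z'.submodule]] by simp
      ultimately show ?thesis
        using u(1) by metis
    qed
  qed
qed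

end


section \<open>Connectivity in concatenated graphs\<close>

text \<open>\<open>linked\<close> for vertices of any type, so that it also applies to the grid on
  which several diagrams are concatenated.\<close>

definition joined :: "'v set set \<Rightarrow> ('v \<times> 'v) set" where
  "joined E = {(u, v). {u, v} \<in> E}\<^sup>*"

lemma linked_eq_joined: "linked = joined"
  by (simp add: fun_eq_iff linked_def joined_def)

lemma joined_refl [simp]: "(u, u) \<in> joined E"
  by (simp add: joined_def)

lemma joined_edge: "{u, v} \<in> E \<Longrightarrow> (u, v) \<in> joined E"
  by (auto simp: joined_def)

lemma joined_sym: "(u, v) \<in> joined E \<Longrightarrow> (v, u) \<in> joined E"
  unfolding joined_def by (rule symD[OF sym_rtrancl]) (auto simp: sym_def insert_commute)

lemma joined_trans: "\<lbrakk>(u, v) \<in> joined E; (v, w) \<in> joined E\<rbrakk> \<Longrightarrow> (u, w) \<in> joined E"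
  unfolding joined_def by (rule rtrancl_trans)

lemma joined_mono: "\<lbrakk>(u, v) \<in> joined E; E \<subseteq> E'\<rbrakk> \<Longrightarrow> (u, v) \<in> joined E'"
  unfolding joined_def by (erule rtrancl_mono[THEN subsetD, rotated]) auto

lemma joined_induct [consumes 1, case_names refl step]:
  assumes "(u, v) \<in> joined E" "P u"
    and "\<And>v w. \<lbrakk>(u, v) \<in> joined E; {v, w} \<in> E; P v\<rbrakk> \<Longrightarrow> P w"
  shows "P v"
  using assms(1) unfolding joined_def
  by (induction rule: rtrancl_induct) (use assms(2,3) in \<open>auto simp: joined_def\<close>)

lemma joined_closed:
  assumes "(u, v) \<in> joined E" "u \<in> C" "\<And>a b. \<lbrakk>{a, b} \<in> E; a \<in> C\<rbrakk> \<Longrightarrow> b \<in> C"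
  shows "v \<in> C"
  using assms by (induction rule: joined_induct) auto

lemma joined_in_Union:
  assumes "(u, v) \<in> joined E" "u \<noteq> v"
  shows "u \<in> \<Union>E" "v \<in> \<Union>E"
proof -
  have *: "v = u \<or> v \<in> \<Union>E" if "(u, v) \<in> joined E" for u v
    using that by (induction rule: joined_induct) auto
  show "u \<in> \<Union>E" "v \<in> \<Union>E"
    using *[OF assms(1)] *[OF joined_sym[OF assms(1)]] assms(2) by auto
qed

lemma joined_class: "v \<in> joined E `` {u} \<Longrightarrow> joined E `` {v} = joined E `` {u}"
  by (auto intro: joined_trans joined_sym)

lemma joined_image_iff:
  assumes "inj f"
  shows "(f u, f v) \<in> joined ((`) f ` E) \<longleftrightarrow> (u, v) \<in> joined E"
proof
  assume "(f u, f v) \<in> joined ((`) f ` E)"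
  then have "\<exists>w. f v = f w \<and> (u, w) \<in> joined E"
  proof (induction rule: joined_induct)
    case (step y z)
    then obtain w e where w: "y = f w" "(u, w) \<in> joined E" and e: "e \<in> E" "{f w, z} = f ` e"
      by auto
    then obtain t where t: "z = f t"
      by blast
    then have "f ` {w, t} = f ` e"
      using e by simp
    then have "{w, t} = e"
      using assms by (simp only: inj_image_eq_iff)
    then show ?case
      using w t e joined_trans joined_edge by metis
  qed auto
  then show "(u, v) \<in> joined E"
    using assms by (auto dest: injD)
next
  assume "(u, v) \<in> joined E"
  then show "(f u, f v) \<in> joined ((`) f ` E)"
  proof (induction rule: joined_induct)
    case (step v w)
    have "{f v, f w} \<in> (`) f ` E"
      using step(2) by (metis image_empty image_eqI image_insert)
    then show ?case
      using step joined_trans joined_edge by metis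
  qed simp
qed

lemma joined_image_class:
  assumes "inj f"
  shows "joined ((`) f ` E) `` {f v} = f ` (joined E `` {v})"
proof -
  have "\<exists>w. z = f w" if "(f v, z) \<in> joined ((`) f ` E)" for z
    using that by (induction rule: joined_induct) auto
  then show ?thesis
    using joined_image_iff[OF assms] by fastforce
qed

text \<open>\<open>loops\<close> for an arbitrary graph \<open>E\<close> with a set \<open>I\<close>
  of inner nodes in place of the middle nodes.\<close>

definition components_within :: "'v set set \<Rightarrow> 'v set \<Rightarrow> 'v set set" where
  "components_within E I = {C. (\<exists>v\<in>\<Union>E. C = joined E `` {v}) \<and> C \<subseteq> I}"

lemma components_within_image:
  assumes "inj f"
  shows "components_within ((`) f ` E) (f ` I) = (`) f ` components_within E I"
  unfolding components_within_def
  by (auto simp: joined_image_class[OF assms] inj_image_subset_iff[OF assms] intro!: imageI)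

lemma card_components_within_image:
  assumes "inj f"
  shows "card (components_within ((`) f ` E) (f ` I)) = card (components_within E I)"
  unfolding components_within_image[OF assms]
  by (rule card_image) (use assms in \<open>auto simp: inj_on_def inj_image_eq_iff\<close>)

lemma finite_components_within:
  assumes "finite (\<Union>E)"
  shows "finite (components_within E I)"
  by (rule finite_subset[of _ "(\<lambda>v. joined E `` {v}) ` \<Union>E"]) (use assms in \<open>auto simp: components_within_def\<close>)

text \<open>Elimination of the inner nodes \<open>I\<close>. For two concatenated diagrams with the
  glued column as \<open>I\<close> this is the composite diagram, see
  \<open>contract_placed\<close>.\<close>

definition contract_edges :: "'v set set \<Rightarrow> 'v set \<Rightarrow> 'v set set" where
  "contract_edges E I = {{u, v} | u v. u \<noteq> v \<and> u \<notin> I \<and> v \<notin> I \<and> (u, v) \<in> joined E}"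

lemma Union_contract_edges: "\<Union>(contract_edges E I) \<subseteq> \<Union>E - I"
  using joined_in_Union by (fastforce simp: contract_edges_def)

text \<open>A path between nodes outside \<open>I\<close> splits into edges of \<open>E'\<close>,
  which avoid \<open>I\<close>, and stretches inside \<open>E\<close> whose ends lie outside
  \<open>I\<close>; each such stretch is an edge of the contracted graph or trivial.\<close>

lemma joined_contract:
  assumes I: "I \<inter> \<Union>E' = {}" and uv: "u \<notin> I" "v \<notin> I"
  shows "(u, v) \<in> joined (contract_edges E I \<union> E') \<longleftrightarrow> (u, v) \<in> joined (E \<union> E')"
proof
  assume "(u, v) \<in> joined (contract_edges E I \<union> E')"
  then show "(u, v) \<in> joined (E \<union> E')"
  proof (induction rule: joined_induct)
    case (step v w)
    have "(v, w) \<in> joined (E \<union> E')"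
    proof (cases "{v, w} \<in> E'")
      case False
      then obtain a b where "{v, w} = {a, b}" "(a, b) \<in> joined E"
        using step(2) by (auto simp: contract_edges_def)
      then have "(v, w) \<in> joined E"
        using joined_sym by (metis doubleton_eq_iff)
      then show ?thesis
        by (rule joined_mono) auto
    qed (auto intro: joined_edge)
    then show ?case
      using step joined_trans by metis
  qed simp
next
  have close: "(v, w) \<in> joined (contract_edges E I \<union> E')" if "(v, w) \<in> joined E" "v \<notin> I" "w \<notin> I" for v w
    using that by (cases "v = w") (auto simp: contract_edges_def intro!: joined_edge)
  assume "(u, v) \<in> joined (E \<union> E')"
  \<comment> \<open>\<open>w\<close> is where the current stretch inside \<open>E\<close> began; the
    path may meanwhile have entered \<open>I\<close>.\<close>
  then have "\<exists>w. w \<notin> I \<and> (u, w) \<in> joined (contract_edges E I \<union> E') \<and> (w, v) \<in> joined E"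
  proof (induction rule: joined_induct)
    case refl
    then show ?case using uv(1) by (intro exI[of _ u]) simp
  next
    case (step v v')
    then obtain w where w: "w \<notin> I" "(u, w) \<in> joined (contract_edges E I \<union> E')" "(w, v) \<in> joined E"
      by blast
    show ?case
    proof (cases "{v, v'} \<in> E")
      case True
      then show ?thesis
        using w joined_trans joined_edge by metis
    next
      case False
      then have e: "{v, v'} \<in> E'"
        using step(2) by blast
      then have "v \<notin> I" "v' \<notin> I"
        using I by blast+
      moreover have "(u, v') \<in> joined (contract_edges E I \<union> E')"
        using w(2) close[OF w(3,1) \<open>v \<notin> I\<close>] joined_edge[of v v' "contract_edges E I \<union> E'"] e
        by (meson UnI2 joined_trans)
      ultimately show ?thesis
        by (intro exI[of _ v']) simp
    qed
  qed
  then show "(u, v) \<in> joined (contract_edges E I \<union> E')"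
    using close uv(2) joined_trans by metis
qed

text \<open>An edge of \<open>E'\<close> has no end in \<open>I\<close>, so it cannot touch a
  component that lies inside \<open>I\<close>.\<close>

lemma components_within_union:
  assumes "I \<inter> \<Union>E' = {}"
  shows "components_within (E \<union> E') I = components_within E I"
proof -
  have sub: "joined (E \<union> E') `` {v} = joined E `` {v}" if "joined E `` {v} \<subseteq> I" for v
  proof
    show "joined E `` {v} \<subseteq> joined (E \<union> E') `` {v}"
      using joined_mono[of v _ E "E \<union> E'"] by auto
    have "b \<in> joined E `` {v}" if "(v, b) \<in> joined (E \<union> E')" for b
      using that
    proof (rule joined_closed)
      fix a b assume ab: "{a, b} \<in> E \<union> E'" "a \<in> joined E `` {v}"
      then have "{a, b} \<in> E"
        using assms \<open>joined E `` {v} \<subseteq> I\<close> by blast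
      then show "b \<in> joined E `` {v}"
        using ab(2) joined_trans joined_edge by (metis Image_singleton_iff)
    qed simp
    then show "joined (E \<union> E') `` {v} \<subseteq> joined E `` {v}"
      by blast
  qed
  have mono: "joined E `` {v} \<subseteq> joined (E \<union> E') `` {v}" for v
    using joined_mono[of v _ E "E \<union> E'"] by auto
  have self: "v \<in> joined F `` {v}" for v and F :: "'a set set"
    by simp
  show ?thesis
  proof (intro equalityI subsetI)
    fix C assume "C \<in> components_within (E \<union> E') I"
    then obtain v where v: "v \<in> \<Union>(E \<union> E')" "C = joined (E \<union> E') `` {v}" "C \<subseteq> I"
      by (auto simp: components_within_def)
    then have "v \<in> \<Union>E"
      using self[of v "E \<union> E'"] assms by blast
    then show "C \<in> components_within E I"
      using v sub[of v] mono[of v] unfolding components_within_def by blast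
  next
    fix C assume "C \<in> components_within E I"
    then show "C \<in> components_within (E \<union> E') I"
      using sub unfolding components_within_def by blast
  qed
qed

text \<open>A component inside \<open>I \<union> I'\<close> either lies inside \<open>I\<close> and
  disappears in the contraction, or becomes a component inside \<open>I'\<close> when
  \<open>I\<close> is removed from it. The hypothesis \<open>cover\<close> ensures that the
  remaining nodes still occur in the contracted graph, since \<open>components_within\<close> counts
  only components of nodes on edges.\<close>

lemma card_components_contract:
  assumes I: "I \<inter> \<Union>E' = {}" "I \<inter> I' = {}"
    and cover: "\<Union>E - I \<subseteq> \<Union>(contract_edges E I) \<union> \<Union>E'"
    and fin: "finite (\<Union>E)" "finite (\<Union>E')"
  shows "card (components_within (E \<union> E') (I \<union> I'))
    = card (components_within E I) + card (components_within (contract_edges E I \<union> E') I')"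
proof -
  let ?G = "E \<union> E'" and ?H = "contract_edges E I \<union> E'"
  define X where "X = {C \<in> components_within ?G (I \<union> I'). \<not> C \<subseteq> I}"
  have split: "components_within ?G (I \<union> I') = components_within ?G I \<union> X" "components_within ?G I \<inter> X = {}"
    unfolding X_def by (auto simp: components_within_def)
  have minus: "joined ?G `` {v} - I = joined ?H `` {v}" if v: "v \<notin> I" for v
  proof -
    have "w \<notin> I" if "(v, w) \<in> joined ?H" for w
      using joined_in_Union(2)[OF that] Union_contract_edges[of E I] I(1) v by blast
    then show ?thesis
      using joined_contract[OF I(1) v] by auto
  qed
  have X: "\<exists>v. v \<in> \<Union>?G \<and> v \<notin> I \<and> C = joined ?G `` {v}" if C: "C \<in> X" for C
  proof -
    obtain u where u: "u \<in> \<Union>?G" "C = joined ?G `` {u}"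
      using C by (auto simp: X_def components_within_def)
    obtain v where v: "v \<in> C" "v \<notin> I"
      using C by (auto simp: X_def)
    then have "v \<in> \<Union>?G"
      using u joined_in_Union(2)[of u v ?G] by (cases "u = v") auto
    then show ?thesis
      using u v joined_class[of v ?G u] by auto
  qed
  have "bij_betw (\<lambda>C. C - I) X (components_within ?H I')"
  proof (rule bij_betw_imageI)
    show "inj_on (\<lambda>C. C - I) X"
    proof (rule inj_onI)
      fix C D assume CD: "C \<in> X" "D \<in> X" "C - I = D - I"
      obtain v w where v: "v \<notin> I" "C = joined ?G `` {v}" and w: "w \<notin> I" "D = joined ?G `` {w}"
        using X[OF CD(1)] X[OF CD(2)] by blast
      have "v \<in> C - I"
        using v by simp
      then have "v \<in> joined ?G `` {w}"
        unfolding CD(3) w(2) by blast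
      then show "C = D"
        using joined_class[of v ?G w] v(2) w(2) by simp
    qed
    show "(\<lambda>C. C - I) ` X = components_within ?H I'"
    proof (intro equalityI subsetI)
      fix D assume "D \<in> (\<lambda>C. C - I) ` X"
      then obtain C where C: "C \<in> X" "D = C - I"
        by blast
      obtain v where v: "v \<in> \<Union>?G" "v \<notin> I" "C = joined ?G `` {v}"
        using X[OF C(1)] by blast
      have "v \<in> \<Union>?H"
        using v cover by blast
      moreover have "D \<subseteq> I'"
        using C by (auto simp: X_def components_within_def)
      ultimately show "D \<in> components_within ?H I'"
        using minus[OF v(2)] v(3) C(2) by (auto simp: components_within_def)
    next
      fix D assume "D \<in> components_within ?H I'"
      then obtain v where v: "v \<in> \<Union>?H" "D = joined ?H `` {v}" "D \<subseteq> I'"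
        by (auto simp: components_within_def)
      have "v \<notin> I" "v \<in> \<Union>?G"
        using v(1) Union_contract_edges[of E I] I(1) by blast+
      moreover from this have "D = joined ?G `` {v} - I"
        using minus v(2) by simp
      moreover have "v \<in> joined ?G `` {v}"
        by simp
      then have "\<not> joined ?G `` {v} \<subseteq> I"
        using \<open>v \<notin> I\<close> by blast
      then have "joined ?G `` {v} \<in> X"
        using v(3) calculation unfolding X_def components_within_def by blast
      ultimately show "D \<in> (\<lambda>C. C - I) ` X"
        by blast
    qed
  qed
  then have "card X = card (components_within ?H I')"
    by (rule bij_betw_same_card)
  moreover have "finite (components_within ?G (I \<union> I'))"
    by (rule finite_components_within) (use fin in auto)
  ultimately show ?thesis
    using split components_within_union[OF I(1), of E] by (simp add: card_Un_disjoint)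
qed


subsection \<open>Diagrams between levels\<close>

text \<open>
  A diagram is placed between the columns \<open>p\<close> and \<open>q\<close> of a grid of nodes, so that several diagrams can be
  concatenated at once.
\<close>

primrec level :: "nat \<Rightarrow> nat \<Rightarrow> node \<Rightarrow> nat \<times> nat" where
  "level p q (Lft i) = (p, i)"
| "level p q (Rgt i) = (q, i)"

primrec clevel :: "nat \<Rightarrow> nat \<Rightarrow> nat \<Rightarrow> cnode \<Rightarrow> nat \<times> nat" where
  "clevel p q r (Outer u) = level p r u"
| "clevel p q r (Mid i) = (q, i)"

abbreviation placed :: "nat \<Rightarrow> nat \<Rightarrow> diagram \<Rightarrow> (nat \<times> nat) set set" where
  "placed p q d \<equiv> (`) (level p q) ` d"

lemma inj_level: "p \<noteq> q \<Longrightarrow> inj (level p q)"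
proof (rule injI)
  fix u v assume "p \<noteq> q" "level p q u = level p q v"
  then show "u = v" by (cases u; cases v) auto
qed

lemma inj_clevel:
  assumes "distinct [p, q, r]"
  shows "inj (clevel p q r)"
proof (rule injI)
  fix u v assume "clevel p q r u = clevel p q r v"
  then show "u = v"
    using assms injD[OF inj_level, of p r]
    by (cases u; cases v) (auto, (metis fst_conv level.simps node.exhaust)+)
qed

lemma clevel_concat_graph:
  "(`) (clevel p q r) ` concat_graph x y = placed p q x \<union> placed q r y"
proof -
  have "clevel p q r (to_left u) = level p q u" "clevel p q r (to_right u) = level q r u" for u
    by (cases u; simp)+
  then show ?thesis
    by (simp add: concat_graph_def image_Un image_image)
qed

lemma in_diagram_comp_iff:
  assumes "distinct [p, q, r]"
  shows "{u, v} \<in> diagram_comp x y \<longleftrightarrow>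
    u \<noteq> v \<and> (level p r u, level p r v) \<in> joined (placed p q x \<union> placed q r y)"
proof -
  have "(level p r u, level p r v) \<in> joined (placed p q x \<union> placed q r y) \<longleftrightarrow>
      (Outer u, Outer v) \<in> joined (concat_graph x y)" for u v
    unfolding clevel_concat_graph[symmetric]
    using joined_image_iff[OF inj_clevel[OF assms], of "Outer u" "Outer v"] by simp
  then show ?thesis
    unfolding diagram_comp_def linked_eq_joined using joined_sym by (auto simp: doubleton_eq_iff)
qed

lemma card_loops:
  assumes "distinct [p, q, r]"
  shows "card (loops x y) = card (components_within (placed p q x \<union> placed q r y) ({q} \<times> UNIV))"
proof -
  have "{q} \<times> UNIV = clevel p q r ` range Mid"
    by (auto simp: image_image)
  then show ?thesis
    unfolding clevel_concat_graph[symmetric]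
    using card_components_within_image[OF inj_clevel[OF assms]] by (simp add: loops_def components_within_def linked_eq_joined)
qed

lemma contract_placed:
  assumes "distinct [p, q, r]"
  shows "contract_edges (placed p q x \<union> placed q r y) ({q} \<times> UNIV) = placed p r (diagram_comp x y)"
    (is "contract_edges ?E ?I = _")
proof (intro equalityI subsetI)
  fix e assume "e \<in> contract_edges ?E ?I"
  then obtain a b where ab: "e = {a, b}" "a \<noteq> b" "a \<notin> ?I" "b \<notin> ?I" "(a, b) \<in> joined ?E"
    by (auto simp: contract_edges_def)
  have "\<exists>u. c = level p r u" if c: "c \<in> \<Union>?E" "c \<notin> ?I" for c
  proof -
    obtain w where "c = level p q w \<or> c = level q r w"
      using c(1) by blast
    then show ?thesis
      using c(2) by (cases w) (auto intro: exI[of _ w])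
  qed
  then obtain u v where "a = level p r u" "b = level p r v"
    using ab joined_in_Union by metis
  then have "e = level p r ` {u, v}" "{u, v} \<in> diagram_comp x y"
    using ab in_diagram_comp_iff[OF assms] by auto
  then show "e \<in> placed p r (diagram_comp x y)"
    by blast
next
  fix e assume "e \<in> placed p r (diagram_comp x y)"
  then obtain c where c: "c \<in> diagram_comp x y" "e = level p r ` c"
    by blast
  then obtain u v where "c = {u, v}"
    unfolding diagram_comp_def by blast
  then have uv: "{u, v} \<in> diagram_comp x y" "e = {level p r u, level p r v}"
    using c by simp_all
  have "level p r w \<notin> ?I" for w
    using assms by (cases w) auto
  moreover have "level p r u \<noteq> level p r v"
    using injD[OF inj_level, of p r u v] assms uv(1) in_diagram_comp_iff[OF assms, of u v] by auto
  moreover have "(level p r u, level p r v) \<in> joined ?E"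
    using uv(1) in_diagram_comp_iff[OF assms] by simp
  ultimately show "e \<in> contract_edges ?E ?I"
    unfolding contract_edges_def uv(2)
    by (intro CollectI exI[of _ "level p r u"] exI[of _ "level p r v"] conjI) simp_all
qed

lemma placed_disjoint:
  assumes "r \<notin> {p, q}"
  shows "{r} \<times> UNIV \<inter> \<Union>(placed p q d) = {}"
proof -
  have "fst (level p q u) \<noteq> r" for u
    using assms by (cases u) auto
  then show ?thesis
    by (auto simp: disjoint_iff) (metis fst_conv)
qed

lemma diagram_comp_eqI:
  assumes "\<And>u v. {u, v} \<in> diagram_comp x y \<longleftrightarrow> {u, v} \<in> diagram_comp x' y'"
  shows "diagram_comp x y = diagram_comp x' y'"
proof -
  have "\<exists>u v. e = {u, v}" if "e \<in> diagram_comp x y" for e x y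
    using that by (auto simp: diagram_comp_def)
  then show ?thesis
    using assms by (metis subsetI subset_antisym)
qed

text \<open>Both sides arise from the concatenation of all three diagrams on columns 0 to 3 by
  eliminating columns 1 and 2, in the two possible orders.\<close>

lemma diagram_comp_assoc: "diagram_comp (diagram_comp x y) z = diagram_comp x (diagram_comp y z)"
proof (rule diagram_comp_eqI)
  fix u v
  let ?G = "placed 0 1 x \<union> placed 1 2 y \<union> placed 2 3 z"
  have out: "level 0 3 w \<notin> {1} \<times> UNIV" "level 0 3 w \<notin> {2} \<times> UNIV" for w
    by (cases w; simp)+
  have "{1} \<times> UNIV \<inter> \<Union>(placed 2 3 z) = {}" "{2} \<times> UNIV \<inter> \<Union>(placed 0 1 x) = {}"
    by (rule placed_disjoint, simp)+
  from joined_contract[OF this(1) out(1) out(1), of u v "placed 0 1 x \<union> placed 1 2 y"]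
    joined_contract[OF this(2) out(2) out(2), of u v "placed 1 2 y \<union> placed 2 3 z"]
  have "(level 0 3 u, level 0 3 v) \<in> joined (placed 0 2 (diagram_comp x y) \<union> placed 2 3 z)
      \<longleftrightarrow> (level 0 3 u, level 0 3 v) \<in> joined ?G"
    and "(level 0 3 u, level 0 3 v) \<in> joined (placed 0 1 x \<union> placed 1 3 (diagram_comp y z))
      \<longleftrightarrow> (level 0 3 u, level 0 3 v) \<in> joined ?G"
    by (simp_all add: contract_placed Un_ac)
  then show "{u, v} \<in> diagram_comp (diagram_comp x y) z \<longleftrightarrow> {u, v} \<in> diagram_comp x (diagram_comp y z)"
    using in_diagram_comp_iff[of 0 2 3 u v "diagram_comp x y" z]
      in_diagram_comp_iff[of 0 1 3 u v x "diagram_comp y z"] by simp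
qed

text \<open>This provides the hypothesis \<open>cover\<close> of
  \<open>card_components_contract\<close>: every node outside the glued column still occurs in the
  composite.\<close>

lemma placed_cover:
  assumes "\<Union>x = nodes n" "\<Union>y = nodes n" "\<Union>(diagram_comp x y) = nodes n"
  shows "\<Union>(placed p q x \<union> placed q r y) - {q} \<times> UNIV \<subseteq> \<Union>(placed p r (diagram_comp x y))"
proof -
  have U: "\<Union>(placed a b d) = level a b ` nodes n" if "\<Union>d = nodes n" for a b d
    using that by (auto simp: image_UN[symmetric])
  show ?thesis
    unfolding Union_Un_distrib U[OF assms(1)] U[OF assms(2)] U[OF assms(3)]
    by (auto simp: nodes_def image_Un image_image)
qed

text \<open>Both sides count the components of the triple concatenation inside columns 1 and 2,
  eliminating column 1 first on the left and column 2 first on the right.\<close>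

lemma card_loops_assoc:
  assumes "\<Union>x = nodes n" "\<Union>y = nodes n" "\<Union>z = nodes n"
    "\<Union>(diagram_comp x y) = nodes n" "\<Union>(diagram_comp y z) = nodes n"
  shows "card (loops x y) + card (loops (diagram_comp x y) z)
    = card (loops y z) + card (loops x (diagram_comp y z))"
proof -
  let ?G = "placed 0 1 x \<union> placed 1 2 y \<union> placed 2 3 z"
  have fin: "finite (\<Union>(placed a b d))" if "\<Union>d = nodes n" for a b d
  proof -
    have "\<Union>(placed a b d) = level a b ` \<Union>d" by auto
    then show ?thesis using that by (simp add: nodes_def)
  qed
  note f = fin[OF assms(1)] fin[OF assms(2)] fin[OF assms(3)]
  have g: "finite (\<Union>(placed 0 1 x \<union> placed 1 2 y))" "finite (\<Union>(placed 1 2 y \<union> placed 2 3 z))"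
    unfolding Union_Un_distrib finite_Un by (intro conjI f)+
  have c: "contract_edges (placed 0 1 x \<union> placed 1 2 y) ({1} \<times> UNIV) = placed 0 2 (diagram_comp x y)"
    "contract_edges (placed 1 2 y \<union> placed 2 3 z) ({2} \<times> UNIV) = placed 1 3 (diagram_comp y z)"
    by (simp_all add: contract_placed)
  have "card (components_within (placed 0 1 x \<union> placed 1 2 y \<union> placed 2 3 z) ({1} \<times> UNIV \<union> {2} \<times> UNIV))
      = card (components_within (placed 0 1 x \<union> placed 1 2 y) ({1} \<times> UNIV))
        + card (components_within (contract_edges (placed 0 1 x \<union> placed 1 2 y) ({1} \<times> UNIV) \<union> placed 2 3 z)
            ({2} \<times> UNIV))"
  proof (rule card_components_contract[OF placed_disjoint])
    show "\<Union>(placed 0 1 x \<union> placed 1 2 y) - {1} \<times> UNIV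
        \<subseteq> \<Union>(contract_edges (placed 0 1 x \<union> placed 1 2 y) ({1} \<times> UNIV)) \<union> \<Union>(placed 2 3 z)"
      unfolding c by (rule le_supI1[OF placed_cover[OF assms(1,2,4)]])
  qed (simp, force, rule g(1), rule f(3))
  moreover have "card (components_within (placed 1 2 y \<union> placed 2 3 z \<union> placed 0 1 x) ({2} \<times> UNIV \<union> {1} \<times> UNIV))
      = card (components_within (placed 1 2 y \<union> placed 2 3 z) ({2} \<times> UNIV))
        + card (components_within (contract_edges (placed 1 2 y \<union> placed 2 3 z) ({2} \<times> UNIV) \<union> placed 0 1 x)
            ({1} \<times> UNIV))"
  proof (rule card_components_contract[OF placed_disjoint])
    show "\<Union>(placed 1 2 y \<union> placed 2 3 z) - {2} \<times> UNIV
        \<subseteq> \<Union>(contract_edges (placed 1 2 y \<union> placed 2 3 z) ({2} \<times> UNIV)) \<union> \<Union>(placed 0 1 x)"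
      unfolding c by (rule le_supI1[OF placed_cover[OF assms(2,3,5)]])
  qed (simp, force, rule g(2), rule f(1))
  moreover have "placed 1 2 y \<union> placed 2 3 z \<union> placed 0 1 x = placed 0 1 x \<union> placed 1 2 y \<union> placed 2 3 z"
    "{2 :: nat} \<times> (UNIV :: nat set) \<union> {1} \<times> UNIV = {1} \<times> UNIV \<union> {2} \<times> UNIV"
    "placed 1 3 (diagram_comp y z) \<union> placed 0 1 x = placed 0 1 x \<union> placed 1 3 (diagram_comp y z)"
    by blast+
  moreover have "card (loops x y) = card (components_within (placed 0 1 x \<union> placed 1 2 y) ({1} \<times> UNIV))"
    "card (loops y z) = card (components_within (placed 1 2 y \<union> placed 2 3 z) ({2} \<times> UNIV))"
    "card (loops (diagram_comp x y) z)
      = card (components_within (placed 0 2 (diagram_comp x y) \<union> placed 2 3 z) ({2} \<times> UNIV))"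
    "card (loops x (diagram_comp y z))
      = card (components_within (placed 0 1 x \<union> placed 1 3 (diagram_comp y z)) ({1} \<times> UNIV))"
    by (rule card_loops, simp)+
  ultimately show ?thesis
    unfolding c by simp
qed


section \<open>Brauer diagrams\<close>

lemma finite_nodes: "finite (nodes n)"
  by (simp add: nodes_def)

lemma brauerD:
  assumes "d \<in> brauer_diagrams n"
  shows "e \<in> d \<Longrightarrow> \<exists>u\<in>nodes n. \<exists>v\<in>nodes n. u \<noteq> v \<and> e = {u, v}"
    and "u \<in> nodes n \<Longrightarrow> \<exists>!v. {u, v} \<in> d"
  using assms by (simp_all add: brauer_diagrams_def)

lemma brauer_edge:
  assumes "d \<in> brauer_diagrams n" "{u, v} \<in> d"
  shows "u \<in> nodes n" "v \<in> nodes n" "u \<noteq> v"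
proof -
  obtain a b where "a \<in> nodes n" "b \<in> nodes n" "a \<noteq> b" "{u, v} = {a, b}"
    using brauerD(1)[OF assms] by auto
  then show "u \<in> nodes n" "v \<in> nodes n" "u \<noteq> v"
    by (auto simp: doubleton_eq_iff)
qed

lemma brauer_edgeE:
  assumes "d \<in> brauer_diagrams n" "e \<in> d"
  obtains u v where "e = {u, v}" "u \<in> nodes n" "v \<in> nodes n" "u \<noteq> v"
  using brauerD(1)[OF assms] by auto

lemma brauer_partner: "\<lbrakk>d \<in> brauer_diagrams n; u \<in> nodes n\<rbrakk> \<Longrightarrow> \<exists>v. {u, v} \<in> d"
  using brauerD(2) by blast

lemma brauer_unique: "\<lbrakk>d \<in> brauer_diagrams n; {u, v} \<in> d; {u, w} \<in> d\<rbrakk> \<Longrightarrow> v = w"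
  using brauerD(2)[of d n u] brauer_edge(1)[of d n u v] by blast

lemma Union_brauer:
  assumes "d \<in> brauer_diagrams n"
  shows "\<Union>d = nodes n"
proof
  show "\<Union>d \<subseteq> nodes n"
    using brauer_edgeE[OF assms] by blast
  show "nodes n \<subseteq> \<Union>d"
    using brauer_partner[OF assms] by blast
qed

lemma brauer_diagrams_subset: "brauer_diagrams n \<subseteq> Pow (Pow (nodes n))"
  using Union_brauer by blast

lemma finite_brauer_diagrams: "finite (brauer_diagrams n)"
  by (rule finite_subset[OF brauer_diagrams_subset]) (simp add: finite_nodes)

text \<open>Every node already has its partner in \<open>x\<close>, so \<open>y\<close> has no room
  for a further edge. Identities between diagrams thus reduce to one inclusion.\<close>

lemma brauer_subset_eq:
  assumes "x \<in> brauer_diagrams n" "y \<in> brauer_diagrams n" "x \<subseteq> y"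
  shows "x = y"
proof
  show "y \<subseteq> x"
  proof
    fix e assume "e \<in> y"
    then obtain u v where uv: "e = {u, v}" "u \<in> nodes n"
      using brauer_edgeE[OF assms(2)] by metis
    then obtain w where "{u, w} \<in> x"
      using brauer_partner[OF assms(1)] by blast
    moreover from this have "w = v"
      using brauer_unique[OF assms(2)] assms(3) uv(1) \<open>e \<in> y\<close> by blast
    ultimately show "e \<in> x"
      using uv(1) by simp
  qed
qed (rule assms)

text \<open>A perfect matching is the same as an involution without fixed points.\<close>

lemma involution_diagram:
  assumes "\<And>u. u \<in> nodes n \<Longrightarrow> f u \<in> nodes n" "\<And>u. u \<in> nodes n \<Longrightarrow> f (f u) = u"
    "\<And>u. u \<in> nodes n \<Longrightarrow> f u \<noteq> u"
  shows "{{u, f u} | u. u \<in> nodes n} \<in> brauer_diagrams n"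
proof -
  have "\<exists>!v. {u, v} \<in> {{u, f u} | u. u \<in> nodes n}" if u: "u \<in> nodes n" for u
  proof (rule ex1I[of _ "f u"])
    show "v = f u" if "{u, v} \<in> {{u, f u} | u. u \<in> nodes n}" for v
      using that assms(2) by (auto simp: doubleton_eq_iff)
  qed (use u in blast)
  moreover have "\<exists>u\<in>nodes n. \<exists>v\<in>nodes n. u \<noteq> v \<and> e = {u, v}" if e: "e \<in> {{u, f u} | u. u \<in> nodes n}" for e
  proof -
    obtain u where "u \<in> nodes n" "e = {u, f u}" using e by blast
    then show ?thesis
      using assms(1)[of u] assms(3)[of u] by (intro bexI[of _ u] bexI[of _ "f u"]) auto
  qed
  ultimately show ?thesis
    by (simp add: brauer_diagrams_def)
qed


subsection \<open>Composition\<close>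

text \<open>
  With \<open>g = \<tau> \<circ> \<sigma>\<close>, the orbit of \<open>u\<close> is a \<open>g\<close>-cycle of some length \<open>m\<close>, on which \<open>\<tau>\<close> acts as \<open>i \<mapsto> m - i\<close> and
  \<open>\<sigma>\<close> as \<open>i \<mapsto> m - 1 - i\<close>. Since \<open>\<sigma>\<close> has no fixed points, \<open>m\<close> is even and \<open>\<tau>\<close> fixes exactly \<open>0\<close> and \<open>m / 2\<close>.
\<close>

lemma dihedral_orbit_fixed_points:
  fixes \<sigma> \<tau> :: "'a \<Rightarrow> 'a"
  assumes \<sigma>\<sigma>: "\<And>x. \<sigma> (\<sigma> x) = x" and \<tau>\<tau>: "\<And>x. \<tau> (\<tau> x) = x"
    and fin: "finite D" "\<And>x. x \<in> D \<Longrightarrow> \<sigma> x \<in> D" "\<And>x. x \<in> D \<Longrightarrow> \<tau> x \<in> D"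
    and free: "\<And>x. x \<in> D \<Longrightarrow> \<sigma> x \<noteq> x"
    and u: "u \<in> D" "\<tau> u = u"
  shows "\<exists>!v. (u, v) \<in> {(x, y). y = \<sigma> x \<or> y = \<tau> x}\<^sup>* \<and> v \<noteq> u \<and> \<tau> v = v"
proof -
  let ?r = "{(x, y). y = \<sigma> x \<or> y = \<tau> x}"
  define g where "g = \<tau> \<circ> \<sigma>"
  have inj: "inj (g ^^ i)" for i
  proof -
    have "inj g"
      unfolding g_def
      by (intro inj_compose inj_on_inverseI[where g = \<sigma>] inj_on_inverseI[where g = \<tau>] \<sigma>\<sigma> \<tau>\<tau>)
    then show ?thesis by (rule inj_fn)
  qed
  have gD: "(g ^^ i) u \<in> D" for i
    by (induction i) (auto simp: g_def u fin)
  have "\<exists>m>0. (g ^^ m) u = u"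
  proof (rule funpow_inj_finite)
    show "inj g" using inj[of 1] by simp
    have "{y. \<exists>i. y = (g ^^ i) u} \<subseteq> D" using gD by blast
    then show "finite {y. \<exists>i. y = (g ^^ i) u}" using fin(1) by (rule finite_subset)
  qed blast
  then have ex: "\<exists>m. m > 0 \<and> (g ^^ m) u = u" by simp
  define m where "m = (LEAST m. m > 0 \<and> (g ^^ m) u = u)"
  have m: "m > 0" "(g ^^ m) u = u"
    using LeastI_ex[OF ex] by (simp_all add: m_def)
  have least: "m \<le> j" if "j > 0" "(g ^^ j) u = u" for j
    unfolding m_def using that by (intro Least_le) simp
  have \<tau>_pow: "\<tau> ((g ^^ i) u) = (g ^^ (m - i)) u" if "i \<le> m" for i
  proof -
    \<comment> \<open>The reason is \<open>g \<circ> \<tau> \<circ> g = \<tau>\<close>: conjugation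
      by \<open>\<tau>\<close> inverts \<open>g\<close>.\<close>
    have "(g ^^ i) (\<tau> ((g ^^ i) u)) = u"
    proof (induction i)
      case (Suc i)
      have "(g ^^ Suc i) (\<tau> ((g ^^ Suc i) u)) = (g ^^ i) (g (\<tau> (g ((g ^^ i) u))))"
        by (simp add: funpow_swap1)
      also have "g (\<tau> (g ((g ^^ i) u))) = \<tau> ((g ^^ i) u)"
        by (simp add: g_def \<sigma>\<sigma> \<tau>\<tau>)
      finally show ?case using Suc by simp
    qed (simp add: u)
    also have "u = (g ^^ i) ((g ^^ (m - i)) u)"
      using m(2) that by (metis comp_apply funpow_add le_add_diff_inverse)
    finally show ?thesis
      using inj by (auto dest: injD)
  qed
  have \<sigma>_pow: "\<sigma> ((g ^^ i) u) = (g ^^ (m - Suc i)) u" if "i < m" for i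
  proof -
    have "\<sigma> ((g ^^ i) u) = \<tau> ((g ^^ Suc i) u)"
      by (simp add: g_def \<tau>\<tau>)
    then show ?thesis
      using \<tau>_pow[of "Suc i"] that by simp
  qed
  have orbit: "\<exists>i<m. v = (g ^^ i) u" if "(u, v) \<in> ?r\<^sup>*" for v
    using that
  proof (induction rule: rtrancl_induct)
    case base
    then show ?case using m(1) by (intro exI[of _ 0]) simp
  next
    case (step v w)
    then obtain i where i: "i < m" "v = (g ^^ i) u" by blast
    show ?case
    proof (cases "w = \<sigma> v")
      case True
      then show ?thesis using \<sigma>_pow[OF i(1)] i m(1) by (intro exI[of _ "m - Suc i"]) simp
    next
      case False
      then have w: "w = (g ^^ (m - i)) u"
        using step(2) \<tau>_pow[of i] i by simp
      show ?thesis
      proof (cases "i = 0")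
        case True
        then show ?thesis using w m by (intro exI[of _ 0]) simp
      next
        case False
        then show ?thesis using w i by (intro exI[of _ "m - i"]) simp
      qed
    qed
  qed
  have reach: "(u, (g ^^ i) u) \<in> ?r\<^sup>*" for i
  proof (induction i)
    case (Suc i)
    have "((g ^^ i) u, \<sigma> ((g ^^ i) u)) \<in> ?r" and *: "(\<sigma> ((g ^^ i) u), (g ^^ Suc i) u) \<in> ?r"
      by (simp_all add: g_def)
    then have "(u, \<sigma> ((g ^^ i) u)) \<in> ?r\<^sup>*"
      by (intro rtrancl_into_rtrancl[OF Suc])
    then show ?case
      using * by (rule rtrancl_into_rtrancl)
  qed simp
  obtain i where i: "m = 2 * i"
  proof (cases "even m")
    case False
    then obtain i where "m = Suc (2 * i)" by (auto elim: oddE)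
    then have "\<sigma> ((g ^^ i) u) = (g ^^ i) u"
      using \<sigma>_pow[of i] by simp
    then show ?thesis using free[OF gD] by blast
  qed (auto elim: evenE)
  show ?thesis
  proof (rule ex1I[of _ "(g ^^ i) u"])
    show "(u, (g ^^ i) u) \<in> ?r\<^sup>* \<and> (g ^^ i) u \<noteq> u \<and> \<tau> ((g ^^ i) u) = (g ^^ i) u"
      using reach \<tau>_pow[of i] least[of i] m(1) i by auto
    fix v assume v: "(u, v) \<in> ?r\<^sup>* \<and> v \<noteq> u \<and> \<tau> v = v"
    then obtain j where j: "j < m" "v = (g ^^ j) u"
      using orbit by blast
    then have "j \<noteq> 0" using v by (cases j) auto
    have eq: "(g ^^ (m - j)) u = (g ^^ j) u"
      using v j \<tau>_pow[of j] by simp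
    have period: "a = b" if "a \<le> b" "b < m" "(g ^^ a) u = (g ^^ b) u" for a b
    proof (rule ccontr)
      assume "a \<noteq> b"
      have "(g ^^ b) u = (g ^^ a) ((g ^^ (b - a)) u)"
        using that(1) by (metis comp_apply funpow_add le_add_diff_inverse)
      from injD[OF inj trans[OF that(3) this]] have "(g ^^ (b - a)) u = u"
        by (rule sym)
      then show False
        using least[of "b - a"] that \<open>a \<noteq> b\<close> by simp
    qed
    have "m - j = j"
      using period[of "m - j" j] period[of j "m - j"] eq j(1) \<open>j \<noteq> 0\<close> by (cases "m - j \<le> j") auto
    then have "j = i"
      using i j(1) by simp
    then show "v = (g ^^ i) u"
      using j(2) by simp
  qed
qed

text \<open>
  On the disjoint union of the nodes of \<open>x\<close> and of \<open>y\<close>, let \<open>\<sigma>\<close> exchange the ends of each edge and let \<open>\<tau>\<close> exchange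
  the nodes that are glued together. The components of the concatenated graph are the orbits of the group generated by
  \<open>\<sigma>\<close> and \<open>\<tau>\<close>, and the outer nodes are the fixed points of \<open>\<tau>\<close>.
\<close>

lemma diagram_comp_closed:
  assumes x: "x \<in> brauer_diagrams n" and y: "y \<in> brauer_diagrams n"
  shows "diagram_comp x y \<in> brauer_diagrams n"
proof -
  \<comment> \<open>The value \<open>u\<close> outside \<open>nodes n\<close> makes
    \<open>mate d\<close> an involution of the whole type, as
    \<open>dihedral_orbit_fixed_points\<close> requires.\<close>
  define mate where "mate d u = (if u \<in> nodes n then THE v. {u, v} \<in> d else u)" for d u
  have mate: "{u, mate d u} \<in> d" if "d \<in> brauer_diagrams n" "u \<in> nodes n" for d u
    using theI'[OF brauerD(2)[OF that]] that(2) by (simp add: mate_def)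
  have mate_eq: "mate d u = v" if "d \<in> brauer_diagrams n" "{u, v} \<in> d" for d u v
    using brauer_unique[OF that(1,2) mate[OF that(1)]] brauer_edge(1)[OF that] by simp
  have mate_mate: "mate d (mate d u) = u" if "d \<in> brauer_diagrams n" for d u
    using mate_eq[OF that, of "mate d u" u] mate[OF that, of u] by (cases "u \<in> nodes n") (auto simp: insert_commute mate_def)
  \<comment> \<open>The flag is \<open>False\<close> on the nodes of \<open>x\<close> and
    \<open>True\<close> on those of \<open>y\<close>.\<close>
  define \<sigma> where "\<sigma> = (\<lambda>(u, b). (mate (if b then y else x) u, b))"
  define \<tau> where "\<tau> = (\<lambda>(u, b). case u of Lft i \<Rightarrow> if b then (Rgt i, False) else (u, b)
      | Rgt i \<Rightarrow> if b then (u, b) else (Lft i, True))"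
  define cn where "cn = (\<lambda>(u, b). if b then to_right u else to_left u)"
  define start where "start u = (u, case u of Lft i \<Rightarrow> False | Rgt i \<Rightarrow> True)" for u
  let ?D = "nodes n \<times> (UNIV :: bool set)"
  let ?r = "{(a, b). b = \<sigma> a \<or> b = \<tau> a}"
  let ?G = "concat_graph x y"
  have \<sigma>D: "\<sigma> a \<in> ?D" "\<sigma> a \<noteq> a" "{cn a, cn (\<sigma> a)} \<in> ?G" if aD: "a \<in> ?D" for a
  proof -
    obtain u b where a: "a = (u, b)" "u \<in> nodes n" using aD by auto
    have d: "(if b then y else x) \<in> brauer_diagrams n" using x y by simp
    have e: "{u, mate (if b then y else x) u} \<in> (if b then y else x)"
      by (rule mate[OF d a(2)])
    then show "\<sigma> a \<in> ?D" "\<sigma> a \<noteq> a"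
      using brauer_edge[OF d e] by (auto simp: \<sigma>_def a)
    show "{cn a, cn (\<sigma> a)} \<in> ?G"
      using e by (cases b) (auto simp: \<sigma>_def a cn_def concat_graph_def intro!: image_eqI[where x = "{u, _}"])
  qed
  have \<tau>: "\<tau> (\<tau> a) = a" "cn (\<tau> a) = cn a" "a \<in> ?D \<Longrightarrow> \<tau> a \<in> ?D" for a
    by (cases a; cases "fst a"; auto simp: \<tau>_def cn_def nodes_def)+
  have cn_eq: "a = b \<or> a = \<tau> b" if "cn a = cn b" for a b
    using that by (cases a; cases b; cases "fst a"; cases "fst b"; auto simp: \<tau>_def cn_def split: if_splits)
  have start: "cn (start u) = Outer u" "\<tau> (start u) = start u" "u \<in> nodes n \<Longrightarrow> start u \<in> ?D" for u
    by (cases u; auto simp: start_def cn_def \<tau>_def)+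
  have cn_outer: "a = start v" if "cn a = Outer v" for a v
    using cn_eq[of a "start v"] start that by auto
  have fixed: "\<exists>v. a = start v" if "\<tau> a = a" for a
    using that by (cases a; cases "fst a"; auto simp: \<tau>_def start_def split: if_splits)
  have D: "b \<in> ?D" if "(a, b) \<in> ?r\<^sup>*" "a \<in> ?D" for a b
    using that(1)
  proof (induction rule: rtrancl_induct)
    case (step b c)
    then have "c = \<sigma> b \<or> c = \<tau> b" by simp
    then show ?case using \<sigma>D(1)[OF step(3)] \<tau>(3)[OF step(3)] by (elim disjE) simp_all
  qed (rule that(2))
  have to: "(cn a, cn b) \<in> joined ?G" if "(a, b) \<in> ?r\<^sup>*" "a \<in> ?D" for a b
    using that(1)
  proof (induction rule: rtrancl_induct)
    case (step b c)
    have "b \<in> ?D" using D step(1) that(2) by blast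
    then have "(cn b, cn c) \<in> joined ?G"
      using step(2) \<sigma>D(3) \<tau>(2) by (auto intro: joined_edge)
    then show ?case using step(3) joined_trans by metis
  qed simp
  have lift: "\<exists>b. w = cn b \<and> (a, b) \<in> ?r\<^sup>*" if "(cn a, w) \<in> joined ?G" "a \<in> ?D" for a w
    using that(1)
  proof (induction rule: joined_induct)
    case refl
    then show ?case by blast
  next
    case (step v w)
    then obtain b where b: "v = cn b" "(a, b) \<in> ?r\<^sup>*" by blast
    obtain c d where cd: "v = cn c" "w = cn d" "d = \<sigma> c"
    proof -
      have "(\<exists>e\<in>x. {v, w} = to_left ` e) \<or> (\<exists>e\<in>y. {v, w} = to_right ` e)"
        using step(2) by (auto simp: concat_graph_def)
      then show ?thesis
      proof (elim disjE bexE)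
        fix e assume e: "e \<in> x" "{v, w} = to_left ` e"
        then obtain s t where st: "e = {s, t}" using brauer_edgeE[OF x] by metis
        then have "v = to_left s \<and> w = to_left t \<or> v = to_left t \<and> w = to_left s"
          using e(2) by (auto simp: doubleton_eq_iff)
        moreover have "mate x s = t" "mate x t = s"
          using mate_eq[OF x] e(1) st by (auto simp: insert_commute)
        ultimately show ?thesis
        proof (elim disjE conjE)
          assume "v = to_left s" "w = to_left t" "mate x s = t"
          then show ?thesis by (intro that[of "(s, False)" "(t, False)"]) (simp_all add: cn_def \<sigma>_def)
        next
          assume "v = to_left t" "w = to_left s" "mate x t = s"
          then show ?thesis by (intro that[of "(t, False)" "(s, False)"]) (simp_all add: cn_def \<sigma>_def)
        qed
      next
        fix e assume e: "e \<in> y" "{v, w} = to_right ` e"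
        then obtain s t where st: "e = {s, t}" using brauer_edgeE[OF y] by metis
        then have "v = to_right s \<and> w = to_right t \<or> v = to_right t \<and> w = to_right s"
          using e(2) by (auto simp: doubleton_eq_iff)
        moreover have "mate y s = t" "mate y t = s"
          using mate_eq[OF y] e(1) st by (auto simp: insert_commute)
        ultimately show ?thesis
        proof (elim disjE conjE)
          assume "v = to_right s" "w = to_right t" "mate y s = t"
          then show ?thesis by (intro that[of "(s, True)" "(t, True)"]) (simp_all add: cn_def \<sigma>_def)
        next
          assume "v = to_right t" "w = to_right s" "mate y t = s"
          then show ?thesis by (intro that[of "(t, True)" "(s, True)"]) (simp_all add: cn_def \<sigma>_def)
        qed
      qed
    qed
    \<comment> \<open>The edge of the graph may leave from either of the two nodes glued at
      \<open>v\<close>; a step along \<open>\<tau>\<close> passes from one to the other.\<close>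
    have "c = b \<or> c = \<tau> b"
      using cn_eq b(1) cd(1) by simp
    then have "(a, c) \<in> ?r\<^sup>*"
      using b(2) by (auto intro: rtrancl_into_rtrancl)
    then have "(a, d) \<in> ?r\<^sup>*"
      using cd(3) by (auto intro: rtrancl_into_rtrancl)
    then show ?case using cd(2) by blast
  qed
  have iff: "{u, v} \<in> diagram_comp x y \<longleftrightarrow> (start u, start v) \<in> ?r\<^sup>* \<and> start v \<noteq> start u"
    if u: "u \<in> nodes n" for u v
  proof -
    have "{u, v} \<in> diagram_comp x y \<longleftrightarrow> u \<noteq> v \<and> (Outer u, Outer v) \<in> joined ?G"
      unfolding diagram_comp_def linked_eq_joined using joined_sym by (auto simp: doubleton_eq_iff)
    moreover have "(Outer u, Outer v) \<in> joined ?G \<longleftrightarrow> (start u, start v) \<in> ?r\<^sup>*"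
    proof
      assume "(Outer u, Outer v) \<in> joined ?G"
      then obtain b where "Outer v = cn b" "(start u, b) \<in> ?r\<^sup>*"
        using lift[of "start u" "Outer v"] start(1)[of u] start(3)[OF u] by auto
      then show "(start u, start v) \<in> ?r\<^sup>*"
        using cn_outer[of b v] by simp
    next
      assume "(start u, start v) \<in> ?r\<^sup>*"
      then show "(Outer u, Outer v) \<in> joined ?G"
        using to[of "start u" "start v"] start(1) start(3)[OF u] by simp
    qed
    moreover have "start v = start u \<longleftrightarrow> u = v"
      by (auto simp: start_def)
    ultimately show ?thesis by blast
  qed
  have "\<exists>!v. {u, v} \<in> diagram_comp x y" if u: "u \<in> nodes n" for u
  proof -
    have "\<exists>!b. (start u, b) \<in> ?r\<^sup>* \<and> b \<noteq> start u \<and> \<tau> b = b"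
    proof (rule dihedral_orbit_fixed_points[of \<sigma> \<tau> ?D])
      show "\<sigma> (\<sigma> a) = a" for a
        using mate_mate x y by (cases a) (auto simp: \<sigma>_def)
    qed (use \<tau> \<sigma>D start u finite_nodes in auto)
    then obtain b where b: "(start u, b) \<in> ?r\<^sup>*" "b \<noteq> start u" "\<tau> b = b"
      and unique: "\<And>c. \<lbrakk>(start u, c) \<in> ?r\<^sup>*; c \<noteq> start u; \<tau> c = c\<rbrakk> \<Longrightarrow> c = b"
      by blast
    obtain v where v: "b = start v" using fixed[OF b(3)] by blast
    have "{u, v} \<in> diagram_comp x y"
      using iff[OF u] b v by simp
    moreover have "w = v" if "{u, w} \<in> diagram_comp x y" for w
    proof -
      have "start w = b"
        using iff[OF u] that unique start(2) by blast
      then show ?thesis using v by (simp add: start_def)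
    qed
    ultimately show ?thesis by blast
  qed
  moreover have "\<exists>u\<in>nodes n. \<exists>v\<in>nodes n. u \<noteq> v \<and> e = {u, v}" if "e \<in> diagram_comp x y" for e
  proof -
    obtain u v where uv: "e = {u, v}" "u \<noteq> v" "(Outer u, Outer v) \<in> joined ?G"
      using \<open>e \<in> diagram_comp x y\<close> unfolding diagram_comp_def linked_eq_joined by blast
    have "w \<in> nodes n" if "Outer w \<in> \<Union>?G" for w
    proof -
      have "(\<exists>s\<in>\<Union>x. Outer w = to_left s) \<or> (\<exists>s\<in>\<Union>y. Outer w = to_right s)"
        using that by (auto simp: concat_graph_def)
      then show ?thesis
        unfolding Union_brauer[OF x] Union_brauer[OF y]
      proof (elim disjE bexE)
        fix s assume "s \<in> nodes n" "Outer w = to_left s"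
        then show ?thesis by (cases s) auto
      next
        fix s assume "s \<in> nodes n" "Outer w = to_right s"
        then show ?thesis by (cases s) auto
      qed
    qed
    then show ?thesis
      using uv joined_in_Union[OF uv(3)] by blast
  qed
  ultimately show ?thesis
    by (simp add: brauer_diagrams_def)
qed


lemma concat_edges:
  "{u, v} \<in> x \<Longrightarrow> (to_left u, to_left v) \<in> joined (concat_graph x y)"
  "{u, v} \<in> y \<Longrightarrow> (to_right u, to_right v) \<in> joined (concat_graph x y)"
proof -
  assume "{u, v} \<in> x"
  then have "to_left ` {u, v} \<in> concat_graph x y"
    unfolding concat_graph_def by blast
  then show "(to_left u, to_left v) \<in> joined (concat_graph x y)"
    by (intro joined_edge) simp
next
  assume "{u, v} \<in> y"
  then have "to_right ` {u, v} \<in> concat_graph x y"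
    unfolding concat_graph_def by blast
  then show "(to_right u, to_right v) \<in> joined (concat_graph x y)"
    by (intro joined_edge) simp
qed

lemma in_diagram_compI:
  "\<lbrakk>u \<noteq> v; (Outer u, Outer v) \<in> joined (concat_graph x y)\<rbrakk> \<Longrightarrow> {u, v} \<in> diagram_comp x y"
  unfolding diagram_comp_def linked_eq_joined by blast

text \<open>A closed loop stays among the middle nodes, so it is excluded once every middle node is
  connected to an outer one.\<close>

lemma no_loops:
  assumes x: "x \<in> brauer_diagrams n" and y: "y \<in> brauer_diagrams n"
    and "\<And>i. i \<in> {1..n} \<Longrightarrow> \<exists>u. (Mid i, Outer u) \<in> joined (concat_graph x y)"
  shows "loops x y = {}"
proof -
  have False if v: "v \<in> \<Union>(concat_graph x y)" "joined (concat_graph x y) `` {v} \<subseteq> range Mid" for v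
  proof -
    obtain i where i: "v = Mid i"
      using v(2) joined_refl[of v] by blast
    have "(\<exists>s\<in>\<Union>x. Mid i = to_left s) \<or> (\<exists>s\<in>\<Union>y. Mid i = to_right s)"
      using v(1) i by (auto simp: concat_graph_def)
    then have "i \<in> {1..n}"
      unfolding Union_brauer[OF x] Union_brauer[OF y]
    proof (elim disjE bexE)
      fix s assume "s \<in> nodes n" "Mid i = to_left s"
      then show ?thesis by (cases s) (auto simp: nodes_def)
    next
      fix s assume "s \<in> nodes n" "Mid i = to_right s"
      then show ?thesis by (cases s) (auto simp: nodes_def)
    qed
    then obtain u where "(v, Outer u) \<in> joined (concat_graph x y)"
      using assms(3) i by blast
    then show False
      using v(2) by blast
  qed
  then show ?thesis
    unfolding loops_def linked_eq_joined by blast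
qed

subsection \<open>Permutation diagrams\<close>

text \<open>With \<open>i\<close> on the right and \<open>p i\<close> on the left, composing
  diagrams corresponds to \<open>p \<circ> q\<close> in the same order.\<close>

definition perm_diagram :: "nat \<Rightarrow> (nat \<Rightarrow> nat) \<Rightarrow> diagram" where
  "perm_diagram n p = {{Lft (p i), Rgt i} | i. i \<in> {1..n}}"

lemma identity_diagram_eq: "identity_diagram n = perm_diagram n id"
  by (simp add: identity_diagram_def perm_diagram_def)

lemma perm_diagram_brauer:
  assumes p: "p permutes {1..n}"
  shows "perm_diagram n p \<in> brauer_diagrams n"
proof -
  define f where "f u = (case u of Lft i \<Rightarrow> Rgt (inv' p i) | Rgt i \<Rightarrow> Lft (p i))" for u
  note inv = permutes_inv[OF p] permutes_inverses[OF p]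
  have "{{u, f u} | u. u \<in> nodes n} \<in> brauer_diagrams n"
    by (rule involution_diagram)
      (auto simp: f_def nodes_def inv(2,3) permutes_in_image[OF p, simplified]
        permutes_in_image[OF inv(1), simplified] split: node.splits)
  moreover have "{{u, f u} | u. u \<in> nodes n} = perm_diagram n p"
  proof (intro equalityI subsetI)
    fix e assume "e \<in> {{u, f u} | u. u \<in> nodes n}"
    then obtain u where u: "e = {u, f u}" "u \<in> nodes n" by blast
    show "e \<in> perm_diagram n p"
    proof (cases u)
      case (Lft i)
      then have "e = {Lft (p (inv' p i)), Rgt (inv' p i)}" "inv' p i \<in> {1..n}"
        using u permutes_in_image[OF inv(1), of i] by (auto simp: f_def inv nodes_def)
      then show ?thesis unfolding perm_diagram_def by blast
    next
      case (Rgt i)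
      then have "e = {Lft (p i), Rgt i}" "i \<in> {1..n}"
        using u by (auto simp: f_def nodes_def)
      then show ?thesis unfolding perm_diagram_def by blast
    qed
  next
    fix e assume "e \<in> perm_diagram n p"
    then obtain i where "e = {Lft (p i), Rgt i}" "i \<in> {1..n}"
      unfolding perm_diagram_def by blast
    then have "e = {Rgt i, f (Rgt i)}" "Rgt i \<in> nodes n"
      by (auto simp: f_def nodes_def)
    then show "e \<in> {{u, f u} | u. u \<in> nodes n}" by blast
  qed
  ultimately show ?thesis by simp
qed

lemma identity_diagram_brauer: "identity_diagram n \<in> brauer_diagrams n"
  unfolding identity_diagram_eq by (rule perm_diagram_brauer[OF permutes_id])

lemma perm_diagram_edge: "i \<in> {1..n} \<Longrightarrow> {Lft (p i), Rgt i} \<in> perm_diagram n p"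
  unfolding perm_diagram_def by blast

lemma perm_diagram_inj:
  assumes "p permutes {1..n}" "q permutes {1..n}" "perm_diagram n p = perm_diagram n q"
  shows "p = q"
proof
  fix i
  show "p i = q i"
  proof (cases "i \<in> {1..n}")
    case True
    have "{Rgt i, Lft (p i)} \<in> perm_diagram n p" "{Rgt i, Lft (q i)} \<in> perm_diagram n p"
      using perm_diagram_edge[OF True, of p] perm_diagram_edge[OF True, of q] assms(3)
      by (simp_all add: insert_commute)
    then show ?thesis
      using brauer_unique[OF perm_diagram_brauer[OF assms(1)]] by blast
  next
    case False
    then show ?thesis
      using assms(1,2) by (simp add: permutes_def)
  qed
qed

lemma perm_diagram_comp:
  assumes p: "p permutes {1..n}" and q: "q permutes {1..n}"
  shows "diagram_comp (perm_diagram n p) (perm_diagram n q) = perm_diagram n (p \<circ> q)"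
    and "loops (perm_diagram n p) (perm_diagram n q) = {}"
proof -
  note P = perm_diagram_brauer[OF p] and Q = perm_diagram_brauer[OF q]
  let ?G = "concat_graph (perm_diagram n p) (perm_diagram n q)"
  have r: "(Mid (q i), Outer (Rgt i)) \<in> joined ?G" if "i \<in> {1..n}" for i
    using concat_edges(2)[OF perm_diagram_edge[OF that]] by simp
  have l: "(Outer (Lft (p i)), Mid i) \<in> joined ?G" if "i \<in> {1..n}" for i
    using concat_edges(1)[OF perm_diagram_edge[OF that]] by simp
  have "perm_diagram n (p \<circ> q) \<subseteq> diagram_comp (perm_diagram n p) (perm_diagram n q)"
  proof
    fix e assume "e \<in> perm_diagram n (p \<circ> q)"
    then obtain i where i: "e = {Lft (p (q i)), Rgt i}" "i \<in> {1..n}"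
      unfolding perm_diagram_def by auto
    have "q i \<in> {1..n}"
      using permutes_in_image[OF q] i(2) by simp
    then have "(Outer (Lft (p (q i))), Outer (Rgt i)) \<in> joined ?G"
      using l r[OF i(2)] joined_trans by metis
    then show "e \<in> diagram_comp (perm_diagram n p) (perm_diagram n q)"
      unfolding i(1) by (intro in_diagram_compI) auto
  qed
  then show "diagram_comp (perm_diagram n p) (perm_diagram n q) = perm_diagram n (p \<circ> q)"
    by (rule brauer_subset_eq[OF perm_diagram_brauer[OF permutes_compose[OF q p]] diagram_comp_closed[OF P Q],
          symmetric])
  show "loops (perm_diagram n p) (perm_diagram n q) = {}"
    by (rule no_loops[OF P Q]) (rule exI, rule joined_sym, erule l)
qed

lemma identity_comp:
  assumes x: "x \<in> brauer_diagrams n"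
  shows "diagram_comp (identity_diagram n) x = x" "loops (identity_diagram n) x = {}"
    and "diagram_comp x (identity_diagram n) = x" "loops x (identity_diagram n) = {}"
proof -
  note I = identity_diagram_brauer
  have edge: "{Lft i, Rgt i} \<in> identity_diagram n" if "i \<in> {1..n}" for i
    using that unfolding identity_diagram_def by blast
  have l: "(Outer (Lft i), Mid i) \<in> joined (concat_graph (identity_diagram n) x)" if "i \<in> {1..n}" for i
    using concat_edges(1)[OF edge[OF that]] by simp
  have r: "(Outer (Rgt i), Mid i) \<in> joined (concat_graph x (identity_diagram n))" if "i \<in> {1..n}" for i
    using joined_sym[OF concat_edges(2)[OF edge[OF that]]] by simp
  have l': "(Outer u, to_right u) \<in> joined (concat_graph (identity_diagram n) x)" if "u \<in> nodes n" for u
    using that l by (cases u) (auto simp: nodes_def)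
  have r': "(Outer u, to_left u) \<in> joined (concat_graph x (identity_diagram n))" if "u \<in> nodes n" for u
    using that r by (cases u) (auto simp: nodes_def)
  have "x \<subseteq> diagram_comp (identity_diagram n) x" "x \<subseteq> diagram_comp x (identity_diagram n)"
  proof (safe)
    fix e assume e: "e \<in> x"
    then obtain u v where uv: "e = {u, v}" "u \<in> nodes n" "v \<in> nodes n" "u \<noteq> v"
      using brauer_edgeE[OF x] by metis
    have "(Outer u, Outer v) \<in> joined (concat_graph (identity_diagram n) x)"
      using l'[OF uv(2)] joined_sym[OF l'[OF uv(3)]] concat_edges(2)[of u v x "identity_diagram n"] e uv(1)
        joined_trans by metis
    then show "e \<in> diagram_comp (identity_diagram n) x"
      unfolding uv(1) by (rule in_diagram_compI[OF uv(4)])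
    have "(Outer u, Outer v) \<in> joined (concat_graph x (identity_diagram n))"
      using r'[OF uv(2)] joined_sym[OF r'[OF uv(3)]] concat_edges(1)[of u v x "identity_diagram n"] e uv(1)
        joined_trans by metis
    then show "e \<in> diagram_comp x (identity_diagram n)"
      unfolding uv(1) by (rule in_diagram_compI[OF uv(4)])
  qed
  then show "diagram_comp (identity_diagram n) x = x" "diagram_comp x (identity_diagram n) = x"
    using brauer_subset_eq[OF x diagram_comp_closed[OF I x]] brauer_subset_eq[OF x diagram_comp_closed[OF x I]]
    by auto
  show "loops (identity_diagram n) x = {}"
    by (rule no_loops[OF I x]) (rule exI, rule joined_sym, erule l)
  show "loops x (identity_diagram n) = {}"
    by (rule no_loops[OF x I]) (rule exI, rule joined_sym, erule r)
qed


subsection \<open>Edges between nodes of one side\<close>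

definition left_edges :: "diagram \<Rightarrow> node set set" where
  "left_edges d = {e \<in> d. e \<subseteq> range Lft}"

lemma left_edgesE:
  assumes "d \<in> brauer_diagrams n" "e \<in> left_edges d"
  obtains i j where "e = {Lft i, Lft j}" "i \<in> {1..n}" "j \<in> {1..n}" "i \<noteq> j" "e \<in> d"
proof -
  have e: "e \<in> d" "e \<subseteq> range Lft"
    using assms(2) by (auto simp: left_edges_def)
  then obtain u v where "e = {u, v}" "u \<in> nodes n" "v \<in> nodes n" "u \<noteq> v"
    using brauer_edgeE[OF assms(1)] by metis
  moreover from this e obtain i j where "u = Lft i" "v = Lft j"
    by blast
  ultimately show ?thesis
    using that[of i j] e(1) by (auto simp: nodes_def)
qed

lemma left_edges_iff: "{Lft i, Lft j} \<in> left_edges d \<longleftrightarrow> {Lft i, Lft j} \<in> d"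
  by (simp add: left_edges_def)

lemma left_edges_empty_iff:
  assumes "d \<in> brauer_diagrams n"
  shows "left_edges d = {} \<longleftrightarrow> \<not> has_left_left d"
proof -
  have "has_left_left d" if "e \<in> left_edges d" for e
    using left_edgesE[OF assms that] unfolding has_left_left_def by metis
  moreover have "left_edges d \<noteq> {}" if "has_left_left d"
    using that unfolding has_left_left_def by (auto simp: left_edges_def)
  ultimately show ?thesis by blast
qed

text \<open>A left edge of \<open>x\<close> joins two outer nodes of the concatenated graph.
  Multiplication on the right therefore only enlarges the set of left edges, which is why sorting
  diagrams by these sets produces right ideals.\<close>

lemma left_edges_comp:
  assumes x: "x \<in> brauer_diagrams n"
  shows "left_edges x \<subseteq> left_edges (diagram_comp x y)"
proof
  fix e assume "e \<in> left_edges x"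
  then obtain i j where ij: "e = {Lft i, Lft j}" "i \<noteq> j" "e \<in> x"
    by (rule left_edgesE[OF x])
  have "{Lft i, Lft j} \<in> diagram_comp x y"
    by (rule in_diagram_compI) (use ij concat_edges(1)[of "Lft i" "Lft j" x y] in auto)
  then show "e \<in> left_edges (diagram_comp x y)"
    unfolding ij(1) left_edges_iff .
qed

lemma has_right_right_comp:
  assumes y: "y \<in> brauer_diagrams n" and "has_right_right y"
  shows "has_right_right (diagram_comp x y)"
proof -
  obtain i j where ij: "{Rgt i, Rgt j} \<in> y"
    using assms(2) unfolding has_right_right_def by blast
  have "{Rgt i, Rgt j} \<in> diagram_comp x y"
    by (rule in_diagram_compI) (use brauer_edge(3)[OF y ij] concat_edges(2)[OF ij] in auto)
  then show ?thesis
    unfolding has_right_right_def by blast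
qed

text \<open>If \<open>x\<close> had no left-to-right edge, no path could leave the left outer nodes;
  if \<open>y\<close> had none, no path could reach the right outer nodes.\<close>

lemma has_left_right_compD:
  assumes x: "x \<in> brauer_diagrams n" and y: "y \<in> brauer_diagrams n" and "has_left_right (diagram_comp x y)"
  shows "has_left_right x" "has_left_right y"
proof -
  obtain i j where "{Lft i, Rgt j} \<in> diagram_comp x y"
    using assms(3) unfolding has_left_right_def by blast
  then obtain u v where "{Lft i, Rgt j} = {u, v}" "(Outer u, Outer v) \<in> joined (concat_graph x y)"
    unfolding diagram_comp_def linked_eq_joined by blast
  then have link: "(Outer (Lft i), Outer (Rgt j)) \<in> joined (concat_graph x y)"
    using joined_sym by (auto simp: doubleton_eq_iff)
  have edge: "(\<exists>s t. {s, t} \<in> x \<and> a = to_left s \<and> b = to_left t)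
      \<or> (\<exists>s t. {s, t} \<in> y \<and> a = to_right s \<and> b = to_right t)" if ab: "{a, b} \<in> concat_graph x y" for a b
  proof -
    have "(\<exists>e\<in>x. {a, b} = to_left ` e) \<or> (\<exists>e\<in>y. {a, b} = to_right ` e)"
      using ab by (auto simp: concat_graph_def)
    then show ?thesis
    proof (elim disjE bexE)
      fix e assume e: "e \<in> x" "{a, b} = to_left ` e"
      then obtain s t where st: "e = {s, t}" using brauer_edgeE[OF x] by metis
      then have "{s, t} \<in> x" "{t, s} \<in> x"
        using e(1) by (simp_all add: insert_commute)
      moreover have "a = to_left s \<and> b = to_left t \<or> a = to_left t \<and> b = to_left s"
        using e(2) st by (auto simp: doubleton_eq_iff)
      ultimately show ?thesis by blast
    next
      fix e assume e: "e \<in> y" "{a, b} = to_right ` e"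
      then obtain s t where st: "e = {s, t}" using brauer_edgeE[OF y] by metis
      then have "{s, t} \<in> y" "{t, s} \<in> y"
        using e(1) by (simp_all add: insert_commute)
      moreover have "a = to_right s \<and> b = to_right t \<or> a = to_right t \<and> b = to_right s"
        using e(2) st by (auto simp: doubleton_eq_iff)
      ultimately show ?thesis by blast
    qed
  qed
  have lr: "has_left_right d" if "{s, t} \<in> d" "s = Lft i" "t = Rgt j" for s t d i j
    using that unfolding has_left_right_def by blast
  show "has_left_right x"
  proof (rule ccontr)
    assume no: "\<not> has_left_right x"
    have "Outer (Rgt j) \<in> range (\<lambda>i. Outer (Lft i))"
      using link
    proof (rule joined_closed)
      fix a b assume ab: "{a, b} \<in> concat_graph x y" "a \<in> range (\<lambda>i. Outer (Lft i))"
      from edge[OF ab(1)] show "b \<in> range (\<lambda>i. Outer (Lft i))"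
      proof (elim disjE exE conjE)
        fix s t assume "{s, t} \<in> x" "a = to_left s" "b = to_left t"
        then show ?thesis using ab(2) no lr[of s t x] by (cases s; cases t) auto
      next
        fix s t assume "{s, t} \<in> y" "a = to_right s" "b = to_right t"
        then show ?thesis using ab(2) by (cases s) auto
      qed
    qed simp
    then show False by auto
  qed
  show "has_left_right y"
  proof (rule ccontr)
    assume no: "\<not> has_left_right y"
    have "Outer (Rgt j) \<in> range (\<lambda>i. Outer (Lft i)) \<union> range Mid"
      using link
    proof (rule joined_closed)
      fix a b assume ab: "{a, b} \<in> concat_graph x y" "a \<in> range (\<lambda>i. Outer (Lft i)) \<union> range Mid"
      from edge[OF ab(1)] show "b \<in> range (\<lambda>i. Outer (Lft i)) \<union> range Mid"
      proof (elim disjE exE conjE)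
        fix s t assume "{s, t} \<in> x" "a = to_left s" "b = to_left t"
        then show ?thesis by (cases t) auto
      next
        fix s t assume "{s, t} \<in> y" "a = to_right s" "b = to_right t"
        then show ?thesis using ab(2) no lr[of s t y] by (cases s; cases t) auto
      qed
    qed simp
    then show False by auto
  qed
qed

lemma perm_diagram_no_left_left: "\<not> has_left_left (perm_diagram n p)" "\<not> has_right_right (perm_diagram n p)"
  by (auto simp: has_left_left_def has_right_right_def perm_diagram_def doubleton_eq_iff)

lemma perm_diagram_has_left_right: "n > 0 \<Longrightarrow> has_left_right (perm_diagram n p)"
  using perm_diagram_edge[of 1 n p] unfolding has_left_right_def by auto

lemma eq_perm_diagramI:
  assumes d: "d \<in> brauer_diagrams n" and f: "\<And>j. j \<in> {1..n} \<Longrightarrow> {Lft (f j), Rgt j} \<in> d"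
  shows "\<exists>p. p permutes {1..n} \<and> d = perm_diagram n p"
proof -
  define p where "p i = (if i \<in> {1..n} then f i else i)" for i
  have range: "f i \<in> {1..n}" if "i \<in> {1..n}" for i
    using brauer_edge(1)[OF d f[OF that]] by (auto simp: nodes_def)
  have "inj_on p {1..n}"
  proof (rule inj_onI)
    fix i j assume ij: "i \<in> {1..n}" "j \<in> {1..n}" "p i = p j"
    then have "{Lft (f i), Rgt i} \<in> d" "{Lft (f i), Rgt j} \<in> d"
      using f[of i] f[of j] by (simp_all add: p_def)
    then show "i = j"
      using brauer_unique[OF d] by blast
  qed
  moreover have "p ` {1..n} \<subseteq> {1..n}"
    using range by (auto simp: p_def)
  ultimately have "bij_betw p {1..n} {1..n}"
    by (simp add: bij_betw_def endo_inj_surj)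
  then have p: "p permutes {1..n}"
    by (rule bij_imp_permutes) (auto simp: p_def)
  have "perm_diagram n p \<subseteq> d"
    using f by (auto simp: perm_diagram_def p_def)
  then show ?thesis
    using brauer_subset_eq[OF perm_diagram_brauer[OF p] d] p by blast
qed

lemma no_right_right_imp_perm:
  assumes d: "d \<in> brauer_diagrams n" and "\<not> has_right_right d"
  shows "\<exists>p. p permutes {1..n} \<and> d = perm_diagram n p"
proof -
  have "\<exists>i. {Lft i, Rgt j} \<in> d" if j: "j \<in> {1..n}" for j
  proof -
    obtain v where v: "{Rgt j, v} \<in> d"
      using brauer_partner[OF d, of "Rgt j"] j by (auto simp: nodes_def)
    then show ?thesis
      using assms(2) by (cases v) (auto simp: has_right_right_def insert_commute)
  qed
  then obtain f where "\<And>j. j \<in> {1..n} \<Longrightarrow> {Lft (f j), Rgt j} \<in> d"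
    by metis
  then show ?thesis
    by (rule eq_perm_diagramI[OF d])
qed

text \<open>The \<open>n\<close> left nodes are matched injectively, hence bijectively, with the
  \<open>n\<close> right nodes. The matching is inverted because \<open>perm_diagram\<close> indexes
  edges by their right ends.\<close>

lemma no_left_left_imp_perm:
  assumes d: "d \<in> brauer_diagrams n" and "\<not> has_left_left d"
  shows "\<exists>p. p permutes {1..n} \<and> d = perm_diagram n p"
proof -
  have "\<exists>j. {Lft i, Rgt j} \<in> d" if i: "i \<in> {1..n}" for i
  proof -
    obtain v where v: "{Lft i, v} \<in> d"
      using brauer_partner[OF d, of "Lft i"] i by (auto simp: nodes_def)
    then show ?thesis
      using assms(2) by (cases v) (auto simp: has_left_left_def)
  qed
  then obtain q where q: "\<And>i. i \<in> {1..n} \<Longrightarrow> {Lft i, Rgt (q i)} \<in> d"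
    by metis
  have "inj_on q {1..n}"
  proof (rule inj_onI)
    fix i j assume ij: "i \<in> {1..n}" "j \<in> {1..n}" "q i = q j"
    then have "{Rgt (q i), Lft i} \<in> d" "{Rgt (q i), Lft j} \<in> d"
      using q[of i] q[of j] by (simp_all add: insert_commute)
    then show "i = j"
      using brauer_unique[OF d] by blast
  qed
  moreover have "q ` {1..n} \<subseteq> {1..n}"
  proof (rule image_subsetI)
    show "q i \<in> {1..n}" if "i \<in> {1..n}" for i
      using brauer_edge(2)[OF d q[OF that]] by (auto simp: nodes_def)
  qed
  ultimately have surj: "q ` {1..n} = {1..n}"
    by (simp add: endo_inj_surj)
  have "{Lft (inv_into {1..n} q j), Rgt j} \<in> d" if "j \<in> {1..n}" for j
  proof -
    have "j \<in> q ` {1..n}" using that surj by simp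
    then show ?thesis
      using q[of "inv_into {1..n} q j"] inv_into_into[of j q] f_inv_into_f[of j q] by metis
  qed
  then show ?thesis
    by (rule eq_perm_diagramI[OF d])
qed


text \<open>A left edge of \<open>x\<close> belongs to the composite anyway. For any other edge of
  \<open>y\<close>, both ends are connected to the outer nodes of the same name, so the edge
  reappears there.\<close>

lemma comp_eq_right:
  assumes x: "x \<in> brauer_diagrams n" and y: "y \<in> brauer_diagrams n"
    and link: "\<And>u v. \<lbrakk>{u, v} \<in> y; {u, v} \<notin> left_edges x\<rbrakk> \<Longrightarrow>
      (Outer u, to_right u) \<in> joined (concat_graph x y)"
  shows "diagram_comp x y = y"
proof (rule brauer_subset_eq[OF y diagram_comp_closed[OF x y], symmetric], rule subsetI)
  fix e assume e: "e \<in> y"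
  then obtain u v where uv: "e = {u, v}" "u \<noteq> v"
    using brauer_edgeE[OF y] by metis
  have "(Outer u, Outer v) \<in> joined (concat_graph x y)"
  proof (cases "e \<in> left_edges x")
    case True
    then have "u \<in> range Lft" "v \<in> range Lft" "{u, v} \<in> x"
      unfolding uv(1) by (auto simp: left_edges_def)
    then show ?thesis
      using concat_edges(1)[of u v x y] by auto
  next
    case False
    then have "(Outer u, to_right u) \<in> joined (concat_graph x y)" "(Outer v, to_right v) \<in> joined (concat_graph x y)"
      using link[of u v] link[of v u] e uv(1) by (auto simp: insert_commute)
    then show ?thesis
      using concat_edges(2)[of u v y x] e uv(1) joined_trans joined_sym by metis
  qed
  then show "e \<in> diagram_comp x y"
    unfolding uv(1) by (rule in_diagram_compI[OF uv(2)])
qed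


subsection \<open>Diagrams acting as the identity on a prescribed left edge\<close>

text \<open>
  In front of a diagram with left edge \<open>ab\<close>, the strand that starts at \<open>k\<close> on the left runs through \<open>a\<close> and \<open>b\<close>
  and comes back to \<open>k\<close>, so the composite is that diagram again.
\<close>

definition hook_diagram :: "nat \<Rightarrow> nat \<Rightarrow> nat \<Rightarrow> nat \<Rightarrow> diagram" where
  "hook_diagram n a b k =
    {{Lft a, Lft b}, {Rgt b, Rgt k}, {Lft k, Rgt a}} \<union> {{Lft i, Rgt i} | i. i \<in> {1..n} - {a, b, k}}"

locale hook =
  fixes n a b k :: nat
  assumes mem: "a \<in> {1..n}" "b \<in> {1..n}" "k \<in> {1..n}" and neq: "a \<noteq> b" "a \<noteq> k" "b \<noteq> k"
begin

lemma hook_diagram_brauer: "hook_diagram n a b k \<in> brauer_diagrams n"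
proof -
  define f where "f u = (case u of
      Lft i \<Rightarrow> if i = a then Lft b else if i = b then Lft a else if i = k then Rgt a else Rgt i
    | Rgt i \<Rightarrow> if i = a then Lft k else if i = b then Rgt k else if i = k then Rgt b else Lft i)" for u
  have f: "f (Lft a) = Lft b" "f (Lft b) = Lft a" "f (Lft k) = Rgt a" "f (Rgt a) = Lft k"
    "f (Rgt b) = Rgt k" "f (Rgt k) = Rgt b"
    using neq by (auto simp: f_def)
  have f': "f (Lft i) = Rgt i" "f (Rgt i) = Lft i" if "i \<notin> {a, b, k}" for i
    using that by (auto simp: f_def)
  have nodes: "Lft i \<in> nodes n \<longleftrightarrow> i \<in> {1..n}" "Rgt i \<in> nodes n \<longleftrightarrow> i \<in> {1..n}" for i
    by (auto simp: nodes_def)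
  have cases: "u \<in> {Lft a, Lft b, Lft k, Rgt a, Rgt b, Rgt k} \<or> (\<exists>i\<in>{1..n} - {a, b, k}. u = Lft i \<or> u = Rgt i)"
    if "u \<in> nodes n" for u
    using that by (cases u) (auto simp: nodes)
  have "{{u, f u} | u. u \<in> nodes n} \<in> brauer_diagrams n"
  proof (rule involution_diagram)
    fix u assume u: "u \<in> nodes n"
    from cases[OF u] show "f u \<in> nodes n"
      using mem by (elim disjE bexE insertE emptyE; simp add: f f' nodes)
    from cases[OF u] show "f (f u) = u"
      by (elim disjE bexE insertE emptyE; simp add: f f')
    from cases[OF u] show "f u \<noteq> u"
      using neq by (elim disjE bexE insertE emptyE; simp add: f f')
  qed
  moreover have "{{u, f u} | u. u \<in> nodes n} = hook_diagram n a b k"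
  proof (intro equalityI subsetI)
    fix e assume "e \<in> {{u, f u} | u. u \<in> nodes n}"
    then obtain u where u: "e = {u, f u}" "u \<in> nodes n" by blast
    from cases[OF u(2)] show "e \<in> hook_diagram n a b k"
      unfolding u(1) hook_diagram_def by (elim disjE bexE insertE emptyE; auto simp: f f' insert_commute)
  next
    fix e assume "e \<in> hook_diagram n a b k"
    then consider "e = {Lft a, f (Lft a)}" | "e = {Rgt b, f (Rgt b)}" | "e = {Lft k, f (Lft k)}"
      | i where "i \<in> {1..n} - {a, b, k}" "e = {Lft i, f (Lft i)}"
      unfolding hook_diagram_def by (auto simp: f f')
    then show "e \<in> {{u, f u} | u. u \<in> nodes n}"
      by cases (use mem nodes in blast)+
  qed
  ultimately show ?thesis by simp
qed

text \<open>The hook diagram contributes its own left edge. Away from \<open>a\<close>,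
  \<open>b\<close> and \<open>k\<close> its strands are straight, so left edges of \<open>x\<close>
  there survive.\<close>

lemma hook_left_edges:
  assumes x: "x \<in> brauer_diagrams n"
  shows "{Lft a, Lft b} \<in> left_edges (diagram_comp (hook_diagram n a b k) x)"
    and "\<lbrakk>{Lft i, Lft j} \<in> left_edges x; i \<notin> {a, b, k}; j \<notin> {a, b, k}\<rbrakk> \<Longrightarrow>
      {Lft i, Lft j} \<in> left_edges (diagram_comp (hook_diagram n a b k) x)"
proof -
  have "{Lft a, Lft b} \<in> left_edges (hook_diagram n a b k)"
    by (simp add: left_edges_iff hook_diagram_def)
  then show "{Lft a, Lft b} \<in> left_edges (diagram_comp (hook_diagram n a b k) x)"
    using left_edges_comp[OF hook_diagram_brauer] by blast
  assume ij: "{Lft i, Lft j} \<in> left_edges x" "i \<notin> {a, b, k}" "j \<notin> {a, b, k}"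
  then have e: "{Lft i, Lft j} \<in> x"
    by (simp add: left_edges_iff)
  have "i \<in> {1..n}" "j \<in> {1..n}" "i \<noteq> j"
    using brauer_edge[OF x e] by (auto simp: nodes_def)
  then have "{Lft i, Rgt i} \<in> hook_diagram n a b k" "{Lft j, Rgt j} \<in> hook_diagram n a b k"
    using ij by (auto simp: hook_diagram_def)
  note l = concat_edges(1)[OF this(1), of x] concat_edges(1)[OF this(2), of x]
  have "(Outer (Lft i), Outer (Lft j)) \<in> joined (concat_graph (hook_diagram n a b k) x)"
    using l concat_edges(2)[OF e, of "hook_diagram n a b k"] joined_trans joined_sym by (metis to_left.simps to_right.simps)
  then have "{Lft i, Lft j} \<in> diagram_comp (hook_diagram n a b k) x"
    using \<open>i \<noteq> j\<close> by (intro in_diagram_compI) auto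
  then show "{Lft i, Lft j} \<in> left_edges (diagram_comp (hook_diagram n a b k) x)"
    by (simp add: left_edges_iff)
qed

lemma hook_comp:
  assumes x: "x \<in> brauer_diagrams n" and ab: "{Lft a, Lft b} \<in> x"
  shows "diagram_comp (hook_diagram n a b k) x = x" "loops (hook_diagram n a b k) x = {}"
proof -
  let ?e = "hook_diagram n a b k"
  let ?G = "concat_graph ?e x"
  have e: "{Lft k, Rgt a} \<in> ?e" "{Rgt b, Rgt k} \<in> ?e"
    by (simp_all add: hook_diagram_def)
  have ka: "(Outer (Lft k), Mid a) \<in> joined ?G"
    using concat_edges(1)[OF e(1), of x] by simp
  have ab': "(Mid a, Mid b) \<in> joined ?G"
    using concat_edges(2)[OF ab, of ?e] by simp
  have bk: "(Mid b, Mid k) \<in> joined ?G"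
    using concat_edges(1)[OF e(2), of x] by simp
  have straight: "(Outer (Lft i), Mid i) \<in> joined ?G" if "i \<in> {1..n}" "i \<notin> {a, b}" for i
  proof (cases "i = k")
    case True
    then show ?thesis
      using joined_trans[OF joined_trans[OF ka ab'] bk] by simp
  next
    case False
    then have "{Lft i, Rgt i} \<in> ?e"
      using that by (auto simp: hook_diagram_def)
    from concat_edges(1)[OF this, of x] show ?thesis by simp
  qed
  show "diagram_comp ?e x = x"
  proof (rule comp_eq_right[OF hook_diagram_brauer x])
    fix u v assume uv: "{u, v} \<in> x" "{u, v} \<notin> left_edges ?e"
    show "(Outer u, to_right u) \<in> joined ?G"
    proof (cases u)
      case (Lft i)
      have "i \<noteq> a"
        using uv brauer_unique[OF x ab, of v] by (auto simp: Lft left_edges_iff hook_diagram_def)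
      moreover have "i \<noteq> b"
        using uv brauer_unique[OF x, of "Lft b" "Lft a" v] ab
        by (auto simp: Lft left_edges_iff hook_diagram_def insert_commute[of "Lft b"])
      ultimately show ?thesis
        using straight[of i] brauer_edge(1)[OF x uv(1)] by (auto simp: Lft nodes_def)
    qed simp
  qed
  show "loops ?e x = {}"
  proof (rule no_loops[OF hook_diagram_brauer x])
    fix i assume i: "i \<in> {1..n}"
    consider "i = a" | "i = b" | "i \<notin> {a, b}" by blast
    then show "\<exists>u. (Mid i, Outer u) \<in> joined ?G"
    proof cases
      case 1
      then show ?thesis using joined_sym[OF ka] by blast
    next
      case 2
      then show ?thesis using joined_sym[OF joined_trans[OF ka ab']] by blast
    next
      case 3
      then show ?thesis using joined_sym[OF straight[OF i 3]] by blast
    qed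
  qed
qed

end


section \<open>Quotients of free resolutions\<close>

text \<open>Adding one point of the support at a time gives \<open>u g = \<zero>\<close>. As nothing
  cancels, a condition on all values of the sum passes to \<open>a\<close> and to \<open>u\<close>,
  which \<open>free_induct\<close> does not provide.\<close>

lemma (in ring) free_induct_disjoint [consumes 1, case_names zero add]:
  assumes f: "f \<in> Free R S" and zero: "P (\<lambda>x. \<zero>)"
    and add: "\<And>g a u. \<lbrakk>g \<in> S; a \<in> carrier R; u \<in> Free R S; u g = \<zero>; P u\<rbrakk> \<Longrightarrow>
      P (\<lambda>x. single R g a x \<oplus> u x)"
  shows "P f"
proof -
  have "P f" if "finite T" "f \<in> Free R S" "{x. f x \<noteq> \<zero>} \<subseteq> T" for T f
    using that
  proof (induction T arbitrary: f)
    case empty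
    then have "f = (\<lambda>x. \<zero>)" by auto
    then show ?case using zero by simp
  next
    case (insert t T)
    define u where "u = (\<lambda>x. if x = t then \<zero> else f x)"
    have "finite {x. u x \<noteq> \<zero>}"
      by (rule finite_subset[of _ "{x. f x \<noteq> \<zero>}"]) (use insert.prems in \<open>auto simp: u_def free_module_def\<close>)
    then have u: "u \<in> Free R S"
      using insert.prems by (auto simp: u_def free_module_def)
    have Pu: "P u"
      by (rule insert.IH[OF u]) (use insert.prems in \<open>auto simp: u_def\<close>)
    show ?case
    proof (cases "t \<in> S")
      case True
      have "f = (\<lambda>x. single R t (f t) x \<oplus> u x)"
        using free_value[OF insert.prems(1)] by (auto simp: single_def u_def)
      then show ?thesis
        using add[OF True free_value[OF insert.prems(1), of t] u _ Pu] by (simp add: u_def)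
    next
      case False
      then have "f = u"
        using insert.prems(1) by (auto simp: u_def free_module_def)
      then show ?thesis using Pu by simp
    qed
  qed
  then show ?thesis
    using f free_supp[OF f] by blast
qed

text \<open>For a right ideal \<open>K\<close>, the subcomplex of chains with all coefficients in \<open>K\<close> is exact.\<close>

definition (in free_resolution) acyclic :: "'a set \<Rightarrow> bool" where
  "acyclic K \<longleftrightarrow> (\<forall>k. \<forall>x\<in>cycles A S d k. range x \<subseteq> K \<longrightarrow> (k = 0 \<longrightarrow> \<epsilon> x = \<zero>\<^bsub>N\<^esub>) \<longrightarrow>
    (\<exists>y\<in>Free A (S (Suc k)). range y \<subseteq> K \<and> lin A d y = x))"

definition right_ideal :: "('a, 's) ring_scheme \<Rightarrow> 'a set \<Rightarrow> bool" where
  "right_ideal A K \<longleftrightarrow> K \<subseteq> carrier A \<and> \<zero>\<^bsub>A\<^esub> \<in> K \<and> (\<forall>x\<in>K. \<forall>y\<in>K. x \<oplus>\<^bsub>A\<^esub> y \<in> K) \<and>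
    (\<forall>x\<in>K. \<ominus>\<^bsub>A\<^esub> x \<in> K) \<and> (\<forall>x\<in>K. \<forall>a\<in>carrier A. x \<otimes>\<^bsub>A\<^esub> a \<in> K)"

lemma right_idealD:
  assumes "right_ideal A K"
  shows "K \<subseteq> carrier A" "\<zero>\<^bsub>A\<^esub> \<in> K" "\<lbrakk>x \<in> K; y \<in> K\<rbrakk> \<Longrightarrow> x \<oplus>\<^bsub>A\<^esub> y \<in> K" "x \<in> K \<Longrightarrow> \<ominus>\<^bsub>A\<^esub> x \<in> K"
    "\<lbrakk>x \<in> K; a \<in> carrier A\<rbrakk> \<Longrightarrow> x \<otimes>\<^bsub>A\<^esub> a \<in> K"
  using assms by (auto simp: right_ideal_def)

context free_resolution
begin

lemma acyclicD:
  assumes "acyclic K" "x \<in> cycles A S d k" "range x \<subseteq> K" "k = 0 \<Longrightarrow> \<epsilon> x = \<zero>\<^bsub>N\<^esub>"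
  obtains y where "y \<in> Free A (S (Suc k))" "range y \<subseteq> K" "lin A d y = x"
  using assms(1)[unfolded acyclic_def, rule_format, OF assms(2,3,4)] that by blast

lemma acyclic_zero: "acyclic {\<zero>\<^bsub>A\<^esub>}"
  unfolding acyclic_def
proof (intro allI ballI impI)
  fix k x assume "x \<in> cycles A S d k" "range x \<subseteq> {\<zero>\<^bsub>A\<^esub>}"
  then have "x = (\<lambda>h. \<zero>\<^bsub>A\<^esub>)" by auto
  then show "\<exists>y\<in>Free A (S (Suc k)). range y \<subseteq> {\<zero>\<^bsub>A\<^esub>} \<and> lin A d y = x"
    by (intro bexI[of _ "\<lambda>h. \<zero>\<^bsub>A\<^esub>"]) auto
qed

text \<open>The differential multiplies the coefficients of a chain on the right by the entries of
  \<open>d\<close>, so values in a right ideal stay there.\<close>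

lemma lin_range:
  assumes "right_ideal A K" "u \<in> Free A (S (Suc k))" "range u \<subseteq> K"
  shows "lin A d u h \<in> K"
proof -
  note K = right_idealD[OF assms(1)]
  show ?thesis
    using assms(2,3)
  proof (induction rule: free_induct_disjoint)
    case zero
    then show ?case using K(2) by simp
  next
    case (add g a u)
    have "single A g a g \<oplus>\<^bsub>A\<^esub> u g \<in> K" using add(6) by blast
    then have a: "a \<in> K" using add(2,4) by (simp add: single_def)
    have "u x \<in> K" for x
    proof (cases "x = g")
      case True
      then show ?thesis using add(4) K(2) by simp
    next
      case False
      have "single A g a x \<oplus>\<^bsub>A\<^esub> u x \<in> K" using add(6) by blast
      then show ?thesis using False free_value[OF add(3)] by (simp add: single_def)
    qed
    then have "lin A d u h \<in> K" using add(5) by blast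
    then show ?case
      using lin_step[where \<kappa> = d, OF add(1-3) d_value] K(3)[OF K(5)[OF a d_value[OF add(1)]]] by simp
  qed
qed

lemma \<epsilon>_range_zero:
  assumes "\<And>a x. \<lbrakk>a \<in> K; x \<in> carrier N\<rbrakk> \<Longrightarrow> a \<odot>\<^bsub>N\<^esub> x = \<zero>\<^bsub>N\<^esub>" "\<zero>\<^bsub>A\<^esub> \<in> K"
    "u \<in> Free A (S 0)" "range u \<subseteq> K"
  shows "\<epsilon> u = \<zero>\<^bsub>N\<^esub>"
  using assms(3,4)
proof (induction rule: free_induct_disjoint)
  case zero
  then show ?case by (simp add: \<epsilon>_zero)
next
  case (add g a u)
  have s: "single A g \<one>\<^bsub>A\<^esub> \<in> Free A (S 0)" "single A g a \<in> Free A (S 0)"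
    using add by (auto intro!: free_single)
  have "single A g a g \<oplus>\<^bsub>A\<^esub> u g \<in> K" using add(6) by blast
  then have a: "a \<in> K" using add(2,4) by (simp add: single_def)
  have "u x \<in> K" for x
  proof (cases "x = g")
    case True
    then show ?thesis using add(4) assms(2) by simp
  next
    case False
    have "single A g a x \<oplus>\<^bsub>A\<^esub> u x \<in> K" using add(6) by blast
    then show ?thesis using False free_value[OF add(3)] by (simp add: single_def)
  qed
  then have u: "\<epsilon> u = \<zero>\<^bsub>N\<^esub>" using add(5) by blast
  have "single A g a = (\<lambda>x. a \<otimes>\<^bsub>A\<^esub> single A g \<one>\<^bsub>A\<^esub> x)"
    using add(2) by (auto simp: single_def)
  then have "\<epsilon> (single A g a) = \<zero>\<^bsub>N\<^esub>"
    using \<epsilon>_smult[OF add(2) s(1)] assms(1)[OF a \<epsilon>_closed[OF s(1)]] by simp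
  then show ?case
    using \<epsilon>_add[OF s(2) add(3)] u by simp
qed

text \<open>
  A cycle \<open>x = u + v\<close> with \<open>u\<close> in \<open>K\<close> and \<open>v\<close> in \<open>e A\<close>: the boundary of \<open>v\<close> lies in \<open>K\<close> and in \<open>e A\<close>, hence
  in \<open>G\<close>, so it is the boundary of some \<open>w\<close> in \<open>G\<close>; then \<open>v - w\<close> is a cycle in \<open>e A\<close> and \<open>u + w\<close> one in \<open>K\<close>.
\<close>

lemma acyclic_step:
  assumes K: "right_ideal A K" "acyclic K" and G: "G \<subseteq> K" "\<zero>\<^bsub>A\<^esub> \<in> G" "acyclic G"
    and e: "e \<in> carrier A" "e \<otimes>\<^bsub>A\<^esub> e = e" "\<And>x. x \<in> G \<Longrightarrow> e \<otimes>\<^bsub>A\<^esub> x = x"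
      "\<And>a. \<lbrakk>a \<in> carrier A; e \<otimes>\<^bsub>A\<^esub> a \<in> K\<rbrakk> \<Longrightarrow> e \<otimes>\<^bsub>A\<^esub> a \<in> G"
      "\<And>x. x \<in> carrier N \<Longrightarrow> e \<odot>\<^bsub>N\<^esub> x = \<zero>\<^bsub>N\<^esub>"
    and L: "right_ideal A L" "K \<subseteq> L" "e \<in> L" "\<And>x. x \<in> L \<Longrightarrow> \<exists>u\<in>K. \<exists>a\<in>carrier A. x = u \<oplus>\<^bsub>A\<^esub> e \<otimes>\<^bsub>A\<^esub> a"
  shows "acyclic L"
  unfolding acyclic_def
proof (intro allI ballI impI)
  fix k x assume x: "x \<in> cycles A S d k" "range x \<subseteq> L" "k = 0 \<longrightarrow> \<epsilon> x = \<zero>\<^bsub>N\<^esub>"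
  note KD = right_idealD[OF K(1)] and LD = right_idealD[OF L(1)]
  have xF: "x \<in> Free A (S k)" using x(1) by (simp add: cycles_def)
  \<comment> \<open>Zero is split as zero plus zero, so that both parts of \<open>x\<close> have
    finite support.\<close>
  have "\<forall>g. \<exists>p. (x g = \<zero>\<^bsub>A\<^esub> \<longrightarrow> p = (\<zero>\<^bsub>A\<^esub>, \<zero>\<^bsub>A\<^esub>)) \<and> fst p \<in> K \<and> snd p \<in> carrier A \<and> x g = fst p \<oplus>\<^bsub>A\<^esub> e \<otimes>\<^bsub>A\<^esub> snd p"
  proof
    fix g
    show "\<exists>p. (x g = \<zero>\<^bsub>A\<^esub> \<longrightarrow> p = (\<zero>\<^bsub>A\<^esub>, \<zero>\<^bsub>A\<^esub>)) \<and> fst p \<in> K \<and> snd p \<in> carrier A \<and> x g = fst p \<oplus>\<^bsub>A\<^esub> e \<otimes>\<^bsub>A\<^esub> snd p"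
    proof (cases "x g = \<zero>\<^bsub>A\<^esub>")
      case True
      then show ?thesis using KD(2) e(1) by (intro exI[of _ "(\<zero>\<^bsub>A\<^esub>, \<zero>\<^bsub>A\<^esub>)"]) simp
    next
      case False
      obtain u a where "u \<in> K" "a \<in> carrier A" "x g = u \<oplus>\<^bsub>A\<^esub> e \<otimes>\<^bsub>A\<^esub> a"
        using L(4) x(2) by blast
      then show ?thesis using False by (intro exI[of _ "(u, a)"]) simp
    qed
  qed
  then obtain p where p: "\<And>g. x g = \<zero>\<^bsub>A\<^esub> \<Longrightarrow> p g = (\<zero>\<^bsub>A\<^esub>, \<zero>\<^bsub>A\<^esub>)" "\<And>g. fst (p g) \<in> K"
    "\<And>g. snd (p g) \<in> carrier A" "\<And>g. x g = fst (p g) \<oplus>\<^bsub>A\<^esub> e \<otimes>\<^bsub>A\<^esub> snd (p g)"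
    by metis
  define u where "u = (\<lambda>g. fst (p g))"
  define v where "v = (\<lambda>g. e \<otimes>\<^bsub>A\<^esub> snd (p g))"
  have xz: "finite {g. x g \<noteq> \<zero>\<^bsub>A\<^esub>}" "\<And>g. g \<notin> S k \<Longrightarrow> x g = \<zero>\<^bsub>A\<^esub>"
    using xF by (auto simp: free_module_def)
  have uz: "u g = \<zero>\<^bsub>A\<^esub>" "v g = \<zero>\<^bsub>A\<^esub>" if "x g = \<zero>\<^bsub>A\<^esub>" for g
    using p(1)[OF that] e(1) by (simp_all add: u_def v_def)
  have ucl: "u g \<in> K" "u g \<in> carrier A" "v g \<in> carrier A" for g
    using p(2,3)[of g] KD(1) e(1) by (auto simp: u_def v_def)
  have uF: "u \<in> Free A (S k)"
    using uz(1) xz ucl finite_subset[OF _ xz(1), of "{g. u g \<noteq> \<zero>\<^bsub>A\<^esub>}"] by (auto simp: free_module_def)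
  have vF: "v \<in> Free A (S k)"
    using uz(2) xz ucl finite_subset[OF _ xz(1), of "{g. v g \<noteq> \<zero>\<^bsub>A\<^esub>}"] by (auto simp: free_module_def)
  have xuv: "x = (\<lambda>g. u g \<oplus>\<^bsub>A\<^esub> v g)"
    using p(4) by (simp add: u_def v_def fun_eq_iff)
  have ev: "(\<lambda>g. e \<otimes>\<^bsub>A\<^esub> v g) = v"
    using e(1,2) p(3) by (simp add: v_def A.m_assoc[symmetric])
  have \<epsilon>v: "\<epsilon> v = \<zero>\<^bsub>N\<^esub>" if "k = 0"
    using \<epsilon>_smult[OF e(1), of v] ev vF e(5)[OF \<epsilon>_closed, of v] that by simp
  \<comment> \<open>In degree 0 there is no boundary to correct and \<open>w = 0\<close> serves; the
    augmentation of \<open>v\<close> vanishes by itself because \<open>v = e v\<close> and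
    \<open>e\<close> annihilates \<open>N\<close>.\<close>
  have "\<exists>w\<in>Free A (S k). range w \<subseteq> G \<and> (k \<noteq> 0 \<longrightarrow> lin A d w = lin A d v) \<and> (k = 0 \<longrightarrow> \<epsilon> w = \<zero>\<^bsub>N\<^esub>)"
  proof (cases k)
    case 0
    then show ?thesis using G(2) \<epsilon>_zero by (intro bexI[of _ "\<lambda>g. \<zero>\<^bsub>A\<^esub>"]) auto
  next
    case (Suc j)
    have F: "u \<in> Free A (S (Suc j))" "v \<in> Free A (S (Suc j))"
      using uF vF Suc by simp_all
    note dv = lin_d_closed[OF F(2)]
    have "lin A d x = (\<lambda>h. \<zero>\<^bsub>A\<^esub>)"
      using x(1) Suc by (simp add: cycles_def)
    then have sum: "lin A d u h \<oplus>\<^bsub>A\<^esub> lin A d v h = \<zero>\<^bsub>A\<^esub>" for h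
      using lin_add[where \<kappa> = d, OF F d_value] unfolding xuv by (simp add: fun_eq_iff)
    have eq: "lin A d v h = e \<otimes>\<^bsub>A\<^esub> lin A d v h" for h
      using lin_smult[where \<kappa> = d, OF F(2) e(1) d_value] unfolding ev by (simp add: fun_eq_iff)
    have "lin A d v h \<in> G" for h
    proof -
      have "lin A d v h = \<ominus>\<^bsub>A\<^esub> lin A d u h"
        using sum[of h] free_value[OF dv] free_value[OF lin_d_closed[OF F(1)]]
        by (metis A.add.m_comm A.minus_equality)
      moreover have "lin A d u h \<in> K"
        using lin_range[OF K(1) F(1)] ucl(1) by blast
      ultimately have "lin A d v h \<in> K" using KD(4) by simp
      then show ?thesis
        by (rule e(4)[OF free_value[OF dv], of h, folded eq])
    qed
    then have r: "range (lin A d v) \<subseteq> G" by blast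
    have "lin A d v \<in> cycles A S d j"
      by (rule boundary_in_cycles[OF F(2)])
    moreover have "\<epsilon> (lin A d v) = \<zero>\<^bsub>N\<^esub>" if "j = 0"
      using \<epsilon>_d F(2) that by simp
    ultimately obtain w where "w \<in> Free A (S (Suc j))" "range w \<subseteq> G" "lin A d w = lin A d v"
      using acyclicD[OF G(3) _ r] by metis
    then show ?thesis using Suc by blast
  qed
  then obtain w where w: "w \<in> Free A (S k)" "range w \<subseteq> G"
    "k \<noteq> 0 \<Longrightarrow> lin A d w = lin A d v" "k = 0 \<Longrightarrow> \<epsilon> w = \<zero>\<^bsub>N\<^esub>"
    by blast
  have wv: "w g \<in> carrier A" for g using free_value[OF w(1)] .
  have ew: "e \<otimes>\<^bsub>A\<^esub> w g = w g" for g using e(3) w(2) by blast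
  let ?vw = "\<lambda>g. v g \<ominus>\<^bsub>A\<^esub> w g" and ?uw = "\<lambda>g. u g \<oplus>\<^bsub>A\<^esub> w g"
  have e_vw: "e \<otimes>\<^bsub>A\<^esub> ?vw g = ?vw g" for g
    using ew[of g] fun_cong[OF ev, of g] wv[of g] ucl(3)[of g] e(1) by (simp add: A.minus_eq A.r_distr A.r_minus)
  have z: "\<zero>\<^bsub>A\<^esub> \<ominus>\<^bsub>A\<^esub> \<zero>\<^bsub>A\<^esub> = \<zero>\<^bsub>A\<^esub>" by (simp add: A.minus_eq)
  have dk: "s \<in> S k \<Longrightarrow> k \<noteq> 0 \<Longrightarrow> d s h \<in> carrier A" for s h
    using d_value[of s "k - 1"] by simp
  have vw_cyc: "?vw \<in> cycles A S d k"
  proof (cases "k = 0")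
    case True
    then show ?thesis using free_minus[OF vF w(1)] by (simp add: cycles_def)
  next
    case False
    have "lin A d ?vw = (\<lambda>h. lin A d v h \<ominus>\<^bsub>A\<^esub> lin A d w h)"
      by (rule lin_minus[OF vF w(1) dk]) (use False in auto)
    then have "lin A d ?vw = (\<lambda>h. \<zero>\<^bsub>A\<^esub>)"
      using w(3)[OF False] lin_value[where \<kappa> = d, OF vF dk] False by (simp add: A.minus_eq A.r_neg)
    then show ?thesis using free_minus[OF vF w(1)] by (simp add: cycles_def)
  qed
  have vw_\<epsilon>: "\<epsilon> ?vw = \<zero>\<^bsub>N\<^esub>" if "k = 0"
    using \<epsilon>_minus[of v w] vF w(1) w(4) \<epsilon>v that by simp
  obtain y where y: "y \<in> Free A (S (Suc k))" "lin A d y = ?vw"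
    using exact_cycle[OF vw_cyc vw_\<epsilon>] by blast
  \<comment> \<open>Here \<open>e P\<close> acts as a direct summand: multiplying a preimage of
    \<open>v - w\<close> by \<open>e\<close> brings it into \<open>e A\<close> and keeps its
    boundary, since \<open>e (v - w) = v - w\<close>.\<close>
  have ey: "(\<lambda>g. e \<otimes>\<^bsub>A\<^esub> y g) \<in> Free A (S (Suc k))"
    by (rule free_smult[OF y(1) e(1)])
  have d_ey: "lin A d (\<lambda>g. e \<otimes>\<^bsub>A\<^esub> y g) = ?vw"
    using lin_smult[where \<kappa> = d, OF y(1) e(1) d_value] y(2) e_vw by simp
  have uw_K: "range ?uw \<subseteq> K"
    using ucl(1) w(2) G(1) KD(3) by blast
  have x_eq: "x g = ?uw g \<oplus>\<^bsub>A\<^esub> ?vw g" for g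
    using wv[of g] ucl(2,3)[of g] unfolding xuv
    by (simp add: A.minus_eq A.a_ac) (simp add: A.a_assoc[symmetric] A.r_neg A.l_neg)
  have uw_x: "?uw = (\<lambda>g. x g \<ominus>\<^bsub>A\<^esub> ?vw g)"
    by (intro ext add_eq_imp_minus) (use wv ucl x_eq in auto)
  have uw_cyc: "?uw \<in> cycles A S d k"
    unfolding uw_x by (rule cycles_minus[OF x(1) vw_cyc])
  have uw_\<epsilon>: "\<epsilon> ?uw = \<zero>\<^bsub>N\<^esub>" if "k = 0"
    unfolding uw_x using \<epsilon>_minus[of x ?vw] x(3) vw_\<epsilon> xF free_minus[OF vF w(1)] that by simp
  obtain t where t: "t \<in> Free A (S (Suc k))" "range t \<subseteq> K" "lin A d t = ?uw"
    using acyclicD[OF K(2) uw_cyc uw_K uw_\<epsilon>] by blast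
  show "\<exists>y\<in>Free A (S (Suc k)). range y \<subseteq> L \<and> lin A d y = x"
  proof (intro bexI[of _ "\<lambda>g. t g \<oplus>\<^bsub>A\<^esub> e \<otimes>\<^bsub>A\<^esub> y g"] conjI)
    show "(\<lambda>g. t g \<oplus>\<^bsub>A\<^esub> e \<otimes>\<^bsub>A\<^esub> y g) \<in> Free A (S (Suc k))"
      by (rule free_add[OF t(1) ey])
    show "range (\<lambda>g. t g \<oplus>\<^bsub>A\<^esub> e \<otimes>\<^bsub>A\<^esub> y g) \<subseteq> L"
      using t(2) L(2) LD(3) LD(5)[OF L(3) free_value[OF y(1)]] by blast
    show "lin A d (\<lambda>g. t g \<oplus>\<^bsub>A\<^esub> e \<otimes>\<^bsub>A\<^esub> y g) = x"
      using lin_add[where \<kappa> = d, OF t(1) ey d_value] t(3) d_ey x_eq by (simp add: fun_eq_iff)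
  qed
qed

end


section \<open>Dividing a free resolution by an ideal with exact subcomplex\<close>

locale quotient_resolution =
  free_resolution A N S d \<epsilon> + change_of_rings A T \<pi> for A N S d \<epsilon> T \<pi> +
  fixes N'
  assumes N': "left_module T N'" "carrier N' = carrier N" "add N' = add N" "zero N' = zero N"
      "\<And>a x. \<lbrakk>a \<in> carrier A; x \<in> carrier N\<rbrakk> \<Longrightarrow> \<pi> a \<odot>\<^bsub>N'\<^esub> x = a \<odot>\<^bsub>N\<^esub> x"
    and surj: "\<pi> ` carrier A = carrier T"
    and acyclic_kernel: "acyclic {a \<in> carrier A. \<pi> a = \<zero>\<^bsub>T\<^esub>}"
begin

lemma T_zero: "\<pi> \<zero>\<^bsub>A\<^esub> = \<zero>\<^bsub>T\<^esub>"
  by simp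

lemma lift_exists:
  assumes "u \<in> Free T (S k)"
  shows "\<exists>p\<in>Free A (S k). (\<lambda>s. \<pi> (p s)) = u"
proof -
  have "\<exists>a. a \<in> carrier A \<and> \<pi> a = u s \<and> (u s = \<zero>\<^bsub>T\<^esub> \<longrightarrow> a = \<zero>\<^bsub>A\<^esub>)" for s
  proof (cases "u s = \<zero>\<^bsub>T\<^esub>")
    case True
    then show ?thesis using T_zero by (intro exI[of _ "\<zero>\<^bsub>A\<^esub>"]) simp
  next
    case False
    have "u s \<in> carrier T" using R.free_value[OF assms] .
    then show ?thesis using False surj by (metis imageE)
  qed
  then obtain p where p: "\<And>s. p s \<in> carrier A" "\<And>s. \<pi> (p s) = u s" "\<And>s. u s = \<zero>\<^bsub>T\<^esub> \<Longrightarrow> p s = \<zero>\<^bsub>A\<^esub>"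
    by metis
  have "finite {s. p s \<noteq> \<zero>\<^bsub>A\<^esub>}"
    by (rule finite_subset[of _ "{s. u s \<noteq> \<zero>\<^bsub>T\<^esub>}"]) (use p(3) assms in \<open>auto simp: free_module_def\<close>)
  then have "p \<in> Free A (S k)"
    using p assms by (auto simp: free_module_def)
  then show ?thesis using p(2) by (intro bexI[of _ p]) auto
qed

definition lift where
  "lift k u = (SOME p. p \<in> Free A (S k) \<and> (\<lambda>s. \<pi> (p s)) = u)"

lemma lift:
  assumes "u \<in> Free T (S k)"
  shows "lift k u \<in> Free A (S k)" "(\<lambda>s. \<pi> (lift k u s)) = u"
  using someI_ex[of "\<lambda>p. p \<in> Free A (S k) \<and> (\<lambda>s. \<pi> (p s)) = u"] lift_exists[OF assms]
  unfolding lift_def by blast+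

lemma kernel_difference:
  assumes "p \<in> Free A (S k)" "q \<in> Free A (S k)"
    "(\<lambda>s. \<pi> (p s)) = (\<lambda>s. \<pi> (q s))"
  shows "range (\<lambda>s. p s \<ominus>\<^bsub>A\<^esub> q s) \<subseteq> {a \<in> carrier A. \<pi> a = \<zero>\<^bsub>T\<^esub>}"
proof -
  have "\<pi> (p s \<ominus>\<^bsub>A\<^esub> q s) = \<zero>\<^bsub>T\<^esub>" for s
    using fun_cong[OF assms(3), of s] free_value[OF assms(1)] free_value[OF assms(2)]
    by (simp add: \<beta>_minus R.minus_eq R.r_neg)
  then show ?thesis
    using free_value[OF assms(1)] free_value[OF assms(2)] by auto
qed

text \<open>The difference of two lifts has its coefficients in the kernel of \<open>\<pi>\<close>,
  which annihilates \<open>N\<close> because the action on \<open>N\<close> factors through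
  \<open>\<pi>\<close>. Thus the augmentation of the quotient complex does not depend on the
  lift.\<close>

lemma \<epsilon>_cong:
  assumes "p \<in> Free A (S 0)" "q \<in> Free A (S 0)"
    "(\<lambda>s. \<pi> (p s)) = (\<lambda>s. \<pi> (q s))"
  shows "\<epsilon> p = \<epsilon> q"
proof -
  interpret N': left_module T N' by (rule N'(1))
  let ?r = "\<lambda>s. p s \<ominus>\<^bsub>A\<^esub> q s"
  have r: "?r \<in> Free A (S 0)"
    by (rule free_minus[OF assms(1,2)])
  have "a \<odot>\<^bsub>N\<^esub> x = \<zero>\<^bsub>N\<^esub>" if "a \<in> {a \<in> carrier A. \<pi> a = \<zero>\<^bsub>T\<^esub>}" "x \<in> carrier N" for a x
    using N'(5)[of a x, symmetric] N'.smult_zero_left[of x] that N'(2,4) by simp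
  then have "\<epsilon> ?r = \<zero>\<^bsub>N\<^esub>"
    by (rule \<epsilon>_range_zero[OF _ _ r kernel_difference[OF assms]]) simp_all
  moreover have "\<epsilon> p = \<epsilon> (\<lambda>s. ?r s \<oplus>\<^bsub>A\<^esub> q s)"
    using free_value[OF assms(1)] free_value[OF assms(2)] by (simp add: minus_add_cancel)
  ultimately show ?thesis
    using \<epsilon>_add[OF r assms(2)] \<epsilon>_closed[OF assms(2)] by simp
qed

text \<open>Exactness in degree 0 is inherited directly, since the augmentation of a chain is that
  of a lift. In positive degrees a lift of a cycle is only a cycle modulo the kernel of
  \<open>\<pi>\<close> and has to be corrected by means of \<open>acyclic_kernel\<close>.\<close>

lemma quotient_resolution:
  "free_resolution T N' S (base_change \<pi> d) (\<lambda>u. \<epsilon> (lift 0 u))"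
proof -
  let ?d = "base_change \<pi> d"
  have lin_\<pi>: "lin T ?d (\<lambda>s. \<pi> (p s)) = (\<lambda>h. \<pi> (lin A d p h))"
    if "p \<in> Free A (S (Suc k))" for p k
    by (rule lin_map[OF that d_value])
  have \<epsilon>_lift: "\<epsilon> (lift 0 (\<lambda>s. \<pi> (p s))) = \<epsilon> p" if "p \<in> Free A (S 0)" for p
    by (rule \<epsilon>_cong[OF lift(1)[OF map_free[OF that]] that lift(2)[OF map_free[OF that]]])
  show ?thesis
  proof (intro free_resolution.intro free_resolution_axioms.intro N'(1)
      free_complex_base_change[OF free_complex_axioms])
    fix u v a assume u: "u \<in> Free T (S 0)"
    note lu = lift[OF u]
    show "\<epsilon> (lift 0 u) \<in> carrier N'"
      using \<epsilon>_closed[OF lu(1)] N'(2) by simp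
    show "\<epsilon> (lift 0 (\<lambda>x. u x \<oplus>\<^bsub>T\<^esub> v x)) = \<epsilon> (lift 0 u) \<oplus>\<^bsub>N'\<^esub> \<epsilon> (lift 0 v)"
      if v: "v \<in> Free T (S 0)"
    proof -
      note lv = lift[OF v]
      have "(\<lambda>x. u x \<oplus>\<^bsub>T\<^esub> v x) = (\<lambda>x. \<pi> (lift 0 u x \<oplus>\<^bsub>A\<^esub> lift 0 v x))"
        using fun_cong[OF lu(2)] fun_cong[OF lv(2)] free_value[OF lu(1)] free_value[OF lv(1)] by auto
      then show ?thesis
        using \<epsilon>_lift[OF free_add[OF lu(1) lv(1)]] \<epsilon>_add[OF lu(1) lv(1)] N'(3) by simp
    qed
    show "\<epsilon> (lift 0 (\<lambda>x. a \<otimes>\<^bsub>T\<^esub> u x)) = a \<odot>\<^bsub>N'\<^esub> \<epsilon> (lift 0 u)" if "a \<in> carrier T"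
    proof -
      obtain b where b: "b \<in> carrier A" "a = \<pi> b"
        using surj \<open>a \<in> carrier T\<close> by blast
      have "(\<lambda>x. a \<otimes>\<^bsub>T\<^esub> u x) = (\<lambda>x. \<pi> (b \<otimes>\<^bsub>A\<^esub> lift 0 u x))"
        using fun_cong[OF lu(2)] free_value[OF lu(1)] b by auto
      then show ?thesis
        using \<epsilon>_lift[OF free_smult[OF lu(1) b(1)]] \<epsilon>_smult[OF b(1) lu(1)] N'(5)[OF b(1) \<epsilon>_closed[OF lu(1)]] b(2)
        by simp
    qed
    show "\<exists>w\<in>Free T (S (Suc 0)). lin T ?d w = u" if e: "\<epsilon> (lift 0 u) = \<zero>\<^bsub>N'\<^esub>"
    proof -
      obtain y where y: "y \<in> Free A (S (Suc 0))" "lin A d y = lift 0 u"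
        using exact_0[OF lu(1)] e N'(4) by auto
      show ?thesis
        using lin_\<pi>[OF y(1)] y(2) lu(2) map_free[OF y(1)] by metis
    qed
  next
    fix w assume w: "w \<in> Free T (S (Suc 0))"
    note lw = lift[OF w]
    have "lin T ?d w = (\<lambda>h. \<pi> (lin A d (lift (Suc 0) w) h))"
      using lin_\<pi>[OF lw(1)] lw(2) by simp
    then show "\<epsilon> (lift 0 (lin T ?d w)) = \<zero>\<^bsub>N'\<^esub>"
      using \<epsilon>_lift[OF lin_d_closed[OF lw(1)]] \<epsilon>_d[OF lw(1)] N'(4) by simp
  next
    fix x assume "x \<in> carrier N'"
    then obtain p where p: "p \<in> Free A (S 0)" "\<epsilon> p = x"
      using \<epsilon>_surj N'(2) by auto
    show "\<exists>u\<in>Free T (S 0). \<epsilon> (lift 0 u) = x"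
      using \<epsilon>_lift[OF p(1)] map_free[OF p(1)] p(2) by (intro bexI[of _ "\<lambda>s. \<pi> (p s)"]) simp_all
  next
    fix u k assume u: "u \<in> Free T (S (Suc k))" "lin T ?d u = (\<lambda>h. \<zero>\<^bsub>T\<^esub>)"
    define p where "p = lift (Suc k) u"
    have p: "p \<in> Free A (S (Suc k))" "(\<lambda>s. \<pi> (p s)) = u"
      unfolding p_def by (rule lift[OF u(1)])+
    have "\<pi> (lin A d p h) = \<zero>\<^bsub>T\<^esub>" for h
      using lin_\<pi>[OF p(1)] p(2) u(2) by (simp add: fun_eq_iff)
    then have r0: "range (lin A d p) \<subseteq> {a \<in> carrier A. \<pi> a = \<zero>\<^bsub>T\<^esub>}"
      using free_value[OF lin_d_closed[OF p(1)]] by auto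
    have "\<epsilon> (lin A d p) = \<zero>\<^bsub>N\<^esub>" if "k = 0"
      using \<epsilon>_d p(1) that by simp
    \<comment> \<open>The boundary of the lift \<open>p\<close> is a cycle with values in the
      kernel, hence the boundary of some \<open>q\<close> with values in the kernel; then
      \<open>p - q\<close> is a genuine cycle that still lifts \<open>u\<close>.\<close>
    then obtain q where q: "q \<in> Free A (S (Suc k))"
      "range q \<subseteq> {a \<in> carrier A. \<pi> a = \<zero>\<^bsub>T\<^esub>}" "lin A d q = lin A d p"
      by (rule acyclicD[OF acyclic_kernel boundary_in_cycles[OF p(1)] r0])
    let ?r = "\<lambda>s. p s \<ominus>\<^bsub>A\<^esub> q s"
    have r: "?r \<in> Free A (S (Suc k))"
      by (rule free_minus[OF p(1) q(1)])
    have "lin A d ?r = (\<lambda>h. \<zero>\<^bsub>A\<^esub>)"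
      using lin_minus[where \<kappa> = d, OF p(1) q(1) d_value] free_value[OF lin_d_closed[OF p(1)]]
      unfolding q(3) by (simp add: A.minus_eq A.r_neg)
    then obtain y where y: "y \<in> Free A (S (Suc (Suc k)))" "lin A d y = ?r"
      using exact_Suc[OF r] by blast
    have "\<pi> (?r s) = u s" for s
    proof -
      have "\<pi> (q s) = \<zero>\<^bsub>T\<^esub>" using q(2) by blast
      then show ?thesis
        using fun_cong[OF p(2), of s] free_value[OF p(1)] free_value[OF q(1)] R.free_value[OF u(1)]
        by (simp add: \<beta>_minus R.minus_eq)
    qed
    then have "lin T ?d (\<lambda>s. \<pi> (y s)) = u"
      using lin_\<pi>[OF y(1)] y(2) by simp
    then show "\<exists>w\<in>Free T (S (Suc (Suc k))). lin T ?d w = u"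
      using map_free[OF y(1)] by blast
  qed
qed

end


section \<open>Algebras with a finite basis\<close>

lemma ring_cong:
  assumes "ring M" "carrier N = carrier M" "monoid.mult N = monoid.mult M" "one N = one M" "add N = add M" "zero N = zero M"
  shows "ring N"
proof -
  interpret M: ring M by fact
  show ?thesis
  proof (rule ringI)
    show "abelian_group N"
      by (rule abelian_group_cong[OF M.is_abelian_group]) (use assms in simp_all)
    show "monoid N"
      by (rule monoidI) (use assms M.m_assoc in auto)
  qed (use assms M.l_distr M.r_distr in auto)
qed

lemma left_module_rank_one:
  assumes "ring A" "ring R" "\<alpha> \<in> ring_hom A R" "carrier N = carrier R" "add N = add R" "zero N = zero R"
    and smult: "\<And>a v. \<lbrakk>a \<in> carrier A; v \<in> carrier R\<rbrakk> \<Longrightarrow> a \<odot>\<^bsub>N\<^esub> v = \<alpha> a \<otimes>\<^bsub>R\<^esub> v"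
  shows "left_module A N"
proof -
  interpret h: ring_hom_ring A R \<alpha>
    using assms(1-3) by (intro ring_hom_ringI2)
  show ?thesis
  proof (intro left_module.intro left_module_axioms.intro)
    show "abelian_group N"
      by (rule abelian_group_cong[OF h.S.is_abelian_group]) (use assms in simp_all)
  qed (use assms(1,4,5) in \<open>auto simp: smult h.S.l_distr h.S.r_distr h.S.m_assoc\<close>)
qed

text \<open>A twisted monoid algebra: \<open>c_cocycle\<close> is the two-cocycle condition, which
  expresses associativity on basis elements. Brauer algebras, with powers of \<open>\<delta>\<close>
  as \<open>c\<close>, and group algebras, with \<open>c\<close> constantly 1, are
  instances.\<close>

locale finite_basis_algebra = cring R for R (structure) +
  fixes S :: "'x set" and c :: "'x \<Rightarrow> 'x \<Rightarrow> 'a" and \<mu> :: "'x \<Rightarrow> 'x \<Rightarrow> 'x" and e :: 'x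
  assumes finite_basis: "finite S"
    and c_closed: "\<lbrakk>x \<in> S; y \<in> S\<rbrakk> \<Longrightarrow> c x y \<in> carrier R"
    and \<mu>_closed: "\<lbrakk>x \<in> S; y \<in> S\<rbrakk> \<Longrightarrow> \<mu> x y \<in> S"
    and e_closed: "e \<in> S"
    and \<mu>_assoc: "\<lbrakk>x \<in> S; y \<in> S; z \<in> S\<rbrakk> \<Longrightarrow> \<mu> (\<mu> x y) z = \<mu> x (\<mu> y z)"
    and c_cocycle: "\<lbrakk>x \<in> S; y \<in> S; z \<in> S\<rbrakk> \<Longrightarrow> c x y \<otimes> c (\<mu> x y) z = c y z \<otimes> c x (\<mu> y z)"
    and \<mu>_unit: "x \<in> S \<Longrightarrow> \<mu> e x = x" "x \<in> S \<Longrightarrow> \<mu> x e = x"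
    and c_unit: "x \<in> S \<Longrightarrow> c e x = \<one>" "x \<in> S \<Longrightarrow> c x e = \<one>"
begin

abbreviation B where "B \<equiv> basis_algebra R S c \<mu> e"

lemma B_simps:
  "carrier B = Free R S" "zero B = (\<lambda>x. \<zero>)" "one B = single R e \<one>"
  "f \<oplus>\<^bsub>B\<^esub> g = (\<lambda>x. f x \<oplus> g x)" "a \<odot>\<^bsub>B\<^esub> f = (\<lambda>x. a \<otimes> f x)"
  by (simp_all add: basis_algebra_def free_module_def)

text \<open>Enlarging the index set from the supports to all pairs makes it independent of
  \<open>f\<close> and \<open>g\<close>, so that sums of products can be added termwise.\<close>

lemma mult_eq:
  assumes "f \<in> Free R S" "g \<in> Free R S"
  shows "(f \<otimes>\<^bsub>B\<^esub> g) z = (\<Oplus>p\<in>{p \<in> S \<times> S. \<mu> (fst p) (snd p) = z}. c (fst p) (snd p) \<otimes> (f (fst p) \<otimes> g (snd p)))"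
proof -
  have "(\<Oplus>p\<in>{(x, y). x \<in> S \<and> y \<in> S \<and> f x \<noteq> \<zero> \<and> g y \<noteq> \<zero> \<and> \<mu> x y = z}.
          c (fst p) (snd p) \<otimes> (f (fst p) \<otimes> g (snd p))) =
      (\<Oplus>p\<in>{p \<in> S \<times> S. \<mu> (fst p) (snd p) = z}. c (fst p) (snd p) \<otimes> (f (fst p) \<otimes> g (snd p)))"
    by (rule add.finprod_mono_neutral_cong_left)
      (use finite_basis c_closed free_value[OF assms(1)] free_value[OF assms(2)] in auto)
  then show ?thesis
    by (simp add: basis_algebra_def)
qed

lemma mult_support:
  assumes "(f \<otimes>\<^bsub>B\<^esub> g) z \<noteq> \<zero>"
  obtains x y where "x \<in> S" "y \<in> S" "f x \<noteq> \<zero>" "g y \<noteq> \<zero>" "\<mu> x y = z"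
proof -
  let ?P = "{(x, y). x \<in> S \<and> y \<in> S \<and> f x \<noteq> \<zero> \<and> g y \<noteq> \<zero> \<and> \<mu> x y = z}"
  have "?P \<noteq> {}"
  proof
    assume P: "?P = {}"
    have "(f \<otimes>\<^bsub>B\<^esub> g) z = (\<Oplus>p\<in>?P. c (fst p) (snd p) \<otimes> (f (fst p) \<otimes> g (snd p)))"
      by (simp add: basis_algebra_def)
    then show False using assms unfolding P by simp
  qed
  then show ?thesis using that by auto
qed

lemma mult_closed:
  assumes "f \<in> Free R S" "g \<in> Free R S"
  shows "f \<otimes>\<^bsub>B\<^esub> g \<in> Free R S"
proof -
  have "(f \<otimes>\<^bsub>B\<^esub> g) z \<in> carrier R" for z
    unfolding mult_eq[OF assms] using c_closed free_value[OF assms(1)] free_value[OF assms(2)]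
    by (intro finsum_closed) auto
  moreover have "(f \<otimes>\<^bsub>B\<^esub> g) z = \<zero>" if "z \<notin> S" for z
    using mult_support[of f g z] \<mu>_closed that by metis
  moreover from this have "finite {z. (f \<otimes>\<^bsub>B\<^esub> g) z \<noteq> \<zero>}"
    by (intro finite_subset[OF _ finite_basis]) auto
  ultimately show ?thesis
    by (auto simp: free_module_def)
qed

lemma mult_add_left:
  assumes "f \<in> Free R S" "f' \<in> Free R S" "g \<in> Free R S"
  shows "(\<lambda>x. f x \<oplus> f' x) \<otimes>\<^bsub>B\<^esub> g = (\<lambda>z. (f \<otimes>\<^bsub>B\<^esub> g) z \<oplus> (f' \<otimes>\<^bsub>B\<^esub> g) z)"
proof
  fix z
  let ?P = "{p \<in> S \<times> S. \<mu> (fst p) (snd p) = z}"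
  note v = free_value[OF assms(1)] free_value[OF assms(2)] free_value[OF assms(3)]
  have "((\<lambda>x. f x \<oplus> f' x) \<otimes>\<^bsub>B\<^esub> g) z
      = (\<Oplus>p\<in>?P. c (fst p) (snd p) \<otimes> (f (fst p) \<otimes> g (snd p)) \<oplus> c (fst p) (snd p) \<otimes> (f' (fst p) \<otimes> g (snd p)))"
    unfolding mult_eq[OF free_add[OF assms(1,2)] assms(3)]
    using c_closed v by (intro add.finprod_cong') (auto simp: l_distr r_distr)
  also have "\<dots> = (f \<otimes>\<^bsub>B\<^esub> g) z \<oplus> (f' \<otimes>\<^bsub>B\<^esub> g) z"
    unfolding mult_eq[OF assms(1,3)] mult_eq[OF assms(2,3)] using c_closed v by (intro finsum_addf) auto
  finally show "((\<lambda>x. f x \<oplus> f' x) \<otimes>\<^bsub>B\<^esub> g) z = (f \<otimes>\<^bsub>B\<^esub> g) z \<oplus> (f' \<otimes>\<^bsub>B\<^esub> g) z" .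
qed

lemma mult_add_right:
  assumes "f \<in> Free R S" "g \<in> Free R S" "g' \<in> Free R S"
  shows "f \<otimes>\<^bsub>B\<^esub> (\<lambda>x. g x \<oplus> g' x) = (\<lambda>z. (f \<otimes>\<^bsub>B\<^esub> g) z \<oplus> (f \<otimes>\<^bsub>B\<^esub> g') z)"
proof
  fix z
  let ?P = "{p \<in> S \<times> S. \<mu> (fst p) (snd p) = z}"
  note v = free_value[OF assms(1)] free_value[OF assms(2)] free_value[OF assms(3)]
  have "(f \<otimes>\<^bsub>B\<^esub> (\<lambda>x. g x \<oplus> g' x)) z
      = (\<Oplus>p\<in>?P. c (fst p) (snd p) \<otimes> (f (fst p) \<otimes> g (snd p)) \<oplus> c (fst p) (snd p) \<otimes> (f (fst p) \<otimes> g' (snd p)))"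
    unfolding mult_eq[OF assms(1) free_add[OF assms(2,3)]]
    using c_closed v by (intro add.finprod_cong') (auto simp: r_distr)
  also have "\<dots> = (f \<otimes>\<^bsub>B\<^esub> g) z \<oplus> (f \<otimes>\<^bsub>B\<^esub> g') z"
    unfolding mult_eq[OF assms(1,2)] mult_eq[OF assms(1,3)] using c_closed v by (intro finsum_addf) auto
  finally show "(f \<otimes>\<^bsub>B\<^esub> (\<lambda>x. g x \<oplus> g' x)) z = (f \<otimes>\<^bsub>B\<^esub> g) z \<oplus> (f \<otimes>\<^bsub>B\<^esub> g') z" .
qed

lemma mult_zero:
  "(\<lambda>x. \<zero>) \<otimes>\<^bsub>B\<^esub> g = (\<lambda>x. \<zero>)" "f \<otimes>\<^bsub>B\<^esub> (\<lambda>x. \<zero>) = (\<lambda>x. \<zero>)"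
  using mult_support[of "\<lambda>x. \<zero>" g] mult_support[of f "\<lambda>x. \<zero>"] by (auto simp: fun_eq_iff)

lemma mult_single:
  assumes "x \<in> S" "y \<in> S" "a \<in> carrier R" "b \<in> carrier R"
  shows "single R x a \<otimes>\<^bsub>B\<^esub> single R y b = single R (\<mu> x y) (c x y \<otimes> (a \<otimes> b))"
proof
  fix z
  let ?P = "{p \<in> S \<times> S. \<mu> (fst p) (snd p) = z}"
  have v: "single R x a t \<in> carrier R" "single R y b t \<in> carrier R" for t
    using assms by (simp_all add: single_def)
  show "(single R x a \<otimes>\<^bsub>B\<^esub> single R y b) z = single R (\<mu> x y) (c x y \<otimes> (a \<otimes> b)) z"
  proof (cases "\<mu> x y = z")
    case True
    have "(\<Oplus>p\<in>?P. c (fst p) (snd p) \<otimes> (single R x a (fst p) \<otimes> single R y b (snd p)))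
        = (\<Oplus>p\<in>{(x, y)}. c (fst p) (snd p) \<otimes> (single R x a (fst p) \<otimes> single R y b (snd p)))"
      by (rule add.finprod_mono_neutral_cong_right)
        (use assms True finite_basis c_closed v in \<open>auto simp: single_def\<close>)
    then show ?thesis
      unfolding mult_eq[OF free_single[OF assms(1,3)] free_single[OF assms(2,4)]]
      using assms c_closed True by (simp add: single_def)
  next
    case False
    have "(single R x a \<otimes>\<^bsub>B\<^esub> single R y b) z = \<zero>"
    proof (rule ccontr)
      assume "(single R x a \<otimes>\<^bsub>B\<^esub> single R y b) z \<noteq> \<zero>"
      then obtain x' y' where "single R x a x' \<noteq> \<zero>" "single R y b y' \<noteq> \<zero>" "\<mu> x' y' = z"
        by (rule mult_support)
      then show False using False by (auto simp: single_def split: if_splits)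
    qed
    then show ?thesis using False by (simp add: single_def)
  qed
qed

lemma bilinear_eqI:
  assumes f: "f \<in> Free R S" and zero: "P (\<lambda>x. \<zero>)"
    and single: "\<And>x a. \<lbrakk>x \<in> S; a \<in> carrier R\<rbrakk> \<Longrightarrow> P (single R x a)"
    and add: "\<And>u v. \<lbrakk>u \<in> Free R S; v \<in> Free R S; P u; P v\<rbrakk> \<Longrightarrow> P (\<lambda>x. u x \<oplus> v x)"
  shows "P f"
  using f by (induction rule: free_induct) (auto intro: zero single add free_single)

lemma mult_assoc:
  assumes f: "f \<in> Free R S" and g: "g \<in> Free R S"
    and h: "h \<in> Free R S"
  shows "(f \<otimes>\<^bsub>B\<^esub> g) \<otimes>\<^bsub>B\<^esub> h = f \<otimes>\<^bsub>B\<^esub> (g \<otimes>\<^bsub>B\<^esub> h)"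
proof -
  note cl = mult_closed free_single
  have 1: "(single R x a \<otimes>\<^bsub>B\<^esub> single R y b) \<otimes>\<^bsub>B\<^esub> single R z r = single R x a \<otimes>\<^bsub>B\<^esub> (single R y b \<otimes>\<^bsub>B\<^esub> single R z r)"
    if "x \<in> S" "y \<in> S" "z \<in> S" "a \<in> carrier R" "b \<in> carrier R" "r \<in> carrier R" for x y z a b r
  proof -
    have k: "c x y \<in> carrier R" "c (\<mu> x y) z \<in> carrier R" "c y z \<in> carrier R" "c x (\<mu> y z) \<in> carrier R"
      using that c_closed \<mu>_closed by auto
    have "c (\<mu> x y) z \<otimes> (c x y \<otimes> (a \<otimes> b) \<otimes> r) = (c x y \<otimes> c (\<mu> x y) z) \<otimes> (a \<otimes> (b \<otimes> r))"
      using k that by (simp add: m_ac)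
    also have "\<dots> = c x (\<mu> y z) \<otimes> (a \<otimes> (c y z \<otimes> (b \<otimes> r)))"
      unfolding c_cocycle[OF that(1-3)] using k that by (simp add: m_ac)
    finally show ?thesis
      using that k \<mu>_closed \<mu>_assoc by (simp add: mult_single)
  qed
  have 2: "(single R x a \<otimes>\<^bsub>B\<^esub> single R y b) \<otimes>\<^bsub>B\<^esub> h = single R x a \<otimes>\<^bsub>B\<^esub> (single R y b \<otimes>\<^bsub>B\<^esub> h)"
    if "x \<in> S" "y \<in> S" "a \<in> carrier R" "b \<in> carrier R" for x y a b
  proof -
    have s: "single R x a \<in> Free R S" "single R y b \<in> Free R S"
      using that by (auto intro!: free_single)
    show ?thesis
      using h by (rule bilinear_eqI)
        (use that 1 s mult_closed[OF s] mult_closed[OF s(2)] in \<open>auto simp: mult_zero mult_add_right\<close>)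
  qed
  have 3: "(single R x a \<otimes>\<^bsub>B\<^esub> g) \<otimes>\<^bsub>B\<^esub> h = single R x a \<otimes>\<^bsub>B\<^esub> (g \<otimes>\<^bsub>B\<^esub> h)"
    if "x \<in> S" "a \<in> carrier R" for x a
  proof -
    have s: "single R x a \<in> Free R S"
      using that by (rule free_single)
    show ?thesis
      using g by (rule bilinear_eqI)
        (use that 2 h s cl mult_closed[OF s] mult_closed[OF _ h] in
          \<open>auto simp: mult_zero mult_add_left mult_add_right\<close>)
  qed
  show ?thesis
    using f by (rule bilinear_eqI) (use 3 g h cl in \<open>auto simp: mult_zero mult_add_left\<close>)
qed

lemma mult_one:
  assumes "f \<in> Free R S"
  shows "single R e \<one> \<otimes>\<^bsub>B\<^esub> f = f" "f \<otimes>\<^bsub>B\<^esub> single R e \<one> = f"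
proof -
  note e1 = free_single[OF e_closed one_closed]
  show "single R e \<one> \<otimes>\<^bsub>B\<^esub> f = f"
    using assms by (rule bilinear_eqI)
      (use e1 e_closed in \<open>auto simp: mult_zero mult_add_right mult_single \<mu>_unit c_unit\<close>)
  show "f \<otimes>\<^bsub>B\<^esub> single R e \<one> = f"
    using assms by (rule bilinear_eqI)
      (use e1 e_closed in \<open>auto simp: mult_zero mult_add_left mult_single \<mu>_unit c_unit\<close>)
qed

lemma ring_B: "ring B"
proof (rule ringI)
  show "abelian_group B"
    by (rule abelian_group_cong[OF abelian_group_free[of S]]) (simp_all add: basis_algebra_def)
  show "monoid B"
    by (rule monoidI) (auto simp: B_simps mult_closed mult_assoc mult_one intro!: free_single e_closed)
qed (auto simp: B_simps mult_add_left mult_add_right)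

lemma module_B: "module R B"
proof (rule moduleI)
  show "cring R" by (rule is_cring)
  show "abelian_group B"
    by (rule ring.is_abelian_group[OF ring_B])
qed (auto simp: B_simps free_smult free_value l_distr r_distr m_assoc fun_eq_iff)

text \<open>Both sides of multiplicativity are additive in each factor, so multiples of basis
  elements suffice.\<close>

lemma ring_homI_basis:
  assumes T: "ring T"
    and closed: "\<And>f. f \<in> Free R S \<Longrightarrow> \<phi> f \<in> carrier T"
    and add: "\<And>f g. \<lbrakk>f \<in> Free R S; g \<in> Free R S\<rbrakk> \<Longrightarrow>
      \<phi> (\<lambda>x. f x \<oplus> g x) = \<phi> f \<oplus>\<^bsub>T\<^esub> \<phi> g"
    and mult: "\<And>x y a b. \<lbrakk>x \<in> S; y \<in> S; a \<in> carrier R; b \<in> carrier R\<rbrakk> \<Longrightarrow>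
      \<phi> (single R (\<mu> x y) (c x y \<otimes> (a \<otimes> b))) = \<phi> (single R x a) \<otimes>\<^bsub>T\<^esub> \<phi> (single R y b)"
    and one: "\<phi> (single R e \<one>) = \<one>\<^bsub>T\<^esub>"
  shows "\<phi> \<in> ring_hom B T"
proof -
  interpret T: ring T by fact
  have zero: "\<phi> (\<lambda>x. \<zero>) = \<zero>\<^bsub>T\<^esub>"
    using add[OF free_zero free_zero] closed[OF free_zero] by simp
  note cl = mult_closed free_single
  have 1: "\<phi> (single R x a \<otimes>\<^bsub>B\<^esub> g) = \<phi> (single R x a) \<otimes>\<^bsub>T\<^esub> \<phi> g"
    if "x \<in> S" "a \<in> carrier R" "g \<in> Free R S" for x a g
  proof -
    have s: "single R x a \<in> Free R S"
      using that(1,2) by (rule free_single)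
    show ?thesis
      using that(3) by (rule bilinear_eqI)
        (use that s closed[OF s] mult_closed[OF s] mult closed in
          \<open>auto simp: mult_zero zero mult_single mult_add_right add T.r_distr\<close>)
  qed
  have "\<phi> (f \<otimes>\<^bsub>B\<^esub> g) = \<phi> f \<otimes>\<^bsub>T\<^esub> \<phi> g"
    if "f \<in> Free R S" "g \<in> Free R S" for f g
    using that(1) by (rule bilinear_eqI)
      (use that cl 1 closed in \<open>auto simp: mult_zero zero mult_add_left add T.l_distr\<close>)
  then show ?thesis
    using closed add one by (intro ring_hom_memI) (auto simp: B_simps)
qed

end


section \<open>The Brauer algebra modulo \<open>I\<^sub>0\<close>\<close>

lemma (in ring) free_mono:
  "\<lbrakk>f \<in> Free R S; S \<subseteq> S'\<rbrakk> \<Longrightarrow> f \<in> Free R S'"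
  by (auto simp: free_module_def)

lemma sym_group_simps:
  "carrier (sym_group n) = {p. p permutes {1..n}}" "p \<otimes>\<^bsub>sym_group n\<^esub> q = p \<circ> q" "\<one>\<^bsub>sym_group n\<^esub> = id"
  by (simp_all add: sym_group_def)

locale brauer = cring R for R (structure) +
  fixes \<delta> :: 'a and n :: nat
  assumes \<delta>_closed: "\<delta> \<in> carrier R" and n_pos: "n > 0"

sublocale brauer \<subseteq> Br: finite_basis_algebra R "brauer_diagrams n" "\<lambda>x y. \<delta> [^] card (loops x y)" diagram_comp
  "identity_diagram n"
proof (unfold_locales, goal_cases)
  \<comment> \<open>This is \<open>c_cocycle\<close>: both exponents add up to the number of loops
    in the concatenation of three diagrams.\<close>
  case (6 x y z)
  have "\<delta> [^] card (loops x y) \<otimes> \<delta> [^] card (loops (diagram_comp x y) z)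
      = \<delta> [^] (card (loops x y) + card (loops (diagram_comp x y) z))"
    by (rule nat_pow_mult[OF \<delta>_closed])
  also have "\<dots> = \<delta> [^] (card (loops y z) + card (loops x (diagram_comp y z)))"
    using card_loops_assoc[of x n y z] 6 by (simp add: Union_brauer diagram_comp_closed)
  also have "\<dots> = \<delta> [^] card (loops y z) \<otimes> \<delta> [^] card (loops x (diagram_comp y z))"
    by (rule nat_pow_mult[OF \<delta>_closed, symmetric])
  finally show ?case .
qed (auto simp: finite_brauer_diagrams \<delta>_closed diagram_comp_closed identity_diagram_brauer diagram_comp_assoc
    identity_comp)

sublocale brauer \<subseteq> Sym: finite_basis_algebra R "carrier (sym_group n)" "\<lambda>x y. \<one>" "(\<otimes>\<^bsub>sym_group n\<^esub>)" "\<one>\<^bsub>sym_group n\<^esub>"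
  by unfold_locales (auto simp: sym_group_simps finite_permutations permutes_compose permutes_id o_assoc)

context brauer
begin

abbreviation Br where "Br \<equiv> Br.B"
abbreviation Sym where "Sym \<equiv> Sym.B"
abbreviation I0 where "I0 \<equiv> brauer_I0 R \<delta> n"
abbreviation A where "A \<equiv> quotient_module Br I0"
abbreviation coset where "coset f \<equiv> I0 +>\<^bsub>Br\<^esub> f"
abbreviation BrF where "BrF \<equiv> Free R (brauer_diagrams n)"

lemma brauer_algebra_eq: "brauer_algebra R \<delta> n = Br"
  by (simp add: brauer_algebra_def)

lemma group_algebra_eq: "group_algebra R (sym_group n) = Sym"
  by (simp add: group_algebra_def)

lemma I0_iff: "f \<in> I0 \<longleftrightarrow> f \<in> BrF \<and> (\<forall>d. has_left_right d \<longrightarrow> f d = \<zero>)"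
  by (simp add: brauer_I0_def brauer_algebra_eq Br.B_simps)

lemma Br_minus:
  assumes "f \<in> BrF" "g \<in> BrF"
  shows "(f \<ominus>\<^bsub>Br\<^esub> g) d = f d \<ominus> g d"
proof -
  interpret M: module R Br by (rule Br.module_B)
  have c: "f \<in> carrier Br" "g \<in> carrier Br" using assms by (simp_all add: Br.B_simps)
  have "f \<ominus>\<^bsub>Br\<^esub> g \<oplus>\<^bsub>Br\<^esub> g = f"
    using c by (simp add: M.minus_eq M.a_assoc M.l_neg)
  then have "(f \<ominus>\<^bsub>Br\<^esub> g) d \<oplus> g d = f d"
    by (metis Br.B_simps(4))
  moreover have "f \<ominus>\<^bsub>Br\<^esub> g \<in> BrF"
    using c M.minus_closed by (simp add: Br.B_simps(1))
  ultimately show ?thesis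
    using free_value assms(2) by (intro add_eq_imp_minus) auto
qed

lemma I0_submodule: "submodule I0 R Br"
proof -
  interpret M: module R Br by (rule Br.module_B)
  show ?thesis
  proof (rule M.submoduleI)
    show "\<ominus>\<^bsub>Br\<^esub> f \<in> I0" if f: "f \<in> I0" for f
    proof -
      have c: "f \<in> carrier Br" using f by (simp add: I0_iff Br.B_simps)
      have "\<ominus>\<^bsub>Br\<^esub> f = \<zero>\<^bsub>Br\<^esub> \<ominus>\<^bsub>Br\<^esub> f"
        using c by (simp add: M.minus_eq)
      then have "(\<ominus>\<^bsub>Br\<^esub> f) d = \<zero> \<ominus> f d" for d
        using Br_minus[of "\<zero>\<^bsub>Br\<^esub>" f d] f by (simp add: Br.B_simps I0_iff)
      moreover have "\<ominus>\<^bsub>Br\<^esub> f \<in> BrF"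
        using M.a_inv_closed[OF c] by (simp add: Br.B_simps(1))
      ultimately show ?thesis
        using f by (simp add: I0_iff minus_eq)
    qed
  qed (auto simp: I0_iff Br.B_simps free_add free_smult)
qed

sublocale Q: module_with_submodule R Br I0
  by (intro module_with_submodule.intro module_with_submodule_axioms.intro Br.module_B I0_submodule)

text \<open>Products are supported on composites, and a composite with a left-to-right edge has such
  an edge in both factors.\<close>

lemma I0_ideal: "ideal I0 Br"
proof (rule idealI)
  show "ring Br" by (rule Br.ring_B)
  show "subgroup I0 (add_monoid Br)" by (rule submodule.axioms(1)[OF I0_submodule])
  fix f g assume fg: "f \<in> I0" "g \<in> carrier Br"
  then have c: "f \<in> BrF" "g \<in> BrF" by (simp_all add: I0_iff Br.B_simps)
  have "(g \<otimes>\<^bsub>Br\<^esub> f) d = \<zero>" if d: "has_left_right d" for d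
  proof (rule ccontr)
    assume "(g \<otimes>\<^bsub>Br\<^esub> f) d \<noteq> \<zero>"
    then obtain x y where "x \<in> brauer_diagrams n" "y \<in> brauer_diagrams n" "f y \<noteq> \<zero>" "diagram_comp x y = d"
      by (rule Br.mult_support)
    then show False using has_left_right_compD(2) d fg(1) by (auto simp: I0_iff)
  qed
  then show "g \<otimes>\<^bsub>Br\<^esub> f \<in> I0"
    using Br.mult_closed[OF c(2,1)] by (simp add: I0_iff)
  have "(f \<otimes>\<^bsub>Br\<^esub> g) d = \<zero>" if d: "has_left_right d" for d
  proof (rule ccontr)
    assume "(f \<otimes>\<^bsub>Br\<^esub> g) d \<noteq> \<zero>"
    then obtain x y where "x \<in> brauer_diagrams n" "y \<in> brauer_diagrams n" "f x \<noteq> \<zero>" "diagram_comp x y = d"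
      by (rule Br.mult_support)
    then show False using has_left_right_compD(1) d fg(1) by (auto simp: I0_iff)
  qed
  then show "f \<otimes>\<^bsub>Br\<^esub> g \<in> I0"
    using Br.mult_closed[OF c] by (simp add: I0_iff)
qed

lemma ring_A: "ring A"
  by (rule ring_cong[OF ideal.quotient_is_ring[OF I0_ideal]]) (simp_all add: FactRing_def)

lemma A_carrier: "carrier A = coset ` BrF"
  using Q.quotient_carrier by (simp add: Br.B_simps del: quotient_module_simps)

lemma coset_ops:
  assumes "f \<in> BrF" "g \<in> BrF"
  shows "coset f \<oplus>\<^bsub>A\<^esub> coset g = coset (\<lambda>x. f x \<oplus> g x)"
    and "coset f \<otimes>\<^bsub>A\<^esub> coset g = coset (f \<otimes>\<^bsub>Br\<^esub> g)"
    and "r \<in> carrier R \<Longrightarrow> r \<odot>\<^bsub>A\<^esub> coset f = coset (\<lambda>x. r \<otimes> f x)"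
  using assms Q.quotient_add[of f g] Q.quotient_smult[of r f] ideal.rcoset_mult_add[OF I0_ideal, of f g]
  by (simp_all add: Br.B_simps)

lemma A_one: "\<one>\<^bsub>A\<^esub> = coset (single R (identity_diagram n) \<one>)"
  by (simp add: Br.B_simps)

lemma A_zero: "\<zero>\<^bsub>A\<^esub> = coset (\<lambda>x. \<zero>)"
  using Q.quotient_zero by (simp add: Br.B_simps)

lemma coset_eq_iff:
  assumes "f \<in> BrF" "g \<in> BrF"
  shows "coset f = coset g \<longleftrightarrow> (\<forall>d. has_left_right d \<longrightarrow> f d = g d)"
proof -
  have "f \<ominus>\<^bsub>Br\<^esub> g \<in> BrF"
    using Q.M.minus_closed[of f g] assms by (simp add: Br.B_simps(1))
  moreover have "f d \<ominus> g d = \<zero> \<longleftrightarrow> f d = g d" for d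
    using minus_add_cancel[OF free_value[OF assms(1)] free_value[OF assms(2)], of d d] free_value[OF assms(2)]
    by (auto simp: minus_eq r_neg)
  ultimately show ?thesis
    using Q.coset_eq_iff[of f g] assms by (simp add: Br.B_simps(1) I0_iff Br_minus)
qed

lemma coset_closed: "f \<in> BrF \<Longrightarrow> coset f \<in> carrier A"
  unfolding A_carrier by blast


subsection \<open>The quotient onto the group algebra\<close>

definition to_group_algebra :: "(diagram \<Rightarrow> 'a) \<Rightarrow> (nat \<Rightarrow> nat) \<Rightarrow> 'a" where
  "to_group_algebra f = (\<lambda>p. if p permutes {1..n} then f (perm_diagram n p) else \<zero>)"

definition total :: "((nat \<Rightarrow> nat) \<Rightarrow> 'a) \<Rightarrow> 'a" where
  "total g = (\<Oplus>p\<in>carrier (sym_group n). g p)"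

lemma total_single:
  assumes "p \<in> carrier (sym_group n)" "a \<in> carrier R"
  shows "total (single R p a) = a"
proof -
  have "total (single R p a) = (\<Oplus>q\<in>{p}. single R p a q)"
    unfolding total_def
    by (rule add.finprod_mono_neutral_cong_right) (use assms Sym.finite_basis in \<open>auto simp: single_def\<close>)
  then show ?thesis using assms by (simp add: single_def)
qed

lemma total_zero: "total \<zero>\<^bsub>Sym\<^esub> = \<zero>"
  by (simp add: Sym.B_simps(2) total_def)

lemma total_hom: "total \<in> ring_hom Sym R"
proof (rule Sym.ring_homI_basis[OF ring_axioms])
  show "total f \<in> carrier R" if "f \<in> Free R (carrier (sym_group n))" for f
    unfolding total_def using free_value[OF that] by (intro finsum_closed) auto
  show "total (\<lambda>x. f x \<oplus> g x) = total f \<oplus> total g"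
    if "f \<in> Free R (carrier (sym_group n))" "g \<in> Free R (carrier (sym_group n))" for f g
    unfolding total_def using free_value[OF that(1)] free_value[OF that(2)] by (intro finsum_addf) auto
qed (use Sym.\<mu>_closed Sym.e_closed in \<open>auto simp: total_single\<close>)

lemma to_group_algebra_closed:
  assumes "f \<in> BrF"
  shows "to_group_algebra f \<in> Free R (carrier (sym_group n))"
proof -
  have "finite {p. to_group_algebra f p \<noteq> \<zero>}"
    by (rule finite_subset[OF _ Sym.finite_basis]) (auto simp: to_group_algebra_def sym_group_simps split: if_splits)
  then show ?thesis
    using free_value[OF assms] by (auto simp: free_module_def to_group_algebra_def sym_group_simps)
qed

lemma to_group_algebra_single_perm:
  assumes "p permutes {1..n}"
  shows "to_group_algebra (single R (perm_diagram n p) a) = single R p a"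
  using assms perm_diagram_inj[OF _ assms] by (auto simp: to_group_algebra_def single_def)

lemma to_group_algebra_single_other:
  assumes "\<And>p. p permutes {1..n} \<Longrightarrow> x \<noteq> perm_diagram n p"
  shows "to_group_algebra (single R x a) = (\<lambda>p. \<zero>)"
  using assms by (fastforce simp: to_group_algebra_def single_def)

lemma to_group_algebra_hom: "to_group_algebra \<in> ring_hom Br Sym"
proof (rule Br.ring_homI_basis[OF Sym.ring_B])
  fix x y a b assume xy: "x \<in> brauer_diagrams n" "y \<in> brauer_diagrams n" and ab: "a \<in> carrier R" "b \<in> carrier R"
  let ?m = "\<delta> [^] card (loops x y) \<otimes> (a \<otimes> b)"
  show "to_group_algebra (single R (diagram_comp x y) ?m)
      = to_group_algebra (single R x a) \<otimes>\<^bsub>Sym\<^esub> to_group_algebra (single R y b)"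
  \<comment> \<open>These are the edges that persist in the composite, and each of them makes both
    sides zero. Without them both factors are permutations, since a diagram missing either kind of
    one-sided edge is one.\<close>
  proof (cases "has_left_left x \<or> has_right_right y")
    case True
    have "has_left_left (diagram_comp x y) \<or> has_right_right (diagram_comp x y)"
      using True left_edges_comp[OF xy(1), of y] has_right_right_comp[OF xy(2)] left_edges_empty_iff[OF xy(1)]
        left_edges_empty_iff[OF diagram_comp_closed[OF xy]] by blast
    then have "diagram_comp x y \<noteq> perm_diagram n p" for p
      using perm_diagram_no_left_left by metis
    then have "to_group_algebra (single R (diagram_comp x y) ?m) = (\<lambda>p. \<zero>)"
      by (rule to_group_algebra_single_other)
    moreover have "to_group_algebra (single R x a) = (\<lambda>p. \<zero>) \<or> to_group_algebra (single R y b) = (\<lambda>p. \<zero>)"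
      using True to_group_algebra_single_other perm_diagram_no_left_left by metis
    ultimately show ?thesis
      using Sym.mult_zero by metis
  next
    case False
    then obtain p q where p: "p permutes {1..n}" "x = perm_diagram n p" and q: "q permutes {1..n}" "y = perm_diagram n q"
      using no_left_left_imp_perm[OF xy(1)] no_right_right_imp_perm[OF xy(2)] by blast
    have "p \<circ> q permutes {1..n}"
      by (rule permutes_compose[OF q(1) p(1)])
    then show ?thesis
      using p q ab Sym.mult_single[of p q a b] perm_diagram_comp[OF p(1) q(1)]
      by (simp add: to_group_algebra_single_perm sym_group_simps)
  qed
next
  show "to_group_algebra (single R (identity_diagram n) \<one>) = \<one>\<^bsub>Sym\<^esub>"
    unfolding identity_diagram_eq Sym.B_simps(3) unfolding sym_group_simps(3)
    by (rule to_group_algebra_single_perm[OF permutes_id])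
qed (auto simp: Sym.B_simps to_group_algebra_closed, auto simp: to_group_algebra_def)

definition quot_hom :: "(diagram \<Rightarrow> 'a) set \<Rightarrow> (nat \<Rightarrow> nat) \<Rightarrow> 'a" where
  "quot_hom X = to_group_algebra (SOME f. f \<in> X)"

text \<open>Because \<open>n > 0\<close>, permutation diagrams have a left-to-right edge, so a coset
  of \<open>I\<^sub>0\<close> determines the coefficients at them.\<close>

lemma to_group_algebra_cong:
  assumes "f \<in> BrF" "g \<in> BrF" "coset f = coset g"
  shows "to_group_algebra f = to_group_algebra g"
  using assms(3) perm_diagram_has_left_right[OF n_pos]
  unfolding coset_eq_iff[OF assms(1,2)] by (auto simp: to_group_algebra_def)

lemma quot_hom_coset:
  assumes "f \<in> BrF"
  shows "quot_hom (coset f) = to_group_algebra f"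
proof -
  have c: "f \<in> carrier Br" using assms by (simp add: Br.B_simps)
  define g where "g = (SOME g. g \<in> coset f)"
  have "g \<in> coset f"
    unfolding g_def by (rule someI[of "\<lambda>g. g \<in> coset f"], rule Q.coset_self[OF c])
  then have "g \<in> BrF" "coset g = coset f"
    using Q.coset_memD(1,2)[OF c] by (simp_all add: Br.B_simps(1))
  then show ?thesis
    using to_group_algebra_cong[OF _ assms] by (simp add: quot_hom_def g_def)
qed

lemma quot_hom_hom: "quot_hom \<in> ring_hom A Sym"
proof (rule ring_hom_memI)
  fix X assume "X \<in> carrier A"
  then obtain f where f: "f \<in> BrF" "X = coset f" unfolding A_carrier by blast
  then show "quot_hom X \<in> carrier Sym"
    by (simp add: quot_hom_coset to_group_algebra_closed Sym.B_simps)
  fix Y assume "Y \<in> carrier A"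
  then obtain g where g: "g \<in> BrF" "Y = coset g" unfolding A_carrier by blast
  have c: "f \<in> carrier Br" "g \<in> carrier Br" using f g by (simp_all add: Br.B_simps)
  show "quot_hom (X \<otimes>\<^bsub>A\<^esub> Y) = quot_hom X \<otimes>\<^bsub>Sym\<^esub> quot_hom Y"
    unfolding f(2) g(2) coset_ops(2)[OF f(1) g(1)]
    using ring_hom_mult[OF to_group_algebra_hom c] Br.mult_closed[OF f(1) g(1)] f(1) g(1)
    by (simp add: quot_hom_coset)
  show "quot_hom (X \<oplus>\<^bsub>A\<^esub> Y) = quot_hom X \<oplus>\<^bsub>Sym\<^esub> quot_hom Y"
    unfolding f(2) g(2) coset_ops(1)[OF f(1) g(1)]
    using ring_hom_add[OF to_group_algebra_hom c] free_add[OF f(1) g(1)] f(1) g(1)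
    by (simp add: quot_hom_coset Br.B_simps(4))
next
  show "quot_hom \<one>\<^bsub>A\<^esub> = \<one>\<^bsub>Sym\<^esub>"
    unfolding A_one using ring_hom_one[OF to_group_algebra_hom] free_single[OF Br.e_closed one_closed]
    by (simp add: quot_hom_coset Br.B_simps(3))
qed

lemma quot_hom_surj: "quot_hom ` carrier A = carrier Sym"
proof
  show "quot_hom ` carrier A \<subseteq> carrier Sym"
    using ring_hom_closed[OF quot_hom_hom] by blast
  have "g \<in> to_group_algebra ` BrF" if g: "g \<in> Free R (carrier (sym_group n))" for g
    using g
  proof (rule Sym.bilinear_eqI)
    show "(\<lambda>x. \<zero>) \<in> to_group_algebra ` BrF"
      by (rule image_eqI[of _ _ "\<lambda>x. \<zero>"]) (auto simp: to_group_algebra_def)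
    show "single R p a \<in> to_group_algebra ` BrF" if "p \<in> carrier (sym_group n)" "a \<in> carrier R" for p a
      using that free_single[OF perm_diagram_brauer] to_group_algebra_single_perm
      by (intro image_eqI[of _ _ "single R (perm_diagram n p) a"]) (auto simp: sym_group_simps)
    show "(\<lambda>x. u x \<oplus> v x) \<in> to_group_algebra ` BrF"
      if "u \<in> to_group_algebra ` BrF" "v \<in> to_group_algebra ` BrF" for u v
    proof -
      obtain f h where "u = to_group_algebra f" "f \<in> BrF" "v = to_group_algebra h" "h \<in> BrF"
        using \<open>u \<in> _\<close> \<open>v \<in> _\<close> by blast
      then show ?thesis
        by (intro image_eqI[of _ _ "\<lambda>x. f x \<oplus> h x"]) (auto simp: to_group_algebra_def free_add)
    qed
  qed
  then show "carrier Sym \<subseteq> quot_hom ` carrier A"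
    unfolding A_carrier Sym.B_simps image_image using quot_hom_coset by (metis (no_types, lifting) image_cong subsetI)
qed


subsection \<open>The trivial modules\<close>

abbreviation triv where "triv \<equiv> over_quotient (brauer_trivial_module R n)"
abbreviation sym_triv where "sym_triv \<equiv> group_trivial_module R (sym_group n)"

definition aug :: "(diagram \<Rightarrow> 'a) set \<Rightarrow> 'a" where
  "aug X = total (quot_hom X)"

lemma aug_hom: "aug \<in> ring_hom A R"
proof -
  have "aug = total \<circ> quot_hom" by (simp add: aug_def fun_eq_iff)
  then show ?thesis
    using ring_hom_trans[OF quot_hom_hom total_hom] by simp
qed

text \<open>The augmentation of \<open>A\<close> factors through the group algebra. Hence tensoring
  a resolution over \<open>A\<close> with the trivial module, or first dividing by \<open>J\<close>
  and then tensoring over the group algebra, gives the same complex.\<close>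

lemma base_change_aug: "base_change total (base_change quot_hom \<kappa>) = base_change aug \<kappa>"
  by (simp add: base_change_def aug_def)

lemma aug_coset: "f \<in> BrF \<Longrightarrow> aug (coset f) = total (to_group_algebra f)"
  by (simp add: aug_def quot_hom_coset)

lemma triv_simps: "carrier triv = carrier R" "add triv = add R" "zero triv = \<zero>"
  by (simp_all add: over_quotient_def brauer_trivial_module_def rank_one_module_def)

lemma sym_triv_simps: "carrier sym_triv = carrier R" "add sym_triv = add R" "zero sym_triv = \<zero>"
  "a \<odot>\<^bsub>sym_triv\<^esub> v = total a \<otimes> v"
  by (simp_all add: group_trivial_module_def rank_one_module_def total_def)

text \<open>The diagrams that act as 1 are exactly the permutation diagrams.\<close>

lemma trivial_action:
  assumes "f \<in> BrF"
  shows "f \<odot>\<^bsub>brauer_trivial_module R n\<^esub> v = total (to_group_algebra f) \<otimes> v"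
proof -
  have "{d \<in> brauer_diagrams n. \<not> has_left_left d \<and> \<not> has_right_right d} = perm_diagram n ` carrier (sym_group n)"
    using no_left_left_imp_perm perm_diagram_brauer perm_diagram_no_left_left by (auto simp: sym_group_simps)
  moreover have "(\<Oplus>x\<in>perm_diagram n ` carrier (sym_group n). f x)
      = (\<Oplus>p\<in>carrier (sym_group n). f (perm_diagram n p))"
    using free_value[OF assms] perm_diagram_inj
    by (intro add.finprod_reindex) (auto simp: inj_on_def sym_group_simps)
  moreover have "\<dots> = total (to_group_algebra f)"
    unfolding total_def using free_value[OF assms]
    by (intro add.finprod_cong') (auto simp: to_group_algebra_def sym_group_simps)
  ultimately show ?thesis
    by (simp add: brauer_trivial_module_def rank_one_module_def)
qed

text \<open>All elements of a coset act alike, because the action factors through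
  \<open>to_group_algebra\<close>; so the image taken in \<open>over_quotient\<close> is a
  singleton.\<close>

lemma triv_smult:
  assumes "X \<in> carrier A"
  shows "X \<odot>\<^bsub>triv\<^esub> v = aug X \<otimes> v"
proof -
  obtain f where f: "f \<in> BrF" "X = coset f"
    using assms unfolding A_carrier by blast
  then have c: "f \<in> carrier Br" by (simp add: Br.B_simps)
  have "g \<odot>\<^bsub>brauer_trivial_module R n\<^esub> v = aug X \<otimes> v" if "g \<in> X" for g
  proof -
    have "g \<in> BrF" "coset g = X"
      using Q.coset_memD(1,2)[OF c, of g] that f by (simp_all add: Br.B_simps(1))
    then show ?thesis
      using trivial_action aug_coset by metis
  qed
  then have "(\<lambda>g. g \<odot>\<^bsub>brauer_trivial_module R n\<^esub> v) ` X = (\<lambda>g. aug X \<otimes> v) ` X"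
    by (rule image_cong[OF refl])
  also have "\<dots> = {aug X \<otimes> v}"
    using Q.coset_self[OF c] f(2) by auto
  finally have "(\<lambda>g. g \<odot>\<^bsub>brauer_trivial_module R n\<^esub> v) ` X = {aug X \<otimes> v}" .
  then show ?thesis
    by (simp add: over_quotient_def)
qed

lemma left_module_triv: "left_module A triv"
  by (rule left_module_rank_one[OF ring_A ring_axioms aug_hom]) (simp_all add: triv_simps triv_smult del: quotient_module_simps)

lemma left_module_sym_triv: "left_module Sym sym_triv"
  by (rule left_module_rank_one[OF Sym.ring_B ring_axioms total_hom]) (simp_all add: sym_triv_simps)

lemma augmented_A: "augmented_algebra R A aug triv"
proof (intro augmented_algebra.intro augmented_algebra_axioms.intro change_of_rings.intro change_of_rings_axioms.intro
    is_cring ring_A ring_axioms aug_hom)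
  note id = free_single[OF Br.e_closed one_closed]
  fix r assume r: "r \<in> carrier R"
  have eq: "r \<odot>\<^bsub>A\<^esub> \<one>\<^bsub>A\<^esub> = coset (\<lambda>x. r \<otimes> single R (identity_diagram n) \<one> x)"
    unfolding A_one by (rule coset_ops(3)[OF id id r])
  show "r \<odot>\<^bsub>A\<^esub> \<one>\<^bsub>A\<^esub> \<in> carrier A"
    unfolding eq by (rule coset_closed[OF free_smult[OF id r]])
  have "(\<lambda>x. r \<otimes> single R (identity_diagram n) \<one> x) = single R (perm_diagram n id) r"
    using r by (auto simp: single_def identity_diagram_eq)
  then show "aug (r \<odot>\<^bsub>A\<^esub> \<one>\<^bsub>A\<^esub>) = r"
    unfolding eq using aug_coset[OF free_smult[OF id r]] r
    by (simp add: to_group_algebra_single_perm permutes_id total_single sym_group_simps)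
qed (simp_all add: triv_simps triv_smult del: quotient_module_simps)

lemma augmented_Sym: "augmented_algebra R Sym total sym_triv"
proof (intro augmented_algebra.intro augmented_algebra_axioms.intro change_of_rings.intro change_of_rings_axioms.intro
    is_cring Sym.ring_B ring_axioms total_hom)
  fix r assume r: "r \<in> carrier R"
  have eq: "r \<odot>\<^bsub>Sym\<^esub> \<one>\<^bsub>Sym\<^esub> = single R \<one>\<^bsub>sym_group n\<^esub> r"
    using r by (auto simp: Sym.B_simps single_def)
  show "r \<odot>\<^bsub>Sym\<^esub> \<one>\<^bsub>Sym\<^esub> \<in> carrier Sym"
    unfolding eq Sym.B_simps(1) by (rule free_single[OF Sym.e_closed r])
  show "total (r \<odot>\<^bsub>Sym\<^esub> \<one>\<^bsub>Sym\<^esub>) = r"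
    unfolding eq by (rule total_single[OF Sym.e_closed r])
qed (simp_all add: sym_triv_simps)


subsection \<open>Right ideals spanned by diagrams\<close>

definition D :: "node set set set \<Rightarrow> diagram set" where
  "D V = {d \<in> brauer_diagrams n. has_left_right d \<and> left_edges d \<in> V}"

definition K :: "node set set set \<Rightarrow> (diagram \<Rightarrow> 'a) set set" where
  "K V = coset ` Free R (D V)"

text \<open>The empty set is excluded because it belongs to the permutations; with this choice
  \<open>K LE\<close> is the ideal \<open>J\<close>, see \<open>kernel_quot_hom\<close>.\<close>

definition LE :: "node set set set" where
  "LE = {left_edges d | d. d \<in> brauer_diagrams n \<and> has_left_right d \<and> left_edges d \<noteq> {}}"

text \<open>Diagrams without left-to-right edges are included: the left unit is constructed in
  \<open>Br\<close>, before \<open>I\<^sub>0\<close> is divided out, and there all diagrams above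
  \<open>S\<close> together span a right ideal.\<close>

definition above :: "node set set \<Rightarrow> diagram set" where
  "above S = {d \<in> brauer_diagrams n. S \<subseteq> left_edges d}"

text \<open>Upward closed among the sets that occur in \<open>J\<close>; this is the condition that
  makes \<open>K V\<close> a right ideal.\<close>

definition up_closed :: "node set set set \<Rightarrow> bool" where
  "up_closed V \<longleftrightarrow> V \<subseteq> LE \<and> (\<forall>S\<in>V. \<forall>T\<in>LE. S \<subseteq> T \<longrightarrow> T \<in> V)"

lemma finite_LE: "finite LE"
  by (rule finite_subset[of _ "left_edges ` brauer_diagrams n"]) (auto simp: LE_def finite_brauer_diagrams)

lemma D_F: "f \<in> Free R (D V) \<Longrightarrow> f \<in> BrF"
  by (erule free_mono) (auto simp: D_def)

lemma above_F: "f \<in> Free R (above S) \<Longrightarrow> f \<in> BrF"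
  by (erule free_mono) (auto simp: above_def)

text \<open>Dropping the coefficients at diagrams without left-to-right edges does not change the
  coset, so only the other diagrams have to be checked.\<close>

lemma K_I:
  assumes f: "f \<in> BrF" and V: "\<And>d. \<lbrakk>d \<in> brauer_diagrams n; has_left_right d; f d \<noteq> \<zero>\<rbrakk> \<Longrightarrow> left_edges d \<in> V"
  shows "coset f \<in> K V"
proof -
  define g where "g = (\<lambda>d. if has_left_right d then f d else \<zero>)"
  have "finite {d. g d \<noteq> \<zero>}"
    by (rule finite_subset[OF _ finite_brauer_diagrams[of n]]) (use f in \<open>auto simp: g_def free_module_def split: if_splits\<close>)
  then have g: "g \<in> Free R (D V)"
    using V free_value[OF f] f by (auto simp: free_module_def g_def D_def)
  have "coset f = coset g"
    using coset_eq_iff[OF f D_F[OF g]] by (simp add: g_def)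
  then show ?thesis
    using g by (simp add: K_def)
qed

lemma K_subset: "K V \<subseteq> carrier A"
  using D_F coset_closed by (auto simp: K_def)

lemma K_E:
  assumes "X \<in> K V"
  obtains f where "f \<in> Free R (D V)" "f \<in> BrF" "X = coset f"
  using assms D_F by (auto simp: K_def)

lemma free_outside: "\<lbrakk>f \<in> Free R S; f x \<noteq> \<zero>\<rbrakk> \<Longrightarrow> x \<in> S"
  by (auto simp: free_module_def)

lemma K_mono: "V \<subseteq> W \<Longrightarrow> K V \<subseteq> K W"
  unfolding K_def D_def by (intro image_mono subsetI) (erule free_mono, auto)

text \<open>Multiplication on the right can only add left edges, and \<open>V\<close> is closed
  under passing to larger sets that occur.\<close>

lemma right_ideal_K:
  assumes V: "up_closed V"
  shows "right_ideal A (K V)"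
proof -
  interpret A: ring A by (rule ring_A)
  have mult: "X \<otimes>\<^bsub>A\<^esub> Y \<in> K V" if XY: "X \<in> K V" "Y \<in> carrier A" for X Y
  proof -
    obtain f where f: "f \<in> Free R (D V)" "f \<in> BrF" "X = coset f"
      using XY(1) by (rule K_E)
    obtain g where g: "g \<in> BrF" "Y = coset g"
      using XY(2) unfolding A_carrier by blast
    show ?thesis
      unfolding f(3) g(2) coset_ops(2)[OF f(2) g(1)]
    proof (rule K_I[OF Br.mult_closed[OF f(2) g(1)]])
      fix d assume d: "d \<in> brauer_diagrams n" "has_left_right d" "(f \<otimes>\<^bsub>Br\<^esub> g) d \<noteq> \<zero>"
      from d(3) obtain x y where xy: "x \<in> brauer_diagrams n" "y \<in> brauer_diagrams n" "f x \<noteq> \<zero>" "diagram_comp x y = d"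
        by (rule Br.mult_support)
      have x: "left_edges x \<in> V"
        using free_outside[OF f(1) xy(3)] by (simp add: D_def)
      have "left_edges x \<subseteq> left_edges d"
        using left_edges_comp[OF xy(1)] xy(4) by blast
      moreover have "left_edges x \<noteq> {}"
        using x V by (auto simp: up_closed_def LE_def)
      ultimately have "left_edges d \<in> LE"
        using d by (auto simp: LE_def)
      then show "left_edges d \<in> V"
        using V x \<open>left_edges x \<subseteq> left_edges d\<close> unfolding up_closed_def by blast
    qed
  qed
  show ?thesis
    unfolding right_ideal_def
  proof (intro conjI ballI K_subset)
    show "\<zero>\<^bsub>A\<^esub> \<in> K V"
      unfolding A_zero by (rule K_I) auto
    show "X \<oplus>\<^bsub>A\<^esub> Y \<in> K V" if XY: "X \<in> K V" "Y \<in> K V" for X Y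
    proof -
      obtain f where f: "f \<in> Free R (D V)" "f \<in> BrF" "X = coset f"
        using XY(1) by (rule K_E)
      obtain g where g: "g \<in> Free R (D V)" "g \<in> BrF" "Y = coset g"
        using XY(2) by (rule K_E)
      show ?thesis
        unfolding f(3) g(3) coset_ops(1)[OF f(2) g(2)] K_def by (rule imageI[OF free_add[OF f(1) g(1)]])
    qed
    show "\<ominus>\<^bsub>A\<^esub> X \<in> K V" if X: "X \<in> K V" for X
    proof -
      have "X \<in> carrier A" using X K_subset by blast
      then have "\<ominus>\<^bsub>A\<^esub> X = X \<otimes>\<^bsub>A\<^esub> (\<ominus>\<^bsub>A\<^esub> \<one>\<^bsub>A\<^esub>)"
        using A.r_minus[OF _ A.one_closed, of X] A.r_one by metis
      then show ?thesis
        using mult[OF X A.a_inv_closed[OF A.one_closed]] by metis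
    qed
    show "X \<otimes>\<^bsub>A\<^esub> Y \<in> K V" if "X \<in> K V" "Y \<in> carrier A" for X Y
      using that by (rule mult)
  qed
qed

text \<open>
  The product of the hook diagrams of the edges in \<open>S\<close>, all with the same auxiliary node \<open>k\<close>, which exists since
  \<open>d\<close> has a left-to-right edge.
\<close>

lemma left_unit_exists:
  assumes d: "d \<in> brauer_diagrams n" "has_left_right d" and S: "S \<subseteq> left_edges d"
  shows "\<exists>f\<in>Free R (above S). \<forall>x\<in>Free R (above S). f \<otimes>\<^bsub>Br\<^esub> x = x"
proof -
  obtain k j where k: "{Lft k, Rgt j} \<in> d"
    using d(2) unfolding has_left_right_def by blast
  have k_mem: "k \<in> {1..n}"
    using brauer_edge(1)[OF d(1) k] by (auto simp: nodes_def)
  \<comment> \<open>The node \<open>k\<close> is joined to a right node in \<open>d\<close>, so no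
    left edge of \<open>d\<close>, and in particular none in \<open>S\<close>, ends there.\<close>
  have k_free: "i \<noteq> k" if "{Lft i, Lft i'} \<in> d" for i i'
    using brauer_unique[OF d(1) k, of "Lft i'"] that by auto
  have "finite (left_edges d)"
    using finite_subset[of "left_edges d" "Pow (nodes n)"] Union_brauer[OF d(1)] finite_nodes[of n]
    by (auto simp: left_edges_def)
  then have "finite S" using S by (rule finite_subset[rotated])
  then show ?thesis
    using S
  proof (induction S)
    case empty
    have "above {} = brauer_diagrams n" by (simp add: above_def)
    then show ?case
      using Br.mult_one(1) free_single[OF Br.e_closed one_closed] by (intro bexI[of _ "single R (identity_diagram n) \<one>"]) auto
  next
    case (insert s S)
    then obtain f where f: "f \<in> Free R (above S)"
      "\<And>x. x \<in> Free R (above S) \<Longrightarrow> f \<otimes>\<^bsub>Br\<^esub> x = x"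
      by blast
    have "s \<in> left_edges d" using insert.prems by blast
    then obtain a b where ab: "s = {Lft a, Lft b}" "a \<in> {1..n}" "b \<in> {1..n}" "a \<noteq> b" "s \<in> d"
      by (rule left_edgesE[OF d(1)])
    have "a \<noteq> k" "b \<noteq> k"
      using k_free[of a b] k_free[of b a] ab(1,5) by (auto simp: insert_commute)
    then interpret hook n a b k
      using ab k_mem by unfold_locales auto
    define h where "h = single R (hook_diagram n a b k) \<one>"
    have h: "h \<in> BrF"
      unfolding h_def by (rule free_single[OF hook_diagram_brauer one_closed])
    have sub: "insert s S \<subseteq> left_edges (diagram_comp (hook_diagram n a b k) y)" if y: "y \<in> above S" for y
    proof -
      have yb: "y \<in> brauer_diagrams n" using y by (simp add: above_def)
      have "t \<in> left_edges (diagram_comp (hook_diagram n a b k) y)" if t: "t \<in> S" for t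
      proof -
        have "t \<in> left_edges d" using t insert.prems by blast
        then obtain i i' where i: "t = {Lft i, Lft i'}" "t \<in> d"
          by (rule left_edgesE[OF d(1)])
        have ne: "t \<noteq> s" using t insert.hyps by blast
        \<comment> \<open>Distinct edges of \<open>d\<close> share no node, so the hook for
          \<open>s\<close> is straight at the ends of every other edge of \<open>S\<close> and
          leaves that edge in place.\<close>
        have disj: "c \<notin> {a, b, k}" if c: "{Lft c, Lft c'} = t" for c c'
        proof -
          have "c \<noteq> a" using brauer_unique[OF d(1), of "Lft a" "Lft b" "Lft c'"] c i(2) ab(1,5) ne by auto
          moreover have "c \<noteq> b"
            using brauer_unique[OF d(1), of "Lft b" "Lft a" "Lft c'"] c i(2) ab(1,5) ne by (auto simp: insert_commute)
          moreover have "c \<noteq> k" using k_free[of c c'] c i(2) by auto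
          ultimately show ?thesis by simp
        qed
        have "t \<in> left_edges y" using t y by (auto simp: above_def)
        then show ?thesis
          unfolding i(1) using disj[of i i'] disj[of i' i] i(1) by (intro hook_left_edges(2)[OF yb]) (auto simp: insert_commute)
      qed
      then show ?thesis
        using hook_left_edges(1)[OF yb] ab(1) by auto
    qed
    have hf: "h \<otimes>\<^bsub>Br\<^esub> f \<in> Free R (above (insert s S))"
    proof -
      have z: "z \<in> above (insert s S)" if "(h \<otimes>\<^bsub>Br\<^esub> f) z \<noteq> \<zero>" for z
      proof -
        from that obtain x y where xy: "x \<in> brauer_diagrams n" "y \<in> brauer_diagrams n" "h x \<noteq> \<zero>" "f y \<noteq> \<zero>" "diagram_comp x y = z"
          by (rule Br.mult_support)
        have "x = hook_diagram n a b k" using xy(3) by (auto simp: h_def single_def split: if_splits)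
        then show ?thesis
          using sub[OF free_outside[OF f(1) xy(4)]] xy diagram_comp_closed by (auto simp: above_def)
      qed
      show ?thesis
        using Br.mult_closed[OF h above_F[OF f(1)]] z by (auto simp: free_module_def above_def)
    qed
    moreover have "(h \<otimes>\<^bsub>Br\<^esub> f) \<otimes>\<^bsub>Br\<^esub> x = x" if x: "x \<in> Free R (above (insert s S))" for x
    proof -
      have xS: "x \<in> Free R (above S)"
        using x by (rule free_mono) (auto simp: above_def)
      \<comment> \<open>Diagrams above \<open>insert s S\<close> are also above \<open>S\<close>, so
        \<open>f\<close> fixes \<open>x\<close>. Then \<open>h\<close> fixes each of them by
        \<open>hook_comp\<close>, which yields no loop and therefore no factor
        \<open>\<delta>\<close>.\<close>
      have "(h \<otimes>\<^bsub>Br\<^esub> f) \<otimes>\<^bsub>Br\<^esub> x = h \<otimes>\<^bsub>Br\<^esub> x"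
        using Br.mult_assoc[OF h above_F[OF f(1)] above_F[OF x]] f(2)[OF xS] by simp
      also have "\<dots> = x"
        using x
      proof (induction rule: free_induct)
        case zero
        then show ?case by (simp add: Br.mult_zero)
      next
        case (add y r u)
        have y: "y \<in> brauer_diagrams n" "{Lft a, Lft b} \<in> y"
          using add(1) ab(1) left_edges_iff by (auto simp: above_def)
        have "h \<otimes>\<^bsub>Br\<^esub> single R y r = single R y r"
          unfolding h_def using Br.mult_single[OF hook_diagram_brauer y(1) one_closed add(2)] hook_comp[OF y] add(2) by simp
        then show ?case
          using Br.mult_add_right[OF h free_single[OF y(1) add(2)] above_F[OF add(3)]] add(4) by simp
      qed
      finally show ?thesis .
    qed
    ultimately show ?case by blast
  qed
qed

lemma quot_hom_K:
  assumes "X \<in> K LE"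
  shows "quot_hom X = \<zero>\<^bsub>Sym\<^esub>"
proof -
  obtain f where f: "f \<in> Free R (D LE)" "f \<in> BrF" "X = coset f"
    using assms by (rule K_E)
  have "f (perm_diagram n p) = \<zero>" if p: "p permutes {1..n}" for p
  proof (rule ccontr)
    assume "f (perm_diagram n p) \<noteq> \<zero>"
    then have "left_edges (perm_diagram n p) \<in> LE"
      using free_outside[OF f(1)] by (simp add: D_def)
    then show False
      using left_edges_empty_iff[OF perm_diagram_brauer[OF p]] perm_diagram_no_left_left
      by (auto simp: LE_def)
  qed
  then show ?thesis
    unfolding f(3) quot_hom_coset[OF f(2)] by (auto simp: Sym.B_simps to_group_algebra_def)
qed

lemma kernel_quot_hom: "{X \<in> carrier A. quot_hom X = \<zero>\<^bsub>Sym\<^esub>} = K LE"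
proof (intro equalityI subsetI)
  fix X assume X: "X \<in> {X \<in> carrier A. quot_hom X = \<zero>\<^bsub>Sym\<^esub>}"
  then obtain f where f: "f \<in> BrF" "X = coset f" unfolding A_carrier by blast
  have z: "to_group_algebra f = (\<lambda>p. \<zero>)"
    using X quot_hom_coset[OF f(1)] f(2) by (simp add: Sym.B_simps)
  show "X \<in> K LE"
    unfolding f(2)
  proof (rule K_I[OF f(1)])
    fix d assume d: "d \<in> brauer_diagrams n" "has_left_right d" "f d \<noteq> \<zero>"
    have "left_edges d \<noteq> {}"
    proof
      assume "left_edges d = {}"
      then obtain p where p: "p permutes {1..n}" "d = perm_diagram n p"
        using no_left_left_imp_perm[OF d(1)] left_edges_empty_iff[OF d(1)] by blast
      then show False
        using fun_cong[OF z, of p] d(3) by (simp add: to_group_algebra_def)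
    qed
    then show "left_edges d \<in> LE"
      using d by (auto simp: LE_def)
  qed
next
  fix X assume "X \<in> K LE"
  then show "X \<in> {X \<in> carrier A. quot_hom X = \<zero>\<^bsub>Sym\<^esub>}"
    using quot_hom_K K_subset by blast
qed

lemma triv_quot_hom:
  assumes "X \<in> carrier A"
  shows "quot_hom X \<odot>\<^bsub>sym_triv\<^esub> v = X \<odot>\<^bsub>triv\<^esub> v"
  by (simp add: sym_triv_simps triv_smult[OF assms] aug_def)

text \<open>Induction on the number of sets in \<open>V\<close>. Removing a minimal \<open>S\<close>
  leaves an upward closed family, and the sets strictly above \<open>S\<close> form another; both
  are smaller. Then \<open>acyclic_step\<close> with the left unit for \<open>above S\<close> puts
  \<open>S\<close> back.\<close>

lemma acyclic_K:
  assumes "up_closed V"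
  shows "free_resolution.acyclic A triv (gens A triv) (gen_boundary A) (augmentation A triv) (K V)"
proof -
  interpret triv: left_module A triv by (rule left_module_triv)
  interpret P: free_resolution A triv "gens A triv" "gen_boundary A" "augmentation A triv"
    by (rule triv.std_free_resolution)
  show ?thesis
    using assms
  proof (induction "card V" arbitrary: V rule: less_induct)
    case less
    have V: "V \<subseteq> LE" and finV: "finite V"
      using less.prems finite_LE finite_subset by (auto simp: up_closed_def)
    show ?case
    proof (cases "V = {}")
      case True
      have "K V = {\<zero>\<^bsub>A\<^esub>}"
      proof -
        have "Free R (D V) = {\<lambda>x. \<zero>}"
          using True by (auto simp: D_def free_module_def)
        then show ?thesis unfolding K_def A_zero by simp
      qed
      then show ?thesis using P.acyclic_zero by simp
    next
      case False
      then obtain S where S: "S \<in> V" "\<And>T. T \<in> V \<Longrightarrow> T \<subseteq> S \<Longrightarrow> T = S"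
        using finite_has_minimal[OF finV] by metis
      define V' where "V' = V - {S}"
      define W where "W = {T \<in> LE. S \<subset> T}"
      have V': "up_closed V'"
        using less.prems S(2) unfolding up_closed_def V'_def by blast
      have W: "up_closed W"
        unfolding up_closed_def W_def by blast
      have WV': "W \<subseteq> V'"
        using less.prems S(1) unfolding up_closed_def V'_def W_def by blast
      have "card V' < card V"
        unfolding V'_def by (rule card_Diff1_less[OF finV S(1)])
      moreover have "card W \<le> card V'"
        using WV' finV by (intro card_mono) (auto simp: V'_def)
      ultimately have acyc: "P.acyclic (K V')" "P.acyclic (K W)"
        using less.hyps V' W by simp_all
      obtain d where d: "d \<in> brauer_diagrams n" "has_left_right d" "S = left_edges d" "S \<noteq> {}"
        using subsetD[OF V S(1)] unfolding LE_def by blast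
      obtain f where f: "f \<in> Free R (above S)"
        and unit: "\<And>x. x \<in> Free R (above S) \<Longrightarrow> f \<otimes>\<^bsub>Br\<^esub> x = x"
        using left_unit_exists[OF d(1,2), of S] d(3) by blast
      note fF = above_F[OF f]
      have above_V: "left_edges z \<in> V" if "z \<in> above S" "has_left_right z" for z
        using that S(1) d(4) less.prems unfolding up_closed_def above_def LE_def by blast
      have fa: "(f \<otimes>\<^bsub>Br\<^esub> a) \<in> Free R (above S)" if a: "a \<in> BrF" for a
      proof -
        have "z \<in> above S" if "(f \<otimes>\<^bsub>Br\<^esub> a) z \<noteq> \<zero>" for z
        proof -
          from that obtain x y where xy: "x \<in> brauer_diagrams n" "y \<in> brauer_diagrams n" "f x \<noteq> \<zero>" "diagram_comp x y = z"
            by (rule Br.mult_support)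
          then show ?thesis
            using free_outside[OF f xy(3)] left_edges_comp[OF xy(1), of y] diagram_comp_closed[OF xy(1,2)]
            by (auto simp: above_def)
        qed
        then show ?thesis
          using Br.mult_closed[OF fF a] by (auto simp: free_module_def above_def)
      qed
      have above_K: "coset g \<in> K V" if g: "g \<in> Free R (above S)" for g
        by (rule K_I[OF above_F[OF g]]) (use free_outside[OF g] above_V in blast)
      show ?thesis
      proof (rule P.acyclic_step[where K = "K V'" and G = "K W" and e = "coset f"])
        show "right_ideal A (K V')" "P.acyclic (K V')" "P.acyclic (K W)"
          by (rule right_ideal_K[OF V'] acyc)+
        show "K W \<subseteq> K V'" by (rule K_mono[OF WV'])
        show "\<zero>\<^bsub>A\<^esub> \<in> K W" by (rule right_idealD(2)[OF right_ideal_K[OF W]])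
        show "coset f \<in> carrier A" by (rule coset_closed[OF fF])
        show "coset f \<otimes>\<^bsub>A\<^esub> coset f = coset f"
          unfolding coset_ops(2)[OF fF fF] unit[OF f] ..
        show "coset f \<otimes>\<^bsub>A\<^esub> X = X" if X: "X \<in> K W" for X
        proof -
          obtain g where g: "g \<in> Free R (D W)" "g \<in> BrF" "X = coset g"
            using X by (rule K_E)
          have "g \<in> Free R (above S)"
            using g(1) by (rule free_mono) (auto simp: D_def W_def above_def)
          then show ?thesis
            unfolding g(3) coset_ops(2)[OF fF g(2)] by (simp only: unit)
        qed
        \<comment> \<open>A diagram in the support contains \<open>S\<close>, being a term of a
          product with \<open>f\<close> on the left, and its left edges lie in \<open>V'\<close>,
          which omits \<open>S\<close>; so it contains \<open>S\<close> strictly.\<close>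
        show "coset f \<otimes>\<^bsub>A\<^esub> X \<in> K W" if X: "X \<in> carrier A" "coset f \<otimes>\<^bsub>A\<^esub> X \<in> K V'" for X
        proof -
          obtain a where a: "a \<in> BrF" "X = coset a"
            using X(1) unfolding A_carrier by blast
          obtain g where g: "g \<in> Free R (D V')" "g \<in> BrF" "coset f \<otimes>\<^bsub>A\<^esub> X = coset g"
            using X(2) by (rule K_E)
          have eq: "coset (f \<otimes>\<^bsub>Br\<^esub> a) = coset g"
            using g(3) unfolding a(2) coset_ops(2)[OF fF a(1)] .
          show ?thesis
            unfolding a(2) coset_ops(2)[OF fF a(1)]
          proof (rule K_I[OF Br.mult_closed[OF fF a(1)]])
            fix z assume z: "z \<in> brauer_diagrams n" "has_left_right z" "(f \<otimes>\<^bsub>Br\<^esub> a) z \<noteq> \<zero>"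
            have "S \<subseteq> left_edges z"
              using free_outside[OF fa[OF a(1)] z(3)] by (simp add: above_def)
            moreover have "g z \<noteq> \<zero>"
              using eq z coset_eq_iff[OF Br.mult_closed[OF fF a(1)] g(2)] by simp
            then have "left_edges z \<in> V'"
              using free_outside[OF g(1)] by (simp add: D_def)
            ultimately show "left_edges z \<in> W"
              using V by (auto simp: V'_def W_def)
          qed
        qed
        \<comment> \<open>\<open>S\<close> is nonempty, so \<open>f\<close> involves no permutation
          and its image in the group algebra is zero.\<close>
        show "coset f \<odot>\<^bsub>triv\<^esub> x = \<zero>\<^bsub>triv\<^esub>" if x: "x \<in> carrier triv" for x
        proof -
          have "coset f \<in> K LE"
            using above_K[OF f] K_mono[OF V] by blast
          then have "aug (coset f) = \<zero>"
            using quot_hom_K by (simp add: aug_def total_zero)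
          then show ?thesis
            using x by (simp add: triv_smult[OF coset_closed[OF fF]] triv_simps)
        qed
        show "right_ideal A (K V)" by (rule right_ideal_K[OF less.prems])
        show "K V' \<subseteq> K V" by (rule K_mono) (auto simp: V'_def)
        show "coset f \<in> K V" by (rule above_K[OF f])
        show "\<exists>u\<in>K V'. \<exists>a\<in>carrier A. X = u \<oplus>\<^bsub>A\<^esub> coset f \<otimes>\<^bsub>A\<^esub> a" if X: "X \<in> K V" for X
        proof -
          obtain g where g: "g \<in> Free R (D V)" "g \<in> BrF" "X = coset g"
            using X by (rule K_E)
          \<comment> \<open>The terms whose left edges are exactly \<open>S\<close> lie above
            \<open>S\<close> and are reproduced by multiplication with \<open>f\<close>; by
            minimality of \<open>S\<close> the remaining ones belong to the upward closed family
            \<open>V'\<close>.\<close>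
          define u where "u = (\<lambda>z. if left_edges z = S then \<zero> else g z)"
          define v where "v = (\<lambda>z. if left_edges z = S then g z else \<zero>)"
          have gD: "finite {z. g z \<noteq> \<zero>}" "\<And>z. z \<notin> D V \<Longrightarrow> g z = \<zero>" "\<And>z. g z \<in> carrier R"
            using g(1) free_value[OF g(1)] by (auto simp: free_module_def)
          have fin: "finite {z. u z \<noteq> \<zero>}" "finite {z. v z \<noteq> \<zero>}"
            using finite_subset[OF _ gD(1), of "{z. u z \<noteq> \<zero>}"] finite_subset[OF _ gD(1), of "{z. v z \<noteq> \<zero>}"]
            unfolding u_def v_def by (simp_all add: Collect_mono_iff split: if_splits)
          have val: "u z \<in> carrier R" "z \<notin> D V' \<Longrightarrow> u z = \<zero>" "v z \<in> carrier R" "z \<notin> above S \<Longrightarrow> v z = \<zero>" for z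
            using gD(2,3)[of z] by (auto simp: u_def v_def D_def V'_def above_def)
          have u: "u \<in> Free R (D V')" and v: "v \<in> Free R (above S)"
            using fin val by (auto simp: free_module_def)
          have "g = (\<lambda>z. u z \<oplus> v z)"
            using gD(3) by (auto simp: u_def v_def)
          then have "X = coset u \<oplus>\<^bsub>A\<^esub> coset f \<otimes>\<^bsub>A\<^esub> coset v"
            unfolding g(3) coset_ops(2)[OF fF above_F[OF v]] unit[OF v] coset_ops(1)[OF D_F[OF u] above_F[OF v]]
            by simp
          moreover have "coset u \<in> K V'"
            unfolding K_def using u by blast
          ultimately show ?thesis
            using coset_closed[OF above_F[OF v]] by blast
        qed
      qed
    qed
  qed
qed

text \<open>Base change of the standard resolution over \<open>A\<close> along \<open>aug\<close>
  computes the left side. Its quotient by \<open>J\<close> is a resolution over \<open>Sym\<close>,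
  whose base change along \<open>total\<close> is the same complex; comparison with the standard
  resolution over \<open>Sym\<close> reaches the right side.\<close>

theorem Tor_iso: "module_iso R (Tor R A k triv triv) (Tor R Sym k sym_triv sym_triv)"
proof -
  interpret triv: left_module A triv by (rule left_module_triv)
  interpret sym: left_module Sym sym_triv by (rule left_module_sym_triv)
  have "up_closed LE"
    unfolding up_closed_def by blast
  then have acyclic: "free_resolution.acyclic A triv (gens A triv) (gen_boundary A) (augmentation A triv)
      {X \<in> carrier A. quot_hom X = \<zero>\<^bsub>Sym\<^esub>}"
    unfolding kernel_quot_hom by (rule acyclic_K)
  interpret QR: quotient_resolution A triv "gens A triv" "gen_boundary A" "augmentation A triv" Sym quot_hom sym_triv
    by (intro quotient_resolution.intro quotient_resolution_axioms.intro triv.std_free_resolution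
        change_of_rings.intro change_of_rings_axioms.intro ring_A Sym.ring_B quot_hom_hom left_module_sym_triv
        quot_hom_surj acyclic triv_quot_hom)
      (simp_all add: triv_simps sym_triv_simps)
  from free_resolution_homology_iso[OF is_cring total_hom QR.quotient_resolution sym.std_free_resolution]
  have comparison: "module_iso R (homology R (gens A triv) (base_change aug (gen_boundary A)) k)
      (homology R (gens Sym sym_triv) (base_change total (gen_boundary Sym)) k)"
    by (simp only: base_change_aug)
  have A: "module_iso R (homology R (gens A triv) (base_change aug (gen_boundary A)) k) (Tor R A k triv triv)"
    by (rule augmented_algebra.Tor_iso_homology[OF augmented_A left_module_triv])
  have Sym: "module_iso R (homology R (gens Sym sym_triv) (base_change total (gen_boundary Sym)) k)
      (Tor R Sym k sym_triv sym_triv)"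
    by (rule augmented_algebra.Tor_iso_homology[OF augmented_Sym left_module_sym_triv])
  \<comment> \<open>\<open>module_iso_sym\<close> needs closure under the operations in the source
    in order to invert the isomorphism.\<close>
  have "module R (homology R (gens A triv) (base_change aug (gen_boundary A)) k)"
  proof -
    interpret change_of_rings A R aug
      by (intro change_of_rings.intro change_of_rings_axioms.intro ring_A ring_axioms aug_hom)
    interpret C: free_complex_comm R "gens A triv" "base_change aug (gen_boundary A)"
      by (intro free_complex_comm.intro is_cring free_complex_base_change QR.free_complex_axioms)
    show ?thesis
      unfolding homology_def by (rule module_with_submodule.module_quotient[OF C.homology_submodule])
  qed
  from module_iso_sym[OF this A] show ?thesis
    by (rule module_iso_trans[OF module_iso_trans[OF _ comparison] Sym])
qed

end

theorem theorem1p4: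
  fixes R :: "('r, 's) ring_scheme" and \<delta> :: 'r and n k :: nat
  assumes "cring R" and "\<delta> \<in> carrier R" and "n > 0"
  shows "module_iso R
    (Tor R (quotient_module (brauer_algebra R \<delta> n) (brauer_I0 R \<delta> n)) k
      (over_quotient (brauer_trivial_module R n)) (over_quotient (brauer_trivial_module R n)))
    (Tor R (group_algebra R (sym_group n)) k
      (group_trivial_module R (sym_group n)) (group_trivial_module R (sym_group n)))"
proof -
  interpret brauer R \<delta> n
    using assms by (intro brauer.intro brauer_axioms.intro)
  show ?thesis
    unfolding brauer_algebra_eq group_algebra_eq by (rule Tor_iso)
qed

end
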